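(* Fix $\alpha>0$. Let $\mathbf{u}_h=\tfrac12\nabla^\perp h\in W^{3,2}_{\mathrm{div}}(\mathbb{T}^2;\mathbb{R}^2)$, $f\in W^{2,2}(\mathbb{T}^2)$ and $(b_0,\omega_0)\in\mathcal{M}=W^{3,2}(\mathbb{T}^2)\times W^{2,2}(\mathbb{T}^2)$. Then there exists a unique maximal solution $(b^\alpha,\omega^\alpha,T^\alpha_{\max})$ of the $\alpha$-TQG system with data $\mathbf{u}_h$, $f$ and initial condition $(b_0,\omega_0)$.
   Context: $\mathbb{T}^2$ is the two-dimensional flat torus, $\nabla^\perp=(-\partial_y,\partial_x)$, $W^{k,2}(\mathbb{T}^2)$ are the usual $L^2$-based Sobolev spaces with norm $\|\cdot\|_{k,2}$, and $W^{k,2}_{\mathrm{div}}(\mathbb{T}^2;\mathbb{R}^2)$ is the space of weakly divergence-free vector fields in $W^{k,2}$. $\mathcal{M}=W^{3,2}(\mathbb{T}^2)\times W^{2,2}(\mathbb{T}^2)$ has norm $\|(b,\omega)\|_{\mathcal{M}}=\|b\|_{3,2}+\|\omega\|_{2,2}$. Standing assumption: all functions under consideration have zero average over $\mathbb{T}^2$. The $\alpha$-TQG system ($\alpha>0$) for $(b^\alpha,\omega^\alpha)$ is $$\partial_t b^\alpha+\mathbf{u}^\alpha\cdot\nabla b^\alpha=0,\qquad \partial_t\omega^\alpha+\mathbf{u}^\alpha\cdot\nabla(\omega^\alpha-b^\alpha)=-\mathbf{u}_h\cdot\nabla b^\alpha,$$ $$\mathbf{u}^\alpha=\nabla^\perp\psi^\alpha,\qquad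 \mathbf{u}_h=\tfrac12\nabla^\perp h,\qquad \omega^\alpha=(\Delta-1)(1-\alpha\Delta)\psi^\alpha+f,$$ where $h$ and $f$ are given time-independent functions. Local strong solution: given $T>0$, $(b^\alpha,\omega^\alpha,T)$ is a local strong solution with initial condition $(b_0,\omega_0)$ if $b^\alpha\in C([0,T];W^{3,2}(\mathbb{T}^2))$, $\omega^\alpha\in C([0,T];W^{2,2}(\mathbb{T}^2))$, and for all $t\in[0,T]$ $$b^\alpha(t)=b_0-\int_0^t\mathrm{div}(b^\alpha\mathbf{u}^\alpha)\,d\tau,\qquad \omega^\alpha(t)=\omega_0-\int_0^t\big[\mathrm{div}((\omega^\alpha-b^\alpha)\mathbf{u}^\alpha)+\mathrm{div}(b^\alpha\mathbf{u}_h)\big]\,d\tau,$$ with $\mathbf{u}^\alpha=\nabla^\perp(1-\alpha\Delta)^{-1}(\Delta-1)^{-1}(\omega^\alpha-f)$. Maximal solution: $(b^\alpha,\omega^\alpha,T^\alpha_{\max})$ is a maximal solution with initial condition $(b_0,\omega_0)$ if (i) there is an increasing sequence of times $(T_n)_{n\in\mathbb{N}}$ with limit $T^\alpha_{\max}\in(0,\infty]$; (ii) for each $n$, $(b^\alpha,\omega^\alpha,T_n)$ is a local strong solution with initial condition $(b_0,\omega_0)$; (iii) if $T^\alpha_{\max}<\infty$, then $\limsup_{T_n\to T^\alpha_{\max}}\|(b^\alpha,\omega^\alpha)(T_n)\|_{\mathcal{M}}^2=\infty$. *)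

theory Defs
  imports "HOL-Analysis.Analysis"
begin

section \<open>The space $L^2$ of the flat torus\<close>

text \<open>
  The torus is $\mathbb{R}^2/\mathbb{Z}^2$: functions on it are functions on the plane of period 1
  in each variable, and integrals are taken over the fundamental square. The elements of
  \<open>l2_torus\<close> are the usual classes of square-integrable functions modulo equality almost everywhere.
\<close>

definition torus :: "(real \<times> real) measure" where
  "torus = restrict_space lborel ({0..<1} \<times> {0..<1})"

definition periodic :: "(real \<times> real \<Rightarrow> real) \<Rightarrow> bool" where
  "periodic \<phi> \<longleftrightarrow> (\<forall>x y. \<phi> (x + 1, y) = \<phi> (x, y) \<and> \<phi> (x, y + 1) = \<phi> (x, y))"

definition square_integrable :: "(real \<times> real \<Rightarrow> real) \<Rightarrow> bool" where
  "square_integrable u \<longleftrightarrow>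
     u \<in> borel_measurable borel \<and> periodic u \<and> integrable torus (\<lambda>p. (u p)\<^sup>2)"

definition l2_rel :: "(real \<times> real \<Rightarrow> real) \<Rightarrow> (real \<times> real \<Rightarrow> real) \<Rightarrow> bool" where
  "l2_rel u v \<longleftrightarrow> square_integrable u \<and> square_integrable v \<and> (AE p in torus. u p = v p)"

lemma square_integrable_zero: "square_integrable (\<lambda>p. 0)"
  by (simp add: square_integrable_def periodic_def)

lemma measurable_torus: "u \<in> borel_measurable borel \<Longrightarrow> u \<in> borel_measurable torus"
  unfolding torus_def by (rule measurable_restrict_space1) simp

lemma square_integrable_measurable: "square_integrable u \<Longrightarrow> u \<in> borel_measurable torus"
  by (simp add: square_integrable_def measurable_torus)

lemma integrable_torus_mult:
  assumes "square_integrable u" "square_integrable v"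
  shows "integrable torus (\<lambda>p. u p * v p)"
proof (rule Bochner_Integration.integrable_bound)
  show "integrable torus (\<lambda>p. (u p)\<^sup>2 + (v p)\<^sup>2)"
    using assms by (simp add: square_integrable_def)
  show "(\<lambda>p. u p * v p) \<in> borel_measurable torus"
    using assms by (intro borel_measurable_times square_integrable_measurable)
  have "norm (a * b) \<le> norm (a\<^sup>2 + b\<^sup>2)" for a b :: real
  proof -
    have "2 * (\<bar>a\<bar> * \<bar>b\<bar>) \<le> a\<^sup>2 + b\<^sup>2"
      using sum_squares_bound[of "\<bar>a\<bar>" "\<bar>b\<bar>"] by simp
    moreover have "0 \<le> \<bar>a\<bar> * \<bar>b\<bar>" by simp
    ultimately show ?thesis unfolding real_norm_def abs_mult by linarith
  qed
  then show "AE p in torus. norm (u p * v p) \<le> norm ((u p)\<^sup>2 + (v p)\<^sup>2)"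
    by simp
qed

lemma square_integrable_add:
  assumes "square_integrable u" "square_integrable v"
  shows "square_integrable (\<lambda>p. u p + v p)"
proof -
  have "integrable torus (\<lambda>p. (u p)\<^sup>2 + (v p)\<^sup>2 + 2 * (u p * v p))"
    using assms integrable_torus_mult[OF assms] by (simp add: square_integrable_def)
  then show ?thesis
    using assms
    by (simp add: square_integrable_def periodic_def power2_sum mult.assoc borel_measurable_add)
qed

lemma square_integrable_scale:
  "square_integrable u \<Longrightarrow> square_integrable (\<lambda>p. c * u p)"
  by (simp add: square_integrable_def periodic_def power_mult_distrib borel_measurable_times)

lemma l2_rel_refl: "l2_rel u u \<longleftrightarrow> square_integrable u"
  by (simp add: l2_rel_def)

quotient_type l2_torus = "real \<times> real \<Rightarrow> real" / partial: l2_rel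
proof (rule part_equivpI)
  show "\<exists>u. l2_rel u u"
    using square_integrable_zero l2_rel_refl by blast
  show "symp l2_rel"
    by (auto simp: symp_def l2_rel_def elim: AE_mp)
  show "transp l2_rel"
    unfolding transp_def l2_rel_def by auto
qed

lemma l2_rel_integral_mult:
  assumes "l2_rel u u'" "l2_rel v v'"
  shows "(LINT p|torus. u p * v p) = (LINT p|torus. u' p * v' p)"
  using assms unfolding l2_rel_def
  by (intro integral_cong_AE borel_measurable_times square_integrable_measurable) auto

instantiation l2_torus :: real_inner
begin

lift_definition zero_l2_torus :: l2_torus is "\<lambda>p. 0"
  by (simp add: l2_rel_refl square_integrable_zero)

lift_definition plus_l2_torus :: "l2_torus \<Rightarrow> l2_torus \<Rightarrow> l2_torus" is "\<lambda>u v p. u p + v p"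
  unfolding l2_rel_def by (auto intro: square_integrable_add)

lift_definition scaleR_l2_torus :: "real \<Rightarrow> l2_torus \<Rightarrow> l2_torus" is "\<lambda>c u p. c * u p"
  unfolding l2_rel_def by (auto intro: square_integrable_scale)

definition uminus_l2_torus :: "l2_torus \<Rightarrow> l2_torus" where
  "- u = (- 1) *\<^sub>R (u :: l2_torus)"

definition minus_l2_torus :: "l2_torus \<Rightarrow> l2_torus \<Rightarrow> l2_torus" where
  "u - v = u + - (v :: l2_torus)"

lift_definition inner_l2_torus :: "l2_torus \<Rightarrow> l2_torus \<Rightarrow> real"
  is "\<lambda>u v. LINT p|torus. u p * v p"
  by (rule l2_rel_integral_mult)

definition norm_l2_torus :: "l2_torus \<Rightarrow> real" where
  "norm u = sqrt (inner u (u :: l2_torus))"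

definition sgn_l2_torus :: "l2_torus \<Rightarrow> l2_torus" where
  "sgn u = inverse (norm u) *\<^sub>R (u :: l2_torus)"

definition dist_l2_torus :: "l2_torus \<Rightarrow> l2_torus \<Rightarrow> real" where
  "dist u v = norm (u - v :: l2_torus)"

definition uniformity_l2_torus :: "(l2_torus \<times> l2_torus) filter" where
  "uniformity_l2_torus = (INF e\<in>{0<..}. principal {(u, v). dist u v < e})"

definition open_l2_torus :: "l2_torus set \<Rightarrow> bool" where
  "open_l2_torus U \<longleftrightarrow> (\<forall>u\<in>U. eventually (\<lambda>(u', v). u' = u \<longrightarrow> v \<in> U) uniformity)"

instance
proof
  fix u v w :: l2_torus and a b :: real
  show "u + v + w = u + (v + w)"
    by transfer (auto simp: l2_rel_def algebra_simps intro: square_integrable_add)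
  show "u + v = v + u"
    by transfer (auto simp: l2_rel_def algebra_simps intro: square_integrable_add)
  show "0 + u = u"
    by transfer (auto simp: l2_rel_def)
  show "- u + u = 0"
    unfolding uminus_l2_torus_def
    by transfer (auto simp: l2_rel_def square_integrable_zero)
  show "u - v = u + - v"
    by (simp add: minus_l2_torus_def)
  show "a *\<^sub>R (u + v) = a *\<^sub>R u + a *\<^sub>R v"
    by transfer (auto simp: l2_rel_def distrib_left
        intro!: square_integrable_add square_integrable_scale)
  show "(a + b) *\<^sub>R u = a *\<^sub>R u + b *\<^sub>R u"
    by transfer (use square_integrable_scale square_integrable_add in
        \<open>auto simp: l2_rel_def distrib_right\<close>)
  show "a *\<^sub>R b *\<^sub>R u = (a * b) *\<^sub>R u"
    by transfer (auto simp: l2_rel_def mult.assoc intro: square_integrable_scale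
        dest: square_integrable_scale[of _ "a * b"])
  show "1 *\<^sub>R u = u"
    by transfer (auto simp: l2_rel_def)
  show "sgn u = inverse (norm u) *\<^sub>R u"
    by (simp add: sgn_l2_torus_def)
  show "dist u v = norm (u - v)"
    by (simp add: dist_l2_torus_def)
  show "uniformity = (INF e\<in>{0<..}. principal {(u, v :: l2_torus). dist u v < e})"
    by (simp add: uniformity_l2_torus_def)
  show "open U \<longleftrightarrow> (\<forall>u\<in>U. eventually (\<lambda>(u', v). u' = u \<longrightarrow> v \<in> U) uniformity)"
    for U :: "l2_torus set"
    by (simp add: open_l2_torus_def)
  show "inner u v = inner v u"
    by transfer (simp add: mult.commute)
  show "inner (u + v) w = inner u w + inner v w"
    by transfer (simp add: distrib_right integrable_torus_mult l2_rel_def)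
  show "inner (a *\<^sub>R u) v = a * inner u v"
    by transfer (simp add: mult.assoc)
  show "0 \<le> inner u u"
    by transfer simp
  show "inner u u = 0 \<longleftrightarrow> u = 0"
  proof (transfer, goal_cases)
    case (1 u)
    then have u: "square_integrable u" by (simp add: l2_rel_def)
    have "(LINT p|torus. u p * u p) = 0 \<longleftrightarrow> (AE p in torus. u p * u p = 0)"
      by (rule integral_nonneg_eq_0_iff_AE) (use u in \<open>auto intro: integrable_torus_mult\<close>)
    then show ?case
      using u by (simp add: l2_rel_def square_integrable_zero)
  qed
  show "norm u = sqrt (inner u u)"
    by (simp add: norm_l2_torus_def)
qed

end

text \<open>
  The pointwise product, for products that are again in $L^2$ (as they are when one factor is
  bounded, in particular when it is in $W^{2,2}$); all others are set to \<open>0\<close>.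
\<close>

lift_definition l2_mult :: "l2_torus \<Rightarrow> l2_torus \<Rightarrow> l2_torus" (infixl \<open>\<cdot>\<close> 70)
  is "\<lambda>u v. if square_integrable (\<lambda>p. u p * v p) then (\<lambda>p. u p * v p) else (\<lambda>p. 0)"
proof -
  fix u u' v v' :: "real \<times> real \<Rightarrow> real"
  assume uv: "l2_rel u u'" "l2_rel v v'"
  have ae: "AE p in torus. u p * v p = u' p * v' p"
    using uv by (auto simp: l2_rel_def)
  have "integrable torus (\<lambda>p. (u p * v p)\<^sup>2) \<longleftrightarrow> integrable torus (\<lambda>p. (u' p * v' p)\<^sup>2)"
  proof (rule integrable_cong_AE)
    show "(\<lambda>p. (u p * v p)\<^sup>2) \<in> borel_measurable torus"
      "(\<lambda>p. (u' p * v' p)\<^sup>2) \<in> borel_measurable torus"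
      using uv by (intro borel_measurable_power borel_measurable_times
          square_integrable_measurable; simp add: l2_rel_def)+
    show "AE p in torus. (u p * v p)\<^sup>2 = (u' p * v' p)\<^sup>2"
      using ae by auto
  qed
  then have "square_integrable (\<lambda>p. u p * v p) \<longleftrightarrow> square_integrable (\<lambda>p. u' p * v' p)"
    using uv by (auto simp: l2_rel_def square_integrable_def periodic_def)
  then show "l2_rel (if square_integrable (\<lambda>p. u p * v p) then \<lambda>p. u p * v p else (\<lambda>p. 0))
     (if square_integrable (\<lambda>p. u' p * v' p) then \<lambda>p. u' p * v' p else (\<lambda>p. 0))"
    using ae by (simp add: l2_rel_def square_integrable_zero)
qed

lift_definition average :: "l2_torus \<Rightarrow> real" is "\<lambda>u. LINT p|torus. u p"
  by (auto simp: l2_rel_def intro!: integral_cong_AE square_integrable_measurable)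


section \<open>Weak derivatives and Sobolev spaces\<close>

definition dx :: "(real \<times> real \<Rightarrow> real) \<Rightarrow> (real \<times> real \<Rightarrow> real)" where
  "dx \<phi> = (\<lambda>p. frechet_derivative \<phi> (at p) (1, 0))"

definition dy :: "(real \<times> real \<Rightarrow> real) \<Rightarrow> (real \<times> real \<Rightarrow> real)" where
  "dy \<phi> = (\<lambda>p. frechet_derivative \<phi> (at p) (0, 1))"

primrec of_class_C :: "nat \<Rightarrow> (real \<times> real \<Rightarrow> real) \<Rightarrow> bool" where
  "of_class_C 0 \<phi> \<longleftrightarrow> continuous_on UNIV \<phi>"
| "of_class_C (Suc k) \<phi> \<longleftrightarrow>
     (\<forall>p. \<phi> differentiable (at p)) \<and> of_class_C k (dx \<phi>) \<and> of_class_C k (dy \<phi>)"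

definition test_function :: "(real \<times> real \<Rightarrow> real) \<Rightarrow> bool" where
  "test_function \<phi> \<longleftrightarrow> periodic \<phi> \<and> (\<forall>k. of_class_C k \<phi>)"

text \<open>\<open>v\<close> is the weak derivative $\partial_x^m \partial_y^n u$.\<close>

definition has_weak_deriv :: "nat \<Rightarrow> nat \<Rightarrow> l2_torus \<Rightarrow> l2_torus \<Rightarrow> bool" where
  "has_weak_deriv m n u v \<longleftrightarrow>
     (\<forall>\<phi>. test_function \<phi> \<longrightarrow>
        (LINT p|torus. rep_l2_torus u p * (dx ^^ m) ((dy ^^ n) \<phi>) p) =
        (- 1) ^ (m + n) * (LINT p|torus. rep_l2_torus v p * \<phi> p))"

definition weak_deriv :: "nat \<Rightarrow> nat \<Rightarrow> l2_torus \<Rightarrow> l2_torus" where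
  "weak_deriv m n u = (THE v. has_weak_deriv m n u v)"

text \<open>$W^{k,2}$ and its norm $\|\cdot\|_{k,2}$.\<close>

definition sobolev :: "nat \<Rightarrow> l2_torus set" where
  "sobolev k = {u. \<forall>m n. m + n \<le> k \<longrightarrow> (\<exists>v. has_weak_deriv m n u v)}"

definition sobolev_norm :: "nat \<Rightarrow> l2_torus \<Rightarrow> real" where
  "sobolev_norm k u = sqrt (\<Sum>(m, n) \<in> {(m, n). m + n \<le> k}. (norm (weak_deriv m n u))\<^sup>2)"

definition weakly_div_free :: "l2_torus \<times> l2_torus \<Rightarrow> bool" where
  "weakly_div_free v \<longleftrightarrow>
     (\<forall>\<phi>. test_function \<phi> \<longrightarrow>
        (LINT p|torus. rep_l2_torus (fst v) p * dx \<phi> p + rep_l2_torus (snd v) p * dy \<phi> p) = 0)"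

definition sobolev_div :: "nat \<Rightarrow> (l2_torus \<times> l2_torus) set" where
  "sobolev_div k = {v. fst v \<in> sobolev k \<and> snd v \<in> sobolev k \<and> weakly_div_free v}"

definition laplacian :: "l2_torus \<Rightarrow> l2_torus" where
  "laplacian u = weak_deriv 2 0 u + weak_deriv 0 2 u"

definition grad_perp :: "l2_torus \<Rightarrow> l2_torus \<times> l2_torus" where
  "grad_perp u = (- weak_deriv 0 1 u, weak_deriv 1 0 u)"

text \<open>The divergence of \<open>b v\<close>, for a scalar \<open>b\<close> and a vector field \<open>v\<close>.\<close>

definition div_flux :: "l2_torus \<Rightarrow> l2_torus \<times> l2_torus \<Rightarrow> l2_torus" where
  "div_flux b v = weak_deriv 1 0 (b \<cdot> fst v) + weak_deriv 0 1 (b \<cdot> snd v)"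

text \<open>$C([0,T]; W^{k,2})$\<close>

definition continuous_sobolev :: "real \<Rightarrow> nat \<Rightarrow> (real \<Rightarrow> l2_torus) \<Rightarrow> bool" where
  "continuous_sobolev T k b \<longleftrightarrow>
     (\<forall>t\<in>{0..T}. b t \<in> sobolev k \<and>
        ((\<lambda>s. sobolev_norm k (b s - b t)) \<longlongrightarrow> 0) (at t within {0..T}))"


section \<open>The $\alpha$-TQG system\<close>

text \<open>$(\Delta-1)^{-1}$ and $(1-\alpha\Delta)^{-1}$, as inverses of operators with domain $W^{2,2}$.\<close>

definition inv_laplacian_minus_1 :: "l2_torus \<Rightarrow> l2_torus" where
  "inv_laplacian_minus_1 = inv_into (sobolev 2) (\<lambda>w. laplacian w - w)"

definition inv_1_minus_laplacian :: "real \<Rightarrow> l2_torus \<Rightarrow> l2_torus" where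
  "inv_1_minus_laplacian \<alpha> = inv_into (sobolev 2) (\<lambda>w. w - \<alpha> *\<^sub>R laplacian w)"

definition velocity :: "real \<Rightarrow> l2_torus \<Rightarrow> l2_torus \<Rightarrow> l2_torus \<times> l2_torus" where
  "velocity \<alpha> f \<omega> = grad_perp (inv_1_minus_laplacian \<alpha> (inv_laplacian_minus_1 (\<omega> - f)))"

text \<open>
  The integrands are continuous in time with values in $L^2$, so the gauge integral of the library
  is their Bochner (indeed Riemann) integral. The condition on the averages is the
  standing assumption that all functions under consideration have zero average.
\<close>

definition local_strong_solution ::
  "real \<Rightarrow> l2_torus \<times> l2_torus \<Rightarrow> l2_torus \<Rightarrow> l2_torus \<Rightarrow> l2_torus \<Rightarrow>
   (real \<Rightarrow> l2_torus) \<Rightarrow> (real \<Rightarrow> l2_torus) \<Rightarrow> real \<Rightarrow> bool" where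
  "local_strong_solution \<alpha> u\<^sub>h f b\<^sub>0 \<omega>\<^sub>0 b \<omega> T \<longleftrightarrow>
     T > 0 \<and>
     continuous_sobolev T 3 b \<and> continuous_sobolev T 2 \<omega> \<and>
     (\<forall>t\<in>{0..T}. average (b t) = 0 \<and> average (\<omega> t) = 0) \<and>
     (\<forall>t\<in>{0..T}.
        let F = (\<lambda>\<tau>. div_flux (b \<tau>) (velocity \<alpha> f (\<omega> \<tau>)));
            G = (\<lambda>\<tau>. div_flux (\<omega> \<tau> - b \<tau>) (velocity \<alpha> f (\<omega> \<tau>)) + div_flux (b \<tau>) u\<^sub>h)
        in F integrable_on {0..t} \<and> b t = b\<^sub>0 - integral {0..t} F \<and>
           G integrable_on {0..t} \<and> \<omega> t = \<omega>\<^sub>0 - integral {0..t} G)"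

definition norm_M :: "l2_torus \<Rightarrow> l2_torus \<Rightarrow> real" where
  "norm_M b \<omega> = sobolev_norm 3 b + sobolev_norm 2 \<omega>"

text \<open>
  The values of \<open>b\<close> and \<open>\<omega>\<close> matter only at times $t$ with $0 \le t < T_{\max}$.
\<close>

definition maximal_solution ::
  "real \<Rightarrow> l2_torus \<times> l2_torus \<Rightarrow> l2_torus \<Rightarrow> l2_torus \<Rightarrow> l2_torus \<Rightarrow>
   (real \<Rightarrow> l2_torus) \<Rightarrow> (real \<Rightarrow> l2_torus) \<Rightarrow> ereal \<Rightarrow> bool" where
  "maximal_solution \<alpha> u\<^sub>h f b\<^sub>0 \<omega>\<^sub>0 b \<omega> T\<^sub>m\<^sub>a\<^sub>x \<longleftrightarrow>
     0 < T\<^sub>m\<^sub>a\<^sub>x \<and>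
     (\<exists>T :: nat \<Rightarrow> real.
        strict_mono T \<and> (\<lambda>n. ereal (T n)) \<longlonglongrightarrow> T\<^sub>m\<^sub>a\<^sub>x \<and>
        (\<forall>n. local_strong_solution \<alpha> u\<^sub>h f b\<^sub>0 \<omega>\<^sub>0 b \<omega> (T n)) \<and>
        (T\<^sub>m\<^sub>a\<^sub>x < \<infinity> \<longrightarrow>
           limsup (\<lambda>n. ereal ((norm_M (b (T n)) (\<omega> (T n)))\<^sup>2)) = \<infinity>))"

end

theory Submission
  imports Defs
begin

text \<open>
  On Fourier coefficients the system reads $\dot b = -J(\psi, b)$,
  $\dot \omega = -J(\psi, \omega - b) - J(h/2, b)$ with the quadratic convolution
  $J(g, b) = \nabla^\perp g \cdot \nabla b$ and a stream function $\psi$ that is four derivatives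
  smoother than $\omega$. Testing $J(\psi, b)$ against $w^2 b$ for a weight $w$, the leading term
  cancels by antisymmetry and the commutator with $w$ costs no derivative. So the norm of
  $\mathcal{M}$ grows at a controlled rate, uniformly over Galerkin truncations, and
  differences of solutions are stable in $W^{1,2} \times L^2$. The stability estimate makes the Galerkin
  solutions converge on a time interval that depends only on the norm of the data, and gives uniqueness. The
  limit is strongly continuous because the energies, computed first with mollified weights, are
  Lipschitz in time. Solutions can thus be continued for a time depending only on the norm of the
  current value, which rules out a bounded norm at a finite maximal time.
\<close>

section \<open>Weighted sequences of Fourier coefficients\<close>

text \<open>For \<open>b\<close> in W^{3,2} the term J(psi, b) lies only in W^{2,2}, so the
  top-order energy identity cannot be written down for a solution itself. The energy estimate is
  used where all sums are finite: for Galerkin solutions with the exact weights, and for truncations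
  of a solution with mollified weights, whose truncation error vanishes in the limit while the
  mollification is fixed. Two solutions are compared two derivatives below the solution space: one
  is lost in J, the other pays for the rate 1/n of the truncation error. In the terms that do not
  cancel, the lost derivative falls on a factor that is known to be smooth. \<open>b\<close> lives
  one derivative above \<open>w\<close> because it enters the equation of \<open>w\<close> as a
  source, where nothing cancels. The stream function is needed at weight six: the commutator with a
  weight of order three and the factor \<open>cr\<close> consume four powers, summability over the
  lattice two more. The two derivatives of \<open>w\<close> and \<open>f\<close> and the four gained
  by the multiplier, for \<alpha> > 0, add up to exactly this.\<close>

type_synonym freq = "int \<times> int"

declare split_paired_All [simp del] split_paired_Ex [simp del]

text \<open>The 1-norm variant of the usual weight (1 + |k|^2)^(1/2); its Lipschitz and triangle
  bounds are linear arithmetic.\<close>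

definition wt :: "freq \<Rightarrow> real" where
  "wt k = 1 + \<bar>real_of_int (fst k)\<bar> + \<bar>real_of_int (snd k)\<bar>"

text \<open>The determinant of two frequencies. Replacing \<open>k\<close> or \<open>l\<close> by
  \<open>k - l\<close> changes at most the sign, so any two of the three frequencies
  \<open>k\<close>, \<open>l\<close>, \<open>k - l\<close> can be made to carry the
  derivatives.\<close>

definition cr :: "freq \<Rightarrow> freq \<Rightarrow> real" where
  "cr k l = real_of_int (fst k) * real_of_int (snd l) - real_of_int (snd k) * real_of_int (fst l)"

lemma wt_ge_1 [simp]: "1 \<le> wt k"
  by (simp add: wt_def)

lemma wt_pos [simp]: "0 < wt k"
  using wt_ge_1[of k] by linarith

lemma wt_nonneg [simp]: "0 \<le> wt k"
  using wt_pos[of k] by linarith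

lemma wt_neq_0 [simp]: "wt k \<noteq> 0"
  using wt_pos[of k] by linarith

lemma wt_minus [simp]: "wt (- k) = wt k"
  by (simp add: wt_def)

lemma wt_diff_le: "\<bar>wt k - wt l\<bar> \<le> wt (k - l)"
  unfolding wt_def by (simp, arith)

lemma wt_le_add: "wt k \<le> wt (k - l) + wt l"
  using wt_diff_le[of k l] by linarith

lemma wt_le_mult: "wt k \<le> wt (k - l) * wt l"
proof -
  define a b where "a = wt (k - l) - 1" and "b = wt l - 1"
  have "wt k \<le> 1 + a + b"
    using abs_triangle_ineq[of "real_of_int (fst (k - l))" "real_of_int (fst l)"]
      abs_triangle_ineq[of "real_of_int (snd (k - l))" "real_of_int (snd l)"]
    unfolding wt_def a_def b_def by simp
  moreover have "0 \<le> a * b"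
    unfolding a_def b_def by (intro mult_nonneg_nonneg) auto
  ultimately have "wt k \<le> (1 + a) * (1 + b)"
    by (simp add: algebra_simps)
  then show ?thesis by (simp add: a_def b_def)
qed

lemma cr_swap: "cr l k = - cr k l"
  by (simp add: cr_def algebra_simps)

lemma cr_diff_left: "cr (k - l) l = cr k l"
  by (simp add: cr_def algebra_simps)

lemma cr_diff_right: "cr k (k - l) = - cr k l"
  by (simp add: cr_def algebra_simps)

lemma cr_minus [simp]: "cr (- k) (- l) = cr k l"
  by (simp add: cr_def)

lemma abs_cr_le: "\<bar>cr k l\<bar> \<le> wt k * wt l"
proof -
  define a b c d where "a = \<bar>real_of_int (fst k)\<bar>" "b = \<bar>real_of_int (snd k)\<bar>"
    "c = \<bar>real_of_int (fst l)\<bar>" "d = \<bar>real_of_int (snd l)\<bar>"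
  note ab = this
  have "\<bar>cr k l\<bar> \<le> a * d + b * c"
    unfolding cr_def ab abs_mult[symmetric] by linarith
  also have "\<dots> \<le> (1 + a + b) * (1 + c + d)"
  proof -
    have "0 \<le> a" "0 \<le> b" "0 \<le> c" "0 \<le> d" by (auto simp: ab)
    then have "0 \<le> a * c" "0 \<le> b * d" by auto
    then show ?thesis using \<open>0 \<le> a\<close> \<open>0 \<le> b\<close> \<open>0 \<le> c\<close> \<open>0 \<le> d\<close>
      by (simp add: algebra_simps)
  qed
  finally show ?thesis by (simp add: wt_def ab)
qed

lemma abs_cr_le_left: "\<bar>cr k l\<bar> \<le> wt (k - l) * wt l"
  using abs_cr_le[of "k - l" l] by (simp add: cr_diff_left)

lemma abs_cr_le_right: "\<bar>cr k l\<bar> \<le> wt k * wt (k - l)"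
  using abs_cr_le[of k "k - l"] by (simp add: cr_diff_right)

section \<open>Summability of inverse weights and convolution bounds\<close>

lemma sum_inverse_square_int_bounded:
  "\<exists>C\<ge>0. \<forall>A. finite A \<longrightarrow> (\<Sum>n\<in>A. 1 / (1 + \<bar>real_of_int n\<bar>)\<^sup>2) \<le> C"
proof -
  define f where "f n = 1 / (1 + \<bar>real_of_int n\<bar>)\<^sup>2" for n
  have "summable (\<lambda>n. inverse (real (Suc n) ^ 2))"
    using inverse_power_summable[of 2, where 'a = real] by (subst summable_Suc_iff) simp
  then have sm: "summable (\<lambda>n::nat. 1 / (1 + real n)\<^sup>2)"
    by (simp add: inverse_eq_divide add.commute)
  define S where "S = (\<Sum>n. 1 / (1 + real n)\<^sup>2)"
  have S: "(\<Sum>n\<le>N. 1 / (1 + real n)\<^sup>2) \<le> S" for N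
    unfolding S_def by (rule sum_le_suminf[OF sm]) auto
  have "sum f A \<le> 2 * S" if "finite A" for A
  proof -
    define N where "N = Max ((\<lambda>n. nat \<bar>n\<bar>) ` A)"
    have "A \<subseteq> (int ` {..N}) \<union> ((\<lambda>n. - int n) ` {..N})"
    proof
      fix n assume n: "n \<in> A"
      then have "nat \<bar>n\<bar> \<le> N" unfolding N_def using that by (intro Max_ge) auto
      then show "n \<in> (int ` {..N}) \<union> ((\<lambda>n. - int n) ` {..N})"
        by (cases "0 \<le> n") (auto simp: image_iff intro: bexI[of _ "nat \<bar>n\<bar>"])
    qed
    then have "sum f A \<le> sum f ((int ` {..N}) \<union> ((\<lambda>n. - int n) ` {..N}))"
      by (intro sum_mono2) (auto simp: f_def)
    also have "\<dots> \<le> sum f (int ` {..N}) + sum f ((\<lambda>n. - int n) ` {..N})"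
      by (subst sum.union_inter[symmetric]) (auto simp: f_def intro!: sum_nonneg)
    also have "\<dots> = 2 * (\<Sum>n\<le>N. 1 / (1 + real n)\<^sup>2)"
      by (subst (1 2) sum.reindex) (auto simp: inj_on_def f_def)
    also have "\<dots> \<le> 2 * S" using S[of N] by linarith
    finally show ?thesis .
  qed
  moreover have "0 \<le> 2 * S" using S[of 0] by simp
  ultimately show ?thesis unfolding f_def by blast
qed

text \<open>Since \<open>(wt k)\<^sup>2\<close> dominates the product of the one-dimensional weights
  of the two components, the sum over the lattice is bounded by a product of two one-dimensional
  sums.\<close>

lemma inverse_wt_square_l2: "\<exists>C\<ge>0. \<forall>K. finite K \<longrightarrow> L2_set (\<lambda>k. 1 / (wt k)\<^sup>2) K \<le> C"
proof -
  obtain C where C: "C \<ge> 0"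
    "\<And>A. finite A \<Longrightarrow> (\<Sum>n\<in>A. 1 / (1 + \<bar>real_of_int n\<bar>)\<^sup>2) \<le> C"
    using sum_inverse_square_int_bounded by blast
  define f where "f n = 1 / (1 + \<bar>real_of_int n\<bar>)\<^sup>2" for n
  have "L2_set (\<lambda>k. 1 / (wt k)\<^sup>2) K \<le> sqrt (C * C)" if K: "finite K" for K
  proof -
    have "(1 / (wt k)\<^sup>2)\<^sup>2 \<le> f (fst k) * f (snd k)" for k
    proof -
      define a b where "a = \<bar>real_of_int (fst k)\<bar>" "b = \<bar>real_of_int (snd k)\<bar>"
      have "(1 + a) * (1 + b) \<le> (wt k)\<^sup>2" "0 < (1 + a) * (1 + b)"
        unfolding power2_eq_square wt_def a_b_def
        by (intro mult_mono mult_pos_pos; simp)+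
      then have "((1 + a) * (1 + b))\<^sup>2 \<le> ((wt k)\<^sup>2)\<^sup>2"
        by (intro power_mono) auto
      moreover have "0 < ((1 + a) * (1 + b))\<^sup>2"
        using \<open>0 < (1 + a) * (1 + b)\<close> by (rule zero_less_power)
      ultimately have "1 / ((wt k)\<^sup>2)\<^sup>2 \<le> 1 / ((1 + a) * (1 + b))\<^sup>2"
        by (intro divide_left_mono mult_pos_pos) auto
      then show ?thesis
        by (simp add: f_def a_b_def power_divide power_mult_distrib)
    qed
    then have "(\<Sum>k\<in>K. (1 / (wt k)\<^sup>2)\<^sup>2) \<le> (\<Sum>k\<in>K. f (fst k) * f (snd k))"
      by (intro sum_mono)
    also have "\<dots> \<le> (\<Sum>k\<in>fst ` K \<times> snd ` K. f (fst k) * f (snd k))"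
      using K subset_fst_snd[of K] by (intro sum_mono2) (auto simp: f_def)
    also have "\<dots> = sum f (fst ` K) * sum f (snd ` K)"
      by (simp add: sum_product sum.cartesian_product case_prod_unfold)
    also have "\<dots> \<le> C * C"
      using C K unfolding f_def by (intro mult_mono sum_nonneg) auto
    finally show ?thesis unfolding L2_set_def by (rule real_sqrt_le_mono)
  qed
  then show ?thesis by (intro exI[of _ "sqrt (C * C)"]) (use C(1) in auto)
qed

definition c0 :: real where
  "c0 = (SOME C. C \<ge> 0 \<and> (\<forall>K. finite K \<longrightarrow> L2_set (\<lambda>k. 1 / (wt k)\<^sup>2) K \<le> C))"

lemma c0_nonneg [simp]: "0 \<le> c0"
  and L2_set_inverse_wt: "finite K \<Longrightarrow> L2_set (\<lambda>k. 1 / (wt k)\<^sup>2) K \<le> c0"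
  using someI_ex[OF inverse_wt_square_l2[unfolded Bex_def]] unfolding c0_def by blast+

lemma L2_set_reindex: "inj_on s K \<Longrightarrow> L2_set f (s ` K) = L2_set (\<lambda>k. f (s k)) K"
  unfolding L2_set_def by (simp add: sum.reindex)

lemma L2_set_mono_set: "finite K \<Longrightarrow> L \<subseteq> K \<Longrightarrow> L2_set f L \<le> L2_set f K"
  unfolding L2_set_def by (intro real_sqrt_le_mono sum_mono2) auto

lemma L2_set_power2: "(L2_set f K)\<^sup>2 = (\<Sum>k\<in>K. (f k)\<^sup>2)"
  unfolding L2_set_def by (simp add: sum_nonneg)

lemma L2_set_le_of_sum:
  assumes "0 \<le> B" "(\<Sum>k\<in>K. f k * f k) \<le> L2_set f K * B"
  shows "L2_set f K \<le> B"
proof (cases "L2_set f K = 0")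
  case False
  have "L2_set f K * L2_set f K \<le> L2_set f K * B"
    using assms(2) L2_set_power2[of f K] by (simp add: power2_eq_square)
  then show ?thesis
    using False L2_set_nonneg[of f K] by (simp add: mult_le_cancel_left)
qed (use assms in simp)

lemma sum_mult_le_L2_set: "(\<Sum>i\<in>A. f i * g i) \<le> L2_set f A * L2_set g A"
  by (rule order_trans[OF sum_mono L2_set_mult_ineq]) (metis abs_ge_self abs_mult)

text \<open>Cauchy-Schwarz against the inverse weight: the sequence form of the embedding of W^{2,2}
  into absolutely convergent Fourier series, with constant \<open>c0\<close>.\<close>

lemma sum_le_weighted_L2:
  assumes "finite K" "L2_set (\<lambda>m. (wt m)\<^sup>2 * a m) K \<le> A"
  shows "sum a K \<le> c0 * A"
proof -
  have "sum a K = (\<Sum>m\<in>K. (1 / (wt m)\<^sup>2) * ((wt m)\<^sup>2 * a m))" by simp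
  also have "\<dots> \<le> L2_set (\<lambda>m. 1 / (wt m)\<^sup>2) K * L2_set (\<lambda>m. (wt m)\<^sup>2 * a m) K"
    by (rule sum_mult_le_L2_set)
  also have "\<dots> \<le> c0 * A"
    using L2_set_inverse_wt[OF assms(1)] assms by (intro mult_mono) auto
  finally show ?thesis .
qed

text \<open>Young's inequality \<open>\<ell>\<^sup>2 * \<ell>\<^sup>1 * \<ell>\<^sup>2\<close>; the weight \<open>wt\<^sup>2\<close> puts \<open>a\<close> in \<open>\<ell>\<^sup>1\<close>.\<close>

lemma trilinear_le:
  assumes "finite K" "finite L" and nn: "\<And>k. 0 \<le> x k" "\<And>k. 0 \<le> y k" "\<And>k. 0 \<le> a k"
    and a: "\<And>K. finite K \<Longrightarrow> L2_set (\<lambda>m. (wt m)\<^sup>2 * a m) K \<le> A"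
  shows "(\<Sum>k\<in>K. \<Sum>l\<in>L. x k * a (k - l) * y l) \<le> c0 * A * L2_set x K * L2_set y L"
proof -
  define P where "P = (\<lambda>(k, l). k - l) ` (K \<times> L)"
  have P: "finite P" unfolding P_def using assms by auto
  have "(\<Sum>k\<in>K. \<Sum>l\<in>L. x k * a (k - l) * y l)
      = (\<Sum>(k, l)\<in>K \<times> L. x k * a (k - l) * y l)"
    by (simp add: sum.cartesian_product)
  \<comment> \<open>Grouping the pairs by their difference \<open>m\<close> lets \<open>a m\<close>
    factor out; each diagonal is an inner product of \<open>x\<close> with a translate of
    \<open>y\<close>.\<close>
  also have "\<dots> = (\<Sum>m\<in>P. \<Sum>(k, l) | (k, l) \<in> K \<times> L \<and> k - l = m. x k * a (k - l) * y l)"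
    unfolding P_def using assms(1,2)
    by (subst sum.image_gen[of "K \<times> L" _ "\<lambda>(k, l). k - l"]) (auto intro!: sum.cong)
  also have "\<dots> \<le> (\<Sum>m\<in>P. a m * (L2_set x K * L2_set y L))"
  proof (rule sum_mono)
    fix m
    define Q where "Q = {k \<in> K. k - m \<in> L}"
    have "(\<Sum>(k, l) | (k, l) \<in> K \<times> L \<and> k - l = m. x k * a (k - l) * y l)
        = (\<Sum>k\<in>Q. a m * (x k * y (k - m)))"
      by (rule sum.reindex_bij_witness[of _ "\<lambda>k. (k, k - m)" fst]) (auto simp: Q_def)
    also have "\<dots> = a m * (\<Sum>k\<in>Q. x k * y (k - m))" by (simp add: sum_distrib_left)
    also have "(\<Sum>k\<in>Q. x k * y (k - m)) \<le> L2_set x Q * L2_set (\<lambda>k. y (k - m)) Q"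
      by (rule sum_mult_le_L2_set)
    also have "\<dots> \<le> L2_set x K * L2_set y L"
    proof (intro mult_mono)
      show "L2_set x Q \<le> L2_set x K"
        by (rule L2_set_mono_set) (use assms in \<open>auto simp: Q_def\<close>)
      have "L2_set (\<lambda>k. y (k - m)) Q = L2_set y ((\<lambda>k. k - m) ` Q)"
        by (subst L2_set_reindex) (auto simp: inj_on_def)
      also have "\<dots> \<le> L2_set y L"
        by (rule L2_set_mono_set) (use assms in \<open>auto simp: Q_def\<close>)
      finally show "L2_set (\<lambda>k. y (k - m)) Q \<le> L2_set y L" .
    qed auto
    finally show "(\<Sum>(k, l) | (k, l) \<in> K \<times> L \<and> k - l = m. x k * a (k - l) * y l)
        \<le> a m * (L2_set x K * L2_set y L)"
      using nn(3)[of m] by (simp add: mult_left_mono)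
  qed
  also have "\<dots> = sum a P * (L2_set x K * L2_set y L)" by (simp add: sum_distrib_right)
  also have "\<dots> \<le> (c0 * A) * (L2_set x K * L2_set y L)"
    by (intro mult_right_mono sum_le_weighted_L2 P a mult_nonneg_nonneg L2_set_nonneg)
  finally show ?thesis by (simp add: mult.assoc)
qed

text \<open>The roles of \<open>a\<close> and \<open>y\<close> are exchanged: \<open>y\<close> is
  summable, and for fixed \<open>l\<close> the sum over \<open>k\<close> is an inner product of
  \<open>x\<close> with a translate of \<open>a\<close>. This serves the case in which the first
  factor of a product carries all the derivatives.\<close>

lemma trilinear_le':
  assumes "finite K" "finite L" and nn: "\<And>k. 0 \<le> x k" "\<And>k. 0 \<le> y k" "\<And>k. 0 \<le> a k"
    and a: "\<And>K. finite K \<Longrightarrow> L2_set a K \<le> A"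
    and y: "\<And>K. finite K \<Longrightarrow> L2_set (\<lambda>m. (wt m)\<^sup>2 * y m) K \<le> Y"
  shows "(\<Sum>k\<in>K. \<Sum>l\<in>L. x k * a (k - l) * y l) \<le> c0 * A * L2_set x K * Y"
proof -
  have A: "0 \<le> A" using a[of "{}"] by simp
  have "(\<Sum>k\<in>K. \<Sum>l\<in>L. x k * a (k - l) * y l) = (\<Sum>l\<in>L. y l * (\<Sum>k\<in>K. x k * a (k - l)))"
    by (subst sum.swap) (simp add: sum_distrib_left mult_ac)
  also have "\<dots> \<le> (\<Sum>l\<in>L. y l * (L2_set x K * A))"
  proof (intro sum_mono mult_left_mono nn)
    fix l
    have "(\<Sum>k\<in>K. x k * a (k - l)) \<le> L2_set x K * L2_set (\<lambda>k. a (k - l)) K"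
      by (rule sum_mult_le_L2_set)
    also have "L2_set (\<lambda>k. a (k - l)) K = L2_set a ((\<lambda>k. k - l) ` K)"
      by (subst L2_set_reindex) (auto simp: inj_on_def)
    also have "L2_set x K * \<dots> \<le> L2_set x K * A"
      using assms by (intro mult_left_mono a) auto
    finally show "(\<Sum>k\<in>K. x k * a (k - l)) \<le> L2_set x K * A" .
  qed
  also have "\<dots> = sum y L * (L2_set x K * A)" by (simp add: sum_distrib_right)
  also have "\<dots> \<le> (c0 * Y) * (L2_set x K * A)"
    using A by (intro mult_right_mono sum_le_weighted_L2 y assms mult_nonneg_nonneg L2_set_nonneg)
  finally show ?thesis by (simp add: mult_ac)
qed

text \<open>Duality: the convolution itself is the test sequence in \<open>trilinear_le\<close>, and
  one factor of its norm is cancelled by \<open>L2_set_le_of_sum\<close>.\<close>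

lemma L2_set_convolution_le:
  assumes "finite K" "finite L" and nn: "\<And>k. 0 \<le> y k" "\<And>k. 0 \<le> a k"
    and a: "\<And>K. finite K \<Longrightarrow> L2_set (\<lambda>m. (wt m)\<^sup>2 * a m) K \<le> A"
    and y: "L2_set y L \<le> Y"
  shows "L2_set (\<lambda>k. \<Sum>l\<in>L. a (k - l) * y l) K \<le> c0 * A * Y"
proof (rule L2_set_le_of_sum)
  have A: "0 \<le> A" using a[of "{}"] by simp
  have Y: "0 \<le> Y" using y L2_set_nonneg[of y L] by linarith
  show "0 \<le> c0 * A * Y" using A Y by simp
  let ?v = "\<lambda>k. \<Sum>l\<in>L. a (k - l) * y l"
  have "(\<Sum>k\<in>K. ?v k * ?v k) = (\<Sum>k\<in>K. \<Sum>l\<in>L. ?v k * a (k - l) * y l)"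
    by (simp add: sum_distrib_left mult_ac)
  also have "\<dots> \<le> c0 * A * L2_set ?v K * L2_set y L"
    by (rule trilinear_le) (use assms in \<open>auto intro!: sum_nonneg\<close>)
  also have "\<dots> \<le> c0 * A * L2_set ?v K * Y"
    using A y by (intro mult_left_mono) auto
  finally show "(\<Sum>k\<in>K. ?v k * ?v k) \<le> L2_set ?v K * (c0 * A * Y)"
    by (simp add: mult_ac)
qed

lemma L2_set_convolution_le':
  assumes "finite K" "finite L" and nn: "\<And>k. 0 \<le> y k" "\<And>k. 0 \<le> a k"
    and a: "\<And>K. finite K \<Longrightarrow> L2_set a K \<le> A"
    and y: "\<And>K. finite K \<Longrightarrow> L2_set (\<lambda>m. (wt m)\<^sup>2 * y m) K \<le> Y"
  shows "L2_set (\<lambda>k. \<Sum>l\<in>L. a (k - l) * y l) K \<le> c0 * A * Y"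
proof (rule L2_set_le_of_sum)
  have A: "0 \<le> A" using a[of "{}"] by simp
  have Y: "0 \<le> Y" using y[of "{}"] by simp
  show "0 \<le> c0 * A * Y" using A Y by simp
  let ?v = "\<lambda>k. \<Sum>l\<in>L. a (k - l) * y l"
  have "(\<Sum>k\<in>K. ?v k * ?v k) = (\<Sum>k\<in>K. \<Sum>l\<in>L. ?v k * a (k - l) * y l)"
    by (simp add: sum_distrib_left mult_ac)
  also have "\<dots> \<le> c0 * A * L2_set ?v K * Y"
    by (rule trilinear_le') (use assms in \<open>auto intro!: sum_nonneg\<close>)
  finally show "(\<Sum>k\<in>K. ?v k * ?v k) \<le> L2_set ?v K * (c0 * A * Y)"
    by (simp add: mult_ac)
qed

text \<open>The weighted $\ell^2$ norm is at most \<open>B\<close>; finite partial sums avoid a separate summability condition.\<close>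

definition wbound :: "(freq \<Rightarrow> real) \<Rightarrow> (freq \<Rightarrow> complex) \<Rightarrow> real \<Rightarrow> bool" where
  "wbound W x B \<longleftrightarrow> (\<forall>K. finite K \<longrightarrow> L2_set (\<lambda>k. W k * cmod (x k)) K \<le> B)"

lemma wboundD: "wbound W x B \<Longrightarrow> finite K \<Longrightarrow> L2_set (\<lambda>k. W k * cmod (x k)) K \<le> B"
  by (simp add: wbound_def)

lemma wboundI: "(\<And>K. finite K \<Longrightarrow> L2_set (\<lambda>k. W k * cmod (x k)) K \<le> B) \<Longrightarrow> wbound W x B"
  by (simp add: wbound_def)

lemma wbound_nonneg: "wbound W x B \<Longrightarrow> 0 \<le> B"
  using wboundD[of W x B "{}"] by simp

lemma wbound_pointwise: "wbound W x B \<Longrightarrow> W k * cmod (x k) \<le> B"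
  using wboundD[of W x B "{k}"] by (simp add: L2_set_def)

lemma wbound_mono:
  assumes "wbound W x B" "\<And>k. 0 \<le> V k * cmod (y k)" "\<And>k. V k * cmod (y k) \<le> c * (W k * cmod (x k))"
    "c * B \<le> B'" "0 \<le> c"
  shows "wbound V y B'"
proof (rule wboundI)
  fix K :: "freq set" assume "finite K"
  have "L2_set (\<lambda>k. V k * cmod (y k)) K \<le> L2_set (\<lambda>k. c * (W k * cmod (x k))) K"
    using assms by (intro L2_set_mono) auto
  also have "\<dots> = c * L2_set (\<lambda>k. W k * cmod (x k)) K"
    using assms by (simp add: L2_set_right_distrib)
  also have "\<dots> \<le> c * B" using assms wboundD[OF assms(1) \<open>finite K\<close>] by (intro mult_left_mono)
  finally show "L2_set (\<lambda>k. V k * cmod (y k)) K \<le> B'" using assms by linarith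
qed

lemma wbound_weaken:
  assumes "wbound W x B" "\<And>k. 0 \<le> V k" "\<And>k. V k \<le> W k" "B \<le> B'"
  shows "wbound V x B'"
  by (rule wbound_mono[OF assms(1), where c = 1]) (use assms in \<open>auto intro: mult_right_mono\<close>)

lemma wbound_power_weaken:
  assumes "wbound (\<lambda>k. wt k ^ n) x B" "m \<le> n"
  shows "wbound (\<lambda>k. wt k ^ m) x B"
  by (rule wbound_weaken[OF assms(1)]) (use assms in \<open>auto intro: power_increasing\<close>)

lemma wbound_add:
  assumes "wbound W x A" "wbound W y B" "\<And>k. 0 \<le> W k"
  shows "wbound W (\<lambda>k. x k + y k) (A + B)"
proof (rule wboundI)
  fix K :: "freq set" assume K: "finite K"
  have "L2_set (\<lambda>k. W k * cmod (x k + y k)) K \<le> L2_set (\<lambda>k. W k * cmod (x k) + W k * cmod (y k)) K"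
    using assms by (intro L2_set_mono) (auto simp flip: distrib_left intro!: mult_left_mono norm_triangle_ineq)
  also have "\<dots> \<le> L2_set (\<lambda>k. W k * cmod (x k)) K + L2_set (\<lambda>k. W k * cmod (y k)) K"
    by (rule L2_set_triangle_ineq)
  also have "\<dots> \<le> A + B" using K assms by (intro add_mono wboundD)
  finally show "L2_set (\<lambda>k. W k * cmod (x k + y k)) K \<le> A + B" .
qed

lemma wbound_uminus: "wbound W (\<lambda>k. - x k) A = wbound W x A"
  by (simp add: wbound_def)

lemma wbound_diff:
  assumes "wbound W x A" "wbound W y B" "\<And>k. 0 \<le> W k"
  shows "wbound W (\<lambda>k. x k - y k) (A + B)"
  using wbound_add[of W x A "\<lambda>k. - y k" B] assms by (simp add: wbound_uminus)

text \<open>A form of Fatou's lemma: over a finite set the weighted norm is continuous in the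
  coefficients, and \<open>wbound\<close> looks at finite sets only.\<close>

lemma wbound_limit:
  assumes "\<And>k. ((\<lambda>n. x n k) \<longlongrightarrow> y k) F" "F \<noteq> bot" "\<forall>\<^sub>F n in F. wbound W (x n) B"
  shows "wbound W y B"
proof (rule wboundI)
  fix K :: "freq set" assume "finite K"
  have "((\<lambda>n. L2_set (\<lambda>k. W k * cmod (x n k)) K) \<longlongrightarrow> L2_set (\<lambda>k. W k * cmod (y k)) K) F"
    unfolding L2_set_def by (intro tendsto_intros assms)
  then show "L2_set (\<lambda>k. W k * cmod (y k)) K \<le> B"
    by (rule tendsto_upperbound) (use assms \<open>finite K\<close> in \<open>auto elim!: eventually_mono dest: wboundD\<close>)
qed

text \<open>The Fourier coefficients of $\nabla^\perp g \cdot \nabla b$ on $\mathbb{R}^2/\mathbb{Z}^2$.\<close>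

definition jac :: "(freq \<Rightarrow> complex) \<Rightarrow> (freq \<Rightarrow> complex) \<Rightarrow> freq \<Rightarrow> complex" where
  "jac g b k = (\<Sum>\<^sub>\<infinity>l. of_real (- (4 * pi\<^sup>2) * cr k l) * g (k - l) * b l)"

lemma cmod_jac_term: "cmod (of_real (- (4 * pi\<^sup>2) * cr k l) * g * b) = 4 * pi\<^sup>2 * (\<bar>cr k l\<bar> * cmod g * cmod b)"
proof -
  have "cmod (of_real (- (4 * pi\<^sup>2) * cr k l) * g * b) = \<bar>- (4 * pi\<^sup>2) * cr k l\<bar> * cmod g * cmod b"
    by (simp only: norm_mult norm_of_real)
  then show ?thesis by (simp add: abs_mult)
qed

text \<open>By \<open>abs_cr_le_right\<close> one derivative falls on \<open>g\<close> and the other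
  on the output frequency, so \<open>b\<close> enters without derivative. This gives
  \<open>jac\<close> a meaning at the low regularity of the differences and truncation
  errors.\<close>

lemma jac_partial_pointwise:
  assumes "wbound wt g G" "wbound (\<lambda>k. 1) b B" "finite L"
  shows "(\<Sum>l\<in>L. cmod (of_real (- (4 * pi\<^sup>2) * cr k l) * g (k - l) * b l)) \<le> 4 * pi\<^sup>2 * wt k * G * B"
proof -
  have "(\<Sum>l\<in>L. cmod (of_real (- (4 * pi\<^sup>2) * cr k l) * g (k - l) * b l))
      \<le> (\<Sum>l\<in>L. 4 * pi\<^sup>2 * wt k * ((wt (k - l) * cmod (g (k - l))) * (1 * cmod (b l))))"
  proof (rule sum_mono)
    fix l
    have "\<bar>cr k l\<bar> * (cmod (g (k - l)) * cmod (b l)) \<le> (wt k * wt (k - l)) * (cmod (g (k - l)) * cmod (b l))"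
      by (intro mult_right_mono abs_cr_le_right) auto
    then have "4 * pi\<^sup>2 * (\<bar>cr k l\<bar> * (cmod (g (k - l)) * cmod (b l)))
        \<le> 4 * pi\<^sup>2 * ((wt k * wt (k - l)) * (cmod (g (k - l)) * cmod (b l)))"
      by (intro mult_left_mono) auto
    then show "cmod (of_real (- (4 * pi\<^sup>2) * cr k l) * g (k - l) * b l)
        \<le> 4 * pi\<^sup>2 * wt k * ((wt (k - l) * cmod (g (k - l))) * (1 * cmod (b l)))"
      unfolding cmod_jac_term by (simp only: mult_ac mult_1_left)
  qed
  also have "\<dots> = 4 * pi\<^sup>2 * wt k * (\<Sum>l\<in>L. (wt (k - l) * cmod (g (k - l))) * (1 * cmod (b l)))"
    by (simp add: sum_distrib_left)
  also have "\<dots> \<le> 4 * pi\<^sup>2 * wt k * (G * B)"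
  proof (rule mult_left_mono)
    have "(\<Sum>l\<in>L. (wt (k - l) * cmod (g (k - l))) * (1 * cmod (b l)))
        \<le> L2_set (\<lambda>l. wt (k - l) * cmod (g (k - l))) L * L2_set (\<lambda>l. 1 * cmod (b l)) L"
      by (rule sum_mult_le_L2_set)
    also have "L2_set (\<lambda>l. wt (k - l) * cmod (g (k - l))) L = L2_set (\<lambda>l. wt l * cmod (g l)) ((\<lambda>l. k - l) ` L)"
      by (subst L2_set_reindex) (auto simp: inj_on_def)
    also have "\<dots> * L2_set (\<lambda>l. 1 * cmod (b l)) L \<le> G * B"
      using assms by (intro mult_mono wboundD) (auto dest: wbound_nonneg)
    finally show "(\<Sum>l\<in>L. (wt (k - l) * cmod (g (k - l))) * (1 * cmod (b l))) \<le> G * B" .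
  qed auto
  finally show ?thesis by (simp add: mult_ac)
qed

lemma jac_abs_summable:
  assumes "wbound wt g G" "wbound (\<lambda>k. 1) b B"
  shows "(\<lambda>l. cmod (of_real (- (4 * pi\<^sup>2) * cr k l) * g (k - l) * b l)) summable_on UNIV"
  unfolding abs_summable_iff_bdd_above bdd_above_def
  using jac_partial_pointwise[OF assms] by blast

lemma jac_summable:
  assumes "wbound wt g G" "wbound (\<lambda>k. 1) b B"
  shows "(\<lambda>l. of_real (- (4 * pi\<^sup>2) * cr k l) * g (k - l) * b l) summable_on UNIV"
  using jac_abs_summable[OF assms] by (rule abs_summable_summable)

lemma jac_pointwise:
  assumes "wbound wt g G" "wbound (\<lambda>k. 1) b B"
  shows "cmod (jac g b k) \<le> 4 * pi\<^sup>2 * wt k * G * B"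
proof -
  have "cmod (jac g b k) \<le> (\<Sum>\<^sub>\<infinity>l. cmod (of_real (- (4 * pi\<^sup>2) * cr k l) * g (k - l) * b l))"
    unfolding jac_def by (rule norm_infsum_bound[OF jac_abs_summable[OF assms]])
  also have "\<dots> \<le> 4 * pi\<^sup>2 * wt k * G * B"
    using jac_abs_summable[OF assms] jac_partial_pointwise[OF assms]
    by (intro infsum_le_finite_sums) auto
  finally show ?thesis .
qed

lemma jac_diff_left:
  assumes "wbound wt g G" "wbound wt g' G'" "wbound (\<lambda>k. 1) b B"
  shows "jac (\<lambda>k. g k - g' k) b k = jac g b k - jac g' b k"
proof -
  have "jac (\<lambda>k. g k - g' k) b k = (\<Sum>\<^sub>\<infinity>l. of_real (- (4 * pi\<^sup>2) * cr k l) * g (k - l) * b l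
     + - (of_real (- (4 * pi\<^sup>2) * cr k l) * g' (k - l) * b l))"
    unfolding jac_def by (intro infsum_cong) (simp add: algebra_simps)
  also have "\<dots> = jac g b k + (\<Sum>\<^sub>\<infinity>l. - (of_real (- (4 * pi\<^sup>2) * cr k l) * g' (k - l) * b l))"
    unfolding jac_def
    by (intro infsum_add jac_summable[OF assms(1,3)] summable_on_uminus[THEN iffD2] jac_summable[OF assms(2,3)])
  also have "\<dots> = jac g b k - jac g' b k"
    unfolding jac_def by (simp only: infsum_uminus) simp
  finally show ?thesis .
qed

lemma jac_diff_right:
  assumes "wbound wt g G" "wbound (\<lambda>k. 1) b B" "wbound (\<lambda>k. 1) b' B'"
  shows "jac g (\<lambda>k. b k - b' k) k = jac g b k - jac g b' k"
proof -
  have "jac g (\<lambda>k. b k - b' k) k = (\<Sum>\<^sub>\<infinity>l. of_real (- (4 * pi\<^sup>2) * cr k l) * g (k - l) * b l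
     + - (of_real (- (4 * pi\<^sup>2) * cr k l) * g (k - l) * b' l))"
    unfolding jac_def by (intro infsum_cong) (simp add: algebra_simps)
  also have "\<dots> = jac g b k + (\<Sum>\<^sub>\<infinity>l. - (of_real (- (4 * pi\<^sup>2) * cr k l) * g (k - l) * b' l))"
    unfolding jac_def
    by (intro infsum_add jac_summable[OF assms(1,2)] summable_on_uminus[THEN iffD2] jac_summable[OF assms(1,3)])
  also have "\<dots> = jac g b k - jac g b' k"
    unfolding jac_def by (simp only: infsum_uminus) simp
  finally show ?thesis .
qed

lemma jac_finite_support:
  assumes "finite K" "\<And>l. l \<notin> K \<Longrightarrow> b l = 0"
  shows "jac g b k = (\<Sum>l\<in>K. of_real (- (4 * pi\<^sup>2) * cr k l) * g (k - l) * b l)"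
proof -
  have "jac g b k = (\<Sum>\<^sub>\<infinity>l\<in>K. of_real (- (4 * pi\<^sup>2) * cr k l) * g (k - l) * b l)"
    unfolding jac_def by (rule infsum_cong_neutral) (use assms in auto)
  then show ?thesis using assms by simp
qed

lemma jac_cnj:
  assumes "\<And>k. g (- k) = cnj (g k)" "\<And>k. b (- k) = cnj (b k)"
  shows "jac g b (- k) = cnj (jac g b k)"
proof -
  have "bij (uminus :: freq \<Rightarrow> freq)" by (rule Fun.bij_uminus)
  then have "jac g b (- k) = (\<Sum>\<^sub>\<infinity>l. of_real (- (4 * pi\<^sup>2) * cr (- k) (- l)) * g (- k - - l) * b (- l))"
    unfolding jac_def
    by (rule infsum_reindex_bij_betw[symmetric, where g = uminus])
  also have "\<dots> = (\<Sum>\<^sub>\<infinity>l. cnj (of_real (- (4 * pi\<^sup>2) * cr k l) * g (k - l) * b l))"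
    using assms(1)[of "k - _"] assms(2) by (intro infsum_cong) simp
  also have "\<dots> = cnj (jac g b k)"
    unfolding jac_def by (rule infsum_cnj)
  finally show ?thesis .
qed

text \<open>The partial sums over finite \<open>L\<close> converge to \<open>jac g b k\<close> for
  each \<open>k\<close>, so by \<open>wbound_limit\<close> a bound uniform in \<open>L\<close> is
  enough, and for it the sums may be taken with absolute values.\<close>

lemma wbound_jac_of_partial:
  assumes "wbound wt g G" "wbound (\<lambda>k. 1) b B" and W: "\<And>k. 0 \<le> W k"
    and le: "\<And>K L. finite K \<Longrightarrow> finite L \<Longrightarrow>
      L2_set (\<lambda>k. \<Sum>l\<in>L. W k * \<bar>cr k l\<bar> * cmod (g (k - l)) * cmod (b l)) K \<le> C"
  shows "wbound W (jac g b) (4 * pi\<^sup>2 * C)"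
proof -
  let ?s = "\<lambda>L k. (\<Sum>l\<in>L. of_real (- (4 * pi\<^sup>2) * cr k l) * g (k - l) * b l)"
  have lim: "((\<lambda>L. ?s L k) \<longlongrightarrow> jac g b k) (finite_subsets_at_top UNIV)" for k
    unfolding jac_def by (rule infsum_tendsto[OF jac_summable[OF assms(1,2)]])
  have "wbound W (?s L) (4 * pi\<^sup>2 * C)" if L: "finite L" for L
  proof (rule wboundI)
    fix K :: "freq set" assume K: "finite K"
    have "L2_set (\<lambda>k. W k * cmod (?s L k)) K
        \<le> L2_set (\<lambda>k. 4 * pi\<^sup>2 * (\<Sum>l\<in>L. W k * \<bar>cr k l\<bar> * cmod (g (k - l)) * cmod (b l))) K"
    proof (rule L2_set_mono)
      fix k
      have "cmod (?s L k) \<le> (\<Sum>l\<in>L. 4 * pi\<^sup>2 * (\<bar>cr k l\<bar> * cmod (g (k - l)) * cmod (b l)))"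
        by (rule order_trans[OF norm_sum]) (simp add: cmod_jac_term[simplified])
      then have "W k * cmod (?s L k) \<le> W k * (\<Sum>l\<in>L. 4 * pi\<^sup>2 * (\<bar>cr k l\<bar> * cmod (g (k - l)) * cmod (b l)))"
        using W by (intro mult_left_mono)
      also have "\<dots> = 4 * pi\<^sup>2 * (\<Sum>l\<in>L. W k * \<bar>cr k l\<bar> * cmod (g (k - l)) * cmod (b l))"
        by (simp add: sum_distrib_left mult_ac)
      finally show "W k * cmod (?s L k)
        \<le> 4 * pi\<^sup>2 * (\<Sum>l\<in>L. W k * \<bar>cr k l\<bar> * cmod (g (k - l)) * cmod (b l))" .
    qed (use W in auto)
    also have "\<dots> = 4 * pi\<^sup>2 * L2_set (\<lambda>k. \<Sum>l\<in>L. W k * \<bar>cr k l\<bar> * cmod (g (k - l)) * cmod (b l)) K"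
      by (simp add: L2_set_right_distrib)
    also have "\<dots> \<le> 4 * pi\<^sup>2 * C"
      using le[OF K L] by (intro mult_left_mono) auto
    finally show "L2_set (\<lambda>k. W k * cmod (?s L k)) K \<le> 4 * pi\<^sup>2 * C" .
  qed
  then show ?thesis
    by (intro wbound_limit[OF lim]) (auto intro: eventually_finite_subsets_at_top_weakI)
qed

text \<open>\<open>wt k ^ p\<close> and \<open>cr\<close> distribute \<open>p + 1\<close> powers to
  each factor; the two extra powers on \<open>g\<close> make it summable. The exponents
  \<open>q\<close> and \<open>r\<close> are tied to \<open>p\<close> by equations so that facts with
  numerals as exponents unify.\<close>

lemma wbound_jac:
  assumes "wbound (\<lambda>k. wt k ^ q) g G" "wbound (\<lambda>k. wt k ^ r) b B" "q = p + 3" "r = p + 1"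
  shows "wbound (\<lambda>k. wt k ^ p) (jac g b) (4 * pi\<^sup>2 * (c0 * G * B))"
proof (rule wbound_jac_of_partial)
  have g: "wbound (\<lambda>k. wt k ^ (p + 3)) g G" and b: "wbound (\<lambda>k. wt k ^ (p + 1)) b B"
    using assms by auto
  show "wbound wt g G" using wbound_power_weaken[OF g, of 1] by simp
  show "wbound (\<lambda>k. 1) b B" using wbound_power_weaken[OF b, of 0] by simp
  fix K L :: "freq set" assume K: "finite K" and L: "finite L"
  have "L2_set (\<lambda>k. \<Sum>l\<in>L. wt k ^ p * \<bar>cr k l\<bar> * cmod (g (k - l)) * cmod (b l)) K
      \<le> L2_set (\<lambda>k. \<Sum>l\<in>L. (wt (k - l) ^ (p + 1) * cmod (g (k - l))) * (wt l ^ (p + 1) * cmod (b l))) K"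
  proof (intro L2_set_mono sum_mono)
    fix k l
    have "wt k ^ p * \<bar>cr k l\<bar> \<le> (wt (k - l) * wt l) ^ p * (wt (k - l) * wt l)"
      by (intro mult_mono power_mono wt_le_mult abs_cr_le_left) auto
    also have "\<dots> = wt (k - l) ^ (p + 1) * wt l ^ (p + 1)"
      by (simp add: power_mult_distrib)
    finally have "wt k ^ p * \<bar>cr k l\<bar> * (cmod (g (k - l)) * cmod (b l))
        \<le> wt (k - l) ^ (p + 1) * wt l ^ (p + 1) * (cmod (g (k - l)) * cmod (b l))"
      by (rule mult_right_mono) auto
    then show "wt k ^ p * \<bar>cr k l\<bar> * cmod (g (k - l)) * cmod (b l)
        \<le> (wt (k - l) ^ (p + 1) * cmod (g (k - l))) * (wt l ^ (p + 1) * cmod (b l))"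
      by (simp only: mult_ac)
  qed (auto intro!: sum_nonneg)
  also have "\<dots> \<le> c0 * G * B"
  proof (rule L2_set_convolution_le[OF K L])
    fix M :: "freq set" assume "finite M"
    then show "L2_set (\<lambda>m. (wt m)\<^sup>2 * (wt m ^ (p + 1) * cmod (g m))) M \<le> G"
      using wboundD[OF g, of M] by (simp add: power_add power2_eq_square power3_eq_cube ac_simps)
  qed (use L wboundD[OF b] in auto)
  finally show "L2_set (\<lambda>k. \<Sum>l\<in>L. wt k ^ p * \<bar>cr k l\<bar> * cmod (g (k - l)) * cmod (b l)) K \<le> c0 * G * B" .
qed auto

text \<open>\<open>wbound_jac\<close> with \<open>p = 2\<close> would ask for \<open>g\<close> at
  weight five, but the topography is available at weight four only. Splitting
  \<open>wt k ^ 2\<close> into twice the sum of two squares leaves three powers on one factor and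
  one on the other, and the factor with one power still has the two that make it summable. The
  constant 4 is 2 + 2.\<close>

lemma wbound_jac_source:
  assumes g: "wbound (\<lambda>k. wt k ^ 3) g G" and b: "wbound (\<lambda>k. wt k ^ 3) b B"
  shows "wbound (\<lambda>k. wt k ^ 2) (jac g b) (4 * pi\<^sup>2 * (4 * c0 * G * B))"
proof (rule wbound_jac_of_partial)
  show "wbound wt g G" using wbound_power_weaken[OF g, of 1] by simp
  show "wbound (\<lambda>k. 1) b B" using wbound_power_weaken[OF b, of 0] by simp
  fix K L :: "freq set" assume K: "finite K" and L: "finite L"
  let ?g1 = "\<lambda>m. wt m ^ 1 * cmod (g m)" and ?g3 = "\<lambda>m. wt m ^ 3 * cmod (g m)"
  let ?b1 = "\<lambda>m. wt m ^ 1 * cmod (b m)" and ?b3 = "\<lambda>m. wt m ^ 3 * cmod (b m)"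
  have "L2_set (\<lambda>k. \<Sum>l\<in>L. wt k ^ 2 * \<bar>cr k l\<bar> * cmod (g (k - l)) * cmod (b l)) K
      \<le> L2_set (\<lambda>k. 2 * (\<Sum>l\<in>L. ?g3 (k - l) * ?b1 l) + 2 * (\<Sum>l\<in>L. ?g1 (k - l) * ?b3 l)) K"
  proof (intro L2_set_mono)
    fix k
    have "wt k ^ 2 * \<bar>cr k l\<bar> * cmod (g (k - l)) * cmod (b l)
        \<le> 2 * (?g3 (k - l) * ?b1 l) + 2 * (?g1 (k - l) * ?b3 l)" for l
    proof -
      have "wt k ^ 2 \<le> (wt (k - l) + wt l) ^ 2"
        by (intro power_mono wt_le_add) auto
      also have "\<dots> \<le> 2 * wt (k - l) ^ 2 + 2 * wt l ^ 2"
        using sum_squares_bound[of "wt (k - l)" "wt l"] by (simp add: power2_sum)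
      finally have "wt k ^ 2 * \<bar>cr k l\<bar> \<le> (2 * wt (k - l) ^ 2 + 2 * wt l ^ 2) * (wt (k - l) * wt l)"
        by (intro mult_mono abs_cr_le_left) auto
      then have "wt k ^ 2 * \<bar>cr k l\<bar> * (cmod (g (k - l)) * cmod (b l))
         \<le> (2 * wt (k - l) ^ 2 + 2 * wt l ^ 2) * (wt (k - l) * wt l) * (cmod (g (k - l)) * cmod (b l))"
        by (intro mult_right_mono) auto
      then show ?thesis by (simp add: algebra_simps power2_eq_square power3_eq_cube)
    qed
    then have "(\<Sum>l\<in>L. wt k ^ 2 * \<bar>cr k l\<bar> * cmod (g (k - l)) * cmod (b l))
        \<le> (\<Sum>l\<in>L. 2 * (?g3 (k - l) * ?b1 l) + 2 * (?g1 (k - l) * ?b3 l))"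
      by (intro sum_mono)
    also have "\<dots> = 2 * (\<Sum>l\<in>L. ?g3 (k - l) * ?b1 l) + 2 * (\<Sum>l\<in>L. ?g1 (k - l) * ?b3 l)"
      by (simp add: sum.distrib sum_distrib_left)
    finally show "(\<Sum>l\<in>L. wt k ^ 2 * \<bar>cr k l\<bar> * cmod (g (k - l)) * cmod (b l))
       \<le> 2 * (\<Sum>l\<in>L. ?g3 (k - l) * ?b1 l) + 2 * (\<Sum>l\<in>L. ?g1 (k - l) * ?b3 l)" .
  qed (auto intro!: sum_nonneg)
  also have "\<dots> \<le> L2_set (\<lambda>k. 2 * (\<Sum>l\<in>L. ?g3 (k - l) * ?b1 l)) K
      + L2_set (\<lambda>k. 2 * (\<Sum>l\<in>L. ?g1 (k - l) * ?b3 l)) K"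
    by (rule L2_set_triangle_ineq)
  also have "\<dots> = 2 * L2_set (\<lambda>k. \<Sum>l\<in>L. ?g3 (k - l) * ?b1 l) K
      + 2 * L2_set (\<lambda>k. \<Sum>l\<in>L. ?g1 (k - l) * ?b3 l) K"
    by (simp add: L2_set_right_distrib)
  also have "\<dots> \<le> 2 * (c0 * G * B) + 2 * (c0 * G * B)"
  proof (intro add_mono mult_left_mono)
    show "L2_set (\<lambda>k. \<Sum>l\<in>L. ?g3 (k - l) * ?b1 l) K \<le> c0 * G * B"
    proof (rule L2_set_convolution_le'[OF K L])
      fix M :: "freq set" assume "finite M"
      then show "L2_set (\<lambda>m. (wt m)\<^sup>2 * ?b1 m) M \<le> B"
        using wboundD[OF b, of M] by (simp add: mult.assoc[symmetric] power2_eq_square power3_eq_cube)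
    qed (use wboundD[OF g] in auto)
    show "L2_set (\<lambda>k. \<Sum>l\<in>L. ?g1 (k - l) * ?b3 l) K \<le> c0 * G * B"
    proof (rule L2_set_convolution_le[OF K L])
      fix M :: "freq set" assume "finite M"
      then show "L2_set (\<lambda>m. (wt m)\<^sup>2 * ?g1 m) M \<le> G"
        using wboundD[OF g, of M] by (simp add: mult.assoc[symmetric] power2_eq_square power3_eq_cube)
    qed (use L wboundD[OF b] in auto)
  qed auto
  finally show "L2_set (\<lambda>k. \<Sum>l\<in>L. wt k ^ 2 * \<bar>cr k l\<bar> * cmod (g (k - l)) * cmod (b l)) K \<le> 4 * c0 * G * B"
    by (simp add: mult_ac)
qed auto

section \<open>The transport estimate\<close>

text \<open>The weights whose commutator with \<open>jac\<close> loses no derivative.\<close>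

definition adm :: "(freq \<Rightarrow> real) \<Rightarrow> bool" where
  "adm w \<longleftrightarrow> (\<forall>k. 0 \<le> w k) \<and> (\<forall>k l. \<bar>w k - w l\<bar> * wt l \<le> 3 * wt (k - l) ^ 3 * w l)"

text \<open>The symmetric part \<open>w k w l\<close> of the weight cancels by antisymmetry of
  \<open>cr\<close>, and the commutator \<open>w k (w k - w l)\<close> gains the derivative lost in \<open>jac\<close>.\<close>

lemma transport_estimate:
  assumes "finite K" and g: "\<And>k. g (- k) = cnj (g k)" and G: "wbound (\<lambda>k. wt k ^ 6) g G"
    and w: "adm w" and supp: "\<And>k. k \<notin> K \<Longrightarrow> x k = 0"
  shows "\<bar>Re (\<Sum>k\<in>K. of_real ((w k)\<^sup>2) * (cnj (x k) * jac g x k))\<bar>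
      \<le> 12 * pi\<^sup>2 * c0 * G * (L2_set (\<lambda>k. w k * cmod (x k)) K)\<^sup>2"
proof -
  have w0: "0 \<le> w k" and wd: "\<bar>w k - w l\<bar> * wt l \<le> 3 * wt (k - l) ^ 3 * w l" for k l
    using w by (simp_all add: adm_def)
  define T where "T k l = of_real (- (4 * pi\<^sup>2) * cr k l) * g (k - l) * x l * cnj (x k)" for k l
  define S0 where "S0 = (\<Sum>k\<in>K. \<Sum>l\<in>K. of_real (w k * w l) * T k l)"
  \<comment> \<open>Skewness of transport by a real stream function: conjugation symmetry of
    \<open>g\<close> and antisymmetry of \<open>cr\<close> together make the symmetric sum
    \<open>S0\<close> purely imaginary.\<close>
  have T_swap: "T l k = - cnj (T k l)" for k l
    using g[of "k - l"] by (simp add: T_def cr_swap[of l k])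
  have eq: "of_real (w l * w k) * T l k = - cnj (of_real (w k * w l) * T k l)" for k l
    by (subst T_swap) (simp add: mult.commute)
  have "S0 = (\<Sum>k\<in>K. \<Sum>l\<in>K. of_real (w l * w k) * T l k)"
    unfolding S0_def by (rule sum.swap)
  also have "\<dots> = (\<Sum>k\<in>K. \<Sum>l\<in>K. - cnj (of_real (w k * w l) * T k l))"
    by (intro sum.cong refl eq)
  also have "\<dots> = - cnj S0"
    unfolding S0_def by (simp only: sum_negf cnj_sum)
  finally have "Re S0 = Re (- cnj S0)" by simp
  then have Re0: "Re S0 = 0" by simp
  have "(\<Sum>k\<in>K. of_real ((w k)\<^sup>2) * (cnj (x k) * jac g x k)) - S0
      = (\<Sum>k\<in>K. \<Sum>l\<in>K. of_real (w k * (w k - w l)) * T k l)" (is "?X - S0 = ?Y")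
  proof -
    have "?X = (\<Sum>k\<in>K. \<Sum>l\<in>K. of_real ((w k)\<^sup>2) * T k l)"
      using assms(1) supp
      by (simp add: jac_finite_support[of K] sum_distrib_left T_def mult_ac)
    then show ?thesis
      unfolding S0_def \<open>?X = _\<close> sum_subtractf[symmetric]
      by (intro sum.cong refl) (simp add: power2_eq_square algebra_simps)
  qed
  from arg_cong[OF this, of Re] have "\<bar>Re ?X\<bar> = \<bar>Re ?Y\<bar>" using Re0
    by (simp only: minus_complex.sel diff_zero)
  also have "\<dots> \<le> cmod ?Y" by (rule abs_Re_le_cmod)
  also have "\<dots> \<le> (\<Sum>k\<in>K. \<Sum>l\<in>K. cmod (of_real (w k * (w k - w l)) * T k l))"
    by (intro order_trans[OF norm_sum] sum_mono norm_sum)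
  also have "\<dots> \<le> (\<Sum>k\<in>K. \<Sum>l\<in>K. (w k * cmod (x k)) * (12 * pi\<^sup>2 * (wt (k - l) ^ 4 * cmod (g (k - l)))) * (w l * cmod (x l)))"
  proof (intro sum_mono)
    fix k l
    have "\<bar>w k - w l\<bar> * \<bar>cr k l\<bar> \<le> \<bar>w k - w l\<bar> * (wt (k - l) * wt l)"
      by (intro mult_left_mono abs_cr_le_left) auto
    also have "\<dots> = (\<bar>w k - w l\<bar> * wt l) * wt (k - l)" by simp
    also have "\<dots> \<le> (3 * wt (k - l) ^ 3 * w l) * wt (k - l)"
      by (intro mult_right_mono wd) auto
    also have "\<dots> = 3 * (wt (k - l) ^ 4 * w l)" by (simp add: power4_eq_xxxx power3_eq_cube)
    finally have "(w k * (4 * pi\<^sup>2 * (cmod (g (k - l)) * cmod (x l) * cmod (x k)))) * (\<bar>w k - w l\<bar> * \<bar>cr k l\<bar>)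
       \<le> (w k * (4 * pi\<^sup>2 * (cmod (g (k - l)) * cmod (x l) * cmod (x k)))) * (3 * (wt (k - l) ^ 4 * w l))"
      using w0 by (intro mult_left_mono) auto
    moreover have "cmod (of_real (w k * (w k - w l)) * T k l)
       = (w k * (4 * pi\<^sup>2 * (cmod (g (k - l)) * cmod (x l) * cmod (x k)))) * (\<bar>w k - w l\<bar> * \<bar>cr k l\<bar>)"
    proof -
      have "cmod (of_real (w k * (w k - w l)) * T k l)
          = \<bar>w k * (w k - w l)\<bar> * (\<bar>- (4 * pi\<^sup>2) * cr k l\<bar> * cmod (g (k - l)) * cmod (x l) * cmod (x k))"
        unfolding T_def by (simp only: norm_mult norm_of_real complex_mod_cnj)
      then show ?thesis using w0[of k] by (simp add: abs_mult)
    qed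
    ultimately show "cmod (of_real (w k * (w k - w l)) * T k l)
        \<le> (w k * cmod (x k)) * (12 * pi\<^sup>2 * (wt (k - l) ^ 4 * cmod (g (k - l)))) * (w l * cmod (x l))"
      by (simp add: mult_ac)
  qed
  also have "\<dots> \<le> c0 * (12 * pi\<^sup>2 * G) * L2_set (\<lambda>k. w k * cmod (x k)) K * L2_set (\<lambda>k. w k * cmod (x k)) K"
  proof (rule trilinear_le[OF assms(1) assms(1)])
    fix M :: "freq set" assume M: "finite M"
    \<comment> \<open>Here the weight six of the hypothesis is used up: four powers come from the
      commutator and \<open>cr\<close>, two from summability.\<close>
    have "L2_set (\<lambda>m. (wt m)\<^sup>2 * (12 * pi\<^sup>2 * (wt m ^ 4 * cmod (g m)))) M
        = L2_set (\<lambda>m. 12 * pi\<^sup>2 * (wt m ^ 6 * cmod (g m))) M"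
      by (intro L2_set_cong) (simp_all add: power_add[of _ 2 4, simplified])
    also have "\<dots> = 12 * pi\<^sup>2 * L2_set (\<lambda>m. wt m ^ 6 * cmod (g m)) M"
      by (simp add: L2_set_right_distrib)
    also have "\<dots> \<le> 12 * pi\<^sup>2 * G"
      by (intro mult_left_mono wboundD[OF G M]) auto
    finally show "L2_set (\<lambda>m. (wt m)\<^sup>2 * (12 * pi\<^sup>2 * (wt m ^ 4 * cmod (g m)))) M \<le> 12 * pi\<^sup>2 * G" .
  qed (use w0 in auto)
  finally show ?thesis by (simp add: power2_eq_square mult_ac)
qed

text \<open>A mollification of \<open>wt\<close>: bounded for every \<open>\<epsilon> > 0\<close>, and \<open>adm\<close> uniformly in \<open>\<epsilon>\<close>.\<close>

definition qw :: "real \<Rightarrow> freq \<Rightarrow> real" where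
  "qw \<epsilon> k = wt k / (1 + \<epsilon> * wt k)"

text \<open>A sharper form of \<open>adm\<close> that is stable under products.\<close>

definition adm_order :: "nat \<Rightarrow> (freq \<Rightarrow> real) \<Rightarrow> bool" where
  "adm_order n w \<longleftrightarrow> (\<forall>k. 0 \<le> w k) \<and> (\<forall>k l. w k \<le> wt (k - l) ^ n * w l) \<and>
     (\<forall>k l. \<bar>w k - w l\<bar> * wt l \<le> real n * wt (k - l) ^ n * w l)"

lemma adm_order_0: "adm_order 0 (\<lambda>k. 1)"
  by (simp add: adm_order_def)

text \<open>A discrete product rule: the difference of the products is split as
  \<open>(v k - v l) * w k + v l * (w k - w l)\<close>, and \<open>w k\<close> is moved to
  \<open>l\<close> by its growth bound. The orders add because the powers of
  \<open>wt (k - l)\<close> do.\<close>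

lemma adm_order_mult:
  assumes "adm_order m v" "adm_order n w"
  shows "adm_order (m + n) (\<lambda>k. v k * w k)"
proof -
  have v: "0 \<le> v k" "v k \<le> wt (k - l) ^ m * v l" "\<bar>v k - v l\<bar> * wt l \<le> real m * wt (k - l) ^ m * v l"
    and w: "0 \<le> w k" "w k \<le> wt (k - l) ^ n * w l" "\<bar>w k - w l\<bar> * wt l \<le> real n * wt (k - l) ^ n * w l" for k l
    using assms unfolding adm_order_def by metis+
  have "\<bar>v k * w k - v l * w l\<bar> * wt l \<le> real (m + n) * wt (k - l) ^ (m + n) * (v l * w l)" for k l
  proof -
    have "v k * w k - v l * w l = (v k - v l) * w k + v l * (w k - w l)"
      by (simp add: algebra_simps)
    then have "\<bar>v k * w k - v l * w l\<bar> \<le> \<bar>v k - v l\<bar> * w k + v l * \<bar>w k - w l\<bar>"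
      using abs_triangle_ineq[of "(v k - v l) * w k" "v l * (w k - w l)"] v(1)[of l] w(1)[of k]
      by (simp add: abs_mult)
    then have "\<bar>v k * w k - v l * w l\<bar> * wt l \<le> (\<bar>v k - v l\<bar> * w k + v l * \<bar>w k - w l\<bar>) * wt l"
      by (rule mult_right_mono) auto
    also have "\<dots> = (\<bar>v k - v l\<bar> * wt l) * w k + v l * (\<bar>w k - w l\<bar> * wt l)"
      by (simp add: algebra_simps)
    also have "\<dots> \<le> (real m * wt (k - l) ^ m * v l) * (wt (k - l) ^ n * w l) + v l * (real n * wt (k - l) ^ n * w l)"
      by (intro add_mono mult_mono[OF v(3) w(2)] mult_left_mono[OF w(3)] mult_nonneg_nonneg v(1) w(1)) auto
    also have "v l * (real n * wt (k - l) ^ n * w l) \<le> wt (k - l) ^ m * (v l * (real n * wt (k - l) ^ n * w l))"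
    proof -
      have "1 * (v l * (real n * wt (k - l) ^ n * w l)) \<le> wt (k - l) ^ m * (v l * (real n * wt (k - l) ^ n * w l))"
        using v(1)[of l] w(1)[of l] by (intro mult_right_mono one_le_power mult_nonneg_nonneg) auto
      then show ?thesis by simp
    qed
    finally show ?thesis by (simp add: algebra_simps power_add)
  qed
  moreover have "v k * w k \<le> wt (k - l) ^ (m + n) * (v l * w l)" for k l
    using mult_mono[OF v(2)[of k l] w(2)[of k l]] v(1) w(1)
    by (simp add: power_add mult_ac)
  ultimately show ?thesis using v(1) w(1) by (auto simp: adm_order_def)
qed

lemma adm_order_imp_adm:
  assumes "adm_order n w" "n \<le> 3"
  shows "adm w"
proof -
  have w: "0 \<le> w k" "\<bar>w k - w l\<bar> * wt l \<le> real n * wt (k - l) ^ n * w l" for k l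
    using assms by (simp_all add: adm_order_def)
  moreover have "real n * wt (k - l) ^ n * w l \<le> 3 * wt (k - l) ^ 3 * w l" for k l
    using assms(2) w(1)[of l] by (intro mult_right_mono mult_mono power_increasing) auto
  ultimately show ?thesis unfolding adm_def by (meson order_trans)
qed

text \<open>The difference of two values is \<open>(wt k - wt l) / ((1 + \<epsilon> * wt k) * (1 +
  \<epsilon> * wt l))\<close>. Multiplied by \<open>wt l\<close> it reproduces
  \<open>qw \<epsilon> l\<close> and leaves a denominator of at least 1, hence constants that do not
  depend on \<epsilon>.\<close>

lemma adm_order_qw:
  assumes "0 \<le> \<epsilon>" shows "adm_order 1 (qw \<epsilon>)"
proof -
  have p: "0 < 1 + \<epsilon> * wt k" for k using assms by (intro add_pos_nonneg) auto
  have mono: "qw \<epsilon> k \<le> wt (k - l) * qw \<epsilon> l" for k l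
  proof -
    have "wt k * (1 + \<epsilon> * wt l) \<le> wt (k - l) * wt l * (1 + \<epsilon> * wt k)"
    proof -
      have "wt k * 1 \<le> wt (k - l) * wt l" using wt_le_mult[of k l] by simp
      moreover have "1 * (\<epsilon> * wt k * wt l) \<le> wt (k - l) * (\<epsilon> * wt k * wt l)"
        using assms by (intro mult_right_mono) auto
      ultimately show ?thesis by (simp add: algebra_simps)
    qed
    then show ?thesis unfolding qw_def using p[of k] p[of l]
      by (simp add: divide_simps mult_ac split: if_splits)
  qed
  have "\<bar>qw \<epsilon> k - qw \<epsilon> l\<bar> * wt l \<le> wt (k - l) * qw \<epsilon> l" for k l
  proof -
    have "qw \<epsilon> k - qw \<epsilon> l = (wt k - wt l) / ((1 + \<epsilon> * wt k) * (1 + \<epsilon> * wt l))"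
      unfolding qw_def using p[of k] p[of l]
      by (simp add: divide_simps) (simp add: algebra_simps)
    then have "\<bar>qw \<epsilon> k - qw \<epsilon> l\<bar> * wt l = \<bar>wt k - wt l\<bar> / (1 + \<epsilon> * wt k) * qw \<epsilon> l"
      unfolding qw_def using p[of k] p[of l] by (simp add: abs_mult abs_divide)
    also have "\<dots> \<le> wt (k - l) * qw \<epsilon> l"
    proof (rule mult_right_mono)
      have "\<bar>wt k - wt l\<bar> / (1 + \<epsilon> * wt k) \<le> \<bar>wt k - wt l\<bar> / 1"
        using assms p[of k] by (intro divide_left_mono) simp_all
      then show "\<bar>wt k - wt l\<bar> / (1 + \<epsilon> * wt k) \<le> wt (k - l)"
        using wt_diff_le[of k l] by simp
    qed (use p[of l] in \<open>auto simp: qw_def\<close>)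
    finally show ?thesis .
  qed
  then show ?thesis using mono p by (auto simp: adm_order_def qw_def intro!: divide_nonneg_pos)
qed

lemma qw_0 [simp]: "qw 0 = wt"
  by (auto simp: qw_def)

lemma qw_nonneg: "0 \<le> \<epsilon> \<Longrightarrow> 0 \<le> qw \<epsilon> k"
  using adm_order_qw[of \<epsilon>] by (simp add: adm_order_def)

lemma qw_le_wt: "0 \<le> \<epsilon> \<Longrightarrow> qw \<epsilon> k \<le> wt k"
  unfolding qw_def by (simp add: divide_le_eq mult_ge1_I add_pos_nonneg)

lemma qw_le_inverse: "0 < \<epsilon> \<Longrightarrow> qw \<epsilon> k \<le> 1 / \<epsilon>"
  unfolding qw_def using add_pos_nonneg[of 1 "\<epsilon> * wt k"] by (simp add: field_simps)

text \<open>The last two weights are mollifications of \<open>wt k ^ 3\<close> and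
  \<open>wt k ^ 2\<close> and coincide with them for \<epsilon> = 0. One factor \<open>wt\<close>
  stays unmollified in the weight for \<open>b\<close> because the consistency error of
  \<open>b\<close> is controlled in the weight \<open>wt\<close>, that of \<open>w\<close> in the
  weight 1.\<close>

lemma adm_weights:
  assumes "0 \<le> \<epsilon>"
  shows "adm (\<lambda>k. 1)" "adm wt" "adm (\<lambda>k. wt k * (qw \<epsilon> k)\<^sup>2)" "adm (\<lambda>k. (qw \<epsilon> k)\<^sup>2)"
proof -
  note q = adm_order_qw[OF assms] and w = adm_order_qw[of 0, simplified]
  note q2 = adm_order_mult[OF q q]
  show "adm (\<lambda>k. 1)" using adm_order_0 by (rule adm_order_imp_adm) simp
  show "adm wt" using w by (rule adm_order_imp_adm) simp
  show "adm (\<lambda>k. wt k * (qw \<epsilon> k)\<^sup>2)"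
    using adm_order_mult[OF w q2] unfolding power2_eq_square by (rule adm_order_imp_adm) simp
  show "adm (\<lambda>k. (qw \<epsilon> k)\<^sup>2)"
    using q2 unfolding power2_eq_square by (rule adm_order_imp_adm) simp
qed

section \<open>Differential inequalities and ordinary differential equations\<close>

text \<open>The function \<open>exp (- C * s) * D s - e * s\<close> does not increase, which a
  single application of the mean value theorem shows.\<close>

lemma gronwall:
  fixes D :: "real \<Rightarrow> real"
  assumes D: "\<And>s. s \<in> {0..T} \<Longrightarrow> (D has_real_derivative D' s) (at s within {0..T})"
    and le: "\<And>s. s \<in> {0..T} \<Longrightarrow> D' s \<le> C * D s + e"
    and "0 \<le> C" "0 \<le> e" and t: "t \<in> {0..T}"
  shows "D t \<le> exp (C * t) * (D 0 + e * t)"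
proof (cases "t = 0")
  case False
  then have "0 < t" using t by simp
  define \<phi> where "\<phi> s = exp (- C * s) * D s - e * s" for s
  define \<phi>' where "\<phi>' s = exp (- C * s) * (D' s - C * D s) - e" for s
  have "(\<phi> has_derivative (\<lambda>x. \<phi>' s * x)) (at s within {0..t})" if "s \<in> {0..t}" for s
  proof -
    have "(D has_real_derivative D' s) (at s within {0..t})"
      by (rule has_field_derivative_subset[OF D]) (use that t in auto)
    then have "(\<phi> has_real_derivative \<phi>' s) (at s within {0..t})"
      unfolding \<phi>_def \<phi>'_def
      by (auto intro!: derivative_eq_intros simp: algebra_simps)
    then show ?thesis by (simp add: has_field_derivative_def)
  qed
  from mvt_simple[OF \<open>0 < t\<close> this] obtain s where s: "s \<in> {0<..<t}" "\<phi> t - \<phi> 0 = \<phi>' s * t"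
    by auto
  have "exp (- C * s) * (D' s - C * D s) \<le> exp (- C * s) * e"
    using le[of s] s t by (intro mult_left_mono) auto
  also have "\<dots> \<le> 1 * e"
    using s assms by (intro mult_right_mono) auto
  finally have "\<phi>' s \<le> 0" by (simp add: \<phi>'_def)
  then have "\<phi> t \<le> \<phi> 0" using s(2) \<open>0 < t\<close> mult_nonpos_nonneg[of "\<phi>' s" t] by simp
  then have "exp (C * t) * (exp (- C * t) * D t) \<le> exp (C * t) * (D 0 + e * t)"
    by (intro mult_left_mono) (auto simp: \<phi>_def)
  then show ?thesis by (simp add: mult.assoc[symmetric] exp_add[symmetric])
qed simp

text \<open>The derivative is controlled only while \<open>E\<close> is at most \<open>b\<close>. Up
  to the earliest time at which \<open>b\<close> is reached the control applies and yields at most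
  \<open>a + C * T\<close>, which is below \<open>b\<close>.\<close>

lemma barrier:
  fixes E :: "real \<Rightarrow> real"
  assumes E: "\<And>s. s \<in> {0..T} \<Longrightarrow> (E has_real_derivative E' s) (at s within {0..T})"
    and le: "\<And>s. s \<in> {0..T} \<Longrightarrow> E s \<le> b \<Longrightarrow> E' s \<le> C"
    and "E 0 \<le> a" "0 \<le> C" "a + C * T < b" and t: "t \<in> {0..T}"
  shows "E t \<le> b"
proof (rule ccontr)
  assume "\<not> E t \<le> b"
  have cont: "continuous_on {0..T} E"
    by (rule DERIV_continuous_on[OF E])
  define A where "A = {u \<in> {0..t}. b \<le> E u}"
  have "compact A"
  proof -
    have "continuous_on {0..t} E" by (rule continuous_on_subset[OF cont]) (use t in auto)
    then have "closed A"
      unfolding A_def by (intro continuous_on_closed_Collect_le continuous_on_const) auto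
    then show ?thesis
      by (rule compact_eq_bounded_closed[THEN iffD2, OF conjI[rotated]])
        (rule bounded_subset[of "{0..t}"], auto simp: A_def)
  qed
  moreover have "t \<in> A" using \<open>\<not> E t \<le> b\<close> t by (auto simp: A_def)
  ultimately obtain s where s: "s \<in> A" "\<And>u. u \<in> A \<Longrightarrow> s \<le> u"
    using compact_attains_inf[of A] by blast
  have ab: "a < b" using assms(4,5) t by (smt (verit) atLeastAtMost_iff mult_nonneg_nonneg)
  have s': "0 \<le> s" "s \<le> t" "b \<le> E s" using s(1) by (auto simp: A_def)
  then have "0 < s" using ab \<open>E 0 \<le> a\<close> by (cases "s = 0") auto
  have "(E has_derivative (\<lambda>x. E' u * x)) (at u within {0..s})" if "u \<in> {0..s}" for u
  proof -
    have "(E has_real_derivative E' u) (at u within {0..s})"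
      by (rule has_field_derivative_subset[OF E]) (use that t s' in auto)
    then show ?thesis by (simp add: has_field_derivative_def)
  qed
  from mvt_simple[OF \<open>0 < s\<close> this] obtain u where u: "u \<in> {0<..<s}" "E s - E 0 = E' u * s"
    by auto
  have "u \<notin> A" using s(2)[of u] u by auto
  then have "E u < b" using u s' by (auto simp: A_def)
  then have "E' u \<le> C" using le[of u] u s' t by auto
  then have "E' u * s \<le> C * s" using s' by (intro mult_right_mono)
  also have "\<dots> \<le> C * T" using s' t \<open>0 \<le> C\<close> by (intro mult_left_mono) auto
  finally show False using u(2) s' \<open>E 0 \<le> a\<close> assms(5) by linarith
qed

lemma has_vector_derivative_cmod_sum:
  assumes "finite K" "\<And>k. k \<in> K \<Longrightarrow> ((\<lambda>s. x s k) has_vector_derivative d k) (at t within S)"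
  shows "((\<lambda>s. \<Sum>k\<in>K. (w k)\<^sup>2 * (cmod (x s k))\<^sup>2) has_real_derivative
     2 * (\<Sum>k\<in>K. (w k)\<^sup>2 * Re (cnj (x t k) * d k))) (at t within S)"
proof -
  have "((\<lambda>s. (w k)\<^sup>2 * (cmod (x s k))\<^sup>2) has_real_derivative 2 * ((w k)\<^sup>2 * Re (cnj (x t k) * d k)))
      (at t within S)" if "k \<in> K" for k
  proof -
    define p q where "p s = Re (x s k)" and "q s = Im (x s k)" for s
    have "(p has_real_derivative Re (d k)) (at t within S)"
      "(q has_real_derivative Im (d k)) (at t within S)"
      unfolding p_def q_def has_real_derivative_iff_has_vector_derivative
      by (rule bounded_linear.has_vector_derivative[OF bounded_linear_Re assms(2)[OF that]]
          bounded_linear.has_vector_derivative[OF bounded_linear_Im assms(2)[OF that]])+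
    moreover have "(cmod (x s k))\<^sup>2 = (p s)\<^sup>2 + (q s)\<^sup>2" for s
      by (simp add: cmod_power2 p_def q_def)
    moreover have "Re (cnj (x t k) * d k) = p t * Re (d k) + q t * Im (d k)"
      by (simp add: p_def q_def)
    ultimately show ?thesis
      by (auto intro!: derivative_eq_intros simp: algebra_simps)
  qed
  then show ?thesis unfolding sum_distrib_left by (intro DERIV_sum)
qed

text \<open>Global existence by the contraction principle; the weight \<open>exp (2 K t)\<close> makes the Picard
  operator a contraction on all of \<open>{0..T}\<close> at once.\<close>

lemma lipschitz_ode_exists:
  fixes F :: "'a::banach \<Rightarrow> 'a"
  assumes L: "\<And>x y. norm (F x - F y) \<le> L * norm (x - y)" and "0 \<le> T"
  obtains x where "x 0 = x0"
    "\<And>t. t \<in> {0..T} \<Longrightarrow> (x has_vector_derivative F (x t)) (at t within {0..T})"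
proof -
  define K where "K = \<bar>L\<bar> + 1"
  have K: "0 < K" "L \<le> K" by (auto simp: K_def)
  have LK: "norm (F x - F y) \<le> K * norm (x - y)" for x y
    using L[of x y] K(2) by (meson mult_right_mono norm_ge_zero order_trans)
  have "K-lipschitz_on UNIV F"
    using K LK by (intro lipschitz_onI) (auto simp: dist_norm)
  then have Fc: "continuous_on UNIV F"
    by (rule lipschitz_on_continuous_on)
  \<comment> \<open>Elements of \<open>bcontfun\<close> are defined on the whole line; clamping the
    time extends functions on \<open>{0..T}\<close> by their boundary values.\<close>
  define cl where "cl t = max 0 (min T t)" for t :: real
  have cl: "cl t \<in> {0..T}" for t using \<open>0 \<le> T\<close> by (auto simp: cl_def)
  have cl_id: "cl t = t" if "t \<in> {0..T}" for t using that by (auto simp: cl_def)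
  have cl_cont: "continuous_on UNIV cl" unfolding cl_def by (intro continuous_intros)
  \<comment> \<open>The unknown \<open>y\<close> is the solution divided by the exponential, so that
    the plain supremum norm acts as the weighted one.\<close>
  define I where "I y s = F (exp (2 * K * s) *\<^sub>R apply_bcontfun y s)" for y :: "real \<Rightarrow>\<^sub>C 'a" and s
  have I_cont: "continuous_on S (I y)" for y S
    unfolding I_def
    by (intro continuous_on_compose2[OF Fc] continuous_intros continuous_on_apply_bcontfun) auto
  have I_int: "I y integrable_on {0..t}" for y t
    by (rule integrable_continuous_interval[OF I_cont])
  define \<Psi> where "\<Psi> y t = exp (- (2 * K * t)) *\<^sub>R (x0 + integral {0..t} (I y))" for y t
  have \<Psi>_cont: "continuous_on {0..T} (\<Psi> y)" for y
    unfolding \<Psi>_def by (intro continuous_intros indefinite_integral_continuous_1 I_int)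
  define \<Phi> where "\<Phi> y = Bcontfun (\<lambda>t. \<Psi> y (cl t))" for y
  have \<Phi>: "apply_bcontfun (\<Phi> y) t = \<Psi> y (cl t)" for y t
  proof -
    have "continuous_on UNIV (\<lambda>t. \<Psi> y (cl t))"
      by (rule continuous_on_compose2[OF \<Psi>_cont cl_cont]) (use cl in auto)
    moreover have "bounded (range (\<lambda>t. \<Psi> y (cl t)))"
      by (rule bounded_subset[OF compact_imp_bounded[OF compact_continuous_image[OF \<Psi>_cont compact_Icc]]])
        (use cl in auto)
    ultimately have "(\<lambda>t. \<Psi> y (cl t)) \<in> bcontfun" by (simp add: bcontfun_def)
    then show ?thesis unfolding \<Phi>_def by (simp add: Bcontfun_inverse)
  qed
  have contr: "dist (\<Phi> y) (\<Phi> z) \<le> 1 / 2 * dist y z" for y z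
  proof (rule dist_bound)
    fix u
    define t where "t = cl u"
    have t: "0 \<le> t" "t \<le> T" using cl[of u] by (auto simp: t_def)
    have hi: "((\<lambda>s. K * (exp (2 * K * s) * dist y z)) has_integral
        exp (2 * K * t) / 2 * dist y z - exp (2 * K * 0) / 2 * dist y z) {0..t}"
      by (rule fundamental_theorem_of_calculus)
        (auto intro!: derivative_eq_intros simp: t has_real_derivative_iff_has_vector_derivative[symmetric])
    have "norm (integral {0..t} (\<lambda>s. I y s - I z s)) \<le> integral {0..t} (\<lambda>s. K * (exp (2 * K * s) * dist y z))"
    proof (rule integral_norm_bound_integral)
      show "(\<lambda>s. I y s - I z s) integrable_on {0..t}" by (intro integrable_diff I_int)
      show "(\<lambda>s. K * (exp (2 * K * s) * dist y z)) integrable_on {0..t}" using hi by blast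
      fix s
      have "norm (I y s - I z s) \<le> K * norm (exp (2 * K * s) *\<^sub>R apply_bcontfun y s - exp (2 * K * s) *\<^sub>R apply_bcontfun z s)"
        unfolding I_def by (rule LK)
      also have "\<dots> = K * (exp (2 * K * s) * dist (apply_bcontfun y s) (apply_bcontfun z s))"
        by (simp add: dist_norm scaleR_diff_right[symmetric])
      also have "\<dots> \<le> K * (exp (2 * K * s) * dist y z)"
        using K by (intro mult_left_mono dist_bounded) auto
      finally show "norm (I y s - I z s) \<le> K * (exp (2 * K * s) * dist y z)" .
    qed
    also have "\<dots> = exp (2 * K * t) / 2 * dist y z - dist y z / 2"
      using integral_unique[OF hi] by simp
    also have "\<dots> \<le> exp (2 * K * t) / 2 * dist y z" by simp
    finally have *: "norm (integral {0..t} (\<lambda>s. I y s - I z s)) \<le> exp (2 * K * t) / 2 * dist y z" .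
    have "dist (\<Psi> y t) (\<Psi> z t) = exp (- (2 * K * t)) * norm (integral {0..t} (\<lambda>s. I y s - I z s))"
      unfolding \<Psi>_def dist_norm scaleR_diff_right[symmetric] norm_scaleR
      by (simp add: integral_diff[OF I_int I_int])
    also have "\<dots> \<le> exp (- (2 * K * t)) * (exp (2 * K * t) / 2 * dist y z)"
      using * by (intro mult_left_mono) auto
    also have "\<dots> = 1 / 2 * dist y z" by (simp add: exp_minus)
    finally show "dist (apply_bcontfun (\<Phi> y) u) (apply_bcontfun (\<Phi> z) u) \<le> 1 / 2 * dist y z"
      by (simp add: \<Phi> t_def)
  qed
  have "\<exists>!y. \<Phi> y = y"
    by (rule banach_fix_type[of "1 / 2"]) (use contr in auto)
  then obtain y where y: "\<Phi> y = y" by blast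
  define x where "x t = exp (2 * K * t) *\<^sub>R apply_bcontfun y t" for t
  have x: "x t = x0 + integral {0..t} (\<lambda>s. F (x s))" if "t \<in> {0..T}" for t
  proof -
    have "apply_bcontfun y t = \<Psi> y t" using \<Phi>[of y t] cl_id[OF that] y by simp
    then have "x t = exp (2 * K * t) *\<^sub>R exp (- (2 * K * t)) *\<^sub>R (x0 + integral {0..t} (I y))"
      by (simp add: x_def \<Psi>_def)
    also have "\<dots> = x0 + integral {0..t} (I y)"
      by (simp add: exp_minus)
    finally show ?thesis unfolding I_def x_def .
  qed
  have xc: "continuous_on {0..T} (\<lambda>s. F (x s))"
    using I_cont[of "{0..T}" y] by (simp add: I_def x_def)
  show ?thesis
  proof (rule that)
    show "x 0 = x0" using x[of 0] \<open>0 \<le> T\<close> by simp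
    fix t assume t: "t \<in> {0..T}"
    have "((\<lambda>u. x0 + integral {0..u} (\<lambda>s. F (x s))) has_vector_derivative (0 + F (x t))) (at t within {0..T})"
      by (intro has_vector_derivative_add has_vector_derivative_const integral_has_vector_derivative xc t)
    then show "(x has_vector_derivative F (x t)) (at t within {0..T})"
      by (intro has_vector_derivative_transform[OF t x]) auto
  qed
qed

section \<open>The system on the Fourier side\<close>

definition trunc :: "freq set \<Rightarrow> (freq \<Rightarrow> complex) \<Rightarrow> freq \<Rightarrow> complex" where
  "trunc K x k = (if k \<in> K then x k else 0)"

text \<open>Defined through \<open>wt\<close>, so that outside the box each spare power of the
  weight yields a factor \<open>1 / n\<close>. Symmetry under negation keeps truncations of real
  functions real.\<close>

definition fbox :: "nat \<Rightarrow> freq set" where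
  "fbox n = {k. wt k \<le> real n}"

lemma finite_fbox [simp]: "finite (fbox n)"
proof (rule finite_subset)
  show "fbox n \<subseteq> {- int n..int n} \<times> {- int n..int n}"
    by (auto simp: fbox_def wt_def)
qed auto

lemma fbox_mono: "m \<le> n \<Longrightarrow> fbox m \<subseteq> fbox n"
  by (auto simp: fbox_def)

lemma fbox_minus: "- k \<in> fbox n \<longleftrightarrow> k \<in> fbox n"
  by (simp add: fbox_def)

lemma finite_subset_fbox: "finite K \<Longrightarrow> \<exists>n. K \<subseteq> fbox n"
proof (induction rule: finite_induct)
  case (insert k K)
  then obtain n where "K \<subseteq> fbox n" by blast
  moreover obtain m where "wt k \<le> real m" using real_arch_simple by blast
  ultimately have "insert k K \<subseteq> fbox (max n m)" by (auto simp: fbox_def)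
  then show ?case by blast
qed simp

text \<open>Half the time derivative of the weighted energy on \<open>K\<close> when
  \<open>x\<close> moves with velocity \<open>d\<close>. Linearity in \<open>d\<close> is what
  allows main terms and errors to be treated separately.\<close>

definition rate :: "(freq \<Rightarrow> real) \<Rightarrow> freq set \<Rightarrow> (freq \<Rightarrow> complex) \<Rightarrow> (freq \<Rightarrow> complex) \<Rightarrow> real" where
  "rate w K x d = (\<Sum>k\<in>K. (w k)\<^sup>2 * Re (cnj (x k) * d k))"

lemma rate_add: "rate w K x (\<lambda>k. d k + e k) = rate w K x d + rate w K x e"
  by (simp add: rate_def distrib_left sum.distrib)

lemma rate_uminus: "rate w K x (\<lambda>k. - d k) = - rate w K x d"
  by (simp add: rate_def algebra_simps flip: sum_negf)

lemma rate_diff: "rate w K x (\<lambda>k. d k - e k) = rate w K x d - rate w K x e"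
  using rate_add[of w K x d "\<lambda>k. - e k"] by (simp add: rate_uminus)

lemma rate_le:
  assumes "\<And>k. 0 \<le> w k"
  shows "\<bar>rate w K x d\<bar> \<le> L2_set (\<lambda>k. w k * cmod (x k)) K * L2_set (\<lambda>k. w k * cmod (d k)) K"
proof -
  have "\<bar>rate w K x d\<bar> \<le> (\<Sum>k\<in>K. (w k * cmod (x k)) * (w k * cmod (d k)))"
    unfolding rate_def
  proof (rule order_trans[OF sum_abs sum_mono])
    fix k
    have "\<bar>Re (cnj (x k) * d k)\<bar> \<le> cmod (x k) * cmod (d k)"
      using abs_Re_le_cmod[of "cnj (x k) * d k"] by (simp only: norm_mult complex_mod_cnj)
    then have "(w k)\<^sup>2 * \<bar>Re (cnj (x k) * d k)\<bar> \<le> (w k)\<^sup>2 * (cmod (x k) * cmod (d k))"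
      by (intro mult_left_mono) auto
    then show "\<bar>(w k)\<^sup>2 * Re (cnj (x k) * d k)\<bar> \<le> (w k * cmod (x k)) * (w k * cmod (d k))"
      by (simp only: abs_mult abs_power2 power2_eq_square mult_ac)
  qed
  also have "\<dots> \<le> L2_set (\<lambda>k. w k * cmod (x k)) K * L2_set (\<lambda>k. w k * cmod (d k)) K"
    by (rule sum_mult_le_L2_set)
  finally show ?thesis .
qed

lemma rate_transport:
  assumes "finite K" "\<And>k. g (- k) = cnj (g k)" "wbound (\<lambda>k. wt k ^ 6) g G"
    "adm w" "\<And>k. k \<notin> K \<Longrightarrow> x k = 0"
  shows "\<bar>rate w K x (jac g x)\<bar> \<le> 12 * pi\<^sup>2 * c0 * G * (L2_set (\<lambda>k. w k * cmod (x k)) K)\<^sup>2"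
proof -
  have "rate w K x (jac g x) = Re (\<Sum>k\<in>K. of_real ((w k)\<^sup>2) * (cnj (x k) * jac g x k))"
    unfolding rate_def Re_sum by (intro sum.cong refl) (simp only: Re_complex_of_real times_complex.sel complex_of_real_def complex.sel mult_zero_left diff_zero)
  then show ?thesis using transport_estimate[OF assms(1-4), of x] assms(5) by simp
qed

lemma wbound_support:
  assumes "finite K" "\<And>k. k \<notin> K \<Longrightarrow> x k = 0" "\<And>k. 0 \<le> W k"
  shows "wbound W x (L2_set (\<lambda>k. W k * cmod (x k)) K)"
proof (rule wboundI)
  fix L :: "freq set" assume "finite L"
  have "L2_set (\<lambda>k. W k * cmod (x k)) L = L2_set (\<lambda>k. W k * cmod (x k)) (L \<inter> K)"
    unfolding L2_set_def using assms \<open>finite L\<close>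
    by (intro arg_cong[where f = sqrt] sum.mono_neutral_right) auto
  also have "\<dots> \<le> L2_set (\<lambda>k. W k * cmod (x k)) K"
    using assms by (intro L2_set_mono_set) auto
  finally show "L2_set (\<lambda>k. W k * cmod (x k)) L \<le> L2_set (\<lambda>k. W k * cmod (x k)) K" .
qed

lemma wbound_trunc:
  assumes "wbound W x B" "\<And>k. 0 \<le> W k"
  shows "wbound W (trunc K x) B"
  by (rule wbound_mono[OF assms(1), where c = 1]) (use assms in \<open>auto simp: trunc_def\<close>)

lemma wbound_tail:
  assumes "wbound (\<lambda>k. wt k ^ p) x B" "Suc m \<le> p" "0 < n"
  shows "wbound (\<lambda>k. wt k ^ m) (\<lambda>k. x k - trunc (fbox n) x k) (B / real n)"
proof (rule wbound_mono[OF assms(1), where c = "1 / real n"])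
  fix k
  show "wt k ^ m * cmod (x k - trunc (fbox n) x k) \<le> 1 / real n * (wt k ^ p * cmod (x k))"
  proof (cases "k \<in> fbox n")
    case False
    then have "real n \<le> wt k" by (simp add: fbox_def)
    then have "wt k ^ m * real n \<le> wt k ^ m * wt k" by (intro mult_left_mono) auto
    also have "\<dots> = wt k ^ Suc m" by simp
    also have "\<dots> \<le> wt k ^ p" using assms by (intro power_increasing) auto
    finally have "(wt k ^ m * real n) * cmod (x k) \<le> wt k ^ p * cmod (x k)"
      by (intro mult_right_mono) auto
    then show ?thesis using assms False by (simp add: field_simps trunc_def)
  qed (simp add: trunc_def)
qed (use assms in auto)

text \<open>\<open>\<mu>\<close> is the symbol of $(1-\alpha\Delta)^{-1}(\Delta-1)^{-1}$; the coefficients of the topography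
  $h$ enter with the factor $1/2$ already included.\<close>

locale tqg_data =
  fixes \<mu> :: "freq \<Rightarrow> real" and f h :: "freq \<Rightarrow> complex" and M F H :: real
  assumes mu_le: "wt k ^ 4 * \<bar>\<mu> k\<bar> \<le> M"
    and mu_minus: "\<mu> (- k) = \<mu> k"
    and f_cnj: "f (- k) = cnj (f k)"
    and h_cnj: "h (- k) = cnj (h k)"
    and f_bound: "wbound (\<lambda>k. wt k ^ 2) f F"
    and h_bound: "wbound (\<lambda>k. wt k ^ 4) h H"
begin

lemma nonneg [simp]: "0 \<le> M" "0 \<le> F" "0 \<le> H"
proof -
  show "0 \<le> M" using mu_le[of 0] by (meson abs_ge_zero mult_nonneg_nonneg order_trans wt_nonneg zero_le_power)
qed (use wbound_nonneg f_bound h_bound in auto)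

definition strm :: "(freq \<Rightarrow> complex) \<Rightarrow> freq \<Rightarrow> complex" where
  "strm w k = of_real (\<mu> k) * (w k - f k)"

definition Fb :: "(freq \<Rightarrow> complex) \<Rightarrow> (freq \<Rightarrow> complex) \<Rightarrow> freq \<Rightarrow> complex" where
  "Fb b w k = - jac (strm w) b k"

definition Fw :: "(freq \<Rightarrow> complex) \<Rightarrow> (freq \<Rightarrow> complex) \<Rightarrow> freq \<Rightarrow> complex" where
  "Fw b w k = - jac (strm w) (\<lambda>l. w l - b l) k - jac h b k"

text \<open>The bound of the stream function at weight six when \<open>w\<close> is bounded by
  \<open>R\<close> at weight two; see \<open>wbound_strm\<close>.\<close>

definition G :: "real \<Rightarrow> real" where
  "G R = M * (R + F)"

lemma wbound_mu:
  assumes "wbound (\<lambda>k. wt k ^ p) x B"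
  shows "wbound (\<lambda>k. wt k ^ (p + 4)) (\<lambda>k. of_real (\<mu> k) * x k) (M * B)"
proof (rule wbound_mono[OF assms, where c = M])
  fix k
  have "(wt k ^ 4 * \<bar>\<mu> k\<bar>) * (wt k ^ p * cmod (x k)) \<le> M * (wt k ^ p * cmod (x k))"
    by (intro mult_right_mono mu_le) auto
  then show "wt k ^ (p + 4) * cmod (of_real (\<mu> k) * x k) \<le> M * (wt k ^ p * cmod (x k))"
    by (simp add: norm_mult power_add mult_ac)
qed auto

lemma wbound_strm:
  assumes "wbound (\<lambda>k. wt k ^ 2) w R"
  shows "wbound (\<lambda>k. wt k ^ 6) (strm w) (G R)"
proof -
  have "wbound (\<lambda>k. wt k ^ 2) (\<lambda>k. w k - f k) (R + F)"
    by (intro wbound_diff assms f_bound) auto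
  from wbound_mu[OF this] show ?thesis by (simp add: strm_def[abs_def] G_def)
qed

lemma strm_diff: "strm w k - strm w' k = of_real (\<mu> k) * (w k - w' k)"
  by (simp add: strm_def algebra_simps)

lemma strm_cnj: "(\<And>k. w (- k) = cnj (w k)) \<Longrightarrow> strm w (- k) = cnj (strm w k)"
  by (simp add: strm_def mu_minus f_cnj)

lemma Fb_cnj:
  "\<lbrakk>\<And>k. b (- k) = cnj (b k); \<And>k. w (- k) = cnj (w k)\<rbrakk> \<Longrightarrow> Fb b w (- k) = cnj (Fb b w k)"
  unfolding Fb_def by (subst jac_cnj) (auto simp: strm_cnj)

lemma Fw_cnj:
  "\<lbrakk>\<And>k. b (- k) = cnj (b k); \<And>k. w (- k) = cnj (w k)\<rbrakk> \<Longrightarrow> Fw b w (- k) = cnj (Fw b w k)"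
  unfolding Fw_def by (subst (1 2) jac_cnj) (auto simp: strm_cnj h_cnj)

definition bdd :: "real \<Rightarrow> (freq \<Rightarrow> complex) \<Rightarrow> (freq \<Rightarrow> complex) \<Rightarrow> bool" where
  "bdd R b w \<longleftrightarrow> wbound (\<lambda>k. wt k ^ 3) b R \<and> wbound (\<lambda>k. wt k ^ 2) w R"

lemma bddD:
  assumes "bdd R b w"
  shows "0 \<le> R" "m \<le> 3 \<Longrightarrow> wbound (\<lambda>k. wt k ^ m) b R" "m \<le> 2 \<Longrightarrow> wbound (\<lambda>k. wt k ^ m) w R"
    "wbound wt b R" "wbound wt w R" "wbound (\<lambda>k. 1) b R" "wbound (\<lambda>k. 1) w R"
    "m \<le> 6 \<Longrightarrow> wbound (\<lambda>k. wt k ^ m) (strm w) (G R)" "wbound wt (strm w) (G R)" "0 \<le> G R"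
proof -
  have b: "wbound (\<lambda>k. wt k ^ 3) b R" and w: "wbound (\<lambda>k. wt k ^ 2) w R"
    using assms by (auto simp: bdd_def)
  note p = wbound_power_weaken[OF b] wbound_power_weaken[OF w] wbound_power_weaken[OF wbound_strm[OF w]]
  show "0 \<le> R" using wbound_nonneg[OF b] .
  then show "0 \<le> G R" by (simp add: G_def)
  show "m \<le> 3 \<Longrightarrow> wbound (\<lambda>k. wt k ^ m) b R" "m \<le> 2 \<Longrightarrow> wbound (\<lambda>k. wt k ^ m) w R"
    "m \<le> 6 \<Longrightarrow> wbound (\<lambda>k. wt k ^ m) (strm w) (G R)" by (rule p, assumption)+
  show "wbound wt b R" "wbound wt w R" "wbound wt (strm w) (G R)" using p[of 1] by simp_all
  show "wbound (\<lambda>k. 1) b R" "wbound (\<lambda>k. 1) w R" using p[of 0] by simp_all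
qed

lemma h_bounds: "m \<le> 4 \<Longrightarrow> wbound (\<lambda>k. wt k ^ m) h H" "wbound wt h H"
  using wbound_power_weaken[OF h_bound] wbound_power_weaken[OF h_bound, of 1] by simp_all

lemma wbound_strm_h:
  assumes "bdd R b w"
  shows "m \<le> 4 \<Longrightarrow> wbound (\<lambda>k. wt k ^ m) (\<lambda>k. strm w k - h k) (G R + H)"
    "wbound wt (\<lambda>k. strm w k - h k) (G R + H)"
  by (intro wbound_diff bddD[OF assms] h_bounds; simp)+

text \<open>The two occurrences of \<open>b\<close> are merged into one source. Only the transport
  of \<open>w\<close> by its own stream function needs the cancellation; the source can be estimated
  directly because \<open>b\<close> has a derivative more.\<close>

lemma Fw_eq:
  assumes "bdd R b w"
  shows "Fw b w k = - jac (strm w) w k + jac (\<lambda>k. strm w k - h k) b k"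
  unfolding Fw_def
  using jac_diff_right[OF bddD(9,7,6)[OF assms], of k]
    jac_diff_left[OF bddD(9)[OF assms] h_bounds(2) bddD(6)[OF assms], of k] by simp

section \<open>Energy, difference and consistency estimates\<close>

definition C1 :: "real \<Rightarrow> real" where
  "C1 R = 24 * pi\<^sup>2 * c0 * G R * R\<^sup>2 + 16 * pi\<^sup>2 * c0 * (G R + H) * R\<^sup>2"

text \<open>Both transport terms fall under \<open>rate_transport\<close>, the source under
  Cauchy-Schwarz and \<open>wbound_jac_source\<close>; \<open>C1\<close> adds the three constants.
  It depends neither on \<open>K\<close> nor on the weights, so the same bound serves all Galerkin
  levels and all mollifications.\<close>

lemma energy_rate:
  assumes K: "finite K" and supp: "\<And>k. k \<notin> K \<Longrightarrow> b k = 0" "\<And>k. k \<notin> K \<Longrightarrow> w k = 0"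
    and w: "\<And>k. w (- k) = cnj (w k)" and bdd: "bdd R b w"
    and adm: "adm v1" "adm v2" and le: "\<And>k. v1 k \<le> wt k ^ 3" "\<And>k. v2 k \<le> wt k ^ 2"
  shows "\<bar>rate v1 K b (Fb b w) + rate v2 K w (Fw b w)\<bar> \<le> C1 R"
proof -
  have nn: "0 \<le> v1 k" "0 \<le> v2 k" for k using adm by (auto simp: adm_def)
  have R: "0 \<le> R" "0 \<le> G R" using bddD[OF bdd] by auto
  have b: "L2_set (\<lambda>k. v1 k * cmod (b k)) K \<le> R" and ww: "L2_set (\<lambda>k. v2 k * cmod (w k)) K \<le> R"
    by (rule wboundD[OF wbound_weaken[OF bddD(2)[OF bdd order_refl]] K]
        wboundD[OF wbound_weaken[OF bddD(3)[OF bdd order_refl]] K]; use nn le in auto)+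
  note G6 = bddD(8)[OF bdd order_refl]
  have c: "0 \<le> 12 * pi\<^sup>2 * c0 * G R" using R by simp
  have t1: "\<bar>rate v1 K b (jac (strm w) b)\<bar> \<le> 12 * pi\<^sup>2 * c0 * G R * R\<^sup>2"
    by (rule order_trans[OF rate_transport[OF K strm_cnj[of w, OF w] G6 adm(1) supp(1)]])
      (use b c R in \<open>auto intro!: mult_left_mono power_mono\<close>)
  have t2: "\<bar>rate v2 K w (jac (strm w) w)\<bar> \<le> 12 * pi\<^sup>2 * c0 * G R * R\<^sup>2"
    by (rule order_trans[OF rate_transport[OF K strm_cnj[of w, OF w] G6 adm(2) supp(2)]])
      (use ww c R in \<open>auto intro!: mult_left_mono power_mono\<close>)
  let ?s = "jac (\<lambda>k. strm w k - h k) b"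
  have "\<bar>rate v2 K w ?s\<bar> \<le> L2_set (\<lambda>k. v2 k * cmod (w k)) K * L2_set (\<lambda>k. v2 k * cmod (?s k)) K"
    by (rule rate_le[OF nn(2)])
  also have "\<dots> \<le> R * (4 * pi\<^sup>2 * (4 * c0 * (G R + H) * R))"
  proof (intro mult_mono ww)
    have "wbound (\<lambda>k. wt k ^ 2) ?s (4 * pi\<^sup>2 * (4 * c0 * (G R + H) * R))"
      by (rule wbound_jac_source[OF wbound_strm_h(1)[OF bdd] bddD(2)[OF bdd]]) auto
    then show "L2_set (\<lambda>k. v2 k * cmod (?s k)) K \<le> 4 * pi\<^sup>2 * (4 * c0 * (G R + H) * R)"
      by (rule wboundD[OF wbound_weaken K]) (use nn le in auto)
  qed (use R in auto)
  finally have t3: "\<bar>rate v2 K w ?s\<bar> \<le> 16 * pi\<^sup>2 * c0 * (G R + H) * R\<^sup>2"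
    by (simp add: power2_eq_square mult_ac)
  have "rate v1 K b (Fb b w) = - rate v1 K b (jac (strm w) b)"
    unfolding Fb_def[abs_def] rate_uminus ..
  moreover have "rate v2 K w (Fw b w) = - rate v2 K w (jac (strm w) w) + rate v2 K w ?s"
    unfolding Fw_eq[OF bdd, abs_def] rate_add rate_uminus ..
  ultimately show ?thesis using t1 t2 t3 unfolding C1_def by linarith
qed

definition C2 :: "real \<Rightarrow> real" where
  "C2 R = 12 * pi\<^sup>2 * c0 * G R + 4 * pi\<^sup>2 * c0 * (3 * M * R + G R + H)"

text \<open>Where the difference itself is transported, the transport estimate applies. Elsewhere it
  sits in \<open>\<Psi>\<close>, the difference of the stream functions, or in a source term with
  \<open>\<beta>\<close>. For \<open>\<eta>\<close> at weight 0 the multiplier puts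
  \<open>\<Psi>\<close> at weight four, just what \<open>wbound_jac\<close> needs for an output at
  weight 1; the lost derivative falls on \<open>b'\<close> and \<open>w'\<close>, which can afford
  it.\<close>

lemma difference_rate:
  assumes K: "finite K"
    and supp: "\<And>k. k \<notin> K \<Longrightarrow> b k = 0" "\<And>k. k \<notin> K \<Longrightarrow> w k = 0"
    "\<And>k. k \<notin> K \<Longrightarrow> b' k = 0" "\<And>k. k \<notin> K \<Longrightarrow> w' k = 0"
    and w: "\<And>k. w (- k) = cnj (w k)" and bdd: "bdd R b w" "bdd R b' w'"
  defines "\<beta> \<equiv> \<lambda>k. b k - b' k" and "\<eta> \<equiv> \<lambda>k. w k - w' k"
  defines "X \<equiv> L2_set (\<lambda>k. wt k * cmod (\<beta> k)) K" and "Y \<equiv> L2_set (\<lambda>k. 1 * cmod (\<eta> k)) K"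
  shows "\<bar>rate wt K \<beta> (\<lambda>k. Fb b w k - Fb b' w' k) + rate (\<lambda>k. 1) K \<eta> (\<lambda>k. Fw b w k - Fw b' w' k)\<bar>
    \<le> C2 R * (X\<^sup>2 + Y\<^sup>2)"
proof -
  define \<Psi> where "\<Psi> k = strm w k - strm w' k" for k
  have R: "0 \<le> R" "0 \<le> G R" using bddD[OF bdd(1)] by auto
  have X: "0 \<le> X" and Y: "0 \<le> Y" by (auto simp: X_def Y_def)
  have \<beta>0: "k \<notin> K \<Longrightarrow> \<beta> k = 0" and \<eta>0: "k \<notin> K \<Longrightarrow> \<eta> k = 0" for k
    using supp by (auto simp: \<beta>_def \<eta>_def)
  have \<eta>: "wbound (\<lambda>k. wt k ^ 0) \<eta> Y"
    using wbound_support[of K \<eta> "\<lambda>k. 1"] K \<eta>0 by (simp add: Y_def)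
  have \<beta>: "wbound (\<lambda>k. wt k ^ 1) \<beta> X"
    using wbound_support[of K \<beta> wt] K \<beta>0 by (simp add: X_def)
  have \<Psi>4: "wbound (\<lambda>k. wt k ^ 4) \<Psi> (M * Y)"
    using wbound_mu[OF \<eta>] unfolding \<Psi>_def strm_diff \<eta>_def by simp
  have \<Psi>3: "wbound (\<lambda>k. wt k ^ 3) \<Psi> (M * Y)" by (rule wbound_power_weaken[OF \<Psi>4]) simp
  have \<Psi>1: "wbound wt \<Psi> (M * Y)" using wbound_power_weaken[OF \<Psi>4, of 1] by simp
  note s = strm_cnj[of w, OF w] and G6 = bddD(8)[OF bdd(1) order_refl]
  have adms: "adm wt" "adm (\<lambda>k. 1)" using adm_weights[of 0] by auto
  have Fb: "Fb b w k - Fb b' w' k = - jac (strm w) \<beta> k - jac \<Psi> b' k" for k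
    unfolding Fb_def \<beta>_def \<Psi>_def
    using jac_diff_right[OF bddD(9,6)[OF bdd(1)] bddD(6)[OF bdd(2)], of k]
      jac_diff_left[OF bddD(9)[OF bdd(1)] bddD(9,6)[OF bdd(2)], of k] by simp
  have Fw: "Fw b w k - Fw b' w' k
     = - jac (strm w) \<eta> k - jac \<Psi> w' k + jac (\<lambda>k. strm w k - h k) \<beta> k + jac \<Psi> b' k" for k
  proof -
    have "jac (strm w) \<eta> k = jac (strm w) w k - jac (strm w) w' k"
      unfolding \<eta>_def by (rule jac_diff_right[OF bddD(9,7)[OF bdd(1)] bddD(7)[OF bdd(2)]])
    moreover have "jac \<Psi> w' k = jac (strm w) w' k - jac (strm w') w' k"
      unfolding \<Psi>_def by (rule jac_diff_left[OF bddD(9)[OF bdd(1)] bddD(9,7)[OF bdd(2)]])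
    moreover have "jac (\<lambda>k. strm w k - h k) \<beta> k
        = jac (\<lambda>k. strm w k - h k) b k - jac (\<lambda>k. strm w k - h k) b' k"
      unfolding \<beta>_def by (rule jac_diff_right[OF wbound_strm_h(2)[OF bdd(1)] bddD(6)[OF bdd(1)] bddD(6)[OF bdd(2)]])
    moreover have "jac \<Psi> b' k = jac (\<lambda>k. strm w k - h k) b' k - jac (\<lambda>k. strm w' k - h k) b' k"
      using jac_diff_left[OF wbound_strm_h(2)[OF bdd(1)] wbound_strm_h(2)[OF bdd(2)] bddD(6)[OF bdd(2)], of k]
      by (simp add: \<Psi>_def[abs_def])
    ultimately show ?thesis unfolding Fw_eq[OF bdd(1)] Fw_eq[OF bdd(2)] by simp
  qed
  have t1: "\<bar>rate wt K \<beta> (jac (strm w) \<beta>)\<bar> \<le> 12 * pi\<^sup>2 * c0 * G R * X\<^sup>2"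
    unfolding X_def by (rule rate_transport[OF K s G6 adms(1) \<beta>0])
  have t2: "\<bar>rate (\<lambda>k. 1) K \<eta> (jac (strm w) \<eta>)\<bar> \<le> 12 * pi\<^sup>2 * c0 * G R * Y\<^sup>2"
    unfolding Y_def by (rule rate_transport[OF K s G6 adms(2) \<eta>0])
  have t3: "\<bar>rate wt K \<beta> (jac \<Psi> b')\<bar> \<le> X * (4 * pi\<^sup>2 * (c0 * (M * Y) * R))"
  proof (rule order_trans[OF rate_le], goal_cases)
    case 2
    have "wbound (\<lambda>k. wt k ^ 1) (jac \<Psi> b') (4 * pi\<^sup>2 * (c0 * (M * Y) * R))"
      by (rule wbound_jac[OF \<Psi>4 bddD(2)[OF bdd(2), of 2]]) auto
    from wboundD[OF this K] show ?case
      unfolding X_def[symmetric] by (intro mult_left_mono X) simp_all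
  qed simp
  have y: "\<bar>rate (\<lambda>k. 1) K \<eta> z\<bar> \<le> Y * Z" if "wbound (\<lambda>k. wt k ^ 0) z Z" for z Z
  proof (rule order_trans[OF rate_le], goal_cases)
    case 2
    from wboundD[OF that K] show ?case
      unfolding Y_def[symmetric] by (intro mult_left_mono Y) simp_all
  qed simp
  have t4: "\<bar>rate (\<lambda>k. 1) K \<eta> (jac \<Psi> w')\<bar> \<le> Y * (4 * pi\<^sup>2 * (c0 * (M * Y) * R))"
    by (rule y[OF wbound_jac[OF \<Psi>3 bddD(3)[OF bdd(2), of 1]]]) auto
  have t5: "\<bar>rate (\<lambda>k. 1) K \<eta> (jac \<Psi> b')\<bar> \<le> Y * (4 * pi\<^sup>2 * (c0 * (M * Y) * R))"
    by (rule y[OF wbound_jac[OF \<Psi>3 bddD(2)[OF bdd(2), of 1]]]) auto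
  have t6: "\<bar>rate (\<lambda>k. 1) K \<eta> (jac (\<lambda>k. strm w k - h k) \<beta>)\<bar> \<le> Y * (4 * pi\<^sup>2 * (c0 * (G R + H) * X))"
    by (rule y[OF wbound_jac[OF wbound_strm_h(1)[OF bdd(1), of 3] \<beta>]]) auto
  have tri: "\<bar>(- a1 - a3) + (((- a2 - a4) + a6) + a5)\<bar> \<le> A1 + A2 + A3 + A4 + A5 + A6"
    if "\<bar>a1\<bar> \<le> A1" "\<bar>a2\<bar> \<le> A2" "\<bar>a3\<bar> \<le> A3" "\<bar>a4\<bar> \<le> A4" "\<bar>a5\<bar> \<le> A5" "\<bar>a6\<bar> \<le> A6"
    for a1 a2 a3 a4 a5 a6 A1 A2 A3 A4 A5 A6 :: real using that by linarith
  have XY: "X * Y \<le> X\<^sup>2 + Y\<^sup>2" "Y\<^sup>2 \<le> X\<^sup>2 + Y\<^sup>2"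
    using sum_squares_bound[of X Y] X Y by (auto simp: mult_nonneg_nonneg) (use mult_nonneg_nonneg[OF X Y] in linarith)
  have "\<bar>rate wt K \<beta> (\<lambda>k. Fb b w k - Fb b' w' k) + rate (\<lambda>k. 1) K \<eta> (\<lambda>k. Fw b w k - Fw b' w' k)\<bar>
      \<le> 12 * pi\<^sup>2 * c0 * G R * X\<^sup>2 + 12 * pi\<^sup>2 * c0 * G R * Y\<^sup>2
       + X * (4 * pi\<^sup>2 * (c0 * (M * Y) * R)) + Y * (4 * pi\<^sup>2 * (c0 * (M * Y) * R))
       + Y * (4 * pi\<^sup>2 * (c0 * (M * Y) * R)) + Y * (4 * pi\<^sup>2 * (c0 * (G R + H) * X))"
    unfolding Fb Fw rate_add rate_diff rate_uminus by (rule tri[OF t1 t2 t3 t4 t5 t6])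
  also have "\<dots> = 12 * pi\<^sup>2 * c0 * G R * (X\<^sup>2 + Y\<^sup>2)
     + 4 * pi\<^sup>2 * c0 * ((M * R + G R + H) * (X * Y) + 2 * M * R * Y\<^sup>2)"
    by (simp add: algebra_simps power2_eq_square)
  also have "\<dots> \<le> 12 * pi\<^sup>2 * c0 * G R * (X\<^sup>2 + Y\<^sup>2)
     + 4 * pi\<^sup>2 * c0 * ((M * R + G R + H) * (X\<^sup>2 + Y\<^sup>2) + 2 * M * R * (X\<^sup>2 + Y\<^sup>2))"
    using R XY by (intro add_mono mult_left_mono) auto
  also have "\<dots> = C2 R * (X\<^sup>2 + Y\<^sup>2)"
    by (simp add: C2_def algebra_simps)
  finally show ?thesis .
qed

definition C3 :: "real \<Rightarrow> real" where
  "C3 R = 4 * pi\<^sup>2 * c0 * (2 * M * R\<^sup>2 + 2 * G R * R + H * R)"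

lemma C_nonneg: "0 \<le> R \<Longrightarrow> 0 \<le> C1 R" "0 \<le> R \<Longrightarrow> 0 \<le> C2 R" "0 \<le> R \<Longrightarrow> 0 \<le> C3 R" "0 \<le> R \<Longrightarrow> 0 \<le> G R"
  by (auto simp: C1_def C2_def C3_def G_def)

lemma bdd_trunc: "bdd R b w \<Longrightarrow> bdd R (trunc K b) (trunc K w)"
  by (auto simp: bdd_def intro!: wbound_trunc)

text \<open>\<open>difference_rate\<close> sums over finite supports, whereas a solution may have
  full support; it is therefore applied to truncations, and this is the error they make in the
  equation. Cutting off the arguments costs \<open>1 / n\<close> through their tails, cutting off
  the right-hand side to \<open>K\<close> costs \<open>1 / m\<close>. Either uses one spare power of
  the weight, hence the output weights \<open>wt\<close> and 1.\<close>

lemma consistency: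
  assumes bdd: "bdd R b w" and m: "fbox m \<subseteq> K" and pos: "0 < m" "0 < n"
  defines "bn \<equiv> trunc (fbox n) b" and "wn \<equiv> trunc (fbox n) w"
  shows "wbound wt (\<lambda>k. (if k \<in> K then Fb b w k else 0) - Fb bn wn k) (C3 R * (1 / n + 1 / m))"
    "wbound (\<lambda>k. 1) (\<lambda>k. (if k \<in> K then Fw b w k else 0) - Fw bn wn k) (C3 R * (1 / n + 1 / m))"
proof -
  have bdn: "bdd R bn wn" unfolding bn_def wn_def by (rule bdd_trunc[OF bdd])
  have R: "0 \<le> R" "0 \<le> G R" using bddD[OF bdd] by auto
  have n: "0 < real n" "0 < real m" using pos by auto
  have tb: "wbound (\<lambda>k. wt k ^ p) (\<lambda>k. b k - bn k) (R / n)" if "p \<le> 2" for p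
    unfolding bn_def by (rule wbound_tail[OF bddD(2)[OF bdd order_refl]]) (use that pos in auto)
  have tw: "wbound (\<lambda>k. wt k ^ p) (\<lambda>k. w k - wn k) (R / n)" if "p \<le> 1" for p
    unfolding wn_def by (rule wbound_tail[OF bddD(3)[OF bdd order_refl]]) (use that pos in auto)
  define \<Psi> where "\<Psi> k = strm w k - strm wn k" for k
  have \<Psi>: "wbound (\<lambda>k. wt k ^ 4) \<Psi> (M * (R / n))"
    using wbound_mu[OF tw[of 0]] unfolding \<Psi>_def strm_diff by simp
  have \<Psi>3: "wbound (\<lambda>k. wt k ^ 3) \<Psi> (M * (R / n))" by (rule wbound_power_weaken[OF \<Psi>]) simp
  define z where "z k = w k - b k" for k
  define zn where "zn k = wn k - bn k" for k
  have zb: "wbound (\<lambda>k. wt k ^ p) z (R + R)" if "p \<le> 2" for p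
    unfolding z_def by (intro wbound_diff bddD[OF bdd]) (use that in auto)
  have znb: "wbound (\<lambda>k. wt k ^ p) zn (R + R)" if "p \<le> 2" for p
    unfolding zn_def by (intro wbound_diff bddD[OF bdn]) (use that in auto)
  have tz: "wbound (\<lambda>k. wt k ^ p) (\<lambda>k. z k - zn k) (R / n + R / n)" if "p \<le> 1" for p
  proof -
    have "(\<lambda>k. z k - zn k) = (\<lambda>k. (w k - wn k) - (b k - bn k))" by (auto simp: z_def zn_def)
    then show ?thesis using that by (simp only:) (intro wbound_diff tw tb, auto)
  qed
  note z0 = zb[of 0, simplified] znb[of 0, simplified]
  have db: "wbound (\<lambda>k. wt k ^ 1) (\<lambda>k. Fb b w k - Fb bn wn k)
      (4 * pi\<^sup>2 * (c0 * (M * (R / n)) * R) + 4 * pi\<^sup>2 * (c0 * G R * (R / n)))"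
  proof -
    have "Fb b w k - Fb bn wn k = - (jac \<Psi> b k + jac (strm wn) (\<lambda>k. b k - bn k) k)" for k
      unfolding Fb_def \<Psi>_def
      using jac_diff_right[OF bddD(9)[OF bdn] bddD(6)[OF bdd] bddD(6)[OF bdn], of k]
        jac_diff_left[OF bddD(9)[OF bdd] bddD(9)[OF bdn] bddD(6)[OF bdd], of k] by simp
    then show ?thesis unfolding wbound_uminus[symmetric, of _ "\<lambda>k. Fb b w k - Fb bn wn k"]
      by (simp only: minus_minus)
        (intro wbound_add wbound_jac[OF \<Psi> bddD(2)[OF bdd, of 2]] wbound_jac[OF bddD(8)[OF bdn, of 4] tb[of 2]]; simp)
  qed
  have dw: "wbound (\<lambda>k. wt k ^ 0) (\<lambda>k. Fw b w k - Fw bn wn k)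
      (4 * pi\<^sup>2 * (c0 * (M * (R / n)) * (R + R)) + 4 * pi\<^sup>2 * (c0 * G R * (R / n + R / n))
        + 4 * pi\<^sup>2 * (c0 * H * (R / n)))"
  proof -
    have "Fw b w k - Fw bn wn k = - (jac \<Psi> z k + jac (strm wn) (\<lambda>k. z k - zn k) k + jac h (\<lambda>k. b k - bn k) k)" for k
      unfolding Fw_def \<Psi>_def z_def[symmetric] zn_def[symmetric]
      using jac_diff_right[OF bddD(9)[OF bdn] z0, of k]
        jac_diff_left[OF bddD(9)[OF bdd] bddD(9)[OF bdn] z0(1), of k]
        jac_diff_right[OF h_bounds(2) bddD(6)[OF bdd] bddD(6)[OF bdn], of k] by simp
    then show ?thesis unfolding wbound_uminus[symmetric, of _ "\<lambda>k. Fw b w k - Fw bn wn k"]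
      by (simp only: minus_minus)
        (intro wbound_add wbound_jac[OF \<Psi>3 zb[of 1]] wbound_jac[OF bddD(8)[OF bdn, of 3] tz[of 1]]
          wbound_jac[OF h_bounds(1)[of 3] tb[of 1]]; simp)
  qed
  have gb: "wbound (\<lambda>k. wt k ^ 2) (Fb bn wn) (4 * pi\<^sup>2 * (c0 * G R * R))"
    unfolding Fb_def[abs_def] wbound_uminus
    by (rule wbound_jac[OF bddD(8)[OF bdn, of 5] bddD(2)[OF bdn, of 3]]) auto
  have gw: "wbound (\<lambda>k. wt k ^ 1) (Fw bn wn) (4 * pi\<^sup>2 * (c0 * G R * (R + R)) + 4 * pi\<^sup>2 * (c0 * H * R))"
  proof -
    have "Fw bn wn k = - (jac (strm wn) zn k + jac h bn k)" for k by (simp add: Fw_def zn_def[abs_def])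
    then show ?thesis unfolding wbound_uminus[symmetric, of _ "Fw bn wn"]
      by (simp only: minus_minus)
        (intro wbound_add wbound_jac[OF bddD(8)[OF bdn, of 4] znb[of 2]]
          wbound_jac[OF h_bounds(1)[of 4] bddD(2)[OF bdn, of 2]]; simp)
  qed
  have cut: "wbound (\<lambda>k. wt k ^ p) (\<lambda>k. if k \<in> K then 0 else y k) (B / m)"
    if "wbound (\<lambda>k. wt k ^ Suc p) y B" for y p B
  proof (rule wbound_mono[OF that, where c = "1 / real m"])
    fix k
    show "wt k ^ p * cmod (if k \<in> K then 0 else y k) \<le> 1 / real m * (wt k ^ Suc p * cmod (y k))"
    proof (cases "k \<in> K")
      case False
      then have "real m \<le> wt k" using m linear[of "wt k" "real m"] by (auto simp: fbox_def)
      then have "(wt k ^ p * cmod (y k)) * real m \<le> (wt k ^ p * cmod (y k)) * wt k"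
        by (intro mult_left_mono) auto
      then show ?thesis using n False by (simp add: field_simps)
    qed auto
  qed (use n in auto)
  \<comment> \<open>On \<open>K\<close> this is the difference of the two right-hand sides, off
    \<open>K\<close> it is minus \<open>y'\<close>, which is small there because it is bounded with
    one more power.\<close>
  have comb: "wbound (\<lambda>k. wt k ^ p) (\<lambda>k. (if k \<in> K then y k else 0) - y' k) B"
    if "wbound (\<lambda>k. wt k ^ p) (\<lambda>k. y k - y' k) B1" "wbound (\<lambda>k. wt k ^ Suc p) y' B2" "B1 + B2 / m \<le> B"
    for y y' p B B1 B2
  proof -
    have "wbound (\<lambda>k. wt k ^ p) (\<lambda>k. trunc K (\<lambda>k. y k - y' k) k - (if k \<in> K then 0 else y' k)) (B1 + B2 / m)"
      by (intro wbound_diff wbound_trunc that cut) auto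
    moreover have "(\<lambda>k. trunc K (\<lambda>k. y k - y' k) k - (if k \<in> K then 0 else y' k)) = (\<lambda>k. (if k \<in> K then y k else 0) - y' k)"
      by (auto simp: trunc_def)
    ultimately have "wbound (\<lambda>k. wt k ^ p) (\<lambda>k. (if k \<in> K then y k else 0) - y' k) (B1 + B2 / m)" by simp
    then show ?thesis by (rule wbound_weaken) (use that in auto)
  qed
  define P where "P = 4 * pi\<^sup>2 * c0"
  have P: "0 \<le> P" by (simp add: P_def)
  have C3: "C3 R = P * (2 * (M * R\<^sup>2) + 2 * (G R * R) + H * R)" by (simp add: C3_def P_def)
  have nn: "0 \<le> M * R\<^sup>2" "0 \<le> G R * R" "0 \<le> H * R" using R by auto
  have fin: "P * A / n + P * B / m \<le> C3 R * (1 / n + 1 / m)"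
    if "A \<le> 2 * (M * R\<^sup>2) + 2 * (G R * R) + H * R" "B \<le> 2 * (M * R\<^sup>2) + 2 * (G R * R) + H * R" for A B
  proof -
    have "P * A \<le> C3 R" "P * B \<le> C3 R" unfolding C3 using that P by (auto intro: mult_left_mono)
    then have "P * A / n + P * B / m \<le> C3 R / n + C3 R / m"
      using n by (intro add_mono divide_right_mono) auto
    then show ?thesis by (simp add: algebra_simps)
  qed
  have "wbound (\<lambda>k. wt k ^ 1) (\<lambda>k. (if k \<in> K then Fb b w k else 0) - Fb bn wn k) (C3 R * (1 / n + 1 / m))"
  proof (rule comb[OF db])
    show "wbound (\<lambda>k. wt k ^ Suc 1) (Fb bn wn) (4 * pi\<^sup>2 * (c0 * G R * R))"
      using gb by (simp add: power2_eq_square)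
    show "4 * pi\<^sup>2 * (c0 * (M * (R / n)) * R) + 4 * pi\<^sup>2 * (c0 * G R * (R / n)) + 4 * pi\<^sup>2 * (c0 * G R * R) / m
        \<le> C3 R * (1 / n + 1 / m)"
      using fin[of "M * R\<^sup>2 + G R * R" "G R * R"] nn
      by (simp add: P_def algebra_simps power2_eq_square add_divide_distrib)
  qed
  then show "wbound wt (\<lambda>k. (if k \<in> K then Fb b w k else 0) - Fb bn wn k) (C3 R * (1 / n + 1 / m))" by simp
  have "wbound (\<lambda>k. wt k ^ 0) (\<lambda>k. (if k \<in> K then Fw b w k else 0) - Fw bn wn k) (C3 R * (1 / n + 1 / m))"
  proof (rule comb[OF dw])
    show "wbound (\<lambda>k. wt k ^ Suc 0) (Fw bn wn) (4 * pi\<^sup>2 * (c0 * G R * (R + R)) + 4 * pi\<^sup>2 * (c0 * H * R))"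
      using gw by simp
    show "4 * pi\<^sup>2 * (c0 * (M * (R / n)) * (R + R)) + 4 * pi\<^sup>2 * (c0 * G R * (R / n + R / n))
        + 4 * pi\<^sup>2 * (c0 * H * (R / n)) + (4 * pi\<^sup>2 * (c0 * G R * (R + R)) + 4 * pi\<^sup>2 * (c0 * H * R)) / m
        \<le> C3 R * (1 / n + 1 / m)"
      using fin[of "2 * (M * R\<^sup>2) + 2 * (G R * R) + H * R" "2 * (G R * R) + H * R"] nn
      by (simp add: P_def algebra_simps power2_eq_square add_divide_distrib)
  qed
  then show "wbound (\<lambda>k. 1) (\<lambda>k. (if k \<in> K then Fw b w k else 0) - Fw bn wn k) (C3 R * (1 / n + 1 / m))" by simp
qed

end

section \<open>Stability, uniqueness and strong continuity\<close>

definition energy :: "(freq \<Rightarrow> real) \<Rightarrow> freq set \<Rightarrow> (freq \<Rightarrow> complex) \<Rightarrow> real" where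
  "energy w K x = (\<Sum>k\<in>K. (w k)\<^sup>2 * (cmod (x k))\<^sup>2)"

lemma energy_eq_L2_set: "energy w K x = (L2_set (\<lambda>k. w k * cmod (x k)) K)\<^sup>2"
  by (simp add: energy_def L2_set_power2 power_mult_distrib)

lemma energy_nonneg [simp]: "0 \<le> energy w K x"
  by (simp add: energy_eq_L2_set)

lemma energy_mono_set: "finite K \<Longrightarrow> L \<subseteq> K \<Longrightarrow> energy w L x \<le> energy w K x"
  unfolding energy_def by (rule sum_mono2) auto

lemma energy_mono_weight: "(\<And>k. 0 \<le> v k) \<Longrightarrow> (\<And>k. v k \<le> w k) \<Longrightarrow> energy v K x \<le> energy w K x"
  unfolding energy_def by (intro sum_mono mult_right_mono power_mono) auto

lemma energy_le_of_wbound: "wbound w x B \<Longrightarrow> finite K \<Longrightarrow> energy w K x \<le> B\<^sup>2"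
  unfolding energy_eq_L2_set by (intro power_mono wboundD) auto

lemma wbound_of_energy:
  assumes "\<And>K. finite K \<Longrightarrow> energy w K x \<le> B\<^sup>2" "0 \<le> B"
  shows "wbound w x B"
  unfolding wbound_def using assms by (auto simp: energy_eq_L2_set intro: power2_le_imp_le)

lemma energy_diff_le: "energy w K (\<lambda>k. x k - y k) \<le> 2 * energy w K x + 2 * energy w K y"
proof -
  have "(cmod (x k - y k))\<^sup>2 \<le> 2 * (cmod (x k))\<^sup>2 + 2 * (cmod (y k))\<^sup>2" for k
  proof -
    have "(cmod (x k - y k))\<^sup>2 \<le> (cmod (x k) + cmod (y k))\<^sup>2"
      by (intro power_mono norm_triangle_ineq4) auto
    also have "\<dots> \<le> 2 * (cmod (x k))\<^sup>2 + 2 * (cmod (y k))\<^sup>2"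
      using sum_squares_bound[of "cmod (x k)" "cmod (y k)"] by (simp add: power2_sum)
    finally show ?thesis .
  qed
  then have "energy w K (\<lambda>k. x k - y k) \<le> (\<Sum>k\<in>K. (w k)\<^sup>2 * (2 * (cmod (x k))\<^sup>2 + 2 * (cmod (y k))\<^sup>2))"
    unfolding energy_def by (intro sum_mono mult_left_mono) auto
  then show ?thesis
    by (simp add: energy_def distrib_left sum.distrib sum_distrib_left mult_ac)
qed

lemma energy_split: "finite K \<Longrightarrow> L \<subseteq> K \<Longrightarrow> energy w K x = energy w L x + energy w (K - L) x"
  unfolding energy_def by (subst sum.subset_diff[of L K]) auto

context tqg_data
begin

definition C5 :: "real \<Rightarrow> real" where
  "C5 R = 4 * pi\<^sup>2 * (2 * M * R + 2 * G R + H)"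

text \<open>For a fixed frequency the derivative may fall on the output, at the price of the factor
  \<open>wt k\<close>, so that differences are needed only in the plain square-summable norm. This
  suffices to pass to the limit in the equation of each coefficient.\<close>

lemma F_diff_pointwise:
  assumes bdd: "bdd R b w" "bdd R b' w'"
    and \<beta>: "wbound (\<lambda>k. 1) (\<lambda>k. b k - b' k) \<delta>" and \<eta>: "wbound (\<lambda>k. 1) (\<lambda>k. w k - w' k) \<delta>"
  shows "cmod (Fb b w k - Fb b' w' k) \<le> C5 R * wt k * \<delta>"
    "cmod (Fw b w k - Fw b' w' k) \<le> C5 R * wt k * \<delta>"
proof -
  define \<Psi> where "\<Psi> k = strm w k - strm w' k" for k
  have R: "0 \<le> R" "0 \<le> G R" "0 \<le> \<delta>" using bddD[OF bdd(1)] wbound_nonneg[OF \<beta>] by auto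
  have "wbound (\<lambda>k. wt k ^ 4) \<Psi> (M * \<delta>)"
    using wbound_mu[of 0, simplified, OF \<eta>] unfolding \<Psi>_def strm_diff by simp
  from wbound_power_weaken[OF this, of 1] have \<Psi>: "wbound wt \<Psi> (M * \<delta>)" by simp
  define z where "z k = w k - b k" for k
  define z' where "z' k = w' k - b' k" for k
  have z: "wbound (\<lambda>k. 1) z (R + R)" "wbound (\<lambda>k. 1) z' (R + R)"
    unfolding z_def z'_def by (intro wbound_diff bddD(6,7)[OF bdd(1)] bddD(6,7)[OF bdd(2)]; simp)+
  have zd: "wbound (\<lambda>k. 1) (\<lambda>k. z k - z' k) (\<delta> + \<delta>)"
  proof -
    have "(\<lambda>k. z k - z' k) = (\<lambda>k. (w k - w' k) - (b k - b' k))" by (auto simp: z_def z'_def)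
    then show ?thesis by (simp only:) (intro wbound_diff \<beta> \<eta>, simp)
  qed
  note g' = bddD(9)[OF bdd(2)]
  have "Fb b w k - Fb b' w' k = - (jac \<Psi> b k + jac (strm w') (\<lambda>k. b k - b' k) k)"
    unfolding Fb_def \<Psi>_def
    using jac_diff_right[OF g' bddD(6)[OF bdd(1)] bddD(6)[OF bdd(2)], of k]
      jac_diff_left[OF bddD(9)[OF bdd(1)] g' bddD(6)[OF bdd(1)], of k] by simp
  then have "cmod (Fb b w k - Fb b' w' k) \<le> cmod (jac \<Psi> b k) + cmod (jac (strm w') (\<lambda>k. b k - b' k) k)"
    by (simp only: norm_minus_cancel norm_triangle_ineq)
  also have "\<dots> \<le> 4 * pi\<^sup>2 * wt k * (M * \<delta>) * R + 4 * pi\<^sup>2 * wt k * G R * \<delta>"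
    by (intro add_mono jac_pointwise \<Psi> bddD(6)[OF bdd(1)] g' \<beta>)
  also have "\<dots> = 4 * pi\<^sup>2 * (M * R + G R) * (wt k * \<delta>)" by (simp add: algebra_simps)
  also have "\<dots> \<le> C5 R * (wt k * \<delta>)"
    unfolding C5_def using R by (intro mult_right_mono mult_left_mono) auto
  finally show "cmod (Fb b w k - Fb b' w' k) \<le> C5 R * wt k * \<delta>" by (simp add: mult_ac)
  have "Fw b w k - Fw b' w' k = - (jac \<Psi> z k + jac (strm w') (\<lambda>k. z k - z' k) k + jac h (\<lambda>k. b k - b' k) k)"
    unfolding Fw_def \<Psi>_def z_def[symmetric] z'_def[symmetric]
    using jac_diff_right[OF g' z, of k]
      jac_diff_left[OF bddD(9)[OF bdd(1)] g' z(1), of k]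
      jac_diff_right[OF h_bounds(2) bddD(6)[OF bdd(1)] bddD(6)[OF bdd(2)], of k] by simp
  then have "cmod (Fw b w k - Fw b' w' k) \<le> cmod (jac \<Psi> z k + jac (strm w') (\<lambda>k. z k - z' k) k) + cmod (jac h (\<lambda>k. b k - b' k) k)"
    by (simp only: norm_minus_cancel norm_triangle_ineq)
  also have "\<dots> \<le> (cmod (jac \<Psi> z k) + cmod (jac (strm w') (\<lambda>k. z k - z' k) k)) + cmod (jac h (\<lambda>k. b k - b' k) k)"
    by (intro add_right_mono norm_triangle_ineq)
  also have "\<dots> \<le> (4 * pi\<^sup>2 * wt k * (M * \<delta>) * (R + R) + 4 * pi\<^sup>2 * wt k * G R * (\<delta> + \<delta>)) + 4 * pi\<^sup>2 * wt k * H * \<delta>"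
    by (intro add_mono jac_pointwise \<Psi> z g' zd h_bounds \<beta>)
  also have "\<dots> = C5 R * wt k * \<delta>" by (simp add: C5_def algebra_simps)
  finally show "cmod (Fw b w k - Fw b' w' k) \<le> C5 R * wt k * \<delta>" .
qed

text \<open>For finite \<open>K\<close> this is the Galerkin system, for \<open>K = UNIV\<close> the full one.\<close>

definition ksol :: "freq set \<Rightarrow> real \<Rightarrow> real \<Rightarrow> (real \<Rightarrow> freq \<Rightarrow> complex) \<Rightarrow> (real \<Rightarrow> freq \<Rightarrow> complex) \<Rightarrow> bool" where
  "ksol K T R b w \<longleftrightarrow> 0 \<le> T \<and> (\<forall>t\<in>{0..T}. bdd R (b t) (w t) \<and>
     (\<forall>k. b t (- k) = cnj (b t k) \<and> w t (- k) = cnj (w t k)) \<and>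
     (\<forall>k. k \<notin> K \<longrightarrow> b t k = 0 \<and> w t k = 0) \<and>
     (\<forall>k. ((\<lambda>s. b s k) has_vector_derivative (if k \<in> K then Fb (b t) (w t) k else 0)) (at t within {0..T})) \<and>
     (\<forall>k. ((\<lambda>s. w s k) has_vector_derivative (if k \<in> K then Fw (b t) (w t) k else 0)) (at t within {0..T})))"

lemma ksolD:
  assumes "ksol K T R b w" "t \<in> {0..T}"
  shows "bdd R (b t) (w t)" "b t (- k) = cnj (b t k)" "w t (- k) = cnj (w t k)"
    "k \<notin> K \<Longrightarrow> b t k = 0" "k \<notin> K \<Longrightarrow> w t k = 0"
    "((\<lambda>s. b s k) has_vector_derivative (if k \<in> K then Fb (b t) (w t) k else 0)) (at t within {0..T})"
    "((\<lambda>s. w s k) has_vector_derivative (if k \<in> K then Fw (b t) (w t) k else 0)) (at t within {0..T})"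
  using assms by (auto simp: ksol_def)

lemma trunc_out: "k \<notin> K \<Longrightarrow> trunc K x k = 0"
  by (simp add: trunc_def)

lemma trunc_cnj:
  assumes "\<And>k. x (- k) = cnj (x k)"
  shows "trunc (fbox n) x (- k) = cnj (trunc (fbox n) x k)"
  using assms by (simp add: trunc_def fbox_minus)

text \<open>The outcome of \<open>gronwall\<close> in \<open>ksol_stability\<close> with
  \<open>1 / m\<^sup>2\<close> taken out: \<open>2 * R\<^sup>2\<close> comes from the initial
  difference, 32 is twice the square of the 4 in the error bound there, and the summand 1 in the
  exponent absorbs the products of errors and differences.\<close>

definition C4 :: "real \<Rightarrow> real \<Rightarrow> real" where
  "C4 R T = exp ((2 * C2 R + 1) * T) * (2 * R\<^sup>2 + 32 * (C3 R)\<^sup>2 * T)"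

text \<open>Both solutions are truncated to a common box, where \<open>difference_rate\<close>
  governs the main terms and \<open>consistency\<close> the errors. Allowing finite as well as full
  index sets covers the comparison of Galerkin levels and the uniqueness of the limit at
  once.\<close>

lemma ksol_stability:
  assumes sol: "ksol K T R b w" "ksol K' T R b' w'"
    and m: "fbox m \<subseteq> K" "fbox m \<subseteq> K'" "0 < m" and t: "t \<in> {0..T}"
    and init: "b 0 = trunc K b0" "w 0 = trunc K w0" "b' 0 = trunc K' b0" "w' 0 = trunc K' w0"
    and bdd0: "bdd R b0 w0" and S: "finite S"
  shows "energy wt S (\<lambda>k. b t k - b' t k) + energy (\<lambda>k. 1) S (\<lambda>k. w t k - w' t k) \<le> C4 R T / (real m)\<^sup>2"
proof -
  obtain n0 where "S \<subseteq> fbox n0" using finite_subset_fbox[OF S] by blast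
  \<comment> \<open>The box must contain \<open>S\<close>; being at least \<open>m\<close> makes
    \<open>1 / n\<close> no worse than \<open>1 / m\<close>.\<close>
  define n where "n = max m n0"
  have Sn: "S \<subseteq> fbox n" using \<open>S \<subseteq> fbox n0\<close> fbox_mono[of n0 n] by (auto simp: n_def)
  have n: "0 < n" "m \<le> n" using m by (auto simp: n_def)
  have T: "0 \<le> T" using t by auto
  have R: "0 \<le> R" using bddD(1)[OF bdd0] .
  note C = C_nonneg[OF R]
  let ?t = "trunc (fbox n)"
  define \<beta> where "\<beta> s k = ?t (b s) k - ?t (b' s) k" for s k
  define \<eta> where "\<eta> s k = ?t (w s) k - ?t (w' s) k" for s k
  define dB where "dB s k = (if k \<in> K then Fb (b s) (w s) k else 0)" for s k
  define dB' where "dB' s k = (if k \<in> K' then Fb (b' s) (w' s) k else 0)" for s k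
  define dW where "dW s k = (if k \<in> K then Fw (b s) (w s) k else 0)" for s k
  define dW' where "dW' s k = (if k \<in> K' then Fw (b' s) (w' s) k else 0)" for s k
  define D where "D s = (\<Sum>k\<in>fbox n. (wt k)\<^sup>2 * (cmod (\<beta> s k))\<^sup>2) + (\<Sum>k\<in>fbox n. 1\<^sup>2 * (cmod (\<eta> s k))\<^sup>2)" for s
  define D' where "D' s = 2 * (rate wt (fbox n) (\<beta> s) (\<lambda>k. dB s k - dB' s k)
      + rate (\<lambda>k. 1) (fbox n) (\<eta> s) (\<lambda>k. dW s k - dW' s k))" for s
  \<comment> \<open>Two solutions, each with the error \<open>C3 R * (1 / n + 1 / m)\<close>, and
    \<open>n\<close> is at least \<open>m\<close>.\<close>
  define \<epsilon> where "\<epsilon> = 4 * C3 R / real m"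
  have D: "D s = (L2_set (\<lambda>k. wt k * cmod (\<beta> s k)) (fbox n))\<^sup>2 + (L2_set (\<lambda>k. 1 * cmod (\<eta> s k)) (fbox n))\<^sup>2" for s
    unfolding D_def L2_set_power2 by (simp add: power_mult_distrib)
  have der: "(D has_real_derivative D' s) (at s within {0..T})" if s: "s \<in> {0..T}" for s
  proof -
    have "((\<lambda>s. \<beta> s k) has_vector_derivative (dB s k - dB' s k)) (at s within {0..T})"
      "((\<lambda>s. \<eta> s k) has_vector_derivative (dW s k - dW' s k)) (at s within {0..T})" if "k \<in> fbox n" for k
      using has_vector_derivative_diff[OF ksolD(6)[OF sol(1) s, of k] ksolD(6)[OF sol(2) s, of k]]
        has_vector_derivative_diff[OF ksolD(7)[OF sol(1) s, of k] ksolD(7)[OF sol(2) s, of k]] that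
      by (simp_all add: \<beta>_def \<eta>_def dB_def dB'_def dW_def dW'_def trunc_def)
    from DERIV_add[OF has_vector_derivative_cmod_sum[OF finite_fbox this(1), where w = wt]
        has_vector_derivative_cmod_sum[OF finite_fbox this(2), where w = "\<lambda>k. 1"]]
    show ?thesis by (simp add: D_def[abs_def] D'_def rate_def distrib_left)
  qed
  have ineq: "D' s \<le> (2 * C2 R + 1) * D s + 2 * \<epsilon>\<^sup>2" if s: "s \<in> {0..T}" for s
  proof -
    define X where "X = L2_set (\<lambda>k. wt k * cmod (\<beta> s k)) (fbox n)"
    define Y where "Y = L2_set (\<lambda>k. 1 * cmod (\<eta> s k)) (fbox n)"
    define F1 where "F1 k = Fb (?t (b s)) (?t (w s)) k - Fb (?t (b' s)) (?t (w' s)) k" for k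
    define F2 where "F2 k = Fw (?t (b s)) (?t (w s)) k - Fw (?t (b' s)) (?t (w' s)) k" for k
    note bd = ksolD(1)[OF sol(1) s] ksolD(1)[OF sol(2) s]
    have main: "\<bar>rate wt (fbox n) (\<beta> s) F1 + rate (\<lambda>k. 1) (fbox n) (\<eta> s) F2\<bar> \<le> C2 R * (X\<^sup>2 + Y\<^sup>2)"
      unfolding X_def Y_def \<beta>_def \<eta>_def F1_def F2_def
      by (rule difference_rate) (simp_all add: trunc_out trunc_cnj[of "w s", OF ksolD(3)[OF sol(1) s]] bd bdd_trunc)
    have n1: "C3 R * (1 / real n + 1 / real m) + C3 R * (1 / real n + 1 / real m) \<le> \<epsilon>"
    proof -
      have "1 / real n + 1 / real m \<le> 2 / real m"
        using n m by (simp add: field_simps)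
      then have "C3 R * (1 / real n + 1 / real m) \<le> C3 R * (2 / real m)"
        using C by (intro mult_left_mono)
      then show ?thesis by (simp add: \<epsilon>_def)
    qed
    define e1 where "e1 k = (dB s k - Fb (?t (b s)) (?t (w s)) k) - (dB' s k - Fb (?t (b' s)) (?t (w' s)) k)" for k
    define e2 where "e2 k = (dW s k - Fw (?t (b s)) (?t (w s)) k) - (dW' s k - Fw (?t (b' s)) (?t (w' s)) k)" for k
    have e1: "wbound wt e1 \<epsilon>"
    proof (rule wbound_weaken)
      show "wbound wt e1 (C3 R * (1 / real n + 1 / real m) + C3 R * (1 / real n + 1 / real m))"
        unfolding e1_def dB_def dB'_def
        by (intro wbound_diff consistency bd m n) auto
    qed (use n1 in auto)
    have e2: "wbound (\<lambda>k. 1) e2 \<epsilon>"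
    proof (rule wbound_weaken)
      show "wbound (\<lambda>k. 1) e2 (C3 R * (1 / real n + 1 / real m) + C3 R * (1 / real n + 1 / real m))"
        unfolding e2_def dW_def dW'_def
        by (intro wbound_diff consistency bd m n) auto
    qed (use n1 in auto)
    have r1: "\<bar>rate wt (fbox n) (\<beta> s) e1\<bar> \<le> X * \<epsilon>"
      using rate_le[of wt "fbox n" "\<beta> s" e1] wboundD[OF e1, of "fbox n"] mult_left_mono[of "L2_set (\<lambda>k. wt k * cmod (e1 k)) (fbox n)" \<epsilon> X]
      unfolding X_def by simp
    have r2: "\<bar>rate (\<lambda>k. 1) (fbox n) (\<eta> s) e2\<bar> \<le> Y * \<epsilon>"
      using rate_le[of "\<lambda>k. 1" "fbox n" "\<eta> s" e2] wboundD[OF e2, of "fbox n"] mult_left_mono[of "L2_set (\<lambda>k. 1 * cmod (e2 k)) (fbox n)" \<epsilon> Y]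
      unfolding Y_def by simp
    have "D' s = 2 * ((rate wt (fbox n) (\<beta> s) F1 + rate (\<lambda>k. 1) (fbox n) (\<eta> s) F2)
       + (rate wt (fbox n) (\<beta> s) e1 + rate (\<lambda>k. 1) (fbox n) (\<eta> s) e2))"
    proof -
      have "(\<lambda>k. dB s k - dB' s k) = (\<lambda>k. F1 k + e1 k)" "(\<lambda>k. dW s k - dW' s k) = (\<lambda>k. F2 k + e2 k)"
        by (auto simp: F1_def F2_def e1_def e2_def)
      then show ?thesis unfolding D'_def by (simp only: rate_add) simp
    qed
    also have "\<dots> \<le> 2 * (C2 R * (X\<^sup>2 + Y\<^sup>2) + (X * \<epsilon> + Y * \<epsilon>))"
      using main r1 r2 by (intro mult_left_mono add_mono; linarith)
    also have "\<dots> \<le> 2 * (C2 R * (X\<^sup>2 + Y\<^sup>2)) + (X\<^sup>2 + \<epsilon>\<^sup>2) + (Y\<^sup>2 + \<epsilon>\<^sup>2)"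
      using sum_squares_bound[of X \<epsilon>] sum_squares_bound[of Y \<epsilon>] by (simp add: algebra_simps)
    finally show ?thesis unfolding D X_def[symmetric] Y_def[symmetric] by (simp add: algebra_simps)
  qed
  have D0: "D 0 \<le> 2 * R\<^sup>2 / (real m)\<^sup>2"
  proof -
    \<comment> \<open>The two truncated initial data agree on \<open>fbox m\<close>, so their
      difference is controlled by a tail of the common datum.\<close>
    have eq: "cmod (trunc K x k - trunc K' x k) \<le> cmod (x k - trunc (fbox m) x k)" for x k
      using m by (auto simp: trunc_def)
    have gen: "wbound (\<lambda>k. wt k ^ p) (\<lambda>k. ?t (trunc K x) k - ?t (trunc K' x) k) (R / real m)"
      if "wbound (\<lambda>k. wt k ^ q) x R" "Suc p \<le> q" for x p q
    proof (rule wbound_mono[OF wbound_tail[OF that m(3)], where c = 1])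
      show "wt k ^ p * cmod (?t (trunc K x) k - ?t (trunc K' x) k)
          \<le> 1 * (wt k ^ p * cmod (x k - trunc (fbox m) x k))" for k
        using eq[of x k] unfolding trunc_def[of "fbox n"] by (auto intro!: mult_left_mono)
    qed auto
    have "wbound (\<lambda>k. wt k ^ 1) (\<beta> 0) (R / real m)" "wbound (\<lambda>k. wt k ^ 0) (\<eta> 0) (R / real m)"
      unfolding \<beta>_def \<eta>_def init
      by (rule gen[OF bddD(2)[OF bdd0 order_refl]] gen[OF bddD(3)[OF bdd0 order_refl]]; simp)+
    from wboundD[OF this(1), of "fbox n"] wboundD[OF this(2), of "fbox n"]
    have "D 0 \<le> (R / real m)\<^sup>2 + (R / real m)\<^sup>2"
      unfolding D by (intro add_mono power_mono) auto
    then show ?thesis by (simp add: power_divide)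
  qed
  have "D t \<le> exp ((2 * C2 R + 1) * t) * (D 0 + 2 * \<epsilon>\<^sup>2 * t)"
    by (rule gronwall[OF der ineq _ _ t]) (use C in auto)
  also have "\<dots> \<le> exp ((2 * C2 R + 1) * T) * (2 * R\<^sup>2 / (real m)\<^sup>2 + 2 * \<epsilon>\<^sup>2 * T)"
    using D0 t C by (intro mult_mono add_mono mult_left_mono) (auto simp: D intro!: mult_left_mono add_nonneg_nonneg)
  also have "\<dots> = C4 R T / (real m)\<^sup>2"
    by (simp add: C4_def \<epsilon>_def power_divide power_mult_distrib algebra_simps add_divide_distrib)
  finally have *: "D t \<le> C4 R T / (real m)\<^sup>2" .
  have "energy wt S (\<lambda>k. b t k - b' t k) + energy (\<lambda>k. 1) S (\<lambda>k. w t k - w' t k) = energy wt S (\<beta> t) + energy (\<lambda>k. 1) S (\<eta> t)"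
    unfolding energy_def \<beta>_def \<eta>_def trunc_def using Sn by (intro arg_cong2[of _ _ _ _ "(+)"] sum.cong) auto
  also have "\<dots> \<le> energy wt (fbox n) (\<beta> t) + energy (\<lambda>k. 1) (fbox n) (\<eta> t)"
    by (intro add_mono energy_mono_set Sn) auto
  also have "\<dots> = D t" by (simp add: D_def energy_def)
  finally show ?thesis using * by linarith
qed

lemma C4_nonneg: "0 \<le> R \<Longrightarrow> 0 \<le> T \<Longrightarrow> 0 \<le> C4 R T"
  by (auto simp: C4_def intro!: mult_nonneg_nonneg add_nonneg_nonneg)

lemma ksol_stability_wbound:
  assumes sol: "ksol K T R b w" "ksol K' T R b' w'"
    and m: "fbox m \<subseteq> K" "fbox m \<subseteq> K'" "0 < m" and t: "t \<in> {0..T}"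
    and init: "b 0 = trunc K b0" "w 0 = trunc K w0" "b' 0 = trunc K' b0" "w' 0 = trunc K' w0"
    and bdd0: "bdd R b0 w0"
  shows "wbound (\<lambda>k. 1) (\<lambda>k. b t k - b' t k) (sqrt (C4 R T) / real m)"
    "wbound (\<lambda>k. 1) (\<lambda>k. w t k - w' t k) (sqrt (C4 R T) / real m)"
proof -
  have nn: "0 \<le> C4 R T" using C4_nonneg[OF bddD(1)[OF bdd0], of T] t by auto
  have st: "energy wt S (\<lambda>k. b t k - b' t k) + energy (\<lambda>k. 1) S (\<lambda>k. w t k - w' t k) \<le> (sqrt (C4 R T) / real m)\<^sup>2"
    if "finite S" for S
    using ksol_stability[OF assms that] nn by (simp add: power_divide)
  have "wbound wt (\<lambda>k. b t k - b' t k) (sqrt (C4 R T) / real m)"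
  proof (rule wbound_of_energy)
    show "energy wt S (\<lambda>k. b t k - b' t k) \<le> (sqrt (C4 R T) / real m)\<^sup>2" if "finite S" for S
      using st[OF that] energy_nonneg[of "\<lambda>k. 1" S "\<lambda>k. w t k - w' t k"] by linarith
  qed (use nn in auto)
  then show "wbound (\<lambda>k. 1) (\<lambda>k. b t k - b' t k) (sqrt (C4 R T) / real m)"
    by (rule wbound_weaken) auto
  show "wbound (\<lambda>k. 1) (\<lambda>k. w t k - w' t k) (sqrt (C4 R T) / real m)"
  proof (rule wbound_of_energy)
    show "energy (\<lambda>k. 1) S (\<lambda>k. w t k - w' t k) \<le> (sqrt (C4 R T) / real m)\<^sup>2" if "finite S" for S
      using st[OF that] energy_nonneg[of wt S "\<lambda>k. b t k - b' t k"] by linarith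
  qed (use nn in auto)
qed

lemma wbound_0_imp: "(\<And>m::nat. 0 < m \<Longrightarrow> wbound (\<lambda>k. 1) x (B / real m)) \<Longrightarrow> x k = 0"
proof -
  assume a: "\<And>m::nat. 0 < m \<Longrightarrow> wbound (\<lambda>k. 1) x (B / real m)"
  have "cmod (x k) \<le> B / real (Suc m)" for m
    using wbound_pointwise[OF a[of "Suc m"], of k] by simp
  moreover have "(\<lambda>m. B / real (Suc m)) \<longlonglongrightarrow> 0"
    by (rule LIMSEQ_Suc[OF lim_const_over_n])
  ultimately have "cmod (x k) \<le> 0" by (intro LIMSEQ_le_const) auto
  then show "x k = 0" by simp
qed

text \<open>For full index sets the stability bound holds with every \<open>m\<close>, and its
  right-hand side tends to 0.\<close>

lemma ksol_unique:
  assumes sol: "ksol UNIV T R b w" "ksol UNIV T R b' w'"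
    and init: "b 0 = b' 0" "w 0 = w' 0" and t: "t \<in> {0..T}"
  shows "b t = b' t" "w t = w' t"
proof -
  have T: "0 \<in> {0..T}" using t by auto
  note st = ksol_stability_wbound[OF sol _ _ _ t, of _ "b 0" "w 0"]
  have tr: "trunc UNIV x = x" for x by (auto simp: trunc_def)
  have "b t k - b' t k = 0" for k
    by (rule wbound_0_imp[OF st(1)]) (use init ksolD(1)[OF sol(1) T] in \<open>auto simp: tr\<close>)
  then show "b t = b' t" by auto
  have "w t k - w' t k = 0" for k
    by (rule wbound_0_imp[OF st(2)]) (use init ksolD(1)[OF sol(1) T] in \<open>auto simp: tr\<close>)
  then show "w t = w' t" by auto
qed

text \<open>The rate \<open>C / n\<close> is uniform in time, so the theorem on sequences of
  derivatives applies. The index \<open>N\<close> is there because the equation of a coefficient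
  holds only once its frequency lies in the Galerkin box.\<close>

lemma derivative_limit:
  fixes g :: "real \<Rightarrow> 'a::banach"
  assumes der: "\<And>n t. N \<le> n \<Longrightarrow> t \<in> {0..T} \<Longrightarrow> (gn n has_vector_derivative dn n t) (at t within {0..T})"
    and le: "\<And>n t. N \<le> n \<Longrightarrow> t \<in> {0..T} \<Longrightarrow> norm (dn n t - d t) \<le> C / real n"
    and lim: "\<And>t. t \<in> {0..T} \<Longrightarrow> (\<lambda>n. gn n t) \<longlonglongrightarrow> g t"
    and t: "t \<in> {0..T}"
  shows "(g has_vector_derivative d t) (at t within {0..T})"
proof -
  define fn where "fn n = gn (n + N)" for n
  have "\<exists>g'. \<forall>x\<in>{0..T}. (\<lambda>n. fn n x) \<longlonglongrightarrow> g' x \<and> (g' has_derivative (\<lambda>h. h *\<^sub>R d x)) (at x within {0..T})"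
  proof (rule has_derivative_sequence)
    show "convex {0..T}" by simp
    show "(fn n has_derivative (\<lambda>h. h *\<^sub>R dn (n + N) x)) (at x within {0..T})" if "x \<in> {0..T}" for n x
      using der[of "n + N" x] that by (simp add: fn_def has_vector_derivative_def)
    show "\<forall>\<^sub>F n in sequentially. \<forall>x\<in>{0..T}. \<forall>h. norm (h *\<^sub>R dn (n + N) x - h *\<^sub>R d x) \<le> e * norm h" if "0 < e" for e
    proof -
      have "(\<lambda>n. C / real (n + N)) \<longlonglongrightarrow> 0"
        using LIMSEQ_ignore_initial_segment[OF lim_const_over_n[of C], of N] .
      then have "\<forall>\<^sub>F n in sequentially. C / real (n + N) < e"
        using that by (rule order_tendstoD)
      then show ?thesis
      proof eventually_elim
        case (elim n)
        show ?case
        proof (intro ballI allI)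
          fix x h assume "x \<in> {0..T}"
          then have "norm (dn (n + N) x - d x) \<le> e" using le[of "n + N" x] elim by auto
          then have "\<bar>h\<bar> * norm (dn (n + N) x - d x) \<le> \<bar>h\<bar> * e" by (intro mult_left_mono) auto
          then show "norm (h *\<^sub>R dn (n + N) x - h *\<^sub>R d x) \<le> e * norm h"
            by (simp add: scaleR_diff_right[symmetric] mult.commute)
        qed
      qed
    qed
    show "t \<in> {0..T}" by fact
    show "(\<lambda>n. fn n t) \<longlonglongrightarrow> g t" unfolding fn_def by (rule LIMSEQ_ignore_initial_segment[OF lim[OF t]])
  qed
  then obtain g' where g': "\<And>x. x \<in> {0..T} \<Longrightarrow> (\<lambda>n. fn n x) \<longlonglongrightarrow> g' x"
    "\<And>x. x \<in> {0..T} \<Longrightarrow> (g' has_derivative (\<lambda>h. h *\<^sub>R d x)) (at x within {0..T})" by blast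
  have "g x = g' x" if "x \<in> {0..T}" for x
    using g'(1)[OF that] LIMSEQ_ignore_initial_segment[OF lim[OF that], of N]
    unfolding fn_def by (rule LIMSEQ_unique[symmetric])
  then show ?thesis using g'(2)[OF t] t
    unfolding has_vector_derivative_def by (auto intro: has_derivative_transform)
qed

text \<open>Stability makes every coefficient a Cauchy sequence with rate \<open>c / m\<close>,
  uniformly in time. The convergence is in a weak norm only; the strong bounds come from
  \<open>wbound_limit\<close>, and \<open>F_diff_pointwise\<close> carries the derivatives
  over.\<close>

lemma ksol_limit:
  assumes sol: "\<And>n. 0 < n \<Longrightarrow> ksol (fbox n) T R (bn n) (wn n)"
    and init: "\<And>n. 0 < n \<Longrightarrow> bn n 0 = trunc (fbox n) b0" "\<And>n. 0 < n \<Longrightarrow> wn n 0 = trunc (fbox n) w0"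
    and bdd0: "bdd R b0 w0"
  shows "\<exists>b w. ksol UNIV T R b w \<and> b 0 = b0 \<and> w 0 = w0"
proof -
  define c where "c = sqrt (C4 R T)"
  have T: "0 \<le> T" using sol[of 1] by (auto simp: ksol_def)
  have R: "0 \<le> R" using bddD(1)[OF bdd0] .
  have c: "0 \<le> c" using C4_nonneg[OF R T] by (simp add: c_def)
  have st: "wbound (\<lambda>k. 1) (\<lambda>k. bn n t k - bn n' t k) (c / real m)"
    "wbound (\<lambda>k. 1) (\<lambda>k. wn n t k - wn n' t k) (c / real m)"
    if "0 < m" "m \<le> n" "m \<le> n'" "t \<in> {0..T}" for n n' m t
    unfolding c_def
    by (rule ksol_stability_wbound[OF sol sol _ _ that(1,4) init init bdd0];
        use that fbox_mono in auto)+
  have cau: "convergent (\<lambda>n. x n k)"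
    if x: "\<And>m n n'. 0 < m \<Longrightarrow> m \<le> n \<Longrightarrow> m \<le> n' \<Longrightarrow> wbound (\<lambda>k. 1) (\<lambda>k. x n k - x n' k) (c / real m)"
    for x :: "nat \<Rightarrow> freq \<Rightarrow> complex" and k
  proof -
    have "Cauchy (\<lambda>n. x n k)"
    proof (rule metric_CauchyI)
      fix e :: real assume "0 < e"
      obtain m where m: "c / e < real m" using reals_Archimedean2 by blast
      have "c / e \<ge> 0" using c \<open>0 < e\<close> by simp
      then have "0 < m" using m by (cases m) auto
      then have "c / real m < e" using m \<open>0 < e\<close> by (simp add: field_simps)
      moreover have "dist (x n k) (x n' k) \<le> c / real m" if "m \<le> n" "m \<le> n'" for n n'
        using wbound_pointwise[OF x[OF \<open>0 < m\<close> that], of k] by (simp add: dist_norm)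
      ultimately show "\<exists>M. \<forall>m\<ge>M. \<forall>n\<ge>M. dist (x m k) (x n k) < e" by (meson order_le_less_trans)
    qed
    then show ?thesis by (rule Cauchy_convergent)
  qed
  define b where "b t k = lim (\<lambda>n. bn n t k)" for t k
  define w where "w t k = lim (\<lambda>n. wn n t k)" for t k
  have lb: "(\<lambda>n. bn n t k) \<longlonglongrightarrow> b t k" and lw: "(\<lambda>n. wn n t k) \<longlonglongrightarrow> w t k" if "t \<in> {0..T}" for t k
    unfolding b_def w_def convergent_LIMSEQ_iff[symmetric]
    by (rule cau[OF st(1)] cau[OF st(2)]; use that in simp)+
  have ev: "\<forall>\<^sub>F n in sequentially. P n" if "\<And>n. m \<le> n \<Longrightarrow> P n" for P and m :: nat
    using that unfolding eventually_sequentially by blast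
  have err: "wbound (\<lambda>k. 1) (\<lambda>k. bn m t k - b t k) (c / real m)"
    "wbound (\<lambda>k. 1) (\<lambda>k. wn m t k - w t k) (c / real m)" if "t \<in> {0..T}" "0 < m" for m t
  proof -
    show "wbound (\<lambda>k. 1) (\<lambda>k. bn m t k - b t k) (c / real m)"
      by (rule wbound_limit[where x = "\<lambda>n k. bn m t k - bn n t k", OF _ _ ev[of m]])
        (use that in \<open>auto intro!: tendsto_diff lb st\<close>)
    show "wbound (\<lambda>k. 1) (\<lambda>k. wn m t k - w t k) (c / real m)"
      by (rule wbound_limit[where x = "\<lambda>n k. wn m t k - wn n t k", OF _ _ ev[of m]])
        (use that in \<open>auto intro!: tendsto_diff lw st\<close>)
  qed
  have bdd: "bdd R (b t) (w t)" if "t \<in> {0..T}" for t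
    unfolding bdd_def
    by (intro conjI wbound_limit[OF lb[OF that]] wbound_limit[OF lw[OF that]] ev[of 1])
      (use ksolD(1)[OF sol that] in \<open>auto simp: bdd_def\<close>)
  have sym: "b t (- k) = cnj (b t k)" "w t (- k) = cnj (w t k)" if t: "t \<in> {0..T}" for t k
  proof -
    have "(\<lambda>n. bn n t (- k)) \<longlonglongrightarrow> cnj (b t k)"
      by (rule Lim_transform_eventually[OF tendsto_cnj[OF lb[OF t]] ev[of 1]])
        (use ksolD(2)[OF sol t] in auto)
    then show "b t (- k) = cnj (b t k)" by (rule LIMSEQ_unique[OF lb[OF t]])
    have "(\<lambda>n. wn n t (- k)) \<longlonglongrightarrow> cnj (w t k)"
      by (rule Lim_transform_eventually[OF tendsto_cnj[OF lw[OF t]] ev[of 1]])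
        (use ksolD(3)[OF sol t] in auto)
    then show "w t (- k) = cnj (w t k)" by (rule LIMSEQ_unique[OF lw[OF t]])
  qed
  have in_fbox: "k \<in> fbox n" if "nat \<lceil>wt k\<rceil> \<le> n" for k n
    using that by (simp add: fbox_def)
  have n1: "0 < nat \<lceil>wt k\<rceil>" for k by simp
  have dF: "cmod (Fb (bn n t) (wn n t) k - Fb (b t) (w t) k) \<le> C5 R * wt k * c / real n"
    "cmod (Fw (bn n t) (wn n t) k - Fw (b t) (w t) k) \<le> C5 R * wt k * c / real n"
    if "0 < n" "t \<in> {0..T}" for n t k
    using F_diff_pointwise[OF ksolD(1)[OF sol[OF that(1)] that(2)] bdd[OF that(2)] err[OF that(2,1)], of k] by simp_all
  have db: "((\<lambda>s. b s k) has_vector_derivative Fb (b t) (w t) k) (at t within {0..T})"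
    and dw: "((\<lambda>s. w s k) has_vector_derivative Fw (b t) (w t) k) (at t within {0..T})" if t: "t \<in> {0..T}" for t k
  proof -
    show "((\<lambda>s. b s k) has_vector_derivative Fb (b t) (w t) k) (at t within {0..T})"
    proof (rule derivative_limit[where gn = "\<lambda>n s. bn n s k" and N = "nat \<lceil>wt k\<rceil>" and t = t and dn = "\<lambda>n t. Fb (bn n t) (wn n t) k"])
      fix n s assume n: "nat \<lceil>wt k\<rceil> \<le> n" and s: "s \<in> {0..T}"
      have "0 < n" using n n1[of k] by linarith
      show "((\<lambda>s. bn n s k) has_vector_derivative Fb (bn n s) (wn n s) k) (at s within {0..T})"
        using ksolD(6)[OF sol[OF \<open>0 < n\<close>] s, of k] in_fbox[OF n] by simp
      show "cmod (Fb (bn n s) (wn n s) k - Fb (b s) (w s) k) \<le> C5 R * wt k * c / real n"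
        by (rule dF[OF \<open>0 < n\<close> s])
    qed (use lb t in auto)
    show "((\<lambda>s. w s k) has_vector_derivative Fw (b t) (w t) k) (at t within {0..T})"
    proof (rule derivative_limit[where gn = "\<lambda>n s. wn n s k" and N = "nat \<lceil>wt k\<rceil>" and t = t and dn = "\<lambda>n t. Fw (bn n t) (wn n t) k"])
      fix n s assume n: "nat \<lceil>wt k\<rceil> \<le> n" and s: "s \<in> {0..T}"
      have "0 < n" using n n1[of k] by linarith
      show "((\<lambda>s. wn n s k) has_vector_derivative Fw (bn n s) (wn n s) k) (at s within {0..T})"
        using ksolD(7)[OF sol[OF \<open>0 < n\<close>] s, of k] in_fbox[OF n] by simp
      show "cmod (Fw (bn n s) (wn n s) k - Fw (b s) (w s) k) \<le> C5 R * wt k * c / real n"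
        by (rule dF[OF \<open>0 < n\<close> s])
    qed (use lw t in auto)
  qed
  have 0: "0 \<in> {0..T}" using T by auto
  have "b 0 = b0"
  proof
    fix k
    have "bn n 0 k = b0 k" if n: "nat \<lceil>wt k\<rceil> \<le> n" for n
      using init(1)[of n] in_fbox[OF n] n n1[of k] by (simp add: trunc_def)
    then have "(\<lambda>n. bn n 0 k) \<longlonglongrightarrow> b0 k"
      by (rule tendsto_eventually[OF ev])
    then show "b 0 k = b0 k" by (rule LIMSEQ_unique[OF lb[OF 0]])
  qed
  moreover have "w 0 = w0"
  proof
    fix k
    have "wn n 0 k = w0 k" if n: "nat \<lceil>wt k\<rceil> \<le> n" for n
      using init(2)[of n] in_fbox[OF n] n n1[of k] by (simp add: trunc_def)
    then have "(\<lambda>n. wn n 0 k) \<longlonglongrightarrow> w0 k"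
      by (rule tendsto_eventually[OF ev])
    then show "w 0 k = w0 k" by (rule LIMSEQ_unique[OF lw[OF 0]])
  qed
  moreover have "ksol UNIV T R b w"
    unfolding ksol_def using T bdd sym db dw by auto
  ultimately show ?thesis by blast
qed

text \<open>The mollified weights are bounded relative to the norms of the consistency error, so the
  truncated energies are Lipschitz in time; remove the truncation first, then the mollification.\<close>

lemma ksol_energy_lipschitz:
  assumes sol: "ksol UNIV T R b w" and st: "s \<in> {0..T}" "t \<in> {0..T}"
    and B: "\<And>K. finite K \<Longrightarrow> energy (\<lambda>k. wt k ^ 3) K (b s) + energy (\<lambda>k. wt k ^ 2) K (w s) \<le> B"
    and K: "finite K"
  shows "energy (\<lambda>k. wt k ^ 3) K (b t) + energy (\<lambda>k. wt k ^ 2) K (w t) \<le> B + 2 * C1 R * \<bar>t - s\<bar>"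
proof -
  have R: "0 \<le> R" using bddD(1)[OF ksolD(1)[OF sol st(1)]] .
  note C = C_nonneg[OF R]
  obtain n0 where n0: "K \<subseteq> fbox n0" using finite_subset_fbox[OF K] by blast
  define v1 where "v1 \<epsilon> k = wt k * (qw \<epsilon> k)\<^sup>2" for \<epsilon> k
  define v2 where "v2 \<epsilon> k = (qw \<epsilon> k)\<^sup>2" for \<epsilon> k
  define E where "E \<epsilon> L u = energy (v1 \<epsilon>) L (b u) + energy (v2 \<epsilon>) L (w u)" for \<epsilon> L u
  have q: "0 \<le> qw \<epsilon> k" "qw \<epsilon> k \<le> wt k" if "0 \<le> \<epsilon>" for \<epsilon> k using qw_nonneg qw_le_wt that by auto
  have v: "0 \<le> v1 \<epsilon> k" "0 \<le> v2 \<epsilon> k" "v1 \<epsilon> k \<le> wt k ^ 3" "v2 \<epsilon> k \<le> wt k ^ 2" if "0 \<le> \<epsilon>" for \<epsilon> k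
  proof -
    show "v2 \<epsilon> k \<le> wt k ^ 2" unfolding v2_def by (intro power_mono q that)
    then have "wt k * v2 \<epsilon> k \<le> wt k * wt k ^ 2" by (intro mult_left_mono) auto
    then show "v1 \<epsilon> k \<le> wt k ^ 3" unfolding v1_def v2_def by (simp add: power3_eq_cube power2_eq_square)
  qed (auto simp: v1_def v2_def)
  \<comment> \<open>The coefficient 8 collects the 2 of the squared norm, the two components, and
    \<open>1 / n + 1 / n\<close> from \<open>consistency\<close> with both parameters equal to
    \<open>n\<close>.\<close>
  have Elip: "\<bar>E \<epsilon> (fbox n) t - E \<epsilon> (fbox n) s\<bar> \<le> (2 * C1 R + 8 * R * C3 R / \<epsilon>\<^sup>2 * (1 / real n)) * \<bar>t - s\<bar>"
    if \<epsilon>: "0 < \<epsilon>" and n: "0 < n" for \<epsilon> n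
  proof -
    let ?t = "trunc (fbox n)"
    define dE where "dE u = 2 * (rate (v1 \<epsilon>) (fbox n) (?t (b u)) (Fb (b u) (w u)) + rate (v2 \<epsilon>) (fbox n) (?t (w u)) (Fw (b u) (w u)))" for u
    have der: "(E \<epsilon> (fbox n) has_real_derivative dE u) (at u within {0..T})" if u: "u \<in> {0..T}" for u
    proof -
      have "((\<lambda>u. b u k) has_vector_derivative Fb (b u) (w u) k) (at u within {0..T})"
        "((\<lambda>u. w u k) has_vector_derivative Fw (b u) (w u) k) (at u within {0..T})" for k
        using ksolD(6,7)[OF sol u, of k] by simp_all
      from DERIV_add[OF has_vector_derivative_cmod_sum[OF finite_fbox this(1), where w = "v1 \<epsilon>"]
          has_vector_derivative_cmod_sum[OF finite_fbox this(2), where w = "v2 \<epsilon>"]]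
      show ?thesis unfolding E_def[abs_def] dE_def rate_def energy_def distrib_left
        by (simp add: trunc_def cong: sum.cong)
    qed
    have bnd: "\<bar>dE u\<bar> \<le> 2 * C1 R + 8 * R * C3 R / \<epsilon>\<^sup>2 * (1 / real n)" if u: "u \<in> {0..T}" for u
    proof -
      note bd = ksolD(1)[OF sol u] and bdt = bdd_trunc[OF ksolD(1)[OF sol u], of "fbox n"]
      define e1 where "e1 k = Fb (b u) (w u) k - Fb (?t (b u)) (?t (w u)) k" for k
      define e2 where "e2 k = Fw (b u) (w u) k - Fw (?t (b u)) (?t (w u)) k" for k
      \<comment> \<open>\<open>consistency\<close> bounds the errors in the weights
        \<open>wt\<close> and 1 only; the remaining factor \<open>(qw \<epsilon> k)\<^sup>2\<close>
        is at most \<open>1 / \<epsilon>\<^sup>2\<close>.\<close>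
      define \<delta> where "\<delta> = 1 / \<epsilon>\<^sup>2 * (C3 R * (1 / n + 1 / n))"
      have q2: "(qw \<epsilon> k)\<^sup>2 \<le> 1 / \<epsilon>\<^sup>2" for k
        using power_mono[OF qw_le_inverse[OF \<epsilon>, of k] qw_nonneg, of 2] \<epsilon> by (simp add: power_divide)
      have e1: "wbound (v1 \<epsilon>) e1 \<delta>"
      proof (rule wbound_mono[where c = "1 / \<epsilon>\<^sup>2"])
        show "wbound wt e1 (C3 R * (1 / n + 1 / n))"
          using consistency(1)[OF bd subset_UNIV n n] by (simp add: e1_def[abs_def])
        show "v1 \<epsilon> k * cmod (e1 k) \<le> 1 / \<epsilon>\<^sup>2 * (wt k * cmod (e1 k))" for k
          using mult_right_mono[OF q2[of k], of "wt k * cmod (e1 k)"] by (simp add: v1_def mult_ac)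
      qed (use v \<epsilon> in \<open>auto simp: \<delta>_def\<close>)
      have e2: "wbound (v2 \<epsilon>) e2 \<delta>"
      proof (rule wbound_mono[where c = "1 / \<epsilon>\<^sup>2"])
        show "wbound (\<lambda>k. 1) e2 (C3 R * (1 / n + 1 / n))"
          using consistency(2)[OF bd subset_UNIV n n] by (simp add: e2_def[abs_def])
        show "v2 \<epsilon> k * cmod (e2 k) \<le> 1 / \<epsilon>\<^sup>2 * (1 * cmod (e2 k))" for k
          using mult_right_mono[OF q2[of k], of "cmod (e2 k)"] by (simp add: v2_def)
      qed (use v \<epsilon> in \<open>auto simp: \<delta>_def\<close>)
      have main: "\<bar>rate (v1 \<epsilon>) (fbox n) (?t (b u)) (Fb (?t (b u)) (?t (w u))) + rate (v2 \<epsilon>) (fbox n) (?t (w u)) (Fw (?t (b u)) (?t (w u)))\<bar> \<le> C1 R"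
        by (rule energy_rate) (use adm_weights(3,4)[of \<epsilon>] \<epsilon> v bdt trunc_cnj[of "w u", OF ksolD(3)[OF sol u]] in
            \<open>auto simp: v1_def[abs_def] v2_def[abs_def] trunc_def\<close>)
      have L: "L2_set (\<lambda>k. v1 \<epsilon> k * cmod (?t (b u) k)) (fbox n) \<le> R" "L2_set (\<lambda>k. v2 \<epsilon> k * cmod (?t (w u) k)) (fbox n) \<le> R"
        by (rule wboundD[OF wbound_weaken[OF bddD(2)[OF bdt order_refl]] finite_fbox]
            wboundD[OF wbound_weaken[OF bddD(3)[OF bdt order_refl]] finite_fbox]; use v \<epsilon> in auto)+
      have r1: "\<bar>rate (v1 \<epsilon>) (fbox n) (?t (b u)) e1\<bar> \<le> R * \<delta>"
        by (rule order_trans[OF rate_le mult_mono[OF L(1) wboundD[OF e1 finite_fbox]]]) (use v \<epsilon> R in auto)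
      have r2: "\<bar>rate (v2 \<epsilon>) (fbox n) (?t (w u)) e2\<bar> \<le> R * \<delta>"
        by (rule order_trans[OF rate_le mult_mono[OF L(2) wboundD[OF e2 finite_fbox]]]) (use v \<epsilon> R in auto)
      have "Fb (b u) (w u) = (\<lambda>k. Fb (?t (b u)) (?t (w u)) k + e1 k)" "Fw (b u) (w u) = (\<lambda>k. Fw (?t (b u)) (?t (w u)) k + e2 k)"
        by (auto simp: e1_def e2_def)
      then have "dE u = 2 * ((rate (v1 \<epsilon>) (fbox n) (?t (b u)) (Fb (?t (b u)) (?t (w u))) + rate (v2 \<epsilon>) (fbox n) (?t (w u)) (Fw (?t (b u)) (?t (w u))))
        + (rate (v1 \<epsilon>) (fbox n) (?t (b u)) e1 + rate (v2 \<epsilon>) (fbox n) (?t (w u)) e2))"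
        unfolding dE_def by (simp only: rate_add) (simp add: algebra_simps)
      moreover have "\<bar>2 * (a + (c + d))\<bar> \<le> 2 * (A + (C + D))"
        if "\<bar>a\<bar> \<le> A" "\<bar>c\<bar> \<le> C" "\<bar>d\<bar> \<le> D" for a c d A C D :: real
        using that unfolding abs_le_iff by simp
      ultimately have "\<bar>dE u\<bar> \<le> 2 * (C1 R + (R * \<delta> + R * \<delta>))"
        using main r1 r2 by (simp only:)
      also have "\<dots> = 2 * C1 R + 8 * R * C3 R / \<epsilon>\<^sup>2 * (1 / real n)"
        by (simp add: \<delta>_def mult_ac)
      finally show ?thesis .
    qed
    have "norm (E \<epsilon> (fbox n) t - E \<epsilon> (fbox n) s) \<le> (2 * C1 R + 8 * R * C3 R / \<epsilon>\<^sup>2 * (1 / real n)) * norm (t - s)"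
      by (rule field_differentiable_bound[of "{0..T}" _ dE]) (use der bnd st in auto)
    then show ?thesis by simp
  qed
  have EB: "E \<epsilon> L s \<le> B" if "0 \<le> \<epsilon>" "finite L" for \<epsilon> L
  proof -
    have "E \<epsilon> L s \<le> energy (\<lambda>k. wt k ^ 3) L (b s) + energy (\<lambda>k. wt k ^ 2) L (w s)"
      unfolding E_def by (intro add_mono energy_mono_weight v that)
    then show ?thesis using B[OF that(2)] by linarith
  qed
  have step1: "E \<epsilon> K t \<le> B + 2 * C1 R * \<bar>t - s\<bar>" if \<epsilon>: "0 < \<epsilon>" for \<epsilon>
  proof (rule LIMSEQ_le_const[where X = "\<lambda>n. B + (2 * C1 R + 8 * R * C3 R / \<epsilon>\<^sup>2 * (1 / real n)) * \<bar>t - s\<bar>"])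
    have "(\<lambda>n. B + (2 * C1 R + 8 * R * C3 R / \<epsilon>\<^sup>2 * (1 / real n)) * \<bar>t - s\<bar>)
        \<longlonglongrightarrow> B + (2 * C1 R + 8 * R * C3 R / \<epsilon>\<^sup>2 * 0) * \<bar>t - s\<bar>"
      by (intro tendsto_intros lim_1_over_n)
    then show "(\<lambda>n. B + (2 * C1 R + 8 * R * C3 R / \<epsilon>\<^sup>2 * (1 / real n)) * \<bar>t - s\<bar>) \<longlonglongrightarrow> B + 2 * C1 R * \<bar>t - s\<bar>"
      by simp
    have "E \<epsilon> K t \<le> B + (2 * C1 R + 8 * R * C3 R / \<epsilon>\<^sup>2 * (1 / real n)) * \<bar>t - s\<bar>" if "n0 + 1 \<le> n" for n
    proof -
      have "K \<subseteq> fbox n" using n0 fbox_mono[of n0 n] that by auto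
      then have "E \<epsilon> K t \<le> E \<epsilon> (fbox n) t" unfolding E_def by (intro add_mono energy_mono_set) auto
      also have "\<dots> \<le> E \<epsilon> (fbox n) s + (2 * C1 R + 8 * R * C3 R / \<epsilon>\<^sup>2 * (1 / real n)) * \<bar>t - s\<bar>"
        using Elip[OF \<epsilon>, of n] that by linarith
      also have "E \<epsilon> (fbox n) s \<le> B" using \<epsilon> by (intro EB) auto
      finally show ?thesis by simp
    qed
    then show "\<exists>N. \<forall>n\<ge>N. E \<epsilon> K t \<le> B + (2 * C1 R + 8 * R * C3 R / \<epsilon>\<^sup>2 * (1 / real n)) * \<bar>t - s\<bar>" by blast
  qed
  have "((\<lambda>\<epsilon>. E \<epsilon> K t) \<longlongrightarrow> E 0 K t) (at_right 0)"
    unfolding E_def energy_def v1_def v2_def qw_def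
    by (intro tendsto_intros) auto
  then have "E 0 K t \<le> B + 2 * C1 R * \<bar>t - s\<bar>"
    by (rule tendsto_upperbound) (use step1 eventually_at_right_less[of 0] in \<open>auto elim: eventually_mono\<close>)
  then show ?thesis
    by (simp add: E_def v1_def[abs_def] v2_def[abs_def] power3_eq_cube power2_eq_square mult.assoc)
qed

text \<open>Continuity of each coefficient together with control of the total energy gives
  convergence in norm: a finite set that carries almost all the energy at time \<open>s\<close>
  still does so at nearby times, since the total grows at most linearly, and so both tails are
  small.\<close>

lemma ksol_strongly_continuous:
  assumes sol: "ksol UNIV T R b w" and s: "s \<in> {0..T}" and "0 < e"
  shows "\<forall>\<^sub>F t in at s within {0..T}. \<forall>K. finite K \<longrightarrow>
    energy (\<lambda>k. wt k ^ 3) K (\<lambda>k. b t k - b s k) + energy (\<lambda>k. wt k ^ 2) K (\<lambda>k. w t k - w s k) \<le> e"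
proof -
  define E where "E L t = energy (\<lambda>k. wt k ^ 3) L (b t) + energy (\<lambda>k. wt k ^ 2) L (w t)" for L t
  define Ed where "Ed L t = energy (\<lambda>k. wt k ^ 3) L (\<lambda>k. b t k - b s k) + energy (\<lambda>k. wt k ^ 2) L (\<lambda>k. w t k - w s k)" for L t
  \<comment> \<open>The full energy at time \<open>s\<close>, as the supremum of its finite parts;
    \<open>K0\<close> is then chosen to miss less than \<open>e / 8\<close> of it.\<close>
  define B where "B = (SUP L\<in>{L. finite L}. E L s)"
  have "E L s \<le> R\<^sup>2 + R\<^sup>2" if "finite L" for L
    using ksolD(1)[OF sol s] that unfolding E_def bdd_def by (intro add_mono energy_le_of_wbound) auto
  then have bdd: "bdd_above ((\<lambda>L. E L s) ` {L. finite L})" by (auto simp: bdd_above_def)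
  have EB: "E L s \<le> B" if "finite L" for L
    unfolding B_def by (rule cSUP_upper2[OF bdd]) (use that in auto)
  have "B - e / 8 < B" using \<open>0 < e\<close> by simp
  then have "\<exists>L\<in>{L. finite L}. B - e / 8 < E L s"
    unfolding B_def by (intro less_cSUP_iff[THEN iffD1, OF _ bdd]) auto
  then obtain K0 where K0: "finite K0" "B - e / 8 < E K0 s" by auto
  have cont: "((\<lambda>t. b t k) \<longlongrightarrow> b s k) (at s within {0..T})" "((\<lambda>t. w t k) \<longlongrightarrow> w s k) (at s within {0..T})" for k
    using ksolD(6,7)[OF sol s, of k] has_vector_derivative_continuous
    unfolding continuous_within by blast+
  \<comment> \<open>A bound for \<open>Ed K t\<close> that does not depend on \<open>K\<close>: the
    difference on \<open>K0\<close> plus twice the tail energies at \<open>t\<close> and at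
    \<open>s\<close>. Its limit at \<open>s\<close> is \<open>e / 2\<close>.\<close>
  define \<Theta> where "\<Theta> t = Ed K0 t + 2 * (e / 8 + 2 * C1 R * \<bar>t - s\<bar> + (E K0 s - E K0 t)) + 2 * (e / 8)" for t
  have "(\<Theta> \<longlongrightarrow> (\<Sum>k\<in>K0. (wt k ^ 3)\<^sup>2 * (cmod (b s k - b s k))\<^sup>2) + (\<Sum>k\<in>K0. (wt k ^ 2)\<^sup>2 * (cmod (w s k - w s k))\<^sup>2)
     + 2 * (e / 8 + 2 * C1 R * \<bar>s - s\<bar> + (E K0 s - E K0 s)) + 2 * (e / 8)) (at s within {0..T})"
    unfolding \<Theta>_def Ed_def E_def energy_def by (intro tendsto_intros cont)
  moreover have "(\<Sum>k\<in>K0. (wt k ^ 3)\<^sup>2 * (cmod (b s k - b s k))\<^sup>2) + (\<Sum>k\<in>K0. (wt k ^ 2)\<^sup>2 * (cmod (w s k - w s k))\<^sup>2)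
     + 2 * (e / 8 + 2 * C1 R * \<bar>s - s\<bar> + (E K0 s - E K0 s)) + 2 * (e / 8) < e"
    using \<open>0 < e\<close> by simp
  ultimately have "\<forall>\<^sub>F t in at s within {0..T}. \<Theta> t < e" by (rule order_tendstoD(2))
  moreover have "\<forall>\<^sub>F t in at s within {0..T}. t \<in> {0..T}"
    by (auto simp: eventually_at_filter)
  ultimately show ?thesis
  proof eventually_elim
    case (elim t)
    show ?case
    proof (intro allI impI)
      fix K :: "freq set" assume K: "finite K"
      define L where "L = K \<union> K0"
      have L: "finite L" "K0 \<subseteq> L" using K K0 by (auto simp: L_def)
      have spl: "E L u = E K0 u + E (L - K0) u" for u
        unfolding E_def by (simp add: energy_split[OF L])
      have "E L t \<le> B + 2 * C1 R * \<bar>t - s\<bar>"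
        unfolding E_def by (rule ksol_energy_lipschitz[OF sol s elim(2) _ L(1)]) (use EB in \<open>auto simp: E_def\<close>)
      then have t: "E (L - K0) t \<le> e / 8 + 2 * C1 R * \<bar>t - s\<bar> + (E K0 s - E K0 t)"
        using spl[of t] K0(2) by linarith
      have s: "E (L - K0) s \<le> e / 8" using spl[of s] EB[OF L(1)] K0(2) by linarith
      have "Ed K t \<le> Ed L t" unfolding Ed_def using L by (intro add_mono energy_mono_set) (auto simp: L_def)
      also have "\<dots> = Ed K0 t + Ed (L - K0) t" unfolding Ed_def by (simp add: energy_split[OF L])
      also have "Ed (L - K0) t \<le> 2 * E (L - K0) t + 2 * E (L - K0) s"
        using add_mono[OF energy_diff_le[of "\<lambda>k. wt k ^ 3" "L - K0" "b t" "b s"]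
            energy_diff_le[of "\<lambda>k. wt k ^ 2" "L - K0" "w t" "w s"]]
        unfolding Ed_def E_def by (simp add: algebra_simps)
      also have "\<dots> \<le> 2 * (e / 8 + 2 * C1 R * \<bar>t - s\<bar> + (E K0 s - E K0 t)) + 2 * (e / 8)"
        using s t by (intro add_mono mult_left_mono) auto
      finally have "Ed K t \<le> \<Theta> t" by (simp add: \<Theta>_def)
      then show "energy (\<lambda>k. wt k ^ 3) K (\<lambda>k. b t k - b s k) + energy (\<lambda>k. wt k ^ 2) K (\<lambda>k. w t k - w s k) \<le> e"
        using elim(1) by (simp add: Ed_def)
    qed
  qed
qed

end

section \<open>Galerkin approximation\<close>

text \<open>With the discrete metric on the lattice, \<open>bcontfun\<close> provides the Banach space of bounded
  coefficient sequences in which the Galerkin system is solved.\<close>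

instantiation int :: metric_space
begin

definition dist_int :: "int \<Rightarrow> int \<Rightarrow> real" where
  "dist_int i j = \<bar>real_of_int i - real_of_int j\<bar>"

definition uniformity_int :: "(int \<times> int) filter" where
  "uniformity_int = (INF e\<in>{0<..}. principal {(i, j). dist i j < e})"

instance
proof
  show "uniformity = (INF e\<in>{0<..}. principal {(i, j :: int). dist i j < e})"
    by (rule uniformity_int_def)
  show "open U \<longleftrightarrow> (\<forall>i\<in>U. \<forall>\<^sub>F (i', j) in uniformity. i' = i \<longrightarrow> j \<in> U)" for U :: "int set"
  proof -
    have eq: "i = j" if "\<bar>real_of_int i - real_of_int j\<bar> < 1" for i j
      using that by linarith
    have "\<forall>\<^sub>F (i', j) in uniformity. i' = i \<longrightarrow> j \<in> U" if "i \<in> U" for i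
      unfolding uniformity_int_def
      by (rule eventually_INF1[of 1]) (use that in \<open>auto simp: eventually_principal dist_int_def dest: eq\<close>)
    then show ?thesis by (simp add: open_discrete)
  qed
qed (auto simp: dist_int_def)

end

instance bcontfun :: (metric_space, banach) banach ..

text \<open>Boundedness is part of the notion because it makes the class closed under products, and
  the vector field is quadratic.\<close>

definition bounded_lipschitz :: "('a::metric_space \<Rightarrow> complex) \<Rightarrow> bool" where
  "bounded_lipschitz \<phi> \<longleftrightarrow> (\<exists>B C. 0 \<le> B \<and> 0 \<le> C \<and> (\<forall>z. cmod (\<phi> z) \<le> B) \<and> (\<forall>z z'. cmod (\<phi> z - \<phi> z') \<le> C * dist z z'))"

lemma bounded_lipschitz_const: "bounded_lipschitz (\<lambda>z. c)"
  unfolding bounded_lipschitz_def by (rule exI[of _ "cmod c"], rule exI[of _ 0]) auto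

lemma bounded_lipschitz_add:
  assumes "bounded_lipschitz \<phi>" "bounded_lipschitz \<psi>"
  shows "bounded_lipschitz (\<lambda>z. \<phi> z + \<psi> z)"
proof -
  obtain B C B' C' where *: "0 \<le> B" "0 \<le> C" "\<And>z. cmod (\<phi> z) \<le> B" "\<And>z z'. cmod (\<phi> z - \<phi> z') \<le> C * dist z z'"
    "0 \<le> B'" "0 \<le> C'" "\<And>z. cmod (\<psi> z) \<le> B'" "\<And>z z'. cmod (\<psi> z - \<psi> z') \<le> C' * dist z z'"
    using assms unfolding bounded_lipschitz_def by metis
  have "cmod (\<phi> z + \<psi> z) \<le> B + B'" for z
    by (rule norm_triangle_le[OF add_mono[OF *(3,7)]])
  moreover have "cmod ((\<phi> z + \<psi> z) - (\<phi> z' + \<psi> z')) \<le> (C + C') * dist z z'" for z z'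
    using norm_triangle_le[OF add_mono[OF *(4,8)], of z z' z z'] by (simp add: algebra_simps)
  ultimately show ?thesis
    unfolding bounded_lipschitz_def using *(1,2,5,6) by (rule_tac x = "B + B'" in exI, rule_tac x = "C + C'" in exI) auto
qed

lemma bounded_lipschitz_mult:
  assumes "bounded_lipschitz \<phi>" "bounded_lipschitz \<psi>"
  shows "bounded_lipschitz (\<lambda>z. \<phi> z * \<psi> z)"
proof -
  obtain B C B' C' where *: "0 \<le> B" "0 \<le> C" "\<And>z. cmod (\<phi> z) \<le> B" "\<And>z z'. cmod (\<phi> z - \<phi> z') \<le> C * dist z z'"
    "0 \<le> B'" "0 \<le> C'" "\<And>z. cmod (\<psi> z) \<le> B'" "\<And>z z'. cmod (\<psi> z - \<psi> z') \<le> C' * dist z z'"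
    using assms unfolding bounded_lipschitz_def by metis
  have "cmod (\<phi> z * \<psi> z) \<le> B * B'" for z
    unfolding norm_mult by (intro mult_mono * ) auto
  moreover have "cmod (\<phi> z * \<psi> z - \<phi> z' * \<psi> z') \<le> (C * B' + B * C') * dist z z'" for z z'
  proof -
    have "\<phi> z * \<psi> z - \<phi> z' * \<psi> z' = (\<phi> z - \<phi> z') * \<psi> z + \<phi> z' * (\<psi> z - \<psi> z')"
      by (simp add: algebra_simps)
    then have "cmod (\<phi> z * \<psi> z - \<phi> z' * \<psi> z') \<le> cmod (\<phi> z - \<phi> z') * cmod (\<psi> z) + cmod (\<phi> z') * cmod (\<psi> z - \<psi> z')"
      by (metis norm_mult norm_triangle_ineq)
    also have "\<dots> \<le> (C * dist z z') * B' + B * (C' * dist z z')"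
      using * by (intro add_mono mult_mono) auto
    finally show ?thesis by (simp add: algebra_simps)
  qed
  ultimately show ?thesis
    unfolding bounded_lipschitz_def using *(1,2,5,6) by (rule_tac x = "B * B'" in exI, rule_tac x = "C * B' + B * C'" in exI) auto
qed

lemma bounded_lipschitz_uminus: "bounded_lipschitz \<phi> \<Longrightarrow> bounded_lipschitz (\<lambda>z. - \<phi> z)"
  using bounded_lipschitz_mult[OF bounded_lipschitz_const[of "- 1"]] by simp

lemma bounded_lipschitz_diff: "bounded_lipschitz \<phi> \<Longrightarrow> bounded_lipschitz \<psi> \<Longrightarrow> bounded_lipschitz (\<lambda>z. \<phi> z - \<psi> z)"
  using bounded_lipschitz_add[of \<phi> "\<lambda>z. - \<psi> z"] bounded_lipschitz_uminus[of \<psi>] by simp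

lemma bounded_lipschitz_sum: "(\<And>i. i \<in> I \<Longrightarrow> bounded_lipschitz (\<phi> i)) \<Longrightarrow> bounded_lipschitz (\<lambda>z. \<Sum>i\<in>I. \<phi> i z)"
  by (induction I rule: infinite_finite_induct) (auto intro: bounded_lipschitz_const bounded_lipschitz_add)

lemma bounded_lipschitz_cnj: "bounded_lipschitz \<phi> \<Longrightarrow> bounded_lipschitz (\<lambda>z. cnj (\<phi> z))"
  unfolding bounded_lipschitz_def by (simp flip: complex_cnj_diff)

text \<open>Every set of frequencies is a union of products of singletons and hence open.\<close>

lemma continuous_on_freq: "continuous_on S (g :: freq \<Rightarrow> 'a::topological_space)"
proof -
  have "open A" for A :: "freq set"
  proof -
    have "A = (\<Union>p\<in>A. {fst p} \<times> {snd p})" by auto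
    moreover have "open (\<Union>p\<in>A. {fst p} \<times> {snd p})"
      by (intro open_UN ballI open_Times open_discrete)
    ultimately show ?thesis by simp
  qed
  then show ?thesis by (auto simp: continuous_on_open_invariant)
qed

lemma bcontfun_finite_support:
  fixes g :: "freq \<Rightarrow> 'a::real_normed_vector"
  assumes "finite K" "\<And>k. k \<notin> K \<Longrightarrow> g k = 0"
  shows "g \<in> bcontfun"
proof -
  have "range g \<subseteq> insert 0 (g ` K)" using assms by auto
  then have "bounded (range g)"
    using assms(1) by (intro finite_imp_bounded finite_subset[of "range g"]) auto
  then show ?thesis by (simp add: bcontfun_def continuous_on_freq)
qed

lemma bounded_linear_component: "bounded_linear (\<lambda>z. apply_bcontfun z k)"
  by (rule bounded_linear_intro[where K = 1]) (auto simp: norm_bounded)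

lemma vector_derivative_zero_imp_eq:
  fixes g :: "real \<Rightarrow> 'a::real_normed_vector"
  assumes "\<And>s. s \<in> {0..T} \<Longrightarrow> (g has_vector_derivative 0) (at s within {0..T})" "t \<in> {0..T}"
  shows "g t = g 0"
proof -
  obtain c where "\<And>x. x \<in> {0..T} \<Longrightarrow> g x = c"
    using has_vector_derivative_zero_constant[of "{0..T}" g] assms(1) by (auto simp: convex_closed_interval)
  then show ?thesis using assms(2) by auto
qed

context tqg_data
begin

text \<open>The Galerkin system is made globally Lipschitz by clamping every coefficient to the disc of
  radius \<open>R\<close>, which is not seen as long as the energy is at most \<open>R\<^sup>2\<close>; the symmetrization makes
  the conjugation symmetry of the solution automatic.\<close>

lemma galerkin_exists:
  assumes bdd0: "bdd r b0 w0" and sym: "\<And>k. b0 (- k) = cnj (b0 k)" "\<And>k. w0 (- k) = cnj (w0 k)"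
    and T: "0 \<le> T" "2 * r\<^sup>2 + 2 * C1 R * T < R\<^sup>2" and R: "0 \<le> R"
  shows "\<exists>b w. ksol (fbox n) T R b w \<and> b 0 = trunc (fbox n) b0 \<and> w 0 = trunc (fbox n) w0"
proof -
  let ?K = "fbox n"
  \<comment> \<open>The metric projection onto a convex set has Lipschitz constant 1 and fixes the
    disc.\<close>
  define clp where "clp = closest_point (cball (0 :: complex) R)"
  have clp: "cmod (clp z) \<le> R" "cmod (clp z - clp z') \<le> cmod (z - z')" for z z'
    using closest_point_in_set[of "cball (0::complex) R" z] closest_point_lipschitz[of "cball (0::complex) R" z z'] R
    by (auto simp: clp_def dist_norm)
  have clp_id: "clp z = z" if "cmod z \<le> R" for z
    unfolding clp_def by (rule closest_point_self) (use that in simp)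
  \<comment> \<open>The state is one sequence of pairs, and \<open>p\<close> selects the component.
    The average with the conjugate at \<open>- k\<close> is conjugation symmetric whatever
    \<open>z\<close> is.\<close>
  define sy where "sy p z k = (if k \<in> ?K then (clp (p (apply_bcontfun z k)) + cnj (clp (p (apply_bcontfun z (- k))))) / 2 else 0)"
    for p :: "complex \<times> complex \<Rightarrow> complex" and z :: "freq \<Rightarrow>\<^sub>C (complex \<times> complex)" and k
  have sy_sym: "sy p z (- k) = cnj (sy p z k)" for p z k
    by (simp add: sy_def fbox_minus add.commute)
  have sy_out: "k \<notin> ?K \<Longrightarrow> sy p z k = 0" for p z k by (simp add: sy_def)
  have bounded_lipschitz_sy: "bounded_lipschitz (\<lambda>z. sy p z k)" if p: "p = fst \<or> p = snd" for p k
  proof -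
    have p1: "cmod (p x - p y) \<le> dist x y" for x y
      using p by (auto simp: dist_fst_le dist_snd_le dist_norm[symmetric])
    have c: "bounded_lipschitz (\<lambda>z :: freq \<Rightarrow>\<^sub>C (complex \<times> complex). clp (p (apply_bcontfun z k)))" for k
      unfolding bounded_lipschitz_def
    proof (rule exI[of _ R], rule exI[of _ 1], intro conjI allI)
      fix z z' :: "freq \<Rightarrow>\<^sub>C (complex \<times> complex)"
      show "cmod (clp (p (apply_bcontfun z k)) - clp (p (apply_bcontfun z' k))) \<le> 1 * dist z z'"
        using clp(2)[of "p (apply_bcontfun z k)" "p (apply_bcontfun z' k)"] p1[of "apply_bcontfun z k" "apply_bcontfun z' k"]
          dist_bounded[of z k z'] by linarith
    qed (use R clp in auto)
    show ?thesis
    proof (cases "k \<in> ?K")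
      case True
      have "bounded_lipschitz (\<lambda>z. (1 / 2) * (clp (p (apply_bcontfun z k)) + cnj (clp (p (apply_bcontfun z (- k))))))"
        by (intro bounded_lipschitz_mult bounded_lipschitz_const bounded_lipschitz_add bounded_lipschitz_cnj c)
      then show ?thesis using True by (simp add: sy_def)
    qed (simp add: sy_def bounded_lipschitz_const)
  qed
  define sb sw where "sb = sy fst" and "sw = sy snd"
  have blips: "bounded_lipschitz (\<lambda>z. sb z k)" "bounded_lipschitz (\<lambda>z. sw z k)" for k by (auto simp: sb_def sw_def bounded_lipschitz_sy)
  have jf: "jac g (x z) k = (\<Sum>l\<in>?K. of_real (- (4 * pi\<^sup>2) * cr k l) * g (k - l) * x z l)"
    if "\<And>l. l \<notin> ?K \<Longrightarrow> x z l = 0" for g k z and x :: "(freq \<Rightarrow>\<^sub>C (complex \<times> complex)) \<Rightarrow> freq \<Rightarrow> complex"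
    by (rule jac_finite_support) (use that in auto)
  have bF: "bounded_lipschitz (\<lambda>z. Fb (sb z) (sw z) k)" for k
    unfolding Fb_def strm_def sb_def
    by (subst jf) (auto simp: sy_out intro!: bounded_lipschitz_uminus bounded_lipschitz_sum bounded_lipschitz_mult bounded_lipschitz_const bounded_lipschitz_diff blips[unfolded sb_def])
  have wF: "bounded_lipschitz (\<lambda>z. Fw (sb z) (sw z) k)" for k
    unfolding Fw_def strm_def sb_def sw_def
    by (subst jf[of "\<lambda>z l. sy snd z l - sy fst z l"], simp add: sy_out, subst jf, simp add: sy_out)
      (intro bounded_lipschitz_uminus bounded_lipschitz_sum bounded_lipschitz_mult bounded_lipschitz_const bounded_lipschitz_diff blips[unfolded sb_def sw_def])
  define V where "V z k = (if k \<in> ?K then (Fb (sb z) (sw z) k, Fw (sb z) (sw z) k) else 0)" for z k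
  define F where "F z = Bcontfun (V z)" for z
  have F: "apply_bcontfun (F z) = V z" for z
    unfolding F_def by (rule Bcontfun_inverse[OF bcontfun_finite_support[of ?K]]) (auto simp: V_def)
  have "\<exists>C\<ge>0. \<forall>z z'. norm (V z k - V z' k) \<le> C * dist z z'" for k
  proof (cases "k \<in> ?K")
    case True
    obtain C C' where C: "0 \<le> C" "0 \<le> C'" "\<And>z z'. cmod (Fb (sb z) (sw z) k - Fb (sb z') (sw z') k) \<le> C * dist z z'"
      "\<And>z z'. cmod (Fw (sb z) (sw z) k - Fw (sb z') (sw z') k) \<le> C' * dist z z'"
      using bF[of k] wF[of k] unfolding bounded_lipschitz_def by metis
    have "norm (V z k - V z' k) \<le> (C + C') * dist z z'" for z z'
      using norm_Pair_le[of "Fb (sb z) (sw z) k - Fb (sb z') (sw z') k" "Fw (sb z) (sw z) k - Fw (sb z') (sw z') k"]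
        C(3,4)[of z z'] True by (simp add: V_def distrib_right)
    then show ?thesis using C by (intro exI[of _ "C + C'"]) auto
  next
    case False then show ?thesis by (intro exI[of _ 0]) (auto simp: V_def)
  qed
  then obtain C where C: "\<And>k. 0 \<le> C k" "\<And>k z z'. norm (V z k - V z' k) \<le> C k * dist z z'" by metis
  have lip: "norm (F z - F z') \<le> (\<Sum>k\<in>?K. C k) * norm (z - z')" for z z'
  proof (rule norm_bound)
    fix k
    show "norm (apply_bcontfun (F z - F z') k) \<le> (\<Sum>k\<in>?K. C k) * norm (z - z')"
    proof (cases "k \<in> ?K")
      case True
      have "norm (V z k - V z' k) \<le> C k * dist z z'" by (rule C)
      also have "\<dots> \<le> (\<Sum>k\<in>?K. C k) * dist z z'"
        using True C(1) by (intro mult_right_mono member_le_sum) auto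
      finally show ?thesis by (simp add: F dist_norm)
    next
      case False
      then show ?thesis using C(1) by (simp add: F V_def sum_nonneg)
    qed
  qed
  define z0 where "z0 = Bcontfun (\<lambda>k. (trunc ?K b0 k, trunc ?K w0 k))"
  have z0: "apply_bcontfun z0 k = (trunc ?K b0 k, trunc ?K w0 k)" for k
    unfolding z0_def by (subst Bcontfun_inverse[OF bcontfun_finite_support[of ?K]]) (auto simp: trunc_def zero_prod_def)
  obtain x where x: "x 0 = z0" "\<And>t. t \<in> {0..T} \<Longrightarrow> (x has_vector_derivative F (x t)) (at t within {0..T})"
    using lipschitz_ode_exists[of F "\<Sum>k\<in>?K. C k" T z0, OF lip T(1)] by blast
  define b where "b t k = fst (apply_bcontfun (x t) k)" for t k
  define w where "w t k = snd (apply_bcontfun (x t) k)" for t k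
  have comp: "((\<lambda>t. apply_bcontfun (x t) k) has_vector_derivative V (x t) k) (at t within {0..T})" if "t \<in> {0..T}" for t k
    using bounded_linear.has_vector_derivative[OF bounded_linear_component x(2)[OF that], of k] by (simp add: F)
  have db: "((\<lambda>t. b t k) has_vector_derivative (if k \<in> ?K then Fb (sb (x t)) (sw (x t)) k else 0)) (at t within {0..T})"
    and dw: "((\<lambda>t. w t k) has_vector_derivative (if k \<in> ?K then Fw (sb (x t)) (sw (x t)) k else 0)) (at t within {0..T})"
    if "t \<in> {0..T}" for t k
    using bounded_linear.has_vector_derivative[OF bounded_linear_fst comp[OF that, of k]]
      bounded_linear.has_vector_derivative[OF bounded_linear_snd comp[OF that, of k]]
    by (auto simp: b_def w_def V_def split: if_splits)
  have b0: "b 0 = trunc ?K b0" and w0: "w 0 = trunc ?K w0"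
    by (auto simp: b_def w_def x(1) z0)
  have out: "b t k = 0" "w t k = 0" if "k \<notin> ?K" "t \<in> {0..T}" for k t
  proof -
    have "b t k = b 0 k"
      by (rule vector_derivative_zero_imp_eq[of T "\<lambda>t. b t k"]) (use db[of _ k] that in auto)
    then show "b t k = 0" using that by (simp add: b0 trunc_def)
    have "w t k = w 0 k"
      by (rule vector_derivative_zero_imp_eq[of T "\<lambda>t. w t k"]) (use dw[of _ k] that in auto)
    then show "w t k = 0" using that by (simp add: w0 trunc_def)
  qed
  have ssym: "sb z (- k) = cnj (sb z k)" "sw z (- k) = cnj (sw z k)" for z k
    by (simp_all add: sb_def sw_def sy_sym)
  have symb: "b t (- k) = cnj (b t k)" and symw: "w t (- k) = cnj (w t k)" if "t \<in> {0..T}" for t k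
  proof -
    have "b t (- k) - cnj (b t k) = b 0 (- k) - cnj (b 0 k)"
    proof (rule vector_derivative_zero_imp_eq[of T "\<lambda>t. b t (- k) - cnj (b t k)"])
      fix s assume s: "s \<in> {0..T}"
      show "((\<lambda>t. b t (- k) - cnj (b t k)) has_vector_derivative 0) (at s within {0..T})"
        using has_vector_derivative_diff[OF db[OF s, of "- k"]
            bounded_linear.has_vector_derivative[OF bounded_linear_cnj db[OF s, of k]]]
          Fb_cnj[of "sb (x s)" "sw (x s)" k, OF ssym]
        by (simp add: fbox_minus split: if_splits)
    qed fact
    then show "b t (- k) = cnj (b t k)" using sym by (simp add: b0 trunc_def fbox_minus split: if_splits)
    have "w t (- k) - cnj (w t k) = w 0 (- k) - cnj (w 0 k)"
    proof (rule vector_derivative_zero_imp_eq[of T "\<lambda>t. w t (- k) - cnj (w t k)"])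
      fix s assume s: "s \<in> {0..T}"
      show "((\<lambda>t. w t (- k) - cnj (w t k)) has_vector_derivative 0) (at s within {0..T})"
        using has_vector_derivative_diff[OF dw[OF s, of "- k"]
            bounded_linear.has_vector_derivative[OF bounded_linear_cnj dw[OF s, of k]]]
          Fw_cnj[of "sb (x s)" "sw (x s)" k, OF ssym]
        by (simp add: fbox_minus split: if_splits)
    qed fact
    then show "w t (- k) = cnj (w t k)" using sym by (simp add: w0 trunc_def fbox_minus split: if_splits)
  qed
  define E where "E t = energy (\<lambda>k. wt k ^ 3) ?K (b t) + energy (\<lambda>k. wt k ^ 2) ?K (w t)" for t
  have bddE: "bdd R (b t) (w t)" if t: "t \<in> {0..T}" and E: "E t \<le> R\<^sup>2" for t
  proof -
    have "energy (\<lambda>k. wt k ^ 3) ?K (b t) \<le> R\<^sup>2" "energy (\<lambda>k. wt k ^ 2) ?K (w t) \<le> R\<^sup>2"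
      using E energy_nonneg[of "\<lambda>k. wt k ^ 3" ?K "b t"] energy_nonneg[of "\<lambda>k. wt k ^ 2" ?K "w t"]
      unfolding E_def by linarith+
    then have "L2_set (\<lambda>k. wt k ^ 3 * cmod (b t k)) ?K \<le> R" "L2_set (\<lambda>k. wt k ^ 2 * cmod (w t k)) ?K \<le> R"
      using R by (auto simp: energy_eq_L2_set intro: power2_le_imp_le)
    then show ?thesis unfolding bdd_def
      using wbound_support[of ?K "b t" "\<lambda>k. wt k ^ 3"] wbound_support[of ?K "w t" "\<lambda>k. wt k ^ 2"] out t
      by (auto intro: wbound_weaken)
  qed
  have sid: "sb (x t) = b t" "sw (x t) = w t" if t: "t \<in> {0..T}" and E: "E t \<le> R\<^sup>2" for t
  proof -
    note bd = bddE[OF that]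
    have c: "cmod (b t k) \<le> R" "cmod (w t k) \<le> R" for k
      using wbound_pointwise[OF bddD(6)[OF bd], of k] wbound_pointwise[OF bddD(7)[OF bd], of k] by auto
    show "sb (x t) = b t"
    proof
      fix k
      show "sb (x t) k = b t k"
        using symb[OF t, of k] out(1)[OF _ t, of k] c(1)[of k] c(1)[of "- k"]
        by (simp add: sb_def sy_def b_def[symmetric] clp_id)
    qed
    show "sw (x t) = w t"
    proof
      fix k
      show "sw (x t) k = w t k"
        using symw[OF t, of k] out(2)[OF _ t, of k] c(2)[of k] c(2)[of "- k"]
        by (simp add: sw_def sy_def w_def[symmetric] clp_id)
    qed
  qed
  define dE where "dE t = 2 * (rate (\<lambda>k. wt k ^ 3) ?K (b t) (Fb (sb (x t)) (sw (x t))) + rate (\<lambda>k. wt k ^ 2) ?K (w t) (Fw (sb (x t)) (sw (x t))))" for t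
  have derE: "(E has_real_derivative dE t) (at t within {0..T})" if t: "t \<in> {0..T}" for t
  proof -
    have "((\<lambda>t. b t k) has_vector_derivative Fb (sb (x t)) (sw (x t)) k) (at t within {0..T})"
      "((\<lambda>t. w t k) has_vector_derivative Fw (sb (x t)) (sw (x t)) k) (at t within {0..T})" if "k \<in> ?K" for k
      using db[OF t, of k] dw[OF t, of k] that by auto
    from DERIV_add[OF has_vector_derivative_cmod_sum[OF finite_fbox this(1), where w = "\<lambda>k. wt k ^ 3"]
        has_vector_derivative_cmod_sum[OF finite_fbox this(2), where w = "\<lambda>k. wt k ^ 2"]]
    show ?thesis unfolding E_def[abs_def] dE_def rate_def energy_def distrib_left by simp
  qed
  have adms: "adm (\<lambda>k. wt k ^ 3)" "adm (\<lambda>k. wt k ^ 2)"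
    using adm_weights(3,4)[of 0] by (simp_all add: power3_eq_cube power2_eq_square mult.assoc)
  \<comment> \<open>The modified field agrees with the true one only under the bound to be shown,
    which is why \<open>energy_rate\<close> enters through \<open>barrier\<close>.\<close>
  have Ebd: "E t \<le> R\<^sup>2" if t: "t \<in> {0..T}" for t
  proof (rule barrier[OF derE _ _ _ T(2) t])
    fix s assume s: "s \<in> {0..T}" and E: "E s \<le> R\<^sup>2"
    have "\<bar>rate (\<lambda>k. wt k ^ 3) ?K (b s) (Fb (b s) (w s)) + rate (\<lambda>k. wt k ^ 2) ?K (w s) (Fw (b s) (w s))\<bar> \<le> C1 R"
      by (rule energy_rate) (use out s symw bddE[OF s E] adms in auto)
    from abs_le_D1[OF this] show "dE s \<le> 2 * C1 R" unfolding dE_def sid[OF s E] by (rule mult_left_mono) simp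
  next
    have "E 0 \<le> r\<^sup>2 + r\<^sup>2"
      unfolding E_def b0 w0 using bdd_trunc[OF bdd0, of ?K]
      by (intro add_mono energy_le_of_wbound) (auto simp: bdd_def)
    then show "E 0 \<le> 2 * r\<^sup>2" by simp
  qed (use C_nonneg[OF R] in auto)
  have "ksol ?K T R b w"
    unfolding ksol_def
  proof (intro conjI ballI allI impI T(1))
    fix t k assume t: "t \<in> {0..T}"
    show "((\<lambda>s. b s k) has_vector_derivative (if k \<in> ?K then Fb (b t) (w t) k else 0)) (at t within {0..T})"
      "((\<lambda>s. w s k) has_vector_derivative (if k \<in> ?K then Fw (b t) (w t) k else 0)) (at t within {0..T})"
      using db[OF t, of k] dw[OF t, of k] unfolding sid[OF t Ebd[OF t]] by this+
  qed (use bddE[OF _ Ebd] symb symw out in auto)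
  then show ?thesis using b0 w0 by blast
qed

text \<open>The energy starts at no more than \<open>2 * r\<^sup>2\<close> and must stay below
  \<open>R\<^sup>2\<close> for \<open>R = 2 * r + 1\<close>. At the rate \<open>2 * C1 R\<close> it
  gains at most 1/2 in this time, and \<open>R\<^sup>2\<close> exceeds
  \<open>2 * r\<^sup>2 + 1 / 2\<close>. The inner summand 1 keeps the denominator positive.\<close>

definition life :: "real \<Rightarrow> real" where
  "life r = 1 / (2 * (2 * C1 (2 * r + 1) + 1))"

lemma life_pos: "0 \<le> r \<Longrightarrow> 0 < life r"
  using C_nonneg(1)[of "2 * r + 1"] by (auto simp: life_def intro!: divide_pos_pos)

theorem ksol_exists:
  assumes bdd0: "bdd r b0 w0" and sym: "\<And>k. b0 (- k) = cnj (b0 k)" "\<And>k. w0 (- k) = cnj (w0 k)"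
  shows "\<exists>b w. ksol UNIV (life r) (2 * r + 1) b w \<and> b 0 = b0 \<and> w 0 = w0"
proof -
  have r: "0 \<le> r" using bddD(1)[OF bdd0] .
  define R where "R = 2 * r + 1"
  have R: "0 \<le> R" "r \<le> R" using r by (auto simp: R_def)
  have c: "0 \<le> C1 R" using C_nonneg R by auto
  have "2 * C1 R * life r \<le> 1 / 2"
    using c by (simp add: life_def R_def[symmetric] divide_simps)
  moreover have "R\<^sup>2 = 4 * r\<^sup>2 + 4 * r + 1" by (simp add: R_def power2_eq_square algebra_simps)
  moreover have "0 \<le> r\<^sup>2" by simp
  ultimately have T: "2 * r\<^sup>2 + 2 * C1 R * life r < R\<^sup>2" using r by linarith
  have "\<forall>n. \<exists>b w. ksol (fbox n) (life r) R b w \<and> b 0 = trunc (fbox n) b0 \<and> w 0 = trunc (fbox n) w0"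
    using galerkin_exists[OF bdd0 sym _ T R(1)] life_pos[OF r] by (simp add: less_imp_le)
  then obtain bn wn where bw: "\<And>n. ksol (fbox n) (life r) R (bn n) (wn n)"
    "\<And>n. bn n 0 = trunc (fbox n) b0" "\<And>n. wn n 0 = trunc (fbox n) w0" by metis
  have "bdd R b0 w0" using bdd0 R by (auto simp: bdd_def intro: wbound_weaken)
  from ksol_limit[OF bw(1) bw(2,3) this] show ?thesis by (simp add: R_def)
qed

end


section \<open>Fourier series on the torus\<close>

lemma space_torus: "space torus = {0..<1} \<times> {0..<1}"
  by (simp add: torus_def space_restrict_space)

lemma torus_region [measurable]: "{0..<1::real} \<times> {0..<1::real} \<in> sets borel"
  unfolding borel_prod[symmetric] by (intro pair_measureI) auto

lemma emeasure_torus: "emeasure torus (space torus) = 1"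
proof -
  have "emeasure torus (space torus) = emeasure (lborel :: (real \<times> real) measure) ({0..<1} \<times> {0..<1})"
    unfolding space_torus unfolding torus_def by (subst emeasure_restrict_space) auto
  also have "\<dots> = emeasure (lborel \<Otimes>\<^sub>M lborel :: (real \<times> real) measure) ({0..<1} \<times> {0..<1})"
    by (simp add: lborel_prod)
  also have "\<dots> = 1"
    by (subst lborel.emeasure_pair_measure_Times) auto
  finally show ?thesis .
qed

interpretation torus: finite_measure torus
  by standard (simp add: emeasure_torus)

lemma measure_torus: "measure torus (space torus) = 1"
  by (simp add: measure_def emeasure_torus)

lemma integrable_torus_bounded:
  fixes g :: "real \<times> real \<Rightarrow> real"
  assumes "g \<in> borel_measurable borel" "\<And>p. \<bar>g p\<bar> \<le> B"
  shows "integrable torus g"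
  by (rule torus.integrable_const_bound[where B = B]) (use assms measurable_torus in auto)

lemma integrable_torus_mult_bounded:
  fixes u g :: "real \<times> real \<Rightarrow> real"
  assumes "integrable torus u" "g \<in> borel_measurable borel" "\<And>p. \<bar>g p\<bar> \<le> B"
  shows "integrable torus (\<lambda>p. u p * g p)"
proof (rule Bochner_Integration.integrable_bound)
  show "integrable torus (\<lambda>p. B * norm (u p))" using assms by auto
  show "(\<lambda>p. u p * g p) \<in> borel_measurable torus"
    using assms measurable_torus by (intro borel_measurable_times) auto
  have "\<bar>u p\<bar> * \<bar>g p\<bar> \<le> \<bar>u p\<bar> * \<bar>B\<bar>" for p
    using assms(3)[of p] by (intro mult_left_mono) auto
  then show "AE p in torus. norm (u p * g p) \<le> norm (B * norm (u p))"
    by (auto simp: abs_mult mult.commute)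
qed

lemma square_integrable_integrable:
  assumes "square_integrable u" shows "integrable torus u"
proof -
  have "square_integrable (\<lambda>p. 1)"
    by (auto simp: square_integrable_def periodic_def)
  from integrable_torus_mult[OF assms this] show ?thesis by simp
qed

lemma square_integrable_bounded:
  assumes "g \<in> borel_measurable borel" "periodic g" "\<And>p. \<bar>g p\<bar> \<le> B"
  shows "square_integrable g"
proof -
  have "\<bar>(g p)\<^sup>2\<bar> \<le> B\<^sup>2" for p using power_mono[OF assms(3)[of p], of 2] by simp
  then show ?thesis using assms
    by (auto simp: square_integrable_def intro!: integrable_torus_bounded[where B = "B\<^sup>2"])
qed

lemma periodic_shift_int:
  assumes "periodic g" shows "g (x + of_int m, y + of_int n) = g (x, y)"
proof -
  have 1: "g (x + of_int m, y) = g (x, y)" for x y and m :: int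
  proof (induction m rule: int_induct[where k = 0])
    case (step1 i)
    then show ?case using assms by (simp add: periodic_def add.assoc[symmetric])
  next
    case (step2 i)
    have "g (x + of_int (i - 1) + 1, y) = g (x + of_int (i - 1), y)" using assms unfolding periodic_def by blast
    then show ?case using step2 by (simp add: algebra_simps)
  qed simp
  have 2: "g (x, y + of_int m) = g (x, y)" for x y and m :: int
  proof (induction m rule: int_induct[where k = 0])
    case (step1 i)
    then show ?case using assms by (simp add: periodic_def add.assoc[symmetric])
  next
    case (step2 i)
    have "g (x, y + of_int (i - 1) + 1) = g (x, y + of_int (i - 1))" using assms unfolding periodic_def by blast
    then show ?case using step2 by (simp add: algebra_simps)
  qed simp
  show ?thesis by (simp add: 1 2)
qed

lemma periodic_continuous_bounded:
  assumes "periodic g" "continuous_on UNIV g"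
  shows "\<exists>B. \<forall>p. \<bar>g p\<bar> \<le> (B::real)"
proof -
  have "compact (g ` (cbox (0, 0) (1, 1)))"
    using assms(2) by (intro compact_continuous_image compact_cbox) (auto intro: continuous_on_subset)
  from compact_imp_bounded[OF this] obtain B where B: "\<And>p. p \<in> cbox (0, 0) (1, 1) \<Longrightarrow> \<bar>g p\<bar> \<le> B"
    unfolding bounded_iff by auto
  have "\<bar>g (x, y)\<bar> \<le> B" for x y
  proof -
    have "g (x, y) = g (frac x + of_int \<lfloor>x\<rfloor>, frac y + of_int \<lfloor>y\<rfloor>)" by (simp add: frac_def)
    also have "\<dots> = g (frac x, frac y)" by (rule periodic_shift_int[OF assms(1)])
    also have "\<bar>\<dots>\<bar> \<le> B"
      by (rule B) (simp add: cbox_Pair_eq frac_lt_1 less_imp_le)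
    finally show ?thesis .
  qed
  then show ?thesis by (metis surj_pair)
qed

lemma continuous_measurable: "continuous_on UNIV (g :: real \<times> real \<Rightarrow> real) \<Longrightarrow> g \<in> borel_measurable borel"
  by (rule borel_measurable_continuous_onI)

lemma of_class_C_continuous: "of_class_C n \<phi> \<Longrightarrow> continuous_on UNIV \<phi>"
  by (cases n) (auto intro!: differentiable_imp_continuous_on simp: differentiable_on_def)

lemma test_function_square_integrable:
  assumes "test_function \<phi>" shows "square_integrable \<phi>"
proof -
  have c: "continuous_on UNIV \<phi>" using assms of_class_C_continuous unfolding test_function_def by blast
  obtain B where "\<forall>p. \<bar>\<phi> p\<bar> \<le> B"
    using periodic_continuous_bounded[OF _ c] assms by (auto simp: test_function_def)
  then show ?thesis using assms c
    by (intro square_integrable_bounded[of _ B] continuous_measurable) (auto simp: test_function_def)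
qed

section \<open>Derivatives of periodic functions and integration by parts\<close>

lemma periodic_deriv:
  assumes "periodic \<phi>" "\<And>p. \<phi> differentiable (at p)"
  shows "periodic (dx \<phi>)" "periodic (dy \<phi>)"
proof -
  have "frechet_derivative \<phi> (at (p + c)) = frechet_derivative \<phi> (at p)"
    if c: "c = (1, 0) \<or> c = (0, 1)" for p c
  proof -
    have "(\<phi> has_derivative frechet_derivative \<phi> (at (p + c))) (at (p + c))"
      using assms(2) frechet_derivative_works by blast
    then have "((\<lambda>q. \<phi> (q + c)) has_derivative frechet_derivative \<phi> (at (p + c))) (at p)"
      by (intro has_derivative_compose[of "\<lambda>q. q + c" "\<lambda>h. h" p UNIV \<phi> "frechet_derivative \<phi> (at (p + c))"])
        (auto intro!: derivative_eq_intros)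
    moreover have "(\<lambda>q. \<phi> (q + c)) = \<phi>"
      using assms(1) c by (auto simp: periodic_def)
    ultimately show ?thesis using frechet_derivative_at by metis
  qed
  from this[of "(1, 0)" "(_, _)"] this[of "(0, 1)" "(_, _)"]
  show "periodic (dx \<phi>)" "periodic (dy \<phi>)"
    by (simp_all add: periodic_def dx_def dy_def)
qed

lemma test_function_deriv:
  assumes "test_function \<phi>" shows "test_function (dx \<phi>)" "test_function (dy \<phi>)"
proof -
  have 1: "of_class_C (Suc k) \<phi>" for k using assms unfolding test_function_def by blast
  then have "\<And>p. \<phi> differentiable (at p)" "\<And>k. of_class_C k (dx \<phi>)" "\<And>k. of_class_C k (dy \<phi>)"
    by simp_all
  then show "test_function (dx \<phi>)" "test_function (dy \<phi>)"
    using periodic_deriv[of \<phi>] assms unfolding test_function_def by auto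
qed

lemma dx_vector_derivative:
  assumes "\<phi> differentiable (at (x, y))"
  shows "((\<lambda>x. \<phi> (x, y)) has_vector_derivative dx \<phi> (x, y)) (at x within S)"
    "((\<lambda>y. \<phi> (x, y)) has_vector_derivative dy \<phi> (x, y)) (at y within S')"
proof -
  have d: "(\<phi> has_derivative frechet_derivative \<phi> (at (x, y))) (at (x, y))"
    using assms frechet_derivative_works by blast
  interpret bounded_linear "frechet_derivative \<phi> (at (x, y))"
    using d by (rule has_derivative_bounded_linear)
  have "((\<lambda>x. \<phi> (x, y)) has_derivative (\<lambda>h. frechet_derivative \<phi> (at (x, y)) (h, 0))) (at x within S)"
    by (rule has_derivative_compose[of "\<lambda>x. (x, y)" "\<lambda>h. (h, 0)"])
      (use d in \<open>auto intro!: derivative_eq_intros\<close>)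
  moreover have "((\<lambda>y. \<phi> (x, y)) has_derivative (\<lambda>h. frechet_derivative \<phi> (at (x, y)) (0, h))) (at y within S')"
    by (rule has_derivative_compose[of "\<lambda>y. (x, y)" "\<lambda>h. (0, h)"])
      (use d in \<open>auto intro!: derivative_eq_intros\<close>)
  moreover have "frechet_derivative \<phi> (at (x, y)) (h, 0) = h *\<^sub>R dx \<phi> (x, y)"
    "frechet_derivative \<phi> (at (x, y)) (0, h) = h *\<^sub>R dy \<phi> (x, y)" for h
    using scaleR[of h "(1, 0)"] scaleR[of h "(0, 1)"] by (simp_all add: dx_def dy_def)
  ultimately show "((\<lambda>x. \<phi> (x, y)) has_vector_derivative dx \<phi> (x, y)) (at x within S)"
    "((\<lambda>y. \<phi> (x, y)) has_vector_derivative dy \<phi> (x, y)) (at y within S')"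
    by (simp_all add: has_vector_derivative_def)
qed

lemma integral_period_0:
  fixes F g :: "real \<Rightarrow> real"
  assumes F: "\<And>x. (F has_vector_derivative g x) (at x within {0..1})" and g: "continuous_on UNIV g" and "F 1 = F 0"
  shows "(LINT x|lborel. indicator {0..<1} x * g x) = 0"
proof -
  have "(LINT x|lborel. indicator {0..<1} x * g x) = (LINT x|lborel. indicator {0..1} x * g x)"
  proof (rule integral_cong_AE)
    have [measurable]: "g \<in> borel_measurable borel" by (rule borel_measurable_continuous_onI[OF g])
    show "(\<lambda>x. indicator {0..<1} x * g x) \<in> borel_measurable lborel"
      "(\<lambda>x. indicator {0..1} x * g x) \<in> borel_measurable lborel" by measurable
    show "AE x in lborel. indicator {0..<1} x * g x = indicator {0..1} x * g x"
      using AE_lborel_singleton[of "1 :: real"] by eventually_elim (auto simp: indicator_def)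
  qed
  also have "\<dots> = F 1 - F 0"
    using integral_FTC_Icc[of 0 1 F g] F continuous_on_subset[OF g] by simp
  finally show ?thesis using assms(3) by simp
qed

text \<open>Fubini and the fundamental theorem of calculus in one variable; the boundary values
  cancel by periodicity. Applied to a product this is integration by parts.\<close>

lemma integral_torus_deriv_0:
  assumes per: "periodic \<phi>" and C1: "of_class_C 1 \<phi>"
  shows "(LINT p|torus. dx \<phi> p) = 0" "(LINT p|torus. dy \<phi> p) = 0"
proof -
  have d: "\<phi> differentiable (at p)" for p using C1 by simp
  have cx: "continuous_on UNIV (dx \<phi>)" and cy: "continuous_on UNIV (dy \<phi>)" using C1 by auto
  have red: "(LINT p|torus. g p) = (LINT p|(lborel \<Otimes>\<^sub>M lborel). indicator ({0..<1} \<times> {0..<1}) p * g p)" for g :: "real \<times> real \<Rightarrow> real"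
    unfolding torus_def by (subst integral_restrict_space) (auto simp: lborel_prod)
  have int: "integrable (lborel \<Otimes>\<^sub>M lborel) (\<lambda>p. indicator ({0..<1} \<times> {0..<1}) p * g p)"
    if g: "continuous_on UNIV g" "periodic g" for g :: "real \<times> real \<Rightarrow> real"
  proof -
    obtain B where B: "\<And>p. \<bar>g p\<bar> \<le> B" using periodic_continuous_bounded[OF g(2,1)] by blast
    have "integrable torus g"
      by (rule integrable_torus_bounded[OF continuous_measurable[OF g(1)] B])
    then show ?thesis unfolding torus_def by (subst (asm) integrable_restrict_space) (auto simp: lborel_prod)
  qed
  have "(LINT p|torus. dx \<phi> p) = (LINT y|lborel. LINT x|lborel. indicator ({0..<1} \<times> {0..<1}) (x, y) * dx \<phi> (x, y))"
  proof -
    have eq: "(\<lambda>(x, y). indicator ({0..<1} \<times> {0..<1}) (x, y) * dx \<phi> (x, y)) = (\<lambda>p. indicator ({0..<1} \<times> {0..<1}) p * dx \<phi> p)"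
      by (rule ext) (simp add: case_prod_unfold)
    show ?thesis
      unfolding red using lborel_pair.integral_snd[of "\<lambda>x y. indicator ({0..<1} \<times> {0..<1}) (x, y) * dx \<phi> (x, y)",
          unfolded eq, OF int[OF cx periodic_deriv(1)[OF per d]]] by (rule sym)
  qed
  also have "\<dots> = (LINT y|lborel. indicator {0..<1} y * (LINT x|lborel. indicator {0..<1} x * dx \<phi> (x, y)))"
    by (subst Bochner_Integration.integral_mult_right_zero[symmetric])
      (simp add: indicator_times mult_ac)
  also have "(\<lambda>y. LINT x|lborel. indicator {0..<1} x * dx \<phi> (x, y)) = (\<lambda>y. 0)"
  proof
    fix y
    show "(LINT x|lborel. indicator {0..<1} x * dx \<phi> (x, y)) = 0"
    proof (rule integral_period_0[of "\<lambda>x. \<phi> (x, y)"])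
      show "continuous_on UNIV (\<lambda>x. dx \<phi> (x, y))"
        by (intro continuous_on_compose2[OF cx] continuous_intros) auto
      show "\<phi> (1, y) = \<phi> (0, y)" using per by (metis add_0 periodic_def)
    qed (rule dx_vector_derivative[OF d])
  qed
  finally show "(LINT p|torus. dx \<phi> p) = 0" by simp
  have "(LINT p|torus. dy \<phi> p) = (LINT x|lborel. LINT y|lborel. indicator ({0..<1} \<times> {0..<1}) (x, y) * dy \<phi> (x, y))"
    unfolding red
    using lborel_pair.integral_fst'[OF int[OF cy periodic_deriv(2)[OF per d]]] by (rule sym)
  also have "\<dots> = (LINT x|lborel. indicator {0..<1} x * (LINT y|lborel. indicator {0..<1} y * dy \<phi> (x, y)))"
    by (subst Bochner_Integration.integral_mult_right_zero[symmetric])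
      (simp add: indicator_times mult_ac)
  also have "(\<lambda>x. LINT y|lborel. indicator {0..<1} y * dy \<phi> (x, y)) = (\<lambda>x. 0)"
  proof
    fix x
    show "(LINT y|lborel. indicator {0..<1} y * dy \<phi> (x, y)) = 0"
    proof (rule integral_period_0[of "\<lambda>y. \<phi> (x, y)"])
      show "continuous_on UNIV (\<lambda>y. dy \<phi> (x, y))"
        by (intro continuous_on_compose2[OF cy] continuous_intros) auto
      show "\<phi> (x, 1) = \<phi> (x, 0)" using per by (metis add_0 periodic_def)
    qed (rule dx_vector_derivative[OF d])
  qed
  finally show "(LINT p|torus. dy \<phi> p) = 0" by simp
qed

section \<open>Real trigonometric functions with complex amplitudes\<close>

definition phase :: "freq \<Rightarrow> real \<times> real \<Rightarrow> real" where
  "phase k p = 2 * pi * (real_of_int (fst k) * fst p + real_of_int (snd k) * snd p)"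

text \<open>The function space is real, so exponentials enter through their real parts. The
  amplitude \<open>a = 1\<close> gives the cosine and \<open>a = \<i>\<close> minus the sine; a
  derivative just multiplies the amplitude by its symbol.\<close>

definition trig :: "complex \<Rightarrow> freq \<Rightarrow> real \<times> real \<Rightarrow> real" where
  "trig a k p = Re (a * cis (phase k p))"

lemma trig_eq: "trig a k p = Re a * cos (phase k p) - Im a * sin (phase k p)"
  by (simp add: trig_def)

lemma trig_0 [simp]: "trig a 0 p = Re a"
  by (simp add: trig_eq phase_def)

lemma abs_trig_le: "\<bar>trig a k p\<bar> \<le> cmod a"
  unfolding trig_def using abs_Re_le_cmod[of "a * cis (phase k p)"] by (simp add: norm_mult)

lemma phase_add: "phase (k + l) p = phase k p + phase l p"
  by (simp add: phase_def algebra_simps)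

lemma phase_minus: "phase (- k) p = - phase k p"
  by (simp add: phase_def algebra_simps)

lemma phase_diff: "phase (k - l) p = phase k p - phase l p"
  by (simp add: phase_def algebra_simps)

lemma trig_mult: "trig a k p * trig b l p = (trig (a * b) (k + l) p + trig (a * cnj b) (k - l) p) / 2"
  by (simp add: trig_eq phase_add phase_diff cos_add sin_add cos_diff sin_diff) (simp add: algebra_simps)

lemma periodic_trig: "periodic (trig a k)"
proof -
  have "phase k (x + 1, y) = phase k (x, y) + of_int (fst k) * (2 * pi)"
    "phase k (x, y + 1) = phase k (x, y) + of_int (snd k) * (2 * pi)" for x y
    by (simp_all add: phase_def algebra_simps)
  moreover have "cos (t + of_int n * (2 * pi)) = cos t" "sin (t + of_int n * (2 * pi)) = sin t" for t :: real and n
    using cos.plus_of_int[of t n] sin.plus_of_int[of t n] by simp_all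
  ultimately show ?thesis
    by (simp add: periodic_def trig_eq)
qed

definition D1 :: "freq \<Rightarrow> complex" where "D1 k = \<i> * of_real (2 * pi * real_of_int (fst k))"
definition D2 :: "freq \<Rightarrow> complex" where "D2 k = \<i> * of_real (2 * pi * real_of_int (snd k))"

lemma trig_has_derivative: "(trig a k has_derivative (\<lambda>h. trig (D1 k * a) k p * fst h + trig (D2 k * a) k p * snd h)) (at p)"
  unfolding trig_eq[abs_def] phase_def D1_def D2_def
  by (auto intro!: derivative_eq_intros simp: algebra_simps)

lemma trig_differentiable: "trig a k differentiable (at p)"
  using trig_has_derivative differentiableI by blast

lemma dx_trig: "dx (trig a k) = trig (D1 k * a) k" and dy_trig: "dy (trig a k) = trig (D2 k * a) k"
  using frechet_derivative_at[OF trig_has_derivative, symmetric] by (simp_all add: dx_def dy_def)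

lemma of_class_C_trig: "of_class_C n (trig a k)"
proof (induction n arbitrary: a)
  case 0
  then show ?case by (auto intro!: differentiable_imp_continuous_on simp: differentiable_on_def trig_differentiable)
qed (auto simp: dx_trig dy_trig trig_differentiable)

lemma test_function_trig: "test_function (trig a k)"
  by (simp add: test_function_def periodic_trig of_class_C_trig)

lemma square_integrable_trig: "square_integrable (trig a k)"
  by (rule test_function_square_integrable[OF test_function_trig])

lemma trig_measurable: "trig a k \<in> borel_measurable borel"
  by (rule continuous_measurable[OF of_class_C_continuous[OF of_class_C_trig]])

text \<open>For a nonzero frequency the function is a derivative of another \<open>trig\<close>,
  obtained by dividing the amplitude by a nonzero symbol.\<close>

lemma integral_trig: "(LINT p|torus. trig a k p) = (if k = 0 then Re a else 0)"
proof (cases "k = 0")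
  case True
  then show ?thesis by (simp add: measure_torus)
next
  case False
  then consider "fst k \<noteq> 0" | "snd k \<noteq> 0" by (auto simp: prod_eq_iff)
  then show ?thesis
  proof cases
    case 1
    then have "trig a k = dx (trig (a / D1 k) k)" by (simp add: dx_trig D1_def)
    then show ?thesis using False integral_torus_deriv_0(1)[OF periodic_trig of_class_C_trig] by simp
  next
    case 2
    then have "trig a k = dy (trig (a / D2 k) k)" by (simp add: dy_trig D2_def)
    then show ?thesis using False integral_torus_deriv_0(2)[OF periodic_trig of_class_C_trig] by simp
  qed
qed

text \<open>Two conditionals appear because the real functions of frequencies \<open>k\<close> and
  \<open>- k\<close> span the same space; at frequency 0 both apply.\<close>

lemma integral_trig_mult:
  "(LINT p|torus. trig a k p * trig b l p)
    = ((if k = - l then Re (a * b) else 0) + (if k = l then Re (a * cnj b) else 0)) / 2"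
proof -
  have "(LINT p|torus. trig a k p * trig b l p)
      = ((LINT p|torus. trig (a * b) (k + l) p) + (LINT p|torus. trig (a * cnj b) (k - l) p)) / 2"
    unfolding trig_mult using square_integrable_integrable[OF square_integrable_trig] by simp
  moreover have "k + l = 0 \<longleftrightarrow> k = - l" "k - l = 0 \<longleftrightarrow> k = l" by (auto simp: eq_neg_iff_add_eq_0)
  ultimately show ?thesis by (simp add: integral_trig)
qed

lemma square_integrable_rep: "square_integrable (rep_l2_torus u)"
  using Quotient3_rep_reflp[OF Quotient3_l2_torus, of u] by (simp add: l2_rel_refl)

lemma abs_rep [simp]: "abs_l2_torus (rep_l2_torus u) = u"
  by (rule Quotient3_abs_rep[OF Quotient3_l2_torus])

lemma inner_abs:
  "square_integrable f \<Longrightarrow> square_integrable g \<Longrightarrow> inner (abs_l2_torus f) (abs_l2_torus g) = (LINT p|torus. f p * g p)"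
  by (rule inner_l2_torus.abs_eq) (simp_all add: l2_rel_refl)

lemma inner_rep: "inner u v = (LINT p|torus. rep_l2_torus u p * rep_l2_torus v p)"
  using inner_abs[OF square_integrable_rep square_integrable_rep, of u v] by simp

lemma plus_abs:
  "square_integrable f \<Longrightarrow> square_integrable g \<Longrightarrow> abs_l2_torus f + abs_l2_torus g = abs_l2_torus (\<lambda>p. f p + g p)"
  by (rule plus_l2_torus.abs_eq) (simp_all add: l2_rel_refl)

lemma scaleR_abs: "square_integrable f \<Longrightarrow> c *\<^sub>R abs_l2_torus f = abs_l2_torus (\<lambda>p. c * f p)"
  by (rule scaleR_l2_torus.abs_eq) (simp_all add: l2_rel_refl)

lemma diff_abs:
  assumes "square_integrable f" "square_integrable g"
  shows "abs_l2_torus f - abs_l2_torus g = abs_l2_torus (\<lambda>p. f p - g p)"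
  using plus_abs[OF assms(1) square_integrable_scale[OF assms(2), of "- 1"]] scaleR_abs[OF assms(2), of "- 1"]
  by (simp add: diff_conv_add_uminus del: add_uminus_conv_diff)

lemma norm_abs_power2: "square_integrable f \<Longrightarrow> (norm (abs_l2_torus f))\<^sup>2 = (LINT p|torus. (f p)\<^sup>2)"
  by (simp only: power2_norm_eq_inner inner_abs) (simp add: power2_eq_square)

lemma square_integrable_diff: "square_integrable f \<Longrightarrow> square_integrable g \<Longrightarrow> square_integrable (\<lambda>p. f p - g p)"
  using square_integrable_add[of f "\<lambda>p. - 1 * g p"] square_integrable_scale[of g "- 1"] by simp

section \<open>Completeness of the trigonometric system\<close>

text \<open>The admissible multipliers \<open>g\<close> for a fixed \<open>u\<close>. Multiplying
  \<open>g\<close> by polynomials, continuous functions and finally superlevel indicators of a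
  \<open>trig\<close> preserves the property, which leads from the constant 1 to indicators of
  boxes.\<close>

definition orth :: "(real \<times> real \<Rightarrow> real) \<Rightarrow> (real \<times> real \<Rightarrow> real) \<Rightarrow> bool" where
  "orth u g \<longleftrightarrow> g \<in> borel_measurable borel \<and> (\<exists>B. \<forall>p. \<bar>g p\<bar> \<le> B) \<and>
     (\<forall>a k. (LINT p|torus. u p * g p * trig a k p) = 0)"

context
  fixes u :: "real \<times> real \<Rightarrow> real"
  assumes u: "integrable torus u"
begin

lemma orth_integrable:
  assumes "orth u g" shows "integrable torus (\<lambda>p. u p * g p * trig a k p)"
  using assms integrable_torus_mult_bounded[OF u] integrable_torus_mult_bounded[OF _ trig_measurable abs_trig_le]
  unfolding orth_def by blast

lemma orth_trig_mult:
  assumes "orth u g" shows "orth u (\<lambda>p. g p * trig b m p)"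
proof -
  obtain B where B: "\<And>p. \<bar>g p\<bar> \<le> B" using assms by (auto simp: orth_def)
  have "\<bar>g p * trig b m p\<bar> \<le> B * cmod b" for p
    unfolding abs_mult using B[of p] abs_trig_le[of b m p] abs_ge_zero[of "g p"]
    by (intro mult_mono) linarith+
  moreover have "(LINT p|torus. u p * (g p * trig b m p) * trig a k p) = 0" for a k
  proof -
    have "(LINT p|torus. u p * (g p * trig b m p) * trig a k p)
      = (LINT p|torus. (u p * g p * trig (b * a) (m + k) p + u p * g p * trig (b * cnj a) (m - k) p) / 2)"
    proof (rule Bochner_Integration.integral_cong[OF refl])
      fix p
      have "u p * (g p * trig b m p) * trig a k p = u p * g p * (trig b m p * trig a k p)" by simp
      also have "\<dots> = (u p * g p * trig (b * a) (m + k) p + u p * g p * trig (b * cnj a) (m - k) p) / 2"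
        unfolding trig_mult by (simp add: algebra_simps)
      finally show "u p * (g p * trig b m p) * trig a k p
        = (u p * g p * trig (b * a) (m + k) p + u p * g p * trig (b * cnj a) (m - k) p) / 2" .
    qed
    also have "\<dots> = ((LINT p|torus. u p * g p * trig (b * a) (m + k) p) + (LINT p|torus. u p * g p * trig (b * cnj a) (m - k) p)) / 2"
      using orth_integrable[OF assms] by simp
    also have "\<dots> = 0" using assms by (simp add: orth_def)
    finally show ?thesis .
  qed
  ultimately show ?thesis using assms trig_measurable unfolding orth_def
    by (intro conjI allI borel_measurable_times) blast+
qed

lemma orth_scale:
  assumes "orth u g" shows "orth u (\<lambda>p. g p * c)"
proof -
  have "trig (of_real c) 0 = (\<lambda>p. c)" by (rule ext) simp
  then show ?thesis using orth_trig_mult[OF assms, of "of_real c" 0] by simp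
qed

lemma orth_add:
  assumes "orth u g" "orth u g'" shows "orth u (\<lambda>p. g p + g' p)"
proof -
  obtain B B' where B: "\<And>p. \<bar>g p\<bar> \<le> B" "\<And>p. \<bar>g' p\<bar> \<le> B'" using assms unfolding orth_def by blast
  have "\<bar>g p + g' p\<bar> \<le> B + B'" for p using B[of p] by linarith
  moreover have "(LINT p|torus. u p * (g p + g' p) * trig a k p) = 0" for a k
    using orth_integrable[OF assms(1)] orth_integrable[OF assms(2)] assms
    by (simp add: distrib_left distrib_right orth_def)
  ultimately show ?thesis using assms unfolding orth_def
    by (intro conjI allI borel_measurable_add) blast+
qed

lemma orth_polynomial:
  fixes q :: "real \<Rightarrow> real"
  assumes "real_polynomial_function q" "orth u g"
  shows "orth u (\<lambda>p. g p * q (trig b m p))"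
  using assms
proof (induction arbitrary: g rule: real_polynomial_function.induct)
  case (linear f)
  then interpret bounded_linear f by simp
  have "f t = t * f 1" for t using scaleR[of t 1] by simp
  then have "(\<lambda>p. g p * f (trig b m p)) = (\<lambda>p. (g p * trig b m p) * f 1)"
    by (metis mult.assoc)
  then show ?case using orth_scale[OF orth_trig_mult[OF linear.prems]] by simp
next
  case (const c)
  then show ?case by (rule orth_scale)
next
  case (add f1 f2)
  then show ?case using orth_add by (simp add: distrib_left)
next
  case (mult f1 f2)
  then show ?case by (simp add: mult.assoc[symmetric])
qed

text \<open>The values of \<open>trig b m\<close> lie in a compact interval, on which \<phi> is a
  uniform limit of polynomials; the integral of the absolute value of \<open>u\<close> and the bound
  of \<open>g\<close> control the error.\<close>

lemma orth_continuous:
  fixes \<phi> :: "real \<Rightarrow> real"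
  assumes \<phi>: "continuous_on UNIV \<phi>" and g: "orth u g"
  shows "orth u (\<lambda>p. g p * \<phi> (trig b m p))"
proof -
  obtain G where G: "\<And>p. \<bar>g p\<bar> \<le> G" using g by (auto simp: orth_def)
  have G0: "0 \<le> G" using G[of 0] by linarith
  define S where "S = {- cmod b..cmod b}"
  have S: "trig b m p \<in> S" for p using abs_trig_le[of b m p] by (auto simp: S_def abs_le_iff)
  have "compact (\<phi> ` S)" unfolding S_def
    using \<phi> by (intro compact_continuous_image) (auto intro: continuous_on_subset)
  from compact_imp_bounded[OF this] obtain B where B: "\<And>t. t \<in> S \<Longrightarrow> \<bar>\<phi> t\<bar> \<le> B"
    unfolding bounded_iff by auto
  have meas: "(\<lambda>p. g p * \<phi> (trig b m p)) \<in> borel_measurable borel"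
    using g unfolding orth_def
    by (intro borel_measurable_times measurable_compose[OF trig_measurable borel_measurable_continuous_onI[OF \<phi>]]) blast
  have bd: "\<bar>g p * \<phi> (trig b m p)\<bar> \<le> G * B" for p
    unfolding abs_mult using G B[OF S] G0 by (intro mult_mono) auto
  have "(LINT p|torus. u p * (g p * \<phi> (trig b m p)) * trig a k p) = 0" for a k
  proof -
    let ?I = "(LINT p|torus. u p * (g p * \<phi> (trig b m p)) * trig a k p)"
    define C where "C = (LINT p|torus. \<bar>u p\<bar>) * G * cmod a"
    have C: "0 \<le> C" unfolding C_def using G0 by simp
    have i1: "integrable torus (\<lambda>p. u p * (g p * \<phi> (trig b m p)) * trig a k p)"
      by (intro integrable_torus_mult_bounded[OF _ trig_measurable abs_trig_le] integrable_torus_mult_bounded[OF u meas bd])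
    have "\<bar>?I\<bar> \<le> C * e" if "0 < e" for e
    proof -
      obtain q where q: "real_polynomial_function q" "\<And>t. t \<in> S \<Longrightarrow> \<bar>\<phi> t - q t\<bar> < e"
        using Stone_Weierstrass_real_polynomial_function[OF _ continuous_on_subset[OF \<phi> subset_UNIV] \<open>0 < e\<close>, of S]
        by (auto simp: S_def)
      note oq = orth_polynomial[OF q(1) g, of b m]
      have "?I = ?I - (LINT p|torus. u p * (g p * q (trig b m p)) * trig a k p)"
        using oq by (simp add: orth_def)
      also have "\<dots> = (LINT p|torus. u p * (g p * \<phi> (trig b m p)) * trig a k p - u p * (g p * q (trig b m p)) * trig a k p)"
        using i1 orth_integrable[OF oq] by simp
      also have "\<bar>\<dots>\<bar> \<le> (LINT p|torus. \<bar>u p\<bar> * (G * e * cmod a))"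
      proof (rule integral_abs_bound_integral)
        show "integrable torus (\<lambda>p. u p * (g p * \<phi> (trig b m p)) * trig a k p - u p * (g p * q (trig b m p)) * trig a k p)"
          using i1 orth_integrable[OF oq] by simp
        show "integrable torus (\<lambda>p. \<bar>u p\<bar> * (G * e * cmod a))" using u by simp
        fix p
        have "\<bar>u p * (g p * \<phi> (trig b m p)) * trig a k p - u p * (g p * q (trig b m p)) * trig a k p\<bar>
            = \<bar>u p\<bar> * (\<bar>g p\<bar> * \<bar>\<phi> (trig b m p) - q (trig b m p)\<bar> * \<bar>trig a k p\<bar>)"
          by (simp add: abs_mult[symmetric] algebra_simps)
        also have "\<dots> \<le> \<bar>u p\<bar> * (G * e * cmod a)"
          using G[of p] q(2)[OF S, of p] abs_trig_le[of a k p] G0 \<open>0 < e\<close>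
          by (intro mult_left_mono mult_mono) auto
        finally show "\<bar>u p * (g p * \<phi> (trig b m p)) * trig a k p - u p * (g p * q (trig b m p)) * trig a k p\<bar>
          \<le> \<bar>u p\<bar> * (G * e * cmod a)" .
      qed
      also have "\<dots> = C * e" by (simp add: C_def mult_ac)
      finally show ?thesis .
    qed
    moreover have "C * (e / (C + 1)) \<le> 0 + e" "0 < e / (C + 1)" if "0 < e" for e
      using C that by (simp_all add: field_simps)
    ultimately have "\<bar>?I\<bar> \<le> 0" by (meson field_le_epsilon order_trans)
    then show ?thesis by simp
  qed
  then show ?thesis using meas bd unfolding orth_def by blast
qed

text \<open>The indicator is a pointwise limit of continuous ramps with values between 0 and 1, so
  dominated convergence applies.\<close>

lemma orth_superlevel:
  assumes g: "orth u g"
  shows "orth u (\<lambda>p. g p * indicator {d<..} (trig b m p))"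
proof -
  obtain G where G: "\<And>p. \<bar>g p\<bar> \<le> G" using g by (auto simp: orth_def)
  have G0: "0 \<le> G" using G[of 0] by linarith
  define \<phi> where "\<phi> n t = min 1 (max 0 (real n * (t - d)))" for n t
  have \<phi>c: "continuous_on UNIV (\<phi> n)" for n unfolding \<phi>_def by (intro continuous_intros)
  have \<phi>b: "\<bar>\<phi> n t\<bar> \<le> 1" for n t unfolding \<phi>_def by auto
  have \<phi>l: "(\<lambda>n. \<phi> n t) \<longlonglongrightarrow> indicator {d<..} t" for t
  proof (cases "d < t")
    case True
    obtain N :: nat where N: "1 / (t - d) < real N" using reals_Archimedean2 by blast
    have "\<phi> n t = indicator {d<..} t" if "N \<le> n" for n
    proof -
      have "1 / (t - d) \<le> real n" using N that by linarith
      then have "1 \<le> real n * (t - d)" using True by (simp add: field_simps)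
      then show ?thesis using True by (simp add: \<phi>_def)
    qed
    then show ?thesis by (intro tendsto_eventually) (auto simp: eventually_sequentially)
  next
    case False
    then have "real n * (t - d) \<le> 0" for n by (intro mult_nonneg_nonpos) auto
    then have "\<phi> n t = 0" for n by (simp add: \<phi>_def)
    then show ?thesis using False by simp
  qed
  have [measurable]: "g \<in> borel_measurable borel" "trig b m \<in> borel_measurable borel"
    using g trig_measurable by (auto simp: orth_def)
  have meas: "(\<lambda>p. g p * indicator {d<..} (trig b m p)) \<in> borel_measurable borel"
    by measurable
  have "(LINT p|torus. u p * (g p * indicator {d<..} (trig b m p)) * trig a k p) = 0" for a k
  proof -
    have "(\<lambda>n. LINT p|torus. u p * (g p * \<phi> n (trig b m p)) * trig a k p)
        \<longlonglongrightarrow> (LINT p|torus. u p * (g p * indicator {d<..} (trig b m p)) * trig a k p)"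
    proof (rule integral_dominated_convergence[where w = "\<lambda>p. \<bar>u p\<bar> * (G * cmod a)"])
      have um: "u \<in> borel_measurable torus" using u by auto
      have tm: "trig a k \<in> borel_measurable torus" by (intro measurable_torus trig_measurable)
      show "(\<lambda>p. u p * (g p * indicator {d<..} (trig b m p)) * trig a k p) \<in> borel_measurable torus"
        by (intro borel_measurable_times um tm measurable_torus meas)
      show "(\<lambda>p. u p * (g p * \<phi> n (trig b m p)) * trig a k p) \<in> borel_measurable torus" for n
      proof -
        have "(\<lambda>p. g p * \<phi> n (trig b m p)) \<in> borel_measurable borel"
          using orth_continuous[OF \<phi>c g, of n b m] by (simp add: orth_def)
        from borel_measurable_times[OF borel_measurable_times[OF um measurable_torus[OF this]] tm] show ?thesis .
      qed
      show "integrable torus (\<lambda>p. \<bar>u p\<bar> * (G * cmod a))" using u by simp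
      show "AE p in torus. (\<lambda>n. u p * (g p * \<phi> n (trig b m p)) * trig a k p)
          \<longlonglongrightarrow> u p * (g p * indicator {d<..} (trig b m p)) * trig a k p"
        by (intro AE_I2 tendsto_intros \<phi>l)
      fix n
      have "\<bar>u p * (g p * \<phi> n (trig b m p)) * trig a k p\<bar> \<le> \<bar>u p\<bar> * (G * cmod a)" for p
      proof -
        have "\<bar>g p\<bar> * \<bar>\<phi> n (trig b m p)\<bar> * \<bar>trig a k p\<bar> \<le> G * 1 * cmod a"
          using G[of p] \<phi>b abs_trig_le[of a k p] G0 by (intro mult_mono) auto
        then have "\<bar>u p\<bar> * (\<bar>g p\<bar> * \<bar>\<phi> n (trig b m p)\<bar> * \<bar>trig a k p\<bar>) \<le> \<bar>u p\<bar> * (G * cmod a)"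
          by (intro mult_left_mono) auto
        then show ?thesis by (simp add: abs_mult mult_ac)
      qed
      then show "AE p in torus. norm (u p * (g p * \<phi> n (trig b m p)) * trig a k p) \<le> \<bar>u p\<bar> * (G * cmod a)"
        by auto
    qed
    moreover have "(LINT p|torus. u p * (g p * \<phi> n (trig b m p)) * trig a k p) = 0" for n
      using orth_continuous[OF \<phi>c g, of n b m] by (simp add: orth_def)
    ultimately show ?thesis by (simp add: LIMSEQ_const_iff)
  qed
  moreover have "\<bar>g p * indicator {d<..} (trig b m p)\<bar> \<le> G" for p
    using G[of p] G0 by (auto simp: indicator_def)
  ultimately show ?thesis using meas unfolding orth_def by blast
qed

end

text \<open>Exhibits intervals as superlevel sets of trigonometric polynomials, to which \<open>orth_superlevel\<close> applies.\<close>

lemma arc_eq: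
  assumes ab: "0 \<le> a" "a < b" "b \<le> 1" and x: "0 \<le> x" "x < 1"
  shows "cos (pi * (b - a)) < cos (2 * pi * (x - (a + b) / 2)) \<longleftrightarrow> a < x \<and> x < b"
proof -
  define t where "t = \<bar>x - (a + b) / 2\<bar>"
  define s where "s = (b - a) / 2"
  have "\<bar>2 * pi * (x - (a + b) / 2)\<bar> = 2 * pi * t" by (simp add: t_def abs_mult)
  then have c: "cos (2 * pi * (x - (a + b) / 2)) = cos (2 * pi * t)"
    by (metis cos_abs_real)
  have d: "cos (pi * (b - a)) = cos (2 * pi * s)" by (simp add: s_def)
  have ts: "0 \<le> t" "t \<le> 1 - s" "0 < s" "s \<le> 1 / 2"
    using ab x by (auto simp: t_def s_def abs_le_iff field_simps)
  have iff: "a < x \<and> x < b \<longleftrightarrow> t < s" by (auto simp: t_def s_def abs_less_iff field_simps)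
  show ?thesis unfolding c d iff
  proof
    assume "t < s"
    then show "cos (2 * pi * s) < cos (2 * pi * t)"
      using ts by (intro cos_monotone_0_pi) auto
  next
    assume a: "cos (2 * pi * s) < cos (2 * pi * t)"
    show "t < s"
    proof (rule ccontr)
      assume "\<not> t < s"
      then have st: "s \<le> t" by simp
      have "cos (2 * pi * t) \<le> cos (2 * pi * s)"
      proof (cases "t \<le> 1 / 2")
        case True
        then show ?thesis using st ts by (intro cos_monotone_0_pi_le) auto
      next
        case False
        have "cos (2 * pi * t) = cos (2 * pi * (1 - t))"
          using cos_2pi_minus[of "2 * pi * t"] by (simp add: algebra_simps)
        also have "\<dots> \<le> cos (2 * pi * s)" using st ts False by (intro cos_monotone_0_pi_le) auto
        finally show ?thesis .
      qed
      then show False using a by simp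
    qed
  qed
qed

text \<open>The edges at 0 belong to the fundamental square but are lost when an open box reaching
  beyond it is clipped to open intervals starting at 0.\<close>

lemma AE_torus_nonzero: "AE p in torus. fst p \<noteq> 0 \<and> snd p \<noteq> 0"
proof -
  have "emeasure (lborel \<Otimes>\<^sub>M lborel) ({0 :: real} \<times> (UNIV :: real set)) = 0"
    "emeasure (lborel \<Otimes>\<^sub>M lborel) ((UNIV :: real set) \<times> {0 :: real}) = 0"
    by (subst lborel.emeasure_pair_measure_Times; simp)+
  then have "{0 :: real} \<times> (UNIV :: real set) \<in> null_sets lborel" "(UNIV :: real set) \<times> {0 :: real} \<in> null_sets lborel"
    by (auto simp: null_sets_def lborel_prod borel_prod[symmetric] intro!: pair_measureI)
  from null_sets.Un[OF this] have "AE p in lborel. p \<notin> {0 :: real} \<times> (UNIV :: real set) \<union> (UNIV :: real set) \<times> {0 :: real}"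
    by (rule AE_not_in)
  then have "AE p in (lborel :: (real \<times> real) measure). fst p \<noteq> 0 \<and> snd p \<noteq> 0"
    by eventually_elim auto
  then show ?thesis unfolding torus_def by (subst AE_restrict_space_iff) (auto elim: eventually_mono)
qed

text \<open>It is enough that \<open>u\<close> integrates to 0 over every measurable set. The sets
  with this property are closed under complements and disjoint unions, and boxes, an
  intersection-stable generator, have it by \<open>orth_superlevel\<close>.\<close>

lemma orthogonal_trig_imp_0:
  assumes u: "integrable torus u" and 0: "\<And>a k. (LINT p|torus. u p * trig a k p) = 0"
  shows "AE p in torus. u p = 0"
proof (rule torus.density_zero[OF u])
  let ?\<Omega> = "{0..<1::real} \<times> {0..<1::real}"
  have o1: "orth u (\<lambda>p. 1)" using 0 by (auto simp: orth_def)
  have whole: "(LINT p|torus. u p) = 0" using 0[of 1 0] by simp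
  define P where "P A \<longleftrightarrow> (LINT p:(A \<inter> ?\<Omega>)|torus. u p) = 0" for A
  have sets: "A \<inter> ?\<Omega> \<in> sets torus" if "A \<in> sets borel" for A
    using that unfolding torus_def by (auto simp: sets_restrict_space)
  have set_int: "set_integrable torus A u" if "A \<in> sets torus" for A
    using u that unfolding set_integrable_def by (intro integrable_mult_indicator) auto
  have box: "P (box (a1, a2) (b1, b2))" for a1 a2 b1 b2
  proof -
    define a1' b1' a2' b2' where "a1' = max a1 0" "b1' = min b1 1" "a2' = max a2 0" "b2' = min b2 1"
    note defs = this
    have mem: "(x, y) \<in> box (a1, a2) (b1, b2) \<longleftrightarrow> a1 < x \<and> x < b1 \<and> a2 < y \<and> y < b2" for x y
      by (auto simp: box_def Basis_prod_def)
    show ?thesis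
    proof (cases "a1' < b1' \<and> a2' < b2'")
      case False
      then have "box (a1, a2) (b1, b2) \<inter> ?\<Omega> = {}" using mem by (auto simp: defs)
      then show ?thesis by (simp add: P_def set_lebesgue_integral_def)
    next
      case True
      \<comment> \<open>The amplitude shifts the cosine so that its maximum sits at the midpoint of
        the interval; the level is its value at the endpoints.\<close>
      define A where "A = (\<lambda>p. indicator {cos (pi * (b1' - a1'))<..} (trig (cis (- (pi * (a1' + b1')))) (1, 0) p) :: real)"
      define B where "B = (\<lambda>p. indicator {cos (pi * (b2' - a2'))<..} (trig (cis (- (pi * (a2' + b2')))) (0, 1) p) :: real)"
      have "orth u (\<lambda>p. 1 * A p * B p)"
        unfolding A_def B_def by (intro orth_superlevel u o1)
      then have "(LINT p|torus. u p * (1 * A p * B p) * trig 1 0 p) = 0"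
        unfolding orth_def by blast
      moreover have "AE p in torus. indicator (box (a1, a2) (b1, b2) \<inter> ?\<Omega>) p *\<^sub>R u p = u p * (1 * A p * B p) * trig 1 0 p"
        using AE_torus_nonzero AE_space
      proof eventually_elim
        case (elim p)
        obtain x y where p: "p = (x, y)" by (cases p)
        have xy: "0 < x" "x < 1" "0 < y" "y < 1" using elim by (auto simp: p space_torus)
        have "trig (cis (- (pi * (a1' + b1')))) (1, 0) p = cos (2 * pi * (x - (a1' + b1') / 2))"
          "trig (cis (- (pi * (a2' + b2')))) (0, 1) p = cos (2 * pi * (y - (a2' + b2') / 2))"
        proof -
          have "- (pi * (a1' + b1')) + phase (1, 0) p = 2 * pi * (x - (a1' + b1') / 2)"
            "- (pi * (a2' + b2')) + phase (0, 1) p = 2 * pi * (y - (a2' + b2') / 2)"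
            by (simp_all add: p phase_def field_simps)
          then show "trig (cis (- (pi * (a1' + b1')))) (1, 0) p = cos (2 * pi * (x - (a1' + b1') / 2))"
            "trig (cis (- (pi * (a2' + b2')))) (0, 1) p = cos (2 * pi * (y - (a2' + b2') / 2))"
            unfolding trig_def cis_mult by simp_all
        qed
        then have "A p = (if a1' < x \<and> x < b1' then 1 else 0)" "B p = (if a2' < y \<and> y < b2' then 1 else 0)"
          using arc_eq[of a1' b1' x] arc_eq[of a2' b2' y] xy True by (auto simp: A_def B_def defs)
        then show ?case using xy by (auto simp: indicator_def p mem defs)
      qed
      then have "(LINT p|torus. indicator (box (a1, a2) (b1, b2) \<inter> ?\<Omega>) p *\<^sub>R u p)
          = (LINT p|torus. u p * (1 * A p * B p) * trig 1 0 p)"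
        using orth_integrable[OF u \<open>orth u (\<lambda>p. 1 * A p * B p)\<close>, where a = 1 and k = 0]
        by (intro integral_cong_AE borel_measurable_integrable set_int[unfolded set_integrable_def] sets) auto
      ultimately show ?thesis unfolding P_def set_lebesgue_integral_def by simp
    qed
  qed
  have P: "P A" if "A \<in> sets borel" for A
  proof -
    let ?G = "range (\<lambda>(a, b). box a b :: (real \<times> real) set)"
    have sb: "sets borel = sigma_sets UNIV ?G" by (subst borel_eq_box) (simp add: sets_measure_of)
    have "Int_stable ?G"
    proof (rule Int_stableI)
      fix X Y assume "X \<in> ?G" "Y \<in> ?G"
      then obtain a1 a2 b1 b2 c1 c2 d1 d2 where XY: "X = box (a1, a2) (b1, b2)" "Y = box (c1, c2) (d1, d2)"
        by (auto simp: image_iff)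
      have "X \<inter> Y = box (max a1 c1, max a2 c2) (min b1 d1, min b2 d2)"
        unfolding XY by (auto simp: box_def Basis_prod_def)
      then show "X \<inter> Y \<in> ?G" by auto
    qed
    moreover have "?G \<subseteq> Pow UNIV" by simp
    moreover have "A \<in> sigma_sets UNIV ?G" using that sb by simp
    ultimately show ?thesis
    proof (induction rule: sigma_sets_induct_disjoint)
      case (basic A)
      then obtain a b where "A = box a b" by auto
      then show ?case using box[of "fst a" "snd a" "fst b" "snd b"] by simp
    next
      case empty
      then show ?case by (simp add: P_def set_lebesgue_integral_def)
    next
      case (compl A)
      have s: "A \<in> sets borel" using compl sb by simp
      have "(LINT p:((UNIV - A) \<inter> ?\<Omega>)|torus. u p) = (LINT p|torus. u p - indicator (A \<inter> ?\<Omega>) p *\<^sub>R u p)"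
        unfolding set_lebesgue_integral_def
        by (intro Bochner_Integration.integral_cong) (auto simp: space_torus indicator_def)
      also have "\<dots> = (LINT p|torus. u p) - (LINT p:(A \<inter> ?\<Omega>)|torus. u p)"
        unfolding set_lebesgue_integral_def using u set_int[OF sets[OF s]]
        by (intro Bochner_Integration.integral_diff) (auto simp: set_integrable_def)
      finally show ?case using compl whole by (simp add: P_def)
    next
      case (union A)
      have s: "A i \<in> sets borel" for i using union sb by auto
      have "(LINT p:(\<Union>i. A i \<inter> ?\<Omega>)|torus. u p) = (\<Sum>i. (LINT p:(A i \<inter> ?\<Omega>)|torus. u p))"
      proof (rule lebesgue_integral_countable_add)
        show "A i \<inter> ?\<Omega> \<in> sets torus" for i by (rule sets[OF s])
        then show "set_integrable torus (\<Union>i. A i \<inter> ?\<Omega>) u" by (intro set_int sets.countable_UN) auto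
        show "A i \<inter> ?\<Omega> \<inter> (A j \<inter> ?\<Omega>) = {}" if "i \<noteq> j" for i j
          using union(1) that unfolding disjoint_family_on_def by blast
      qed
      then show ?case using union by (simp add: P_def)
    qed
  qed
  show "set_lebesgue_integral torus A u = 0" if "A \<in> sets torus" for A
  proof -
    have "sets torus = (\<inter>) ?\<Omega> ` sets borel" by (simp add: torus_def sets_restrict_space)
    with that have "A \<in> (\<inter>) ?\<Omega> ` sets borel" by simp
    then obtain A' where "A = ?\<Omega> \<inter> A'" "A' \<in> sets borel" by (rule imageE)
    then have "A' \<in> sets borel" "A = A' \<inter> ?\<Omega>" by (simp_all only: Int_commute)
    then show ?thesis using P by (simp add: P_def)
  qed
qed

section \<open>Completeness of the space of square-integrable classes\<close>

lemma integral_abs_le_norm: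
  assumes f: "square_integrable f" shows "(LINT p|torus. \<bar>f p\<bar>) \<le> norm (abs_l2_torus f)"
proof -
  have f': "square_integrable (\<lambda>p. \<bar>f p\<bar>)" using f by (auto simp: square_integrable_def periodic_def)
  have 1: "square_integrable (\<lambda>p. 1)" by (auto simp: square_integrable_def periodic_def)
  have "norm (abs_l2_torus (\<lambda>p. \<bar>f p\<bar>)) = norm (abs_l2_torus f)" "norm (abs_l2_torus (\<lambda>p. 1)) = 1"
    by (rule power2_eq_imp_eq; simp add: norm_abs_power2 f f' 1 measure_torus)+
  moreover have "inner (abs_l2_torus (\<lambda>p. \<bar>f p\<bar>)) (abs_l2_torus (\<lambda>p. 1)) = (LINT p|torus. \<bar>f p\<bar>)"
    by (simp add: inner_abs f' 1)
  ultimately show ?thesis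
    using norm_cauchy_schwarz[of "abs_l2_torus (\<lambda>p. \<bar>f p\<bar>)" "abs_l2_torus (\<lambda>p. 1)"] by simp
qed

text \<open>Riesz-Fischer: a rapidly Cauchy subsequence converges almost everywhere.\<close>

lemma l2_torus_Cauchy_convergent:
  fixes X :: "nat \<Rightarrow> l2_torus"
  assumes X: "Cauchy X" shows "convergent X"
proof -
  have ex: "\<exists>k. \<forall>m\<ge>k. \<forall>m'\<ge>k. norm (X m - X m') < (1 / 2) ^ n" for n :: nat
    using CauchyD[OF X, of "(1 / 2) ^ n"] by simp
  have "\<exists>r. \<forall>n. (\<forall>m\<ge>r n. \<forall>m'\<ge>r n. norm (X m - X m') < (1 / 2) ^ n) \<and> r n < r (Suc n)"
  proof (rule dependent_nat_choice)
    show "\<exists>k. \<forall>m\<ge>k. \<forall>m'\<ge>k. norm (X m - X m') < (1 / 2) ^ 0" by (rule ex)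
    fix x n
    obtain k where "\<forall>m\<ge>k. \<forall>m'\<ge>k. norm (X m - X m') < (1 / 2) ^ Suc n" using ex by blast
    then show "\<exists>y. (\<forall>m\<ge>y. \<forall>m'\<ge>y. norm (X m - X m') < (1 / 2) ^ Suc n) \<and> x < y"
      by (intro exI[of _ "max k (Suc x)"]) auto
  qed
  then obtain r where r: "\<And>n m m'. r n \<le> m \<Longrightarrow> r n \<le> m' \<Longrightarrow> norm (X m - X m') < (1 / 2) ^ n" and rmono: "strict_mono r"
    by (auto simp: strict_mono_Suc_iff)
  define f where "f n = rep_l2_torus (X (r n))" for n
  have f: "square_integrable (f n)" for n unfolding f_def by (rule square_integrable_rep)
  have fX: "abs_l2_torus (f n) = X (r n)" for n by (simp add: f_def)
  have fd: "square_integrable (\<lambda>p. f m p - f n p)" for m n by (rule square_integrable_diff[OF f f])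
  have nfd: "norm (abs_l2_torus (\<lambda>p. f m p - f n p)) < (1 / 2) ^ k" if "k \<le> m" "k \<le> n" for k m n
    using r[of k "r m" "r n"] rmono that
    by (simp add: diff_abs[OF f f, symmetric] fX strict_mono_less_eq)
  \<comment> \<open>\<open>lim\<close> has a value also where the sequence diverges, so
    \<open>F\<close> is Borel and periodic on the whole plane, as \<open>square_integrable\<close>
    demands.\<close>
  define F where "F p = lim (\<lambda>n. f n p)" for p
  have [measurable]: "f n \<in> borel_measurable borel" for n using f by (simp add: square_integrable_def)
  have Fm [measurable]: "F \<in> borel_measurable borel"
    unfolding F_def by (rule borel_measurable_lim_metric) measurable
  have Fp: "periodic F"
    using f unfolding F_def by (simp add: periodic_def square_integrable_def)
  have conv: "AE p in torus. (\<lambda>n. f n p) \<longlonglongrightarrow> F p"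
  proof -
    define g where "g n p = \<bar>f (Suc n) p - f n p\<bar>" for n p
    have gm: "(\<lambda>p. ennreal (g n p)) \<in> borel_measurable torus" for n
      unfolding g_def by (intro measurable_compose[OF _ measurable_ennreal] borel_measurable_abs borel_measurable_diff measurable_torus) measurable
    have gi: "(\<integral>\<^sup>+p. ennreal (g n p) \<partial>torus) \<le> ennreal ((1 / 2) ^ n)" for n
    proof -
      have "integrable torus (\<lambda>p. g n p)"
        unfolding g_def using square_integrable_integrable[OF fd] by (intro integrable_abs)
      then have "(\<integral>\<^sup>+p. ennreal (g n p) \<partial>torus) = ennreal (LINT p|torus. g n p)"
        by (intro nn_integral_eq_integral) (auto simp: g_def)
      also have "(LINT p|torus. g n p) \<le> (1 / 2) ^ n"
        using integral_abs_le_norm[OF fd, of "Suc n" n] nfd[of n "Suc n" n] by (simp add: g_def)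
      finally show ?thesis by (simp add: ennreal_leI)
    qed
    have "(\<integral>\<^sup>+p. (\<Sum>n. ennreal (g n p)) \<partial>torus) = (\<Sum>n. \<integral>\<^sup>+p. ennreal (g n p) \<partial>torus)"
      by (rule nn_integral_suminf[OF gm])
    also have "\<dots> \<le> (\<Sum>n. ennreal ((1 / 2) ^ n))"
      by (intro suminf_le gi) auto
    also have "\<dots> = ennreal (\<Sum>n. (1 / 2) ^ n)"
      by (rule suminf_ennreal2) (auto intro: summable_geometric)
    also have "\<dots> < \<infinity>" by simp
    finally have "AE p in torus. (\<Sum>n. ennreal (g n p)) \<noteq> \<infinity>"
      by (intro nn_integral_PInf_AE borel_measurable_suminf_order gm) auto
    then show ?thesis
    proof eventually_elim
      case (elim p)
      then have "summable (\<lambda>n. g n p)"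
        by (intro summable_suminf_not_top) (auto simp: g_def)
      then have "summable (\<lambda>n. f (Suc n) p - f n p)"
        unfolding g_def by (rule summable_rabs_cancel)
      then obtain s where "(\<lambda>n. \<Sum>i<n. f (Suc i) p - f i p) \<longlonglongrightarrow> s"
        unfolding summable_def sums_def by blast
      then have "(\<lambda>n. f n p - f 0 p) \<longlonglongrightarrow> s" using sum_lessThan_telescope[of "\<lambda>n. f n p"] by simp
      from tendsto_add[OF this tendsto_const[of "f 0 p"]] have "convergent (\<lambda>n. f n p)"
        by (auto simp: convergent_def)
      then show ?case by (simp add: F_def convergent_LIMSEQ_iff)
    qed
  qed
  \<comment> \<open>Fatou's lemma in the second index turns the Cauchy estimate into a distance to
    the limit.\<close>
  have bnd: "(\<integral>\<^sup>+p. ennreal ((f n p - F p)\<^sup>2) \<partial>torus) \<le> ennreal (((1 / 2) ^ n)\<^sup>2)" for n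
  proof -
    have "(\<integral>\<^sup>+p. ennreal ((f n p - F p)\<^sup>2) \<partial>torus) = (\<integral>\<^sup>+p. liminf (\<lambda>m. ennreal ((f n p - f m p)\<^sup>2)) \<partial>torus)"
    proof (rule nn_integral_cong_AE)
      show "AE p in torus. ennreal ((f n p - F p)\<^sup>2) = liminf (\<lambda>m. ennreal ((f n p - f m p)\<^sup>2))"
        using conv
      proof eventually_elim
        case (elim p)
        have "(\<lambda>m. ennreal ((f n p - f m p)\<^sup>2)) \<longlonglongrightarrow> ennreal ((f n p - F p)\<^sup>2)"
          by (intro tendsto_ennrealI tendsto_intros elim)
        then show ?case by (intro lim_imp_Liminf[symmetric]) auto
      qed
    qed
    also have "\<dots> \<le> liminf (\<lambda>m. \<integral>\<^sup>+p. ennreal ((f n p - f m p)\<^sup>2) \<partial>torus)"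
      by (intro nn_integral_liminf measurable_compose[OF _ measurable_ennreal] borel_measurable_power
          borel_measurable_diff measurable_torus) measurable
    also have "\<dots> \<le> liminf (\<lambda>m. ennreal (((1 / 2) ^ n)\<^sup>2))"
    proof (rule Liminf_mono, rule eventually_sequentiallyI)
      fix m assume "n \<le> m"
      have "(\<integral>\<^sup>+p. ennreal ((f n p - f m p)\<^sup>2) \<partial>torus) = ennreal (LINT p|torus. (f n p - f m p)\<^sup>2)"
        using fd[of n m] by (intro nn_integral_eq_integral) (auto simp: square_integrable_def)
      also have "(LINT p|torus. (f n p - f m p)\<^sup>2) = (norm (abs_l2_torus (\<lambda>p. f n p - f m p)))\<^sup>2"
        by (rule norm_abs_power2[OF fd, symmetric])
      also have "\<dots> \<le> ((1 / 2) ^ n)\<^sup>2"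
        using nfd[of n n m] \<open>n \<le> m\<close> by (intro power_mono) auto
      finally show "(\<integral>\<^sup>+p. ennreal ((f n p - f m p)\<^sup>2) \<partial>torus) \<le> ennreal (((1 / 2) ^ n)\<^sup>2)"
        by (simp add: ennreal_leI)
    qed
    also have "\<dots> = ennreal (((1 / 2) ^ n)\<^sup>2)" by (rule Liminf_const) simp
    finally show ?thesis .
  qed
  have fF: "square_integrable (\<lambda>p. f n p - F p)" for n
  proof -
    have "integrable torus (\<lambda>p. (f n p - F p)\<^sup>2)"
    proof (rule integrableI_nonneg)
      show "(\<lambda>p. (f n p - F p)\<^sup>2) \<in> borel_measurable torus" by (rule measurable_torus) measurable
      show "(\<integral>\<^sup>+p. ennreal ((f n p - F p)\<^sup>2) \<partial>torus) < \<infinity>"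
        using bnd[of n] by (rule order_le_less_trans) simp
    qed auto
    moreover have "periodic (\<lambda>p. f n p - F p)" using f[of n] Fp by (simp add: square_integrable_def periodic_def)
    ultimately show ?thesis by (simp add: square_integrable_def)
  qed
  have F: "square_integrable F" using square_integrable_diff[OF f[of 0] fF[of 0]] by simp
  have bound: "norm (X (r n) - abs_l2_torus F) \<le> (1 / 2) ^ n" for n
  proof -
    have "(norm (X (r n) - abs_l2_torus F))\<^sup>2 = (LINT p|torus. (f n p - F p)\<^sup>2)"
      unfolding fX[symmetric] diff_abs[OF f F] by (rule norm_abs_power2[OF fF])
    moreover have "ennreal (LINT p|torus. (f n p - F p)\<^sup>2) \<le> ennreal (((1 / 2) ^ n)\<^sup>2)"
      using bnd[of n] fF[of n] by (subst (asm) nn_integral_eq_integral) (auto simp: square_integrable_def)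
    then have "(LINT p|torus. (f n p - F p)\<^sup>2) \<le> ((1 / 2) ^ n)\<^sup>2"
      by (subst (asm) ennreal_le_iff) auto
    ultimately show ?thesis by (intro power2_le_imp_le[of "norm (X (r n) - abs_l2_torus F)"]) auto
  qed
  have lim: "(\<lambda>n. (1 / 2 :: real) ^ n) \<longlonglongrightarrow> 0" by (rule LIMSEQ_realpow_zero) auto
  have "(\<lambda>n. X (r n) - abs_l2_torus F) \<longlonglongrightarrow> 0"
    by (rule Lim_null_comparison[OF always_eventually[OF allI[OF bound]] lim])
  then have "(X \<circ> r) \<longlonglongrightarrow> abs_l2_torus F" by (simp add: LIM_zero_iff o_def)
  from Cauchy_converges_subseq[OF X rmono this] show ?thesis by (auto simp: convergent_def)
qed

instance l2_torus :: complete_space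
  by standard (rule l2_torus_Cauchy_convergent)

instance l2_torus :: banach ..

section \<open>Fourier coefficients, Bessel, Riesz-Fischer and Parseval\<close>

definition trigL :: "complex \<Rightarrow> freq \<Rightarrow> l2_torus" where
  "trigL a k = abs_l2_torus (trig a k)"

text \<open>\<open>fc u k\<close> is the Fourier coefficient $\int u\,e^{-2\pi i k\cdot p}\,dp$.\<close>

definition fc :: "l2_torus \<Rightarrow> freq \<Rightarrow> complex" where
  "fc u k = Complex (inner u (trigL 1 k)) (inner u (trigL \<i> k))"

lemma trigL_eq: "trigL a k = Re a *\<^sub>R trigL 1 k + Im a *\<^sub>R trigL \<i> k"
  unfolding trigL_def by (simp add: scaleR_abs plus_abs square_integrable_trig square_integrable_scale)
    (simp add: trig_eq[abs_def])

lemma inner_trigL: "inner u (trigL a k) = Re (cnj a * fc u k)"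
  by (subst trigL_eq) (simp add: fc_def inner_add_right)

lemma inner_trigL_trigL: "inner (trigL a k) (trigL b l) = ((if k = - l then Re (a * b) else 0) + (if k = l then Re (a * cnj b) else 0)) / 2"
  unfolding trigL_def by (simp add: inner_abs square_integrable_trig integral_trig_mult)

lemma fc_trigL: "fc (trigL a k) l = ((if l = k then a else 0) + (if l = - k then cnj a else 0)) / 2"
  by (auto simp: fc_def inner_trigL_trigL complex_eq_iff)

lemma bounded_linear_fc: "bounded_linear (\<lambda>u. fc u k)"
proof -
  have "(\<lambda>u. fc u k) = (\<lambda>u. inner u (trigL 1 k) *\<^sub>R 1 + inner u (trigL \<i> k) *\<^sub>R \<i>)"
    by (auto simp: fc_def complex_eq_iff)
  then show ?thesis by (simp only:) (intro bounded_linear_intros)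
qed

lemma fc_add: "fc (u + v) k = fc u k + fc v k"
  and fc_diff: "fc (u - v) k = fc u k - fc v k"
  and fc_uminus: "fc (- u) k = - fc u k"
  and fc_scaleR: "fc (c *\<^sub>R u) k = of_real c * fc u k"
  and fc_0: "fc 0 k = 0"
  by (simp_all add: fc_def complex_eq_iff inner_add_left inner_diff_left)

lemma fc_sum: "fc (\<Sum>i\<in>I. u i) k = (\<Sum>i\<in>I. fc (u i) k)"
  by (induction I rule: infinite_finite_induct) (auto simp: fc_add fc_0)

lemma trigL_minus: "trigL a (- k) = trigL (cnj a) k"
proof -
  have "trig a (- k) = trig (cnj a) k" by (rule ext) (simp add: trig_eq phase_minus)
  then show ?thesis by (simp add: trigL_def)
qed

lemma fc_minus: "fc u (- k) = cnj (fc u k)"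
proof -
  have "trigL \<i> (- k) = - trigL \<i> k" by (simp add: trigL_minus trigL_eq[of "- \<i>"])
  then show ?thesis by (simp add: fc_def trigL_minus complex_eq_iff)
qed

lemma integral_rep_trig: "(LINT p|torus. rep_l2_torus u p * trig a k p) = inner u (trigL a k)"
  using inner_abs[OF square_integrable_rep square_integrable_trig, of u a k] by (simp add: trigL_def)

lemma fc_eqI:
  assumes "\<And>k. fc u k = fc v k" shows "u = v"
proof -
  let ?w = "u - v"
  have "AE p in torus. rep_l2_torus ?w p = 0"
    by (rule orthogonal_trig_imp_0[OF square_integrable_integrable[OF square_integrable_rep]])
      (simp add: integral_rep_trig inner_trigL fc_diff assms)
  then have "inner ?w ?w = (LINT p|torus. 0)"
    unfolding inner_rep
    by (intro integral_cong_AE) (auto intro!: borel_measurable_times square_integrable_measurable[OF square_integrable_rep])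
  then show ?thesis by simp
qed

text \<open>A partial sum of the real Fourier series. For symmetric \<open>K\<close> and
  \<open>c\<close> the terms at \<open>k\<close> and \<open>- k\<close> each contribute half of the
  coefficient, so no factor 2 is needed.\<close>

definition tp :: "freq set \<Rightarrow> (freq \<Rightarrow> complex) \<Rightarrow> l2_torus" where
  "tp K c = (\<Sum>k\<in>K. trigL (c k) k)"

lemma inner_tp: "inner u (tp K c) = (\<Sum>k\<in>K. Re (cnj (c k) * fc u k))"
  by (simp add: tp_def inner_sum_right inner_trigL)

lemma fc_tp:
  assumes "finite K" "\<And>k. - k \<in> K \<longleftrightarrow> k \<in> K" "\<And>k. c (- k) = cnj (c k)"
  shows "fc (tp K c) l = (if l \<in> K then c l else 0)"
proof -
  have "fc (tp K c) l = ((\<Sum>k\<in>K. if l = k then c k else 0) + (\<Sum>k\<in>K. if - l = k then cnj (c k) else 0)) / 2"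
    unfolding tp_def fc_sum fc_trigL sum_divide_distrib[symmetric] sum.distrib[symmetric]
    by (intro arg_cong[where f = "\<lambda>x. x / 2"] sum.cong) (auto simp: minus_equation_iff)
  then show ?thesis using assms by (cases "l \<in> K") simp_all
qed

lemma Re_cnj_mult: "Re (cnj z * z) = (cmod z)\<^sup>2"
  by (simp add: cmod_power2) (simp add: power2_eq_square)

lemma norm_tp:
  assumes "finite K" "\<And>k. - k \<in> K \<longleftrightarrow> k \<in> K" "\<And>k. c (- k) = cnj (c k)"
  shows "(norm (tp K c))\<^sup>2 = (\<Sum>k\<in>K. (cmod (c k))\<^sup>2)"
proof -
  have "fc (tp K c) k = c k" if "k \<in> K" for k using fc_tp[of K c k] assms that by simp
  then show ?thesis
    unfolding power2_norm_eq_inner[of "tp K c"] inner_tp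
  proof (intro sum.cong refl)
    fix k assume "k \<in> K"
    then have "fc (tp K c) k = c k" by fact
    then show "Re (cnj (c k) * fc (tp K c) k) = (cmod (c k))\<^sup>2" by (simp only: Re_cnj_mult)
  qed
qed

lemma bessel: "wbound (\<lambda>k. 1) (fc u) (norm u)"
proof (rule wboundI)
  fix K :: "freq set" assume "finite K"
  then obtain n where n: "K \<subseteq> fbox n" using finite_subset_fbox by blast
  let ?t = "tp (fbox n) (fc u)"
  define S where "S = (\<Sum>k\<in>fbox n. (cmod (fc u k))\<^sup>2)"
  have t: "(norm ?t)\<^sup>2 = S" unfolding S_def by (rule norm_tp) (auto simp: fbox_minus fc_minus)
  have ut: "inner u ?t = S" unfolding inner_tp S_def
    by (simp only: Re_cnj_mult)
  have "0 \<le> (norm (u - ?t))\<^sup>2" by simp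
  also have "\<dots> = (norm u)\<^sup>2 - 2 * inner u ?t + (norm ?t)\<^sup>2"
    by (simp add: power2_norm_eq_inner inner_diff_left inner_diff_right inner_commute)
  finally have S: "S \<le> (norm u)\<^sup>2" using t ut by simp
  have "L2_set (\<lambda>k. 1 * cmod (fc u k)) K \<le> L2_set (\<lambda>k. 1 * cmod (fc u k)) (fbox n)"
    by (rule L2_set_mono_set[OF finite_fbox n])
  also have "\<dots> \<le> norm u"
    by (rule power2_le_imp_le) (use S in \<open>auto simp: L2_set_power2 S_def\<close>)
  finally show "L2_set (\<lambda>k. 1 * cmod (fc u k)) K \<le> norm u" .
qed

text \<open>The sums of squares increase and are bounded, and their differences are the squared
  distances of the partial sums. The convergence along boxes is kept in the conclusion because
  \<open>parseval\<close> and the supremum bound use it.\<close>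

lemma riesz_fischer:
  assumes sym: "\<And>k. c (- k) = cnj (c k)" and B: "wbound (\<lambda>k. 1) c B"
  shows "\<exists>u. (\<lambda>n. tp (fbox n) c) \<longlonglongrightarrow> u \<and> (\<forall>k. fc u k = c k) \<and> norm u \<le> B"
proof -
  define S where "S n = (\<Sum>k\<in>fbox n. (cmod (c k))\<^sup>2)" for n
  have d: "(norm (tp (fbox m) c - tp (fbox n) c))\<^sup>2 = S m - S n" if "n \<le> m" for m n
  proof -
    have sub: "fbox n \<subseteq> fbox m" by (rule fbox_mono[OF that])
    have "tp (fbox m) c - tp (fbox n) c = tp (fbox m - fbox n) c"
      unfolding tp_def using sum.subset_diff[OF sub finite_fbox, of "\<lambda>k. trigL (c k) k"] by simp
    also have "(norm \<dots>)\<^sup>2 = (\<Sum>k\<in>fbox m - fbox n. (cmod (c k))\<^sup>2)"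
      by (rule norm_tp) (auto simp: fbox_minus sym)
    also have "\<dots> = S m - S n" unfolding S_def using sum.subset_diff[OF sub finite_fbox, of "\<lambda>k. (cmod (c k))\<^sup>2"] by simp
    finally show ?thesis .
  qed
  have "incseq S" unfolding S_def by (intro incseq_SucI sum_mono2 fbox_mono) auto
  moreover have SB: "S n \<le> B\<^sup>2" for n
    using power_mono[OF wboundD[OF B finite_fbox[of n]], of 2] by (simp add: S_def L2_set_power2)
  ultimately have "convergent S" by (intro Bseq_mono_convergent BseqI'[of _ "B\<^sup>2"]) (auto simp: S_def sum_nonneg incseq_def)
  then have cS: "Cauchy S" by (rule convergent_Cauchy)
  have "Cauchy (\<lambda>n. tp (fbox n) c)"
  proof (rule metric_CauchyI)
    fix e :: real assume "0 < e"
    then obtain M where M: "\<And>m n. M \<le> m \<Longrightarrow> M \<le> n \<Longrightarrow> \<bar>S m - S n\<bar> < e\<^sup>2"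
      using metric_CauchyD[OF cS, of "e\<^sup>2"] by (auto simp: dist_real_def)
    have *: "dist (tp (fbox m) c) (tp (fbox n) c) < e" if "M \<le> n" "n \<le> m" for m n
      using d[OF that(2)] M[of m n] that \<open>0 < e\<close>
      by (auto simp: dist_norm intro: power2_less_imp_less)
    show "\<exists>M. \<forall>m\<ge>M. \<forall>n\<ge>M. dist (tp (fbox m) c) (tp (fbox n) c) < e"
    proof (intro exI[of _ M] allI impI)
      fix m n assume "M \<le> m" "M \<le> n"
      then show "dist (tp (fbox m) c) (tp (fbox n) c) < e"
        using *[of n m] *[of m n] by (cases "n \<le> m") (auto simp: dist_commute)
    qed
  qed
  then obtain u where u: "(\<lambda>n. tp (fbox n) c) \<longlonglongrightarrow> u"
    using Cauchy_convergent convergent_def by blast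
  have "fc u k = c k" for k
  proof (rule LIMSEQ_unique)
    show "(\<lambda>n. fc (tp (fbox n) c) k) \<longlonglongrightarrow> fc u k"
      by (rule bounded_linear.tendsto[OF bounded_linear_fc u])
    have "k \<in> fbox n" if "nat \<lceil>wt k\<rceil> \<le> n" for n using that by (simp add: fbox_def)
    then have "fc (tp (fbox n) c) k = c k" if "nat \<lceil>wt k\<rceil> \<le> n" for n
      using that by (subst fc_tp) (auto simp: fbox_minus sym)
    then show "(\<lambda>n. fc (tp (fbox n) c) k) \<longlonglongrightarrow> c k"
      by (intro tendsto_eventually eventually_sequentiallyI)
  qed
  moreover have "norm u \<le> B"
  proof (rule LIMSEQ_le_const2[OF tendsto_norm[OF u]])
    have "norm (tp (fbox n) c) \<le> B" for n
      by (rule power2_le_imp_le)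
        (use SB[of n] wbound_nonneg[OF B] in \<open>auto simp: norm_tp fbox_minus sym S_def\<close>)
    then show "\<exists>N. \<forall>n\<ge>N. norm (tp (fbox n) c) \<le> B" by blast
  qed
  ultimately show ?thesis using u by blast
qed

lemma ex_fc:
  assumes "\<And>k. c (- k) = cnj (c k)" "wbound (\<lambda>k. 1) c B"
  obtains u where "\<And>k. fc u k = c k" "norm u \<le> B"
  using riesz_fischer[OF assms] by blast

text \<open>One direction is Bessel's inequality; for the other, \<open>riesz_fischer\<close>
  produces a function with norm at most \<open>B\<close>, and equal coefficients identify it with
  \<open>u\<close>.\<close>

lemma norm_le_iff_wbound: "norm u \<le> B \<longleftrightarrow> wbound (\<lambda>k. 1) (fc u) B"
proof
  assume "norm u \<le> B"
  then show "wbound (\<lambda>k. 1) (fc u) B" using bessel by (rule wbound_weaken[rotated -1]) auto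
next
  assume "wbound (\<lambda>k. 1) (fc u) B"
  from ex_fc[of "fc u", OF fc_minus this] obtain v where "\<And>k. fc v k = fc u k" "norm v \<le> B" by blast
  then show "norm u \<le> B" using fc_eqI[of v u] by simp
qed

lemma parseval: "(\<lambda>n. \<Sum>k\<in>fbox n. Re (cnj (fc v k) * fc u k)) \<longlonglongrightarrow> inner u v"
proof -
  obtain w where w: "(\<lambda>n. tp (fbox n) (fc v)) \<longlonglongrightarrow> w" "\<And>k. fc w k = fc v k"
    using riesz_fischer[OF fc_minus bessel] by blast
  have "w = v" using w(2) by (rule fc_eqI)
  from tendsto_inner[OF tendsto_const w(1), of u] show ?thesis
    unfolding inner_tp \<open>w = v\<close> .
qed

section \<open>Weak derivatives as Fourier multipliers\<close>

definition D :: "nat \<Rightarrow> nat \<Rightarrow> freq \<Rightarrow> complex" where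
  "D m n k = D1 k ^ m * D2 k ^ n"

lemma D_simps: "D 0 0 k = 1" "D 1 0 k = D1 k" "D 0 1 k = D2 k"
  by (simp_all add: D_def)

lemma cnj_D1: "cnj (D1 k) = - D1 k" and cnj_D2: "cnj (D2 k) = - D2 k"
  by (simp_all add: D1_def D2_def)

lemma cnj_D: "cnj (D m n k) = (- 1) ^ (m + n) * D m n k"
  by (simp add: D_def cnj_D1 cnj_D2 power_minus[of "D1 k"] power_minus[of "D2 k"] power_add)

lemma D_minus: "D m n (- k) = cnj (D m n k)"
  by (simp add: D_def D1_def D2_def)

lemma cmod_D: "cmod (D m n k) = (2 * pi * \<bar>real_of_int (fst k)\<bar>) ^ m * (2 * pi * \<bar>real_of_int (snd k)\<bar>) ^ n"
  by (simp add: D_def D1_def D2_def norm_mult norm_power)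

lemma cmod_D_le:
  assumes "m + n \<le> s" shows "cmod (D m n k) \<le> (2 * pi) ^ s * wt k ^ s"
proof -
  have "cmod (D m n k) \<le> (2 * pi * wt k) ^ m * (2 * pi * wt k) ^ n"
    unfolding cmod_D by (intro mult_mono power_mono) (auto simp: wt_def)
  also have "\<dots> = (2 * pi * wt k) ^ (m + n)" by (simp add: power_add)
  also have "\<dots> \<le> (2 * pi * wt k) ^ s"
  proof (rule power_increasing[OF assms])
    have "1 * 1 \<le> 2 * pi * wt k" using pi_gt3 by (intro mult_mono) auto
    then show "1 \<le> 2 * pi * wt k" by simp
  qed
  finally show ?thesis by (simp add: power_mult_distrib)
qed

lemma deriv_trig: "(dx ^^ m) ((dy ^^ n) (trig a k)) = trig (D m n k * a) k"
proof -
  have "(dy ^^ n) (trig a k) = trig (D2 k ^ n * a) k"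
    by (induction n) (auto simp: dy_trig mult.assoc)
  moreover have "(dx ^^ m) (trig b k) = trig (D1 k ^ m * b) k" for b
    by (induction m) (auto simp: dx_trig mult.assoc)
  ultimately show ?thesis by (simp add: D_def mult.assoc)
qed

lemma complex_eqI_Re_cnj:
  assumes "\<And>a. Re (cnj a * z) = Re (cnj a * w)" shows "z = w"
  using assms[of 1] assms[of \<i>] by (simp add: complex_eq_iff)

text \<open>The derivatives of the product of \<phi> with a trigonometric function have integral 0,
  which moves the derivative onto the latter. The sign is absorbed by conjugating the purely
  imaginary symbol.\<close>

lemma fc_abs_deriv:
  assumes \<phi>: "test_function \<phi>"
  shows "fc (abs_l2_torus (dx \<phi>)) k = D1 k * fc (abs_l2_torus \<phi>) k"
    "fc (abs_l2_torus (dy \<phi>)) k = D2 k * fc (abs_l2_torus \<phi>) k"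
proof -
  note sq = test_function_square_integrable[OF \<phi>] test_function_square_integrable[OF test_function_deriv(1)[OF \<phi>]]
    test_function_square_integrable[OF test_function_deriv(2)[OF \<phi>]]
  have C: "of_class_C (Suc n) \<phi>" for n using \<phi> unfolding test_function_def by blast
  have d: "(\<phi> has_derivative frechet_derivative \<phi> (at p)) (at p)" for p
    using C[of 0] frechet_derivative_works by auto
  have cont: "continuous_on UNIV \<phi>" "continuous_on UNIV (dx \<phi>)" "continuous_on UNIV (dy \<phi>)"
    using C[of 0] of_class_C_continuous[OF C] by auto
  have ct: "continuous_on UNIV (trig a k)" for a k by (rule of_class_C_continuous[OF of_class_C_trig])
  have *: "Re (cnj a * fc (abs_l2_torus (dx \<phi>)) k) = Re (cnj a * (D1 k * fc (abs_l2_torus \<phi>) k)) \<and>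
     Re (cnj a * fc (abs_l2_torus (dy \<phi>)) k) = Re (cnj a * (D2 k * fc (abs_l2_torus \<phi>) k))" for a
  proof -
    let ?t = "trig a k"
    define \<psi> where "\<psi> p = \<phi> p * ?t p" for p
    have der: "(\<psi> has_derivative (\<lambda>h. \<phi> p * (trig (D1 k * a) k p * fst h + trig (D2 k * a) k p * snd h)
        + frechet_derivative \<phi> (at p) h * ?t p)) (at p)" for p
      unfolding \<psi>_def by (rule has_derivative_mult[OF d trig_has_derivative])
    have dx\<psi>: "dx \<psi> = (\<lambda>p. \<phi> p * trig (D1 k * a) k p + dx \<phi> p * ?t p)"
      and dy\<psi>: "dy \<psi> = (\<lambda>p. \<phi> p * trig (D2 k * a) k p + dy \<phi> p * ?t p)"
      unfolding dx_def dy_def using frechet_derivative_at[OF der, symmetric] by simp_all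
    have "\<psi> differentiable (at p)" for p using der differentiableI by blast
    then have "of_class_C 1 \<psi>"
      unfolding One_nat_def of_class_C.simps dx\<psi> dy\<psi> by (intro conjI allI continuous_intros cont ct)
    moreover have "periodic \<psi>"
      using \<phi> periodic_trig[of a k] unfolding \<psi>_def by (simp add: test_function_def periodic_def)
    ultimately have 0: "(LINT p|torus. dx \<psi> p) = 0" "(LINT p|torus. dy \<psi> p) = 0"
      by (rule integral_torus_deriv_0[rotated])+
    have "(LINT p|torus. dx \<phi> p * ?t p) = - (LINT p|torus. \<phi> p * trig (D1 k * a) k p)"
      "(LINT p|torus. dy \<phi> p * ?t p) = - (LINT p|torus. \<phi> p * trig (D2 k * a) k p)"
      using 0 unfolding dx\<psi> dy\<psi>
      by (simp_all add: integrable_torus_mult sq square_integrable_trig)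
    then have "inner (abs_l2_torus (dx \<phi>)) (trigL a k) = - inner (abs_l2_torus \<phi>) (trigL (D1 k * a) k)"
      "inner (abs_l2_torus (dy \<phi>)) (trigL a k) = - inner (abs_l2_torus \<phi>) (trigL (D2 k * a) k)"
      unfolding trigL_def by (simp_all add: inner_abs sq square_integrable_trig)
    then show ?thesis unfolding inner_trigL by (simp add: cnj_D1 cnj_D2 mult_ac)
  qed
  show "fc (abs_l2_torus (dx \<phi>)) k = D1 k * fc (abs_l2_torus \<phi>) k"
    "fc (abs_l2_torus (dy \<phi>)) k = D2 k * fc (abs_l2_torus \<phi>) k"
    by (rule complex_eqI_Re_cnj, use * in blast)+
qed

lemma test_function_iterated_deriv:
  assumes "test_function \<phi>"
  shows "test_function ((dx ^^ m) ((dy ^^ n) \<phi>)) \<and>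
    fc (abs_l2_torus ((dx ^^ m) ((dy ^^ n) \<phi>))) k = D m n k * fc (abs_l2_torus \<phi>) k"
proof -
  have y: "test_function ((dy ^^ n) \<phi>) \<and> fc (abs_l2_torus ((dy ^^ n) \<phi>)) k = D2 k ^ n * fc (abs_l2_torus \<phi>) k"
    by (induction n) (auto simp: assms test_function_deriv fc_abs_deriv)
  have "test_function ((dx ^^ m) \<phi>) \<and> fc (abs_l2_torus ((dx ^^ m) \<phi>)) k = D1 k ^ m * fc (abs_l2_torus \<phi>) k"
    if "test_function \<phi>" for \<phi>
    by (induction m) (auto simp: that test_function_deriv fc_abs_deriv)
  from this[of "(dy ^^ n) \<phi>"] y show ?thesis by (simp add: D_def)
qed

text \<open>Trigonometric functions are test functions, which gives one direction. Conversely,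
  Parseval is applied to an arbitrary test function, whose derivatives have the multiplied
  coefficients; conjugating the symbol produces the sign \<open>(- 1) ^ (m + n)\<close>.\<close>

lemma has_weak_deriv_iff: "has_weak_deriv m n u v \<longleftrightarrow> (\<forall>k. fc v k = D m n k * fc u k)"
proof
  assume w: "has_weak_deriv m n u v"
  show "\<forall>k. fc v k = D m n k * fc u k"
  proof
    fix k
    have "Re (cnj a * (cnj (D m n k) * fc u k)) = Re (cnj a * ((- 1) ^ (m + n) * fc v k))" for a
    proof -
      have "(LINT p|torus. rep_l2_torus u p * trig (D m n k * a) k p) = (- 1) ^ (m + n) * (LINT p|torus. rep_l2_torus v p * trig a k p)"
        using w test_function_trig[of a k] unfolding has_weak_deriv_def deriv_trig[symmetric] by blast
      then have "Re (cnj (D m n k * a) * fc u k) = (- 1) ^ (m + n) * Re (cnj a * fc v k)"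
        by (simp only: integral_rep_trig inner_trigL)
      moreover have "(- 1) ^ (m + n) * Re (cnj a * fc v k) = Re (cnj a * ((- 1) ^ (m + n) * fc v k))"
        by (cases "even (m + n)") simp_all
      ultimately show ?thesis by (simp add: mult_ac)
    qed
    from complex_eqI_Re_cnj[OF this] have "(- 1) ^ (m + n) * D m n k * fc u k = (- 1) ^ (m + n) * fc v k"
      by (simp add: cnj_D)
    then show "fc v k = D m n k * fc u k" by simp
  qed
next
  assume v: "\<forall>k. fc v k = D m n k * fc u k"
  show "has_weak_deriv m n u v"
    unfolding has_weak_deriv_def
  proof (intro allI impI)
    fix \<phi> assume \<phi>: "test_function \<phi>"
    let ?\<psi> = "(dx ^^ m) ((dy ^^ n) \<phi>)"
    note it = test_function_iterated_deriv[OF \<phi>, of m n]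
    have "inner u (abs_l2_torus ?\<psi>) = (- 1) ^ (m + n) * inner v (abs_l2_torus \<phi>)"
    proof (rule LIMSEQ_unique[OF parseval])
      have "Re (cnj (fc (abs_l2_torus ?\<psi>) k) * fc u k) = (- 1) ^ (m + n) * Re (cnj (fc (abs_l2_torus \<phi>) k) * fc v k)" for k
        using it[of k] v by (cases "even (m + n)") (simp_all add: cnj_D mult_ac)
      then show "(\<lambda>n'. \<Sum>k\<in>fbox n'. Re (cnj (fc (abs_l2_torus ?\<psi>) k) * fc u k)) \<longlonglongrightarrow> (- 1) ^ (m + n) * inner v (abs_l2_torus \<phi>)"
        using tendsto_mult_left[OF parseval[of "abs_l2_torus \<phi>" v], of "(- 1) ^ (m + n)"]
        by (simp only: sum_distrib_left)
    qed
    then show "(LINT p|torus. rep_l2_torus u p * ?\<psi> p) = (- 1) ^ (m + n) * (LINT p|torus. rep_l2_torus v p * \<phi> p)"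
      using inner_abs[OF square_integrable_rep test_function_square_integrable[OF \<phi>], of v]
        inner_abs[OF square_integrable_rep test_function_square_integrable[of ?\<psi>], of u] it by simp
  qed
qed

lemma ex_weak_deriv_iff: "(\<exists>v. has_weak_deriv m n u v) \<longleftrightarrow> (\<exists>B. wbound (\<lambda>k. 1) (\<lambda>k. D m n k * fc u k) B)"
proof
  assume "\<exists>v. has_weak_deriv m n u v"
  then obtain v where "\<And>k. fc v k = D m n k * fc u k" by (auto simp: has_weak_deriv_iff)
  then have "fc v = (\<lambda>k. D m n k * fc u k)" by auto
  then show "\<exists>B. wbound (\<lambda>k. 1) (\<lambda>k. D m n k * fc u k) B" using bessel[of v] by auto
next
  assume "\<exists>B. wbound (\<lambda>k. 1) (\<lambda>k. D m n k * fc u k) B"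
  then obtain B where B: "wbound (\<lambda>k. 1) (\<lambda>k. D m n k * fc u k) B" by blast
  have "D m n (- k) * fc u (- k) = cnj (D m n k * fc u k)" for k by (simp add: D_minus fc_minus)
  from ex_fc[OF this B] show "\<exists>v. has_weak_deriv m n u v" unfolding has_weak_deriv_iff by metis
qed

lemma has_weak_deriv_weak_deriv:
  assumes "\<exists>v. has_weak_deriv m n u v" shows "has_weak_deriv m n u (weak_deriv m n u)"
proof -
  have "\<exists>!v. has_weak_deriv m n u v"
    using assms by (auto simp: has_weak_deriv_iff intro: fc_eqI)
  then show ?thesis unfolding weak_deriv_def by (rule theI')
qed

lemma fc_weak_deriv: "\<exists>v. has_weak_deriv m n u v \<Longrightarrow> fc (weak_deriv m n u) k = D m n k * fc u k"
  using has_weak_deriv_weak_deriv by (simp add: has_weak_deriv_iff)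

section \<open>Sobolev norms as weighted sequence norms\<close>

text \<open>The weight is at most three times the largest of 1 and the two absolute components, so
  the pure derivatives of order \<open>s\<close> suffice and mixed ones can be left out.\<close>

lemma wt_power_le: "wt k ^ s \<le> 3 ^ s * (1 + cmod (D s 0 k) + cmod (D 0 s k))"
proof -
  define a b where "a = \<bar>real_of_int (fst k)\<bar>" and "b = \<bar>real_of_int (snd k)\<bar>"
  define M where "M = max 1 (max a b)"
  have M: "1 \<le> M" "a \<le> M" "b \<le> M" by (auto simp: M_def)
  have "wt k ^ s \<le> (3 * M) ^ s"
    using M by (intro power_mono) (auto simp: wt_def a_def b_def)
  also have "\<dots> = 3 ^ s * M ^ s" by (simp add: power_mult_distrib)
  also have "M ^ s \<le> 1 + a ^ s + b ^ s"
  proof -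
    have "M = 1 \<or> M = a \<or> M = b" by (auto simp: M_def max_def)
    moreover have "0 \<le> a ^ s" "0 \<le> b ^ s" by (simp_all add: a_def b_def)
    ultimately show ?thesis by auto
  qed
  also have "\<dots> \<le> 1 + (2 * pi * a) ^ s + (2 * pi * b) ^ s"
  proof -
    have "1 \<le> 2 * pi" using pi_gt3 by simp
    from mult_right_mono[OF this, of a] mult_right_mono[OF this, of b] show ?thesis by (intro add_mono power_mono) (auto simp: a_def b_def)
  qed
  also have "\<dots> = 1 + cmod (D s 0 k) + cmod (D 0 s k)"
    by (simp add: cmod_D a_def b_def)
  finally show ?thesis by simp
qed

lemma finite_triangle: "finite {(m, n). m + n \<le> (s :: nat)}"
  by (rule finite_subset[of _ "{..s} \<times> {..s}"]) auto

definition cs :: "nat \<Rightarrow> real" where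
  "cs s = sqrt (real (card {(m, n). m + n \<le> s})) * (2 * pi) ^ s"

lemma cs_nonneg: "0 \<le> cs s"
  by (simp add: cs_def)

lemma wbound_D:
  assumes "wbound (\<lambda>k. wt k ^ s) (fc u) B" "m + n \<le> s"
  shows "wbound (\<lambda>k. 1) (\<lambda>k. D m n k * fc u k) ((2 * pi) ^ s * B)"
proof (rule wbound_mono[OF assms(1), where c = "(2 * pi) ^ s"])
  show "1 * cmod (D m n k * fc u k) \<le> (2 * pi) ^ s * (wt k ^ s * cmod (fc u k))" for k
    using mult_right_mono[OF cmod_D_le[OF assms(2)], of "cmod (fc u k)" k] by (simp add: norm_mult mult.assoc)
qed auto

lemma sobolev_of_wbound:
  assumes "wbound (\<lambda>k. wt k ^ s) (fc u) B"
  shows "u \<in> sobolev s" "sobolev_norm s u \<le> cs s * B"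
proof -
  have B: "0 \<le> B" using wbound_nonneg[OF assms] .
  have ex: "\<exists>v. has_weak_deriv m n u v" if "m + n \<le> s" for m n
    unfolding ex_weak_deriv_iff using wbound_D[OF assms that] by blast
  then show "u \<in> sobolev s" by (simp add: sobolev_def)
  have "norm (weak_deriv m n u) \<le> (2 * pi) ^ s * B" if "m + n \<le> s" for m n
    unfolding norm_le_iff_wbound using wbound_D[OF assms that]
    by (simp add: fc_weak_deriv[OF ex[OF that], abs_def])
  then have "(\<Sum>(m, n)\<in>{(m, n). m + n \<le> s}. (norm (weak_deriv m n u))\<^sup>2)
      \<le> (\<Sum>(m, n)\<in>{(m, n). m + n \<le> s}. ((2 * pi) ^ s * B)\<^sup>2)"
    by (intro sum_mono) (auto intro!: power_mono)
  also have "\<dots> = real (card {(m, n). m + n \<le> s}) * ((2 * pi) ^ s * B)\<^sup>2"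
    by (simp add: case_prod_unfold)
  finally have "sobolev_norm s u \<le> sqrt (real (card {(m, n). m + n \<le> s}) * ((2 * pi) ^ s * B)\<^sup>2)"
    unfolding sobolev_norm_def by (rule real_sqrt_le_mono)
  also have "\<dots> = cs s * B" using B by (simp add: cs_def real_sqrt_mult)
  finally show "sobolev_norm s u \<le> cs s * B" .
qed

lemma sobolev_norm_nonneg: "0 \<le> sobolev_norm s u"
  unfolding sobolev_norm_def by (intro real_sqrt_ge_zero sum_nonneg) auto

text \<open>The exponent \<open>Suc s\<close> combines the \<open>3 ^ s\<close> of
  \<open>wt_power_le\<close> with the three terms on its right-hand side.\<close>

lemma wbound_of_sobolev:
  assumes "u \<in> sobolev s"
  shows "wbound (\<lambda>k. wt k ^ s) (fc u) (3 ^ Suc s * sobolev_norm s u)"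
proof (rule wboundI)
  fix K :: "freq set" assume K: "finite K"
  define N where "N = sobolev_norm s u"
  have ex: "\<exists>v. has_weak_deriv m n u v" if "m + n \<le> s" for m n
    using assms that by (simp add: sobolev_def)
  have b: "L2_set (\<lambda>k. cmod (D m n k) * cmod (fc u k)) K \<le> N" if "m + n \<le> s" for m n
  proof -
    have "(norm (weak_deriv m n u))\<^sup>2 \<le> (\<Sum>(m, n)\<in>{(m, n). m + n \<le> s}. (norm (weak_deriv m n u))\<^sup>2)"
      using member_le_sum[of "(m, n)" "{(m, n). m + n \<le> s}" "\<lambda>(m, n). (norm (weak_deriv m n u))\<^sup>2"] that finite_triangle
      by auto
    then have "norm (weak_deriv m n u) \<le> N"
      unfolding N_def sobolev_norm_def by (simp add: real_le_rsqrt)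
    then have "wbound (\<lambda>k. 1) (fc (weak_deriv m n u)) N" by (simp add: norm_le_iff_wbound)
    from wboundD[OF this K] show ?thesis by (simp add: fc_weak_deriv[OF ex[OF that]] norm_mult)
  qed
  let ?f = "\<lambda>m n k. cmod (D m n k) * cmod (fc u k)"
  have "L2_set (\<lambda>k. wt k ^ s * cmod (fc u k)) K \<le> L2_set (\<lambda>k. 3 ^ s * (?f 0 0 k + ?f s 0 k + ?f 0 s k)) K"
  proof (rule L2_set_mono)
    fix k
    show "wt k ^ s * cmod (fc u k) \<le> 3 ^ s * (?f 0 0 k + ?f s 0 k + ?f 0 s k)"
      using mult_right_mono[OF wt_power_le[of k s], of "cmod (fc u k)"] by (simp add: D_simps algebra_simps)
  qed simp
  also have "\<dots> = 3 ^ s * L2_set (\<lambda>k. ?f 0 0 k + ?f s 0 k + ?f 0 s k) K"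
    by (simp add: L2_set_right_distrib)
  also have "\<dots> \<le> 3 ^ s * (N + N + N)"
  proof (rule mult_left_mono)
    have "L2_set (\<lambda>k. ?f 0 0 k + ?f s 0 k + ?f 0 s k) K \<le> L2_set (\<lambda>k. ?f 0 0 k + ?f s 0 k) K + L2_set (?f 0 s) K"
      by (rule L2_set_triangle_ineq)
    also have "\<dots> \<le> (L2_set (?f 0 0) K + L2_set (?f s 0) K) + L2_set (?f 0 s) K"
      by (intro add_right_mono L2_set_triangle_ineq)
    also have "\<dots> \<le> N + N + N" by (intro add_mono b) auto
    finally show "L2_set (\<lambda>k. ?f 0 0 k + ?f s 0 k + ?f 0 s k) K \<le> N + N + N" .
  qed simp
  finally show "L2_set (\<lambda>k. wt k ^ s * cmod (fc u k)) K \<le> 3 ^ Suc s * sobolev_norm s u"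
    by (simp add: N_def)
qed

lemma sobolev_iff: "u \<in> sobolev s \<longleftrightarrow> (\<exists>B. wbound (\<lambda>k. wt k ^ s) (fc u) B)"
  using wbound_of_sobolev sobolev_of_wbound by blast

lemma sobolev_weak_deriv: "u \<in> sobolev s \<Longrightarrow> m + n \<le> s \<Longrightarrow> fc (weak_deriv m n u) k = D m n k * fc u k"
  by (rule fc_weak_deriv) (simp add: sobolev_def)

lemma average_eq: "average u = Re (fc u 0)"
proof -
  have 1: "square_integrable (\<lambda>p. 1)" by (auto simp: square_integrable_def periodic_def)
  have "average (abs_l2_torus f) = inner (abs_l2_torus f) (trigL 1 0)" if "square_integrable f" for f
  proof -
    have "average (abs_l2_torus f) = (LINT p|torus. f p)"
      by (rule average.abs_eq) (simp add: l2_rel_refl that)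
    then show ?thesis by (simp add: trigL_def inner_abs that square_integrable_trig)
  qed
  from this[OF square_integrable_rep, of u] show ?thesis by (simp add: fc_def)
qed

lemma average_0_iff: "average u = 0 \<longleftrightarrow> fc u 0 = 0"
proof -
  have "Im (fc u 0) = 0" using arg_cong[OF fc_minus[of u 0], of Im] by simp
  then show ?thesis by (auto simp: average_eq complex_eq_iff)
qed

section \<open>The elliptic inverses and the velocity\<close>

definition lam :: "freq \<Rightarrow> real" where
  "lam k = 4 * pi\<^sup>2 * ((real_of_int (fst k))\<^sup>2 + (real_of_int (snd k))\<^sup>2)"

lemma lam_nonneg [simp]: "0 \<le> lam k"
  by (simp add: lam_def)

lemma lam_minus [simp]: "lam (- k) = lam k"
  by (simp add: lam_def)

lemma wt_square_le: "(wt k)\<^sup>2 \<le> 3 * (1 + lam k)"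
proof -
  define a b where "a = \<bar>real_of_int (fst k)\<bar>" and "b = \<bar>real_of_int (snd k)\<bar>"
  have "(1 + a + b)\<^sup>2 \<le> 3 * (1 + a\<^sup>2 + b\<^sup>2)"
    using sum_squares_bound[of 1 a] sum_squares_bound[of 1 b] sum_squares_bound[of a b]
    by (simp add: power2_eq_square algebra_simps)
  also have "\<dots> \<le> 3 * (1 + lam k)"
  proof -
    have "1 \<le> pi" using pi_gt3 by simp
    then have "1 \<le> pi\<^sup>2" by (rule one_le_power)
    then have "1 \<le> 4 * pi\<^sup>2" by simp
    then have "1 * (a\<^sup>2 + b\<^sup>2) \<le> 4 * pi\<^sup>2 * (a\<^sup>2 + b\<^sup>2)" by (intro mult_right_mono) auto
    then show ?thesis by (simp add: lam_def a_def b_def)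
  qed
  finally show ?thesis by (simp add: wt_def a_def b_def)
qed

lemma fc_laplacian: "u \<in> sobolev 2 \<Longrightarrow> fc (laplacian u) k = - of_real (lam k) * fc u k"
  by (simp add: laplacian_def fc_add sobolev_weak_deriv)
    (simp add: D_def D1_def D2_def lam_def power2_eq_square algebra_simps)

text \<open>\<open>inv_into\<close> returns a preimage in W^{2,2}. One exists since dividing by
  \<sigma> gains two powers of the weight, and it is the only one since \<sigma> has no
  zero.\<close>

lemma inverse_multiplier:
  assumes inv: "\<And>w k. w \<in> sobolev 2 \<Longrightarrow> fc (L w) k = of_real (\<sigma> k) * fc w k"
    and \<sigma>: "\<And>k. \<sigma> k \<noteq> 0" "\<And>k. \<sigma> (- k) = \<sigma> k" and C: "\<And>k. (wt k)\<^sup>2 \<le> C * \<bar>\<sigma> k\<bar>"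
  shows "inv_into (sobolev 2) L g \<in> sobolev 2" "fc (inv_into (sobolev 2) L g) k = fc g k / of_real (\<sigma> k)"
proof -
  define c where "c k = fc g k / of_real (\<sigma> k)" for k
  have C0: "0 \<le> C"
  proof (rule ccontr)
    assume "\<not> 0 \<le> C"
    then have "C * \<bar>\<sigma> 0\<bar> \<le> 0" by (intro mult_nonpos_nonneg) auto
    then show False using C[of 0] zero_less_power[OF wt_pos[of 0], of 2] by linarith
  qed
  have wb: "wbound (\<lambda>k. wt k ^ 2) c (C * norm g)"
  proof (rule wbound_mono[OF bessel, where c = C])
    fix k
    have "(wt k)\<^sup>2 * (cmod (fc g k) / \<bar>\<sigma> k\<bar>) \<le> (C * \<bar>\<sigma> k\<bar>) * (cmod (fc g k) / \<bar>\<sigma> k\<bar>)"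
      by (intro mult_right_mono C) auto
    then show "wt k ^ 2 * cmod (c k) \<le> C * (1 * cmod (fc g k))"
      using \<sigma>(1)[of k] by (simp add: c_def norm_divide mult_ac)
  qed (use C0 in auto)
  have "c (- k) = cnj (c k)" for k by (simp add: c_def fc_minus \<sigma>)
  moreover have "wbound (\<lambda>k. 1) c (C * norm g)" using wbound_power_weaken[OF wb, of 0] by simp
  ultimately obtain w where w: "\<And>k. fc w k = c k" using ex_fc by metis
  then have fw: "fc w = c" by auto
  have ws: "w \<in> sobolev 2" using wb fw sobolev_iff by auto
  have Lw: "L w = g" by (rule fc_eqI) (simp add: inv[OF ws] w c_def \<sigma>)
  have "inj_on L (sobolev 2)"
  proof (rule inj_onI)
    fix x y assume xy: "x \<in> sobolev 2" "y \<in> sobolev 2" "L x = L y"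
    show "x = y"
    proof (rule fc_eqI)
      fix k show "fc x k = fc y k" using inv[OF xy(1), of k] inv[OF xy(2), of k] xy(3) \<sigma>(1)[of k] by simp
    qed
  qed
  then have "inv_into (sobolev 2) L g = w" using inv_into_f_f[of L "sobolev 2" w] ws Lw by simp
  then show "inv_into (sobolev 2) L g \<in> sobolev 2" "fc (inv_into (sobolev 2) L g) k = fc g k / of_real (\<sigma> k)"
    using ws w by (simp_all add: c_def)
qed

lemma inv_laplacian:
  "fc (inv_laplacian_minus_1 g) k = - fc g k / of_real (1 + lam k)"
proof -
  have m: "fc (laplacian w - w) k = of_real (- (1 + lam k)) * fc w k" if "w \<in> sobolev 2" for w k
    using that by (simp add: fc_diff fc_laplacian algebra_simps)
  have nz: "- (1 + lam k) \<noteq> 0" for k using lam_nonneg[of k] by linarith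
  have le: "(wt k)\<^sup>2 \<le> 3 * \<bar>- (1 + lam k)\<bar>" for k using wt_square_le[of k] lam_nonneg[of k] by linarith
  note im = inverse_multiplier[of "\<lambda>w. laplacian w - w" "\<lambda>k. - (1 + lam k)" 3, OF m nz _ le]
  have "fc (inv_laplacian_minus_1 g) k = fc g k / of_real (- (1 + lam k))"
    unfolding inv_laplacian_minus_1_def by (rule im) auto
  then show "fc (inv_laplacian_minus_1 g) k = - fc g k / of_real (1 + lam k)"
    by (simp only: of_real_minus divide_minus_right minus_divide_left)
qed

lemma inv_1_minus:
  assumes "0 < \<alpha>"
  shows "inv_1_minus_laplacian \<alpha> g \<in> sobolev 2"
    "fc (inv_1_minus_laplacian \<alpha> g) k = fc g k / of_real (1 + \<alpha> * lam k)"
proof -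
  have m: "fc (w - \<alpha> *\<^sub>R laplacian w) k = of_real (1 + \<alpha> * lam k) * fc w k" if "w \<in> sobolev 2" for w k
    using that by (simp add: fc_diff fc_scaleR fc_laplacian algebra_simps)
  have p: "0 < 1 + \<alpha> * lam k" for k using assms by (intro add_pos_nonneg) auto
  have "1 + \<alpha> * lam k \<noteq> 0" for k using p[of k] by linarith
  moreover have "(wt k)\<^sup>2 \<le> (3 * (1 + 1 / \<alpha>)) * \<bar>1 + \<alpha> * lam k\<bar>" for k
  proof -
    have "1 + lam k \<le> (1 + 1 / \<alpha>) * (1 + \<alpha> * lam k)"
      using assms lam_nonneg[of k] by (simp add: field_simps)
    then have "(wt k)\<^sup>2 \<le> 3 * ((1 + 1 / \<alpha>) * (1 + \<alpha> * lam k))"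
      by (intro order_trans[OF wt_square_le mult_left_mono]) auto
    then show ?thesis using p[of k] by (simp only: abs_of_pos mult.assoc)
  qed
  ultimately show "inv_1_minus_laplacian \<alpha> g \<in> sobolev 2"
    "fc (inv_1_minus_laplacian \<alpha> g) k = fc g k / of_real (1 + \<alpha> * lam k)"
    unfolding inv_1_minus_laplacian_def
    by (intro inverse_multiplier[of "\<lambda>w. w - \<alpha> *\<^sub>R laplacian w" "\<lambda>k. 1 + \<alpha> * lam k" "3 * (1 + 1 / \<alpha>)", OF m]; simp)+
qed

definition mul :: "real \<Rightarrow> freq \<Rightarrow> real" where
  "mul \<alpha> k = - 1 / ((1 + lam k) * (1 + \<alpha> * lam k))"

text \<open>Each of the two second-order factors absorbs \<open>(wt k)\<^sup>2\<close> at the price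
  of a 3. The factor \<open>1 + 1 / \<alpha>\<close> compares \<open>1 + lam k\<close> with
  \<open>1 + \<alpha> * lam k\<close> for small and large \<alpha> alike.\<close>

lemma mul_le:
  assumes "0 < \<alpha>" shows "wt k ^ 4 * \<bar>mul \<alpha> k\<bar> \<le> 9 * (1 + 1 / \<alpha>)"
proof -
  have p: "0 < 1 + \<alpha> * lam k" "0 < 1 + lam k" using assms lam_nonneg[of k] by (auto intro!: add_pos_nonneg)
  have "1 + lam k \<le> (1 + 1 / \<alpha>) * (1 + \<alpha> * lam k)"
    using assms lam_nonneg[of k] by (simp add: field_simps)
  then have "(wt k)\<^sup>2 \<le> 3 * ((1 + 1 / \<alpha>) * (1 + \<alpha> * lam k))"
    by (intro order_trans[OF wt_square_le mult_left_mono]) auto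
  then have "(wt k)\<^sup>2 * (wt k)\<^sup>2 \<le> (3 * (1 + lam k)) * (3 * ((1 + 1 / \<alpha>) * (1 + \<alpha> * lam k)))"
    using p assms wt_square_le[of k] by (intro mult_mono) auto
  then have "wt k ^ 4 \<le> 9 * (1 + 1 / \<alpha>) * ((1 + lam k) * (1 + \<alpha> * lam k))"
  proof -
    have "(3 * x) * (3 * (P * y)) = 9 * P * (x * y)" for x P y :: real by simp
    moreover have "(wt k)\<^sup>2 * (wt k)\<^sup>2 = wt k ^ 4" by (simp flip: power_add)
    ultimately show ?thesis
      using \<open>(wt k)\<^sup>2 * (wt k)\<^sup>2 \<le> (3 * (1 + lam k)) * (3 * ((1 + 1 / \<alpha>) * (1 + \<alpha> * lam k)))\<close> by (simp only:)
  qed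
  then show ?thesis using p by (simp add: mul_def abs_mult divide_simps)
qed

lemma velocity_eq:
  assumes "0 < \<alpha>"
  shows "fc (fst (velocity \<alpha> f w)) k = - D2 k * (of_real (mul \<alpha> k) * (fc w k - fc f k))"
    "fc (snd (velocity \<alpha> f w)) k = D1 k * (of_real (mul \<alpha> k) * (fc w k - fc f k))"
proof -
  let ?\<psi> = "inv_1_minus_laplacian \<alpha> (inv_laplacian_minus_1 (w - f))"
  have \<psi>: "fc ?\<psi> k = of_real (mul \<alpha> k) * (fc w k - fc f k)"
  proof -
    have "fc ?\<psi> k = (- (fc w k - fc f k) / of_real (1 + lam k)) / of_real (1 + \<alpha> * lam k)"
      by (simp only: inv_1_minus[OF assms] inv_laplacian fc_diff)
    also have "\<dots> = (- 1 / (of_real (1 + lam k) * of_real (1 + \<alpha> * lam k))) * (fc w k - fc f k)"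
      by (simp only: divide_divide_eq_left mult_minus1 times_divide_eq_left)
    also have "- 1 / (of_real (1 + lam k) * of_real (1 + \<alpha> * lam k)) = (of_real (mul \<alpha> k) :: complex)"
      by (simp only: mul_def of_real_divide of_real_mult of_real_minus of_real_1)
    finally show ?thesis .
  qed
  have d: "fc (weak_deriv 0 1 ?\<psi>) k = D 0 1 k * fc ?\<psi> k" "fc (weak_deriv 1 0 ?\<psi>) k = D 1 0 k * fc ?\<psi> k"
    by (rule sobolev_weak_deriv[OF inv_1_minus(1)[OF assms]]; simp)+
  show "fc (fst (velocity \<alpha> f w)) k = - D2 k * (of_real (mul \<alpha> k) * (fc w k - fc f k))"
    "fc (snd (velocity \<alpha> f w)) k = D1 k * (of_real (mul \<alpha> k) * (fc w k - fc f k))"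
    unfolding velocity_def grad_perp_def fst_conv snd_conv fc_uminus d D_simps \<psi>
    by (simp_all only: minus_mult_left)
qed

section \<open>Products\<close>

definition cv :: "(freq \<Rightarrow> complex) \<Rightarrow> (freq \<Rightarrow> complex) \<Rightarrow> freq \<Rightarrow> complex" where
  "cv a b k = (\<Sum>\<^sub>\<infinity>l. a (k - l) * b l)"

lemma cv_partial:
  assumes "wbound (\<lambda>k. 1) a A" "wbound (\<lambda>k. 1) b B" "finite L"
  shows "(\<Sum>l\<in>L. cmod (a (k - l) * b l)) \<le> A * B"
proof -
  have "(\<Sum>l\<in>L. cmod (a (k - l) * b l)) = (\<Sum>l\<in>L. (1 * cmod (a (k - l))) * (1 * cmod (b l)))"
    by (simp add: norm_mult)
  also have "\<dots> \<le> L2_set (\<lambda>l. 1 * cmod (a (k - l))) L * L2_set (\<lambda>l. 1 * cmod (b l)) L"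
    by (rule sum_mult_le_L2_set)
  also have "L2_set (\<lambda>l. 1 * cmod (a (k - l))) L = L2_set (\<lambda>l. 1 * cmod (a l)) ((\<lambda>l. k - l) ` L)"
    by (subst L2_set_reindex) (auto simp: inj_on_def)
  also have "\<dots> * L2_set (\<lambda>l. 1 * cmod (b l)) L \<le> A * B"
    using assms by (intro mult_mono wboundD) (auto dest: wbound_nonneg)
  finally show ?thesis .
qed

lemma cv_summable:
  assumes "wbound (\<lambda>k. 1) a A" "wbound (\<lambda>k. 1) b B"
  shows "(\<lambda>l. a (k - l) * b l) summable_on UNIV"
proof (rule abs_summable_summable)
  show "(\<lambda>l. norm (a (k - l) * b l)) summable_on UNIV"
    unfolding abs_summable_iff_bdd_above bdd_above_def using cv_partial[OF assms] by blast
qed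

text \<open>Lets unconditional sums be evaluated along boxes, to match the partial sums in
  \<open>parseval\<close>.\<close>

lemma filterlim_fbox: "filterlim fbox (finite_subsets_at_top UNIV) sequentially"
  unfolding filterlim_def le_filter_def eventually_filtermap eventually_finite_subsets_at_top
proof (intro allI impI)
  fix P assume "\<exists>X :: freq set. finite X \<and> X \<subseteq> UNIV \<and> (\<forall>Y. finite Y \<and> X \<subseteq> Y \<and> Y \<subseteq> UNIV \<longrightarrow> P Y)"
  then obtain X where X: "finite X" "\<And>Y. finite Y \<Longrightarrow> X \<subseteq> Y \<Longrightarrow> P Y" by auto
  obtain n where n: "X \<subseteq> fbox n" using finite_subset_fbox[OF X(1)] by blast
  have "P (fbox m)" if "n \<le> m" for m
    using X(2)[OF finite_fbox, of m] n fbox_mono[OF that] by blast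
  then show "\<forall>\<^sub>F m in sequentially. P (fbox m)" by (rule eventually_sequentiallyI)
qed

lemma cv_box_limit:
  assumes "wbound (\<lambda>k. 1) a A" "wbound (\<lambda>k. 1) b B"
  shows "(\<lambda>n. \<Sum>l\<in>fbox n. a (k - l) * b l) \<longlonglongrightarrow> cv a b k"
  unfolding cv_def by (rule filterlim_compose[OF infsum_tendsto[OF cv_summable[OF assms]] filterlim_fbox])

text \<open>The powers distribute by \<open>wt_le_mult\<close>; the two extra ones make
  \<open>a\<close> summable.\<close>

lemma wbound_cv:
  assumes "wbound (\<lambda>k. wt k ^ q) a A" "q = p + 2" and b: "wbound (\<lambda>k. wt k ^ p) b B"
  shows "wbound (\<lambda>k. wt k ^ p) (cv a b) (c0 * A * B)"
proof (rule wbound_limit)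
  have a: "wbound (\<lambda>k. wt k ^ (p + 2)) a A" using assms by simp
  have a0: "wbound (\<lambda>k. 1) a A" using wbound_power_weaken[OF a, of 0] by simp
  have b0: "wbound (\<lambda>k. 1) b B" using wbound_power_weaken[OF b, of 0] by simp
  show "(\<lambda>n. \<Sum>l\<in>fbox n. a (k - l) * b l) \<longlonglongrightarrow> cv a b k" for k
    by (rule cv_box_limit[OF a0 b0])
  have "wbound (\<lambda>k. wt k ^ p) (\<lambda>k. \<Sum>l\<in>fbox n. a (k - l) * b l) (c0 * A * B)" for n
  proof (rule wboundI)
    fix K :: "freq set" assume K: "finite K"
    have "L2_set (\<lambda>k. wt k ^ p * cmod (\<Sum>l\<in>fbox n. a (k - l) * b l)) K
      \<le> L2_set (\<lambda>k. \<Sum>l\<in>fbox n. (wt (k - l) ^ p * cmod (a (k - l))) * (wt l ^ p * cmod (b l))) K"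
    proof (rule L2_set_mono)
      fix k
      have "wt k ^ p * cmod (\<Sum>l\<in>fbox n. a (k - l) * b l) \<le> wt k ^ p * (\<Sum>l\<in>fbox n. cmod (a (k - l) * b l))"
        by (intro mult_left_mono norm_sum) auto
      also have "\<dots> = (\<Sum>l\<in>fbox n. wt k ^ p * (cmod (a (k - l)) * cmod (b l)))"
        by (simp add: sum_distrib_left norm_mult)
      also have "\<dots> \<le> (\<Sum>l\<in>fbox n. (wt (k - l) * wt l) ^ p * (cmod (a (k - l)) * cmod (b l)))"
        by (intro sum_mono mult_right_mono power_mono wt_le_mult) auto
      also have "\<dots> = (\<Sum>l\<in>fbox n. (wt (k - l) ^ p * cmod (a (k - l))) * (wt l ^ p * cmod (b l)))"
        by (simp add: power_mult_distrib mult_ac)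
      finally show "wt k ^ p * cmod (\<Sum>l\<in>fbox n. a (k - l) * b l)
        \<le> (\<Sum>l\<in>fbox n. (wt (k - l) ^ p * cmod (a (k - l))) * (wt l ^ p * cmod (b l)))" .
    qed auto
    also have "\<dots> \<le> c0 * A * B"
    proof (rule L2_set_convolution_le[OF K])
      fix M :: "freq set" assume "finite M"
      then show "L2_set (\<lambda>m. (wt m)\<^sup>2 * (wt m ^ p * cmod (a m))) M \<le> A"
        using wboundD[OF a, of M] by (simp add: power_add power2_eq_square mult_ac)
    qed (use wboundD[OF b] in auto)
    finally show "L2_set (\<lambda>k. wt k ^ p * cmod (\<Sum>l\<in>fbox n. a (k - l) * b l)) K \<le> c0 * A * B" .
  qed
  then show "\<forall>\<^sub>F n in sequentially. wbound (\<lambda>k. wt k ^ p) (\<lambda>k. \<Sum>l\<in>fbox n. a (k - l) * b l) (c0 * A * B)" by simp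
qed auto

lemma tp_abs: "finite K \<Longrightarrow> tp K c = abs_l2_torus (\<lambda>p. \<Sum>k\<in>K. trig (c k) k p) \<and> square_integrable (\<lambda>p. \<Sum>k\<in>K. trig (c k) k p)"
proof (induction K rule: finite_induct)
  case empty
  then show ?case by (simp add: tp_def square_integrable_zero zero_l2_torus_def)
next
  case (insert k K)
  then show ?case
    by (simp add: tp_def trigL_def plus_abs square_integrable_trig square_integrable_add)
qed

text \<open>The excess \<open>max 0 (\<bar>u\<bar> - C)\<close> is dominated by the distance to the partial sums, all of which
  are bounded by \<open>C\<close>.\<close>

lemma AE_bounded_of_l1:
  assumes B: "wbound (\<lambda>k. wt k ^ 2) (fc u) B"
  shows "AE p in torus. \<bar>rep_l2_torus u p\<bar> \<le> c0 * B"
proof -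
  let ?u = "rep_l2_torus u"
  define C where "C = c0 * B"
  define s where "s n p = (\<Sum>k\<in>fbox n. trig (fc u k) k p)" for n p
  have s: "tp (fbox n) (fc u) = abs_l2_torus (s n)" "square_integrable (s n)" for n
    unfolding s_def[abs_def] using tp_abs[of "fbox n" "fc u"] by auto
  have sb: "\<bar>s n p\<bar> \<le> C" for n p
  proof -
    have "\<bar>s n p\<bar> \<le> (\<Sum>k\<in>fbox n. cmod (fc u k))"
      unfolding s_def by (rule order_trans[OF sum_abs]) (intro sum_mono abs_trig_le)
    also have "\<dots> \<le> C"
      unfolding C_def by (rule sum_le_weighted_L2) (use wboundD[OF B] in auto)
    finally show ?thesis .
  qed
  define g where "g p = (max 0 (\<bar>?u p\<bar> - C))" for p
  have um: "?u \<in> borel_measurable torus" by (rule square_integrable_measurable[OF square_integrable_rep])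
  have gm: "g \<in> borel_measurable torus" unfolding g_def using um by measurable
  have C0: "0 \<le> C" using sb[of 0 0] by linarith
  have gu: "(g p)\<^sup>2 \<le> (?u p)\<^sup>2" for p
    using C0 by (subst abs_le_square_iff[symmetric]) (auto simp: g_def)
  have gi: "integrable torus (\<lambda>p. (g p)\<^sup>2)"
  proof (rule Bochner_Integration.integrable_bound)
    show "integrable torus (\<lambda>p. (?u p)\<^sup>2)" using square_integrable_rep[of u] by (simp add: square_integrable_def)
    show "(\<lambda>p. (g p)\<^sup>2) \<in> borel_measurable torus" using gm by measurable
    show "AE p in torus. norm ((g p)\<^sup>2) \<le> norm ((?u p)\<^sup>2)" using gu by simp
  qed
  have le: "(LINT p|torus. (g p)\<^sup>2) \<le> (norm (u - tp (fbox n) (fc u)))\<^sup>2" for n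
  proof -
    have sq: "square_integrable (\<lambda>p. ?u p - s n p)" by (rule square_integrable_diff[OF square_integrable_rep s(2)])
    have "(LINT p|torus. (g p)\<^sup>2) \<le> (LINT p|torus. (?u p - s n p)\<^sup>2)"
    proof (rule integral_mono)
      show "(g p)\<^sup>2 \<le> (?u p - s n p)\<^sup>2" for p
        using sb[of n p] by (subst abs_le_square_iff[symmetric]) (auto simp: g_def)
      show "integrable torus (\<lambda>p. (?u p - s n p)\<^sup>2)" using sq by (simp add: square_integrable_def)
    qed (rule gi)
    also have "\<dots> = (norm (abs_l2_torus (\<lambda>p. ?u p - s n p)))\<^sup>2" by (rule norm_abs_power2[OF sq, symmetric])
    also have "\<dots> = (norm (u - tp (fbox n) (fc u)))\<^sup>2"
      unfolding s(1) using diff_abs[OF square_integrable_rep s(2), of u n] by simp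
    finally show ?thesis .
  qed
  obtain w where w: "(\<lambda>n. tp (fbox n) (fc u)) \<longlonglongrightarrow> w" "\<And>k. fc w k = fc u k"
    using riesz_fischer[OF fc_minus bessel] by blast
  have "w = u" using w(2) by (rule fc_eqI)
  have "(\<lambda>n. (norm (u - tp (fbox n) (fc u)))\<^sup>2) \<longlonglongrightarrow> (norm (u - u))\<^sup>2"
    using w(1) unfolding \<open>w = u\<close> by (intro tendsto_intros)
  then have "(LINT p|torus. (g p)\<^sup>2) \<le> (norm (u - u))\<^sup>2"
    by (rule LIMSEQ_le_const) (use le in auto)
  then have "(LINT p|torus. (g p)\<^sup>2) = 0" by (intro antisym) auto
  then have "AE p in torus. (g p)\<^sup>2 = 0"
    using integral_nonneg_eq_0_iff_AE[OF gi] by auto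
  then show ?thesis by eventually_elim (auto simp: g_def C_def max_def split: if_splits)
qed

lemma l2_mult_abs:
  assumes "square_integrable (\<lambda>p. rep_l2_torus u p * rep_l2_torus v p)"
  shows "u \<cdot> v = abs_l2_torus (\<lambda>p. rep_l2_torus u p * rep_l2_torus v p)"
  using l2_mult.abs_eq[of "rep_l2_torus u" "rep_l2_torus v"] assms
  by (simp add: l2_rel_refl square_integrable_rep)

lemma square_integrable_AE_mult:
  assumes u: "square_integrable u" and v: "square_integrable v" and B: "AE p in torus. \<bar>u p\<bar> \<le> B"
  shows "square_integrable (\<lambda>p. u p * v p)"
proof -
  have m: "(\<lambda>p. u p * v p) \<in> borel_measurable borel" using u v by (auto simp: square_integrable_def)
  have "integrable torus (\<lambda>p. (u p * v p)\<^sup>2)"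
  proof (rule Bochner_Integration.integrable_bound)
    show "integrable torus (\<lambda>p. B\<^sup>2 * (v p)\<^sup>2)" using v by (simp add: square_integrable_def)
    show "(\<lambda>p. (u p * v p)\<^sup>2) \<in> borel_measurable torus"
      by (intro borel_measurable_power measurable_torus m)
    show "AE p in torus. norm ((u p * v p)\<^sup>2) \<le> norm (B\<^sup>2 * (v p)\<^sup>2)"
      using B
    proof eventually_elim
      case (elim p)
      then have "(u p)\<^sup>2 \<le> B\<^sup>2" by (subst abs_le_square_iff[symmetric]) auto
      then show ?case by (simp add: power_mult_distrib mult_right_mono)
    qed
  qed
  then show ?thesis using u v m by (simp add: square_integrable_def periodic_def)
qed

text \<open>Boundedness of \<open>u\<close> puts the product in L^2, so the default value of
  \<open>l2_mult\<close> is not taken. Testing the product with a trigonometric function amounts to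
  testing \<open>u\<close> with that function times \<open>v\<close>, whose coefficients are shifts
  of those of \<open>v\<close>; Parseval then gives the convolution.\<close>

lemma fc_l2_mult:
  assumes B: "wbound (\<lambda>k. wt k ^ 2) (fc u) B"
  shows "fc (u \<cdot> v) k = cv (fc v) (fc u) k"
proof -
  let ?u = "rep_l2_torus u" and ?v = "rep_l2_torus v"
  have uv: "square_integrable (\<lambda>p. ?u p * ?v p)"
    by (rule square_integrable_AE_mult[OF square_integrable_rep square_integrable_rep AE_bounded_of_l1[OF B]])
  have b0: "wbound (\<lambda>k. 1) (fc u) B" using wbound_power_weaken[OF B, of 0] by simp
  have "Re (cnj a * fc (u \<cdot> v) k) = Re (cnj a * cv (fc v) (fc u) k)" for a
  proof -
    have va: "square_integrable (\<lambda>p. trig a k p * ?v p)"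
      by (rule square_integrable_AE_mult[OF square_integrable_trig square_integrable_rep, where B = "cmod a"])
        (simp add: abs_trig_le)
    define w where "w = abs_l2_torus (\<lambda>p. trig a k p * ?v p)"
    have w: "fc w l = (cnj a * fc v (k + l) + a * cnj (fc v (k - l))) / 2" for l
    proof (rule complex_eqI_Re_cnj)
      fix b
      have "inner w (trigL b l) = (LINT p|torus. trig a k p * ?v p * trig b l p)"
        unfolding w_def trigL_def by (rule inner_abs[OF va square_integrable_trig])
      also have "\<dots> = (LINT p|torus. (?v p * trig (a * b) (k + l) p + ?v p * trig (a * cnj b) (k - l) p) / 2)"
      proof (rule Bochner_Integration.integral_cong[OF refl])
        fix p
        have "trig a k p * ?v p * trig b l p = ?v p * (trig a k p * trig b l p)" by simp
        then show "trig a k p * ?v p * trig b l p = (?v p * trig (a * b) (k + l) p + ?v p * trig (a * cnj b) (k - l) p) / 2"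
          unfolding trig_mult by (simp add: algebra_simps)
      qed
      also have "\<dots> = (inner v (trigL (a * b) (k + l)) + inner v (trigL (a * cnj b) (k - l))) / 2"
        by (simp add: integral_rep_trig[symmetric] integrable_torus_mult square_integrable_rep square_integrable_trig)
      finally show "Re (cnj b * fc w l) = Re (cnj b * ((cnj a * fc v (k + l) + a * cnj (fc v (k - l))) / 2))"
        unfolding inner_trigL by (simp add: algebra_simps)
    qed
    have "inner (u \<cdot> v) (trigL a k) = (LINT p|torus. (?u p * ?v p) * trig a k p)"
      unfolding l2_mult_abs[OF uv] trigL_def by (rule inner_abs[OF uv square_integrable_trig])
    also have "\<dots> = inner u w"
      unfolding w_def using inner_abs[OF square_integrable_rep va, of u] by (simp add: mult_ac)
    finally have "inner u w = Re (cnj a * fc (u \<cdot> v) k)" by (simp only: inner_trigL)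
    moreover have "(\<lambda>n. \<Sum>l\<in>fbox n. Re (cnj (fc w l) * fc u l)) \<longlonglongrightarrow> Re (cnj a * cv (fc v) (fc u) k)"
    proof -
      have "(\<Sum>l\<in>fbox n. Re (cnj (fc w l) * fc u l)) = Re (cnj a * (\<Sum>l\<in>fbox n. fc v (k - l) * fc u l))" for n
      proof -
        \<comment> \<open>Reflecting the summation index shows that the two halves of the
          product-to-sum formula contribute equally.\<close>
        have "(\<Sum>l\<in>fbox n. Re (a * cnj (fc v (k + l)) * fc u l)) = (\<Sum>l\<in>fbox n. Re (a * cnj (fc v (k - l)) * fc u (- l)))"
          by (rule sum.reindex_bij_witness[of _ uminus uminus]) (auto simp: fbox_minus)
        also have "\<dots> = (\<Sum>l\<in>fbox n. Re (cnj a * fc v (k - l) * fc u l))"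
        proof (rule sum.cong[OF refl])
          fix l
          have "a * cnj (fc v (k - l)) * fc u (- l) = cnj (cnj a * fc v (k - l) * fc u l)" by (simp add: fc_minus)
          then show "Re (a * cnj (fc v (k - l)) * fc u (- l)) = Re (cnj a * fc v (k - l) * fc u l)"
            by (simp only: cnj.sel)
        qed
        finally have *: "(\<Sum>l\<in>fbox n. Re (a * cnj (fc v (k + l)) * fc u l)) = (\<Sum>l\<in>fbox n. Re (cnj a * fc v (k - l) * fc u l))" .
        have "(\<Sum>l\<in>fbox n. Re (cnj (fc w l) * fc u l))
            = ((\<Sum>l\<in>fbox n. Re (a * cnj (fc v (k + l)) * fc u l)) + (\<Sum>l\<in>fbox n. Re (cnj a * fc v (k - l) * fc u l))) / 2"
          unfolding w sum.distrib[symmetric] sum_divide_distrib by (intro sum.cong refl) (simp add: algebra_simps)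
        also have "\<dots> = (\<Sum>l\<in>fbox n. Re (cnj a * fc v (k - l) * fc u l))" unfolding * by simp
        also have "\<dots> = Re (cnj a * (\<Sum>l\<in>fbox n. fc v (k - l) * fc u l))"
          unfolding sum_distrib_left Re_sum by (simp only: mult.assoc)
        finally show ?thesis .
      qed
      moreover have "(\<lambda>n. Re (cnj a * (\<Sum>l\<in>fbox n. fc v (k - l) * fc u l))) \<longlonglongrightarrow> Re (cnj a * cv (fc v) (fc u) k)"
        by (intro tendsto_Re tendsto_mult tendsto_const cv_box_limit[OF bessel b0])
      ultimately show ?thesis by simp
    qed
    ultimately show ?thesis using LIMSEQ_unique[OF parseval[of w u]] by simp
  qed
  then show ?thesis by (rule complex_eqI_Re_cnj)
qed

text \<open>The perpendicular gradient on coefficients, as a relation to a bare sequence; it treats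
  the velocity of the solution and the given field alike.\<close>

definition stream_field :: "(freq \<Rightarrow> complex) \<Rightarrow> l2_torus \<times> l2_torus \<Rightarrow> bool" where
  "stream_field g v \<longleftrightarrow> (\<forall>k. fc (fst v) k = - D2 k * g k \<and> fc (snd v) k = D1 k * g k)"

text \<open>The divergence of a product is a symbol times a convolution. Because the field is a
  perpendicular gradient, the terms without \<open>l\<close> cancel in the combined symbol and
  \<open>cr\<close> remains; this is the passage from divergence form to \<open>jac\<close>.\<close>

lemma fc_div_flux:
  assumes b: "wbound (\<lambda>k. wt k ^ 2) (fc b) B" and g: "wbound (\<lambda>k. wt k ^ 4) g G" and v: "stream_field g v"
  shows "fc (div_flux b v) k = jac g (fc b) k"
proof -
  have v1: "fc (fst v) k = - D2 k * g k" and v2: "fc (snd v) k = D1 k * g k" for k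
    using v by (simp_all add: stream_field_def)
  have b1: "wbound (\<lambda>k. wt k ^ 1) (fc b) B" by (rule wbound_power_weaken[OF b]) simp
  have b0: "wbound (\<lambda>k. 1) (fc b) B" using wbound_power_weaken[OF b, of 0] by simp
  have gen: "wbound (\<lambda>k. wt k ^ 3) x (2 * pi * G)"
    if "\<And>k. cmod (x k) = cmod (D m n k) * cmod (g k)" "m + n = 1" for x m n
  proof (rule wbound_mono[OF g, where c = "2 * pi"])
    fix k
    have "cmod (D m n k) \<le> 2 * pi * wt k" using cmod_D_le[of m n 1 k] that(2) by simp
    then have "wt k ^ 3 * cmod (D m n k) * cmod (g k) \<le> wt k ^ 3 * (2 * pi * wt k) * cmod (g k)"
      by (intro mult_right_mono mult_left_mono) auto
    then show "wt k ^ 3 * cmod (x k) \<le> 2 * pi * (wt k ^ 4 * cmod (g k))"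
      unfolding that(1) by (simp add: power4_eq_xxxx power3_eq_cube mult_ac)
  qed auto
  have w: "wbound (\<lambda>k. wt k ^ 3) (fc (fst v)) (2 * pi * G)" "wbound (\<lambda>k. wt k ^ 3) (fc (snd v)) (2 * pi * G)"
  proof -
    have "cmod (fc (fst v) k) = cmod (D 0 1 k) * cmod (g k)" "cmod (fc (snd v) k) = cmod (D 1 0 k) * cmod (g k)" for k
      unfolding D_simps v1 v2 norm_mult norm_minus_cancel by (rule refl)+
    then show "wbound (\<lambda>k. wt k ^ 3) (fc (fst v)) (2 * pi * G)" "wbound (\<lambda>k. wt k ^ 3) (fc (snd v)) (2 * pi * G)"
      by (intro gen[of "fc (fst v)" 0 1] gen[of "fc (snd v)" 1 0]; simp)+
  qed
  have ex: "\<exists>z. has_weak_deriv m n (b \<cdot> y) z" if "m + n = 1" "wbound (\<lambda>k. wt k ^ 3) (fc y) (2 * pi * G)" for m n y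
  proof -
    have "fc (b \<cdot> y) = cv (fc y) (fc b)" using fc_l2_mult[OF b] by auto
    then have "wbound (\<lambda>k. wt k ^ 1) (fc (b \<cdot> y)) (c0 * (2 * pi * G) * B)"
      using wbound_cv[OF that(2) _ b1] by simp
    then have "b \<cdot> y \<in> sobolev 1" using sobolev_iff by blast
    then show ?thesis using that(1) by (simp add: sobolev_def)
  qed
  have u0: "wbound (\<lambda>k. 1) (fc (fst v)) (2 * pi * G)" "wbound (\<lambda>k. 1) (fc (snd v)) (2 * pi * G)"
    using wbound_power_weaken[OF w(1), of 0] wbound_power_weaken[OF w(2), of 0] by simp_all
  note s1 = cv_summable[OF u0(1) b0, of k] and s2 = cv_summable[OF u0(2) b0, of k]
  have "fc (div_flux b v) k = D1 k * cv (fc (fst v)) (fc b) k + D2 k * cv (fc (snd v)) (fc b) k"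
    unfolding div_flux_def fc_add
    by (simp add: fc_weak_deriv[OF ex[OF _ w(1)]] fc_weak_deriv[OF ex[OF _ w(2)]] fc_l2_mult[OF b] D_simps[unfolded One_nat_def])
  also have "\<dots> = (\<Sum>\<^sub>\<infinity>l. D1 k * (fc (fst v) (k - l) * fc b l) + D2 k * (fc (snd v) (k - l) * fc b l))"
    unfolding cv_def infsum_cmult_right'[symmetric]
    by (intro infsum_add[symmetric] summable_on_cmult_right s1 s2)
  also have "\<dots> = jac g (fc b) k"
    unfolding jac_def
  proof (rule infsum_cong)
    fix l
    have "D1 k * (- D2 (k - l)) + D2 k * D1 (k - l) = of_real (- (4 * pi\<^sup>2) * cr k l)"
      by (simp add: D1_def D2_def cr_def complex_eq_iff power2_eq_square algebra_simps)
    then have "(D1 k * (- D2 (k - l)) + D2 k * D1 (k - l)) * (g (k - l) * fc b l)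
       = of_real (- (4 * pi\<^sup>2) * cr k l) * (g (k - l) * fc b l)" by (rule arg_cong)
    then show "D1 k * (fc (fst v) (k - l) * fc b l) + D2 k * (fc (snd v) (k - l) * fc b l)
       = of_real (- (4 * pi\<^sup>2) * cr k l) * g (k - l) * fc b l"
      unfolding v1 v2 by (simp only: algebra_simps)
  qed
  finally show ?thesis .
qed

lemma stream_field_velocity:
  assumes "0 < \<alpha>"
  shows "stream_field (\<lambda>k. of_real (mul \<alpha> k) * (fc w k - fc f k)) (velocity \<alpha> f w)"
  using velocity_eq[OF assms] by (simp add: stream_field_def)

section \<open>Strong solutions on the Fourier side\<close>

text \<open>Identifies W^{s,2}, a mere set, with the normed type \<open>l2_torus\<close>, so that
  continuity and compactness in Sobolev norms become statements about that type.\<close>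

definition lift :: "nat \<Rightarrow> l2_torus \<Rightarrow> l2_torus" where
  "lift s u = (SOME v. \<forall>k. fc v k = of_real (wt k ^ s) * fc u k)"

lemma fc_lift:
  assumes "u \<in> sobolev s"
  shows "fc (lift s u) k = of_real (wt k ^ s) * fc u k"
proof -
  have b: "wbound (\<lambda>k. 1) (\<lambda>k. of_real (wt k ^ s) * fc u k) (3 ^ Suc s * sobolev_norm s u)"
    using wbound_of_sobolev[OF assms] by (simp add: wbound_def norm_mult norm_power)
  have "of_real (wt (- k) ^ s) * fc u (- k) = cnj (of_real (wt k ^ s) * fc u k)" for k
    by (simp add: fc_minus)
  from ex_fc[OF this b] have "\<exists>v. \<forall>k. fc v k = of_real (wt k ^ s) * fc u k" by metis
  from someI_ex[OF this] show ?thesis by (simp add: lift_def)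
qed

lemma wbound_lift:
  assumes "u \<in> sobolev s"
  shows "wbound (\<lambda>k. wt k ^ s) (fc u) (norm (lift s u))"
  using bessel[of "lift s u"] by (simp add: wbound_def fc_lift[OF assms] norm_mult norm_power)

lemma sobolev_diff:
  assumes "u \<in> sobolev s" "v \<in> sobolev s" shows "u - v \<in> sobolev s"
proof (rule sobolev_of_wbound(1))
  show "wbound (\<lambda>k. wt k ^ s) (fc (u - v)) (norm (lift s u) + norm (lift s v))"
    unfolding fc_diff[abs_def] by (intro wbound_diff wbound_lift assms) simp
qed

lemma norm_lift_diff_le:
  assumes "u \<in> sobolev s" "v \<in> sobolev s"
  shows "norm (lift s u - lift s v) \<le> 3 ^ Suc s * sobolev_norm s (u - v)"
  unfolding norm_le_iff_wbound
  using wbound_of_sobolev[OF sobolev_diff[OF assms]]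
  by (simp add: wbound_def fc_diff fc_lift[OF assms(1)] fc_lift[OF assms(2)] right_diff_distrib[symmetric] norm_mult norm_power)

text \<open>After \<open>lift\<close> the curve is continuous into a normed space, and its image of
  a compact interval is bounded.\<close>

lemma continuous_sobolev_bounded:
  assumes "continuous_sobolev T s b"
  shows "\<exists>R. \<forall>t\<in>{0..T}. wbound (\<lambda>k. wt k ^ s) (fc (b t)) R"
proof -
  have b: "b t \<in> sobolev s" "((\<lambda>r. sobolev_norm s (b r - b t)) \<longlongrightarrow> 0) (at t within {0..T})" if "t \<in> {0..T}" for t
    using assms that by (auto simp: continuous_sobolev_def)
  have "continuous_on {0..T} (\<lambda>t. lift s (b t))"
    unfolding continuous_on
  proof (rule ballI)
    fix t assume t: "t \<in> {0..T}"
    have "((\<lambda>r. lift s (b r) - lift s (b t)) \<longlongrightarrow> 0) (at t within {0..T})"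
    proof (rule Lim_null_comparison)
      show "\<forall>\<^sub>F r in at t within {0..T}. norm (lift s (b r) - lift s (b t)) \<le> 3 ^ Suc s * sobolev_norm s (b r - b t)"
        unfolding eventually_at_filter by (intro always_eventually allI impI norm_lift_diff_le b t)
      show "((\<lambda>r. 3 ^ Suc s * sobolev_norm s (b r - b t)) \<longlongrightarrow> 0) (at t within {0..T})"
        by (rule tendsto_mult_right_zero[OF b(2)[OF t]])
    qed
    then show "((\<lambda>t. lift s (b t)) \<longlongrightarrow> lift s (b t)) (at t within {0..T})"
      by (simp add: LIM_zero_iff)
  qed
  then have "bounded ((\<lambda>t. lift s (b t)) ` {0..T})"
    by (intro compact_imp_bounded compact_continuous_image) auto
  then obtain R where R: "norm (lift s (b t)) \<le> R" if "t \<in> {0..T}" for t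
    unfolding bounded_iff by blast
  have "wbound (\<lambda>k. wt k ^ s) (fc (b t)) R" if "t \<in> {0..T}" for t
    by (rule wbound_weaken[OF wbound_lift[OF b(1)[OF that]]]) (use R[OF that] in auto)
  then show ?thesis by blast
qed

lemma cr_0 [simp]: "cr 0 l = 0"
  by (simp add: cr_def)

lemma jac_0 [simp]: "jac g b 0 = 0"
  by (simp add: jac_def)

lemma wbound_mono_bound: "wbound W x A \<Longrightarrow> A \<le> B \<Longrightarrow> wbound W x B"
  by (auto simp: wbound_def intro: order_trans)

context tqg_data
begin

lemma bdd_mono: "bdd R b w \<Longrightarrow> R \<le> R' \<Longrightarrow> bdd R' b w"
  by (auto simp: bdd_def intro: wbound_mono_bound)

lemma ksol_mono: "ksol K T R b w \<Longrightarrow> R \<le> R' \<Longrightarrow> ksol K T R' b w"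
  by (auto simp: ksol_def intro: bdd_mono)

definition C6 :: "real \<Rightarrow> real" where
  "C6 R = 4 * pi\<^sup>2 * (c0 * (2 * M * R + 2 * G R + H))"

text \<open>On bounded sets the right-hand sides are Lipschitz into L^2. This makes the fluxes along
  a solution continuous in time, so that their integrals exist and can be differentiated.\<close>

lemma F_diff_l2:
  assumes bdd: "bdd R b w" "bdd R b' w'"
    and \<beta>: "wbound wt (\<lambda>k. b k - b' k) \<delta>" and \<eta>: "wbound wt (\<lambda>k. w k - w' k) \<delta>"
  shows "wbound (\<lambda>k. 1) (\<lambda>k. Fb b w k - Fb b' w' k) (C6 R * \<delta>)"
    "wbound (\<lambda>k. 1) (\<lambda>k. Fw b w k - Fw b' w' k) (C6 R * \<delta>)"
proof -
  define \<Psi> where "\<Psi> k = strm w k - strm w' k" for k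
  have R: "0 \<le> R" "0 \<le> G R" "0 \<le> \<delta>" using bddD[OF bdd(1)] wbound_nonneg[OF \<beta>] by auto
  have \<eta>0: "wbound (\<lambda>k. wt k ^ 0) (\<lambda>k. w k - w' k) \<delta>"
    using wbound_power_weaken[of 1 _ \<delta> 0] \<eta> by simp
  have "wbound (\<lambda>k. wt k ^ 4) \<Psi> (M * \<delta>)"
    using wbound_mu[OF \<eta>0] unfolding \<Psi>_def strm_diff by simp
  from wbound_power_weaken[OF this, of 3] have \<Psi>: "wbound (\<lambda>k. wt k ^ 3) \<Psi> (M * \<delta>)" by simp
  have \<Psi>1: "wbound wt \<Psi> (M * \<delta>)" using wbound_power_weaken[OF \<Psi>, of 1] by simp
  define z where "z k = w k - b k" for k
  define z' where "z' k = w' k - b' k" for k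
  have z: "wbound (\<lambda>k. 1) z (R + R)" "wbound (\<lambda>k. 1) z' (R + R)" "wbound wt z (R + R)"
    unfolding z_def z'_def by (intro wbound_diff bddD[OF bdd(1)] bddD(6,7)[OF bdd(2)]; simp)+
  have zd: "wbound wt (\<lambda>k. z k - z' k) (\<delta> + \<delta>)"
  proof -
    have "(\<lambda>k. z k - z' k) = (\<lambda>k. (w k - w' k) - (b k - b' k))" by (auto simp: z_def z'_def)
    then show ?thesis by (simp only:) (intro wbound_diff \<beta> \<eta>, simp)
  qed
  note g' = bddD(9)[OF bdd(2)] and g3 = bddD(8)[OF bdd(2), of 3]
  have j: "wbound (\<lambda>k. 1) (jac g b) (4 * pi\<^sup>2 * (c0 * A * B))"
    if "wbound (\<lambda>k. wt k ^ 3) g A" "wbound wt b B" for g b A B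
    using wbound_jac[of 3 g A 1 b B 0] that by simp
  have "(\<lambda>k. Fb b w k - Fb b' w' k) = (\<lambda>k. - (jac \<Psi> b k + jac (strm w') (\<lambda>k. b k - b' k) k))"
    unfolding Fb_def \<Psi>_def
    using jac_diff_right[OF g' bddD(6)[OF bdd(1)] bddD(6)[OF bdd(2)]]
      jac_diff_left[OF bddD(9)[OF bdd(1)] g' bddD(6)[OF bdd(1)]] by auto
  then have "wbound (\<lambda>k. 1) (\<lambda>k. Fb b w k - Fb b' w' k)
      (4 * pi\<^sup>2 * (c0 * (M * \<delta>) * R) + 4 * pi\<^sup>2 * (c0 * G R * \<delta>))"
    by (simp only: wbound_uminus) (intro wbound_add j \<Psi> bddD(4)[OF bdd(1)] g3 \<beta>; simp)
  moreover have "4 * pi\<^sup>2 * (c0 * (M * \<delta>) * R) + 4 * pi\<^sup>2 * (c0 * G R * \<delta>) \<le> C6 R * \<delta>"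
  proof -
    have "4 * pi\<^sup>2 * (c0 * (M * \<delta>) * R) + 4 * pi\<^sup>2 * (c0 * G R * \<delta>) = 4 * pi\<^sup>2 * (c0 * (M * R + G R)) * \<delta>"
      by (simp add: algebra_simps)
    also have "\<dots> \<le> C6 R * \<delta>"
      unfolding C6_def using R by (intro mult_right_mono mult_left_mono) auto
    finally show ?thesis .
  qed
  ultimately show "wbound (\<lambda>k. 1) (\<lambda>k. Fb b w k - Fb b' w' k) (C6 R * \<delta>)" by (rule wbound_mono_bound)
  have "(\<lambda>k. Fw b w k - Fw b' w' k) = (\<lambda>k. - (jac \<Psi> z k + jac (strm w') (\<lambda>k. z k - z' k) k + jac h (\<lambda>k. b k - b' k) k))"
    unfolding Fw_def \<Psi>_def z_def[symmetric] z'_def[symmetric]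
    using jac_diff_right[OF g' z(1,2)] jac_diff_left[OF bddD(9)[OF bdd(1)] g' z(1)]
      jac_diff_right[OF h_bounds(2) bddD(6)[OF bdd(1)] bddD(6)[OF bdd(2)]] by auto
  then have "wbound (\<lambda>k. 1) (\<lambda>k. Fw b w k - Fw b' w' k)
      (4 * pi\<^sup>2 * (c0 * (M * \<delta>) * (R + R)) + 4 * pi\<^sup>2 * (c0 * G R * (\<delta> + \<delta>)) + 4 * pi\<^sup>2 * (c0 * H * \<delta>))"
    by (simp only: wbound_uminus) (intro wbound_add j \<Psi> z g3 zd h_bounds \<beta>; simp)
  moreover have "4 * pi\<^sup>2 * (c0 * (M * \<delta>) * (R + R)) + 4 * pi\<^sup>2 * (c0 * G R * (\<delta> + \<delta>)) + 4 * pi\<^sup>2 * (c0 * H * \<delta>) = C6 R * \<delta>"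
    by (simp add: C6_def algebra_simps)
  ultimately show "wbound (\<lambda>k. 1) (\<lambda>k. Fw b w k - Fw b' w' k) (C6 R * \<delta>)" by simp
qed

lemma Fb_0 [simp]: "Fb b w 0 = 0" and Fw_0 [simp]: "Fw b w 0 = 0"
  by (simp_all add: Fb_def Fw_def)

lemma ksol_cong:
  assumes "ksol K T R b w" and eq: "\<And>t. t \<in> {0..T} \<Longrightarrow> b' t = b t" "\<And>t. t \<in> {0..T} \<Longrightarrow> w' t = w t"
  shows "ksol K T R b' w'"
proof -
  have T: "0 \<le> T" using assms(1) by (simp add: ksol_def)
  note D = ksolD[OF assms(1)]
  have "((\<lambda>s. b' s k) has_vector_derivative (if k \<in> K then Fb (b' t) (w' t) k else 0)) (at t within {0..T})"
    if "t \<in> {0..T}" for t k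
    unfolding eq[OF that]
    by (rule has_vector_derivative_transform[OF that _ D(6)[OF that]]) (simp add: eq)
  moreover have "((\<lambda>s. w' s k) has_vector_derivative (if k \<in> K then Fw (b' t) (w' t) k else 0)) (at t within {0..T})"
    if "t \<in> {0..T}" for t k
    unfolding eq[OF that]
    by (rule has_vector_derivative_transform[OF that _ D(7)[OF that]]) (simp add: eq)
  ultimately show ?thesis unfolding ksol_def using T D(1-5) by (simp add: eq)
qed

lemma ksol_restrict:
  assumes "ksol K T R b w" "0 \<le> T'" "T' \<le> T" shows "ksol K T' R b w"
proof -
  have t: "t \<in> {0..T}" if "t \<in> {0..T'}" for t using that assms by auto
  have s: "{0..T'} \<subseteq> {0..T}" using assms by auto
  note D = ksolD[OF assms(1) t]
  show ?thesis unfolding ksol_def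
    using assms(2) D(1-5) has_vector_derivative_within_subset[OF D(6) s] has_vector_derivative_within_subset[OF D(7) s]
    by blast
qed

text \<open>At the junction the one-sided derivatives agree because the right-hand side depends on
  the current state only, and the states agree there.\<close>

lemma ksol_append:
  assumes 1: "ksol UNIV T R b w" and 2: "ksol UNIV L R b' w'" and eq: "b' 0 = b T" "w' 0 = w T"
  shows "ksol UNIV (T + L) R (\<lambda>t. if t \<in> {0..T} then b t else b' (t - T)) (\<lambda>t. if t \<in> {0..T} then w t else w' (t - T))"
    (is "ksol _ _ _ ?b ?w")
proof -
  have TL: "0 \<le> T" "0 \<le> L" using 1 2 by (auto simp: ksol_def)
  note D = ksolD[OF 1] and D' = ksolD[OF 2]
  have cl: "closure {0..T} = {0..T}" "closure {T..T+L} = {T..T+L}" "{0..T} \<inter> {T..T+L} = {T}" "{0..T} \<union> {T} = {0..T}" "{T..T+L} \<union> {T} = {T..T+L}"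
    using TL by auto
  have u: "{0..T+L} = {0..T} \<union> {T..T+L}" using TL by auto
  have sh: "((\<lambda>t. g (t - T)) has_vector_derivative d) (at t within {T..T+L})"
    if "(g has_vector_derivative d) (at (t - T) within {0..L})" for g :: "real \<Rightarrow> complex" and d t
  proof -
    have im: "(\<lambda>t. t - T) ` {T..T+L} = {0..L}" by (auto intro!: image_eqI[where x = "_ + T"])
    have "((\<lambda>t. t - T) has_vector_derivative 1) (at t within {T..T+L})" by (auto intro!: derivative_eq_intros)
    from vector_diff_chain_within[OF this, of g d] that show ?thesis by (simp add: im o_def)
  qed
  have gl: "((\<lambda>t. if t \<in> {0..T} then x t else x' (t - T)) has_vector_derivative (if t \<in> {0..T} then d t else d' (t - T))) (at t within {0..T+L})"
    if "\<And>t. t \<in> {0..T} \<Longrightarrow> (x has_vector_derivative d t) (at t within {0..T})"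
      "\<And>t. t \<in> {0..L} \<Longrightarrow> (x' has_vector_derivative d' t) (at t within {0..L})"
      "x' 0 = x T" "d' 0 = d T" "t \<in> {0..T+L}"
    for x x' d d' :: "real \<Rightarrow> complex" and t
  proof (rule has_vector_derivative_If_within_closures[OF _ u], unfold cl)
    show "t \<in> {0..T} \<union> {T..T+L}" using that(5) u by auto
    show "(x has_vector_derivative d t) (at t within {0..T})" if "t \<in> {0..T}" using that by fact
    show "((\<lambda>t. x' (t - T)) has_vector_derivative d' (t - T)) (at t within {T..T+L})" if "t \<in> {T..T+L}"
      by (rule sh) (use that \<open>\<And>t. t \<in> {0..L} \<Longrightarrow> (x' has_vector_derivative d' t) (at t within {0..L})\<close> in auto)
    show "x t = x' (t - T)" "d t = d' (t - T)" if "t \<in> {0..T}" "t \<in> {T..T+L}"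
    proof -
      have "t = T" using that by auto
      then show "x t = x' (t - T)" "d t = d' (t - T)" using \<open>x' 0 = x T\<close> \<open>d' 0 = d T\<close> by auto
    qed
  qed
  have r: "t - T \<in> {0..L}" if "t \<in> {0..T+L}" "t \<notin> {0..T}" for t using that by auto
  have A: "((\<lambda>s. ?b s k) has_vector_derivative Fb (?b t) (?w t) k) (at t within {0..T+L})" if "t \<in> {0..T+L}" for t k
  proof -
    have 1: "(\<lambda>s. ?b s k) = (\<lambda>s. if s \<in> {0..T} then b s k else b' (s - T) k)" by auto
    have 2: "Fb (?b t) (?w t) k = (if t \<in> {0..T} then Fb (b t) (w t) k else Fb (b' (t - T)) (w' (t - T)) k)" by auto
    show ?thesis unfolding 1 2
      by (rule gl[of "\<lambda>s. b s k" "\<lambda>s. Fb (b s) (w s) k" "\<lambda>s. b' s k" "\<lambda>s. Fb (b' s) (w' s) k"])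
        (use D(6)[of _ k] D'(6)[of _ k] that in \<open>simp_all only: eq UNIV_I if_True\<close>)
  qed
  have B: "((\<lambda>s. ?w s k) has_vector_derivative Fw (?b t) (?w t) k) (at t within {0..T+L})" if "t \<in> {0..T+L}" for t k
  proof -
    have 1: "(\<lambda>s. ?w s k) = (\<lambda>s. if s \<in> {0..T} then w s k else w' (s - T) k)" by auto
    have 2: "Fw (?b t) (?w t) k = (if t \<in> {0..T} then Fw (b t) (w t) k else Fw (b' (t - T)) (w' (t - T)) k)" by auto
    show ?thesis unfolding 1 2
      by (rule gl[of "\<lambda>s. w s k" "\<lambda>s. Fw (b s) (w s) k" "\<lambda>s. w' s k" "\<lambda>s. Fw (b' s) (w' s) k"])
        (use D(7)[of _ k] D'(7)[of _ k] that in \<open>simp_all only: eq UNIV_I if_True\<close>)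
  qed
  have C: "bdd R (?b t) (?w t) \<and> ?b t (- k) = cnj (?b t k) \<and> ?w t (- k) = cnj (?w t k)" if "t \<in> {0..T+L}" for t k
  proof (cases "t \<in> {0..T}")
    case True
    with D(1-3)[OF True] show "bdd R (?b t) (?w t) \<and> ?b t (- k) = cnj (?b t k) \<and> ?w t (- k) = cnj (?w t k)" by simp
  next
    case False
    with D'(1-3)[OF r[OF that False]] show "bdd R (?b t) (?w t) \<and> ?b t (- k) = cnj (?b t k) \<and> ?w t (- k) = cnj (?w t k)" by (simp only: if_False)
  qed
  show ?thesis unfolding ksol_def
  proof (intro conjI ballI)
    show "0 \<le> T + L" using TL by simp
    fix t assume t: "t \<in> {0..T+L}"
    show "bdd R (?b t) (?w t)" "\<forall>k. ?b t (- k) = cnj (?b t k) \<and> ?w t (- k) = cnj (?w t k)" using C[OF t] by blast+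
    show "\<forall>k. ((\<lambda>s. ?b s k) has_vector_derivative (if k \<in> UNIV then Fb (?b t) (?w t) k else 0)) (at t within {0..T+L})"
      unfolding if_P[OF UNIV_I] using A[OF t] by blast
    show "\<forall>k. ((\<lambda>s. ?w s k) has_vector_derivative (if k \<in> UNIV then Fw (?b t) (?w t) k else 0)) (at t within {0..T+L})"
      unfolding if_P[OF UNIV_I] using B[OF t] by blast
  qed blast
qed

end

lemma has_vector_derivative_indefinite_integral:
  fixes g :: "real \<Rightarrow> l2_torus"
  assumes c: "continuous_on {0..T} g" and t: "t \<in> {0..T}"
  shows "((\<lambda>t. fc (integral {0..t} g) k) has_vector_derivative fc (g t) k) (at t within {0..T})"
  by (rule bounded_linear.has_vector_derivative[OF bounded_linear_fc integral_has_vector_derivative[OF c t]])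

text \<open>Ties the sequence data to functions: \<open>v\<close> is the given field of the
  topography and \<open>h\<close> the coefficient sequence of its stream function.\<close>

locale tqg_system = tqg_data "mul \<alpha>" "fc f" h M F H
  for \<alpha> :: real and f :: l2_torus and h :: "freq \<Rightarrow> complex" and M F H :: real +
  fixes v :: "l2_torus \<times> l2_torus"
  assumes \<alpha>_pos: "0 < \<alpha>" and v: "stream_field h v"
begin

abbreviation "Pb b w \<equiv> div_flux b (velocity \<alpha> f w)"
abbreviation "Pw b w \<equiv> div_flux (w - b) (velocity \<alpha> f w) + div_flux b v"

lemma fc_flux:
  assumes bdd: "bdd R (fc b) (fc w)"
  shows "fc (Pb b w) k = - Fb (fc b) (fc w) k" "fc (Pw b w) k = - Fw (fc b) (fc w) k"
proof -
  have s: "stream_field (strm (fc w)) (velocity \<alpha> f w)"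
    using stream_field_velocity[OF \<alpha>_pos, of w f] unfolding strm_def[abs_def] .
  note b = bddD(2)[OF bdd, of 2, simplified] and w = bddD(3)[OF bdd, of 2, simplified]
    and g = bddD(8)[OF bdd, of 4, simplified]
  have wb: "wbound (\<lambda>k. wt k ^ 2) (fc (w - b)) (R + R)"
    unfolding fc_diff[abs_def] by (intro wbound_diff b w) simp
  show "fc (Pb b w) k = - Fb (fc b) (fc w) k"
    unfolding fc_div_flux[OF b g s] by (simp add: Fb_def)
  have "fc (w - b) = (\<lambda>l. fc w l - fc b l)" by (auto simp: fc_diff)
  then show "fc (Pw b w) k = - Fw (fc b) (fc w) k"
    unfolding fc_add fc_div_flux[OF wb g s] fc_div_flux[OF b h_bound v] by (simp add: Fw_def)
qed

text \<open>The numbers 81 and 27 are the factors \<open>3 ^ Suc s\<close> of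
  \<open>wbound_of_sobolev\<close> for \<open>s = 3\<close> and \<open>s = 2\<close>.\<close>

lemma flux_diff:
  assumes bdd: "bdd R (fc b) (fc w)" "bdd R (fc b') (fc w')"
    and "b \<in> sobolev 3" "b' \<in> sobolev 3" "w \<in> sobolev 2" "w' \<in> sobolev 2"
  defines "\<delta> \<equiv> 81 * sobolev_norm 3 (b - b') + 27 * sobolev_norm 2 (w - w')"
  shows "norm (Pb b w - Pb b' w') \<le> C6 R * \<delta>" "norm (Pw b w - Pw b' w') \<le> C6 R * \<delta>"
proof -
  have "wbound (\<lambda>k. wt k ^ 3) (fc (b - b')) \<delta>" "wbound (\<lambda>k. wt k ^ 2) (fc (w - w')) \<delta>"
    by (rule wbound_mono_bound[OF wbound_of_sobolev[OF sobolev_diff]];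
        use assms sobolev_norm_nonneg[of 3 "b - b'"] sobolev_norm_nonneg[of 2 "w - w'"] in \<open>simp\<close>)+
  from wbound_power_weaken[OF this(1), of 1] wbound_power_weaken[OF this(2), of 1]
  have d: "wbound wt (\<lambda>k. fc b k - fc b' k) \<delta>" "wbound wt (\<lambda>k. fc w k - fc w' k) \<delta>"
    by (simp_all add: fc_diff[abs_def])
  have "fc (Pb b w - Pb b' w') = (\<lambda>k. - (Fb (fc b) (fc w) k - Fb (fc b') (fc w') k))"
    "fc (Pw b w - Pw b' w') = (\<lambda>k. - (Fw (fc b) (fc w) k - Fw (fc b') (fc w') k))"
    by (rule ext, simp only: fc_diff fc_flux[OF bdd(1)] fc_flux[OF bdd(2)], simp)+
  then show "norm (Pb b w - Pb b' w') \<le> C6 R * \<delta>" "norm (Pw b w - Pw b' w') \<le> C6 R * \<delta>"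
    unfolding norm_le_iff_wbound using F_diff_l2[OF bdd d] by (simp_all only: wbound_uminus)
qed

lemma flux_continuous:
  assumes b: "continuous_sobolev T 3 b" and w: "continuous_sobolev T 2 w"
    and bdd: "\<And>t. t \<in> {0..T} \<Longrightarrow> bdd R (fc (b t)) (fc (w t))"
  shows "continuous_on {0..T} (\<lambda>t. Pb (b t) (w t))" "continuous_on {0..T} (\<lambda>t. Pw (b t) (w t))"
proof -
  let ?d = "\<lambda>t s. C6 R * (81 * sobolev_norm 3 (b s - b t) + 27 * sobolev_norm 2 (w s - w t))"
  have bw: "b t \<in> sobolev 3" "w t \<in> sobolev 2" if "t \<in> {0..T}" for t
    using b w that by (auto simp: continuous_sobolev_def)
  have lim: "(?d t \<longlongrightarrow> 0) (at t within {0..T})" if "t \<in> {0..T}" for t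
  proof -
    have "((\<lambda>s. sobolev_norm 3 (b s - b t)) \<longlongrightarrow> 0) (at t within {0..T})" "((\<lambda>s. sobolev_norm 2 (w s - w t)) \<longlongrightarrow> 0) (at t within {0..T})"
      using b w that by (auto simp: continuous_sobolev_def)
    then have "(?d t \<longlongrightarrow> C6 R * (81 * 0 + 27 * 0)) (at t within {0..T})" by (intro tendsto_intros)
    then show ?thesis by simp
  qed
  have cont: "continuous_on {0..T} \<Phi>" if le: "\<And>s t. s \<in> {0..T} \<Longrightarrow> t \<in> {0..T} \<Longrightarrow> norm (\<Phi> s - \<Phi> t) \<le> ?d t s"
    for \<Phi> :: "real \<Rightarrow> l2_torus"
    unfolding continuous_on
  proof (rule ballI)
    fix t assume t: "t \<in> {0..T}"
    have "((\<lambda>s. \<Phi> s - \<Phi> t) \<longlongrightarrow> 0) (at t within {0..T})"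
    proof (rule Lim_null_comparison[OF _ lim[OF t]])
      show "\<forall>\<^sub>F s in at t within {0..T}. norm (\<Phi> s - \<Phi> t) \<le> ?d t s"
        unfolding eventually_at_filter by (intro always_eventually allI impI le t)
    qed
    then show "(\<Phi> \<longlongrightarrow> \<Phi> t) (at t within {0..T})" by (simp add: LIM_zero_iff)
  qed
  show "continuous_on {0..T} (\<lambda>t. Pb (b t) (w t))" "continuous_on {0..T} (\<lambda>t. Pw (b t) (w t))"
    by (rule cont, rule flux_diff; intro bdd bw; assumption)+
qed

lemma ksol_continuous_sobolev:
  assumes sol: "ksol UNIV T R (\<lambda>t. fc (b t)) (\<lambda>t. fc (w t))"
  shows "continuous_sobolev T 3 b" "continuous_sobolev T 2 w"
proof -
  have ev: "\<forall>\<^sub>F s in at t within {0..T}. wbound (\<lambda>k. wt k ^ 3) (fc (b s - b t)) e \<and> wbound (\<lambda>k. wt k ^ 2) (fc (w s - w t)) e"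
    if t: "t \<in> {0..T}" and e: "0 < e" for t e
  proof (rule eventually_mono[OF ksol_strongly_continuous[OF sol t]])
    show "0 < e\<^sup>2" using e by simp
    fix s
    assume *: "\<forall>K. finite K \<longrightarrow> energy (\<lambda>k. wt k ^ 3) K (\<lambda>k. fc (b s) k - fc (b t) k)
        + energy (\<lambda>k. wt k ^ 2) K (\<lambda>k. fc (w s) k - fc (w t) k) \<le> e\<^sup>2"
    have nn: "0 \<le> energy W K x" for W K x by simp
    have "energy (\<lambda>k. wt k ^ 3) K (\<lambda>k. fc (b s) k - fc (b t) k) \<le> e\<^sup>2 \<and> energy (\<lambda>k. wt k ^ 2) K (\<lambda>k. fc (w s) k - fc (w t) k) \<le> e\<^sup>2"
      if "finite K" for K
      using *[rule_format, OF that] nn[of "\<lambda>k. wt k ^ 3" K "\<lambda>k. fc (b s) k - fc (b t) k"]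
        nn[of "\<lambda>k. wt k ^ 2" K "\<lambda>k. fc (w s) k - fc (w t) k"] by linarith
    then show "wbound (\<lambda>k. wt k ^ 3) (fc (b s - b t)) e \<and> wbound (\<lambda>k. wt k ^ 2) (fc (w s - w t)) e"
      unfolding fc_diff[abs_def] using e by (intro conjI wbound_of_energy) auto
  qed
  have gen: "continuous_sobolev T n u"
    if mem: "\<And>t. t \<in> {0..T} \<Longrightarrow> u t \<in> sobolev n"
      and ev: "\<And>t e. t \<in> {0..T} \<Longrightarrow> 0 < e \<Longrightarrow> \<forall>\<^sub>F s in at t within {0..T}. wbound (\<lambda>k. wt k ^ n) (fc (u s - u t)) e" for n u
    unfolding continuous_sobolev_def
  proof (intro ballI conjI mem tendstoI)
    fix t and e :: real assume t: "t \<in> {0..T}" and e: "0 < e"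
    define e' where "e' = e / (cs n + 1)"
    have e': "0 < e'" unfolding e'_def using e cs_nonneg[of n] by (intro divide_pos_pos) auto
    show "\<forall>\<^sub>F s in at t within {0..T}. dist (sobolev_norm n (u s - u t)) 0 < e"
      using ev[OF t e']
    proof (rule eventually_mono)
      fix s assume "wbound (\<lambda>k. wt k ^ n) (fc (u s - u t)) e'"
      from sobolev_of_wbound(2)[OF this] have "sobolev_norm n (u s - u t) \<le> cs n * e'" .
      also have "\<dots> < (cs n + 1) * e'" using e' by simp
      also have "\<dots> = e" using cs_nonneg[of n] by (simp add: e'_def)
      finally show "dist (sobolev_norm n (u s - u t)) 0 < e" using sobolev_norm_nonneg[of n "u s - u t"] by simp
    qed
  qed
  note D = ksolD(1)[OF sol]
  show "continuous_sobolev T 3 b"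
    by (rule gen, rule sobolev_of_wbound(1)[OF bddD(2)[OF D]], assumption, simp,
        drule (1) ev, erule eventually_mono, erule conjunct1)
  show "continuous_sobolev T 2 w"
    by (rule gen, rule sobolev_of_wbound(1)[OF bddD(3)[OF D]], assumption, simp,
        drule (1) ev, erule eventually_mono, erule conjunct2)
qed

text \<open>In one direction the fluxes are continuous, so the integral equations can be
  differentiated coefficientwise, and compactness of the time interval supplies the bound
  \<open>R\<close>. In the other, coefficients plus integrated fluxes have zero derivative; strong
  continuity is recovered by \<open>ksol_continuous_sobolev\<close>.\<close>

lemma local_strong_solution_iff:
  assumes 0: "average b\<^sub>0 = 0" "average w\<^sub>0 = 0"
  shows "local_strong_solution \<alpha> v f b\<^sub>0 w\<^sub>0 b w T \<longleftrightarrow>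
    0 < T \<and> b 0 = b\<^sub>0 \<and> w 0 = w\<^sub>0 \<and> (\<exists>R. ksol UNIV T R (\<lambda>t. fc (b t)) (\<lambda>t. fc (w t)))"
    (is "?L \<longleftrightarrow> ?K")
proof
  assume L: ?L
  then have T: "0 < T" and c: "continuous_sobolev T 3 b" "continuous_sobolev T 2 w"
    and int: "\<And>t. t \<in> {0..T} \<Longrightarrow> b t = b\<^sub>0 - integral {0..t} (\<lambda>s. Pb (b s) (w s))"
      "\<And>t. t \<in> {0..T} \<Longrightarrow> w t = w\<^sub>0 - integral {0..t} (\<lambda>s. Pw (b s) (w s))"
    unfolding local_strong_solution_def Let_def by auto
  obtain Rb Rw where "\<And>t. t \<in> {0..T} \<Longrightarrow> wbound (\<lambda>k. wt k ^ 3) (fc (b t)) Rb"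
      "\<And>t. t \<in> {0..T} \<Longrightarrow> wbound (\<lambda>k. wt k ^ 2) (fc (w t)) Rw"
    using continuous_sobolev_bounded[OF c(1)] continuous_sobolev_bounded[OF c(2)] by blast
  then have bdd: "bdd (max Rb Rw) (fc (b t)) (fc (w t))" if "t \<in> {0..T}" for t
    using that unfolding bdd_def by (meson max.cobounded1 max.cobounded2 wbound_mono_bound)
  note cont = flux_continuous[OF c bdd]
  have b': "((\<lambda>s. fc (b s) k) has_vector_derivative Fb (fc (b t)) (fc (w t)) k) (at t within {0..T})"
    if t: "t \<in> {0..T}" for t k
  proof (rule has_vector_derivative_transform[OF t])
    show "fc (b s) k = fc b\<^sub>0 k - fc (integral {0..s} (\<lambda>s. Pb (b s) (w s))) k" if "s \<in> {0..T}" for s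
      using int(1)[OF that] by (simp add: fc_diff)
    show "((\<lambda>s. fc b\<^sub>0 k - fc (integral {0..s} (\<lambda>s. Pb (b s) (w s))) k) has_vector_derivative Fb (fc (b t)) (fc (w t)) k) (at t within {0..T})"
      using has_vector_derivative_diff[OF has_vector_derivative_const has_vector_derivative_indefinite_integral[OF cont(1) t], of "fc b\<^sub>0 k" k]
      by (simp add: fc_flux(1)[OF bdd[OF t]])
  qed
  have w': "((\<lambda>s. fc (w s) k) has_vector_derivative Fw (fc (b t)) (fc (w t)) k) (at t within {0..T})"
    if t: "t \<in> {0..T}" for t k
  proof (rule has_vector_derivative_transform[OF t])
    show "fc (w s) k = fc w\<^sub>0 k - fc (integral {0..s} (\<lambda>s. Pw (b s) (w s))) k" if "s \<in> {0..T}" for s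
      using int(2)[OF that] by (simp add: fc_diff)
    show "((\<lambda>s. fc w\<^sub>0 k - fc (integral {0..s} (\<lambda>s. Pw (b s) (w s))) k) has_vector_derivative Fw (fc (b t)) (fc (w t)) k) (at t within {0..T})"
      using has_vector_derivative_diff[OF has_vector_derivative_const has_vector_derivative_indefinite_integral[OF cont(2) t], of "fc w\<^sub>0 k" k]
      by (simp only: fc_flux(2)[OF bdd[OF t]] diff_0 minus_minus)
  qed
  have "ksol UNIV T (max Rb Rw) (\<lambda>t. fc (b t)) (\<lambda>t. fc (w t))"
    unfolding ksol_def using T bdd b' w' by (simp add: fc_minus)
  moreover have "b 0 = b\<^sub>0" "w 0 = w\<^sub>0" using int[of 0] T by auto
  ultimately show ?K using T by blast
next
  assume ?K
  then obtain R where T: "0 < T" and i: "b 0 = b\<^sub>0" "w 0 = w\<^sub>0"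
    and sol: "ksol UNIV T R (\<lambda>t. fc (b t)) (\<lambda>t. fc (w t))" by blast
  note c = ksol_continuous_sobolev[OF sol] and bdd = ksolD(1)[OF sol]
  note cont = flux_continuous[OF c bdd]
  have int: "b t = b\<^sub>0 - integral {0..t} (\<lambda>s. Pb (b s) (w s))"
      "w t = w\<^sub>0 - integral {0..t} (\<lambda>s. Pw (b s) (w s))" if t: "t \<in> {0..T}" for t
  proof -
    show "b t = b\<^sub>0 - integral {0..t} (\<lambda>s. Pb (b s) (w s))"
    proof (rule fc_eqI)
      fix k
      have "fc (b t) k + fc (integral {0..t} (\<lambda>s. Pb (b s) (w s))) k
          = fc (b 0) k + fc (integral {0..0} (\<lambda>s. Pb (b s) (w s))) k"
      proof (rule vector_derivative_zero_imp_eq[OF _ t])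
        fix s assume s: "s \<in> {0..T}"
        show "((\<lambda>t. fc (b t) k + fc (integral {0..t} (\<lambda>s. Pb (b s) (w s))) k) has_vector_derivative 0) (at s within {0..T})"
          using has_vector_derivative_add[OF ksolD(6)[OF sol s, of k] has_vector_derivative_indefinite_integral[OF cont(1) s, of k]]
          by (simp add: fc_flux(1)[OF bdd[OF s]])
      qed
      then show "fc (b t) k = fc (b\<^sub>0 - integral {0..t} (\<lambda>s. Pb (b s) (w s))) k"
        by (simp add: fc_diff fc_0 i eq_diff_eq)
    qed
    show "w t = w\<^sub>0 - integral {0..t} (\<lambda>s. Pw (b s) (w s))"
    proof (rule fc_eqI)
      fix k
      have "fc (w t) k + fc (integral {0..t} (\<lambda>s. Pw (b s) (w s))) k
          = fc (w 0) k + fc (integral {0..0} (\<lambda>s. Pw (b s) (w s))) k"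
      proof (rule vector_derivative_zero_imp_eq[OF _ t])
        fix s assume s: "s \<in> {0..T}"
        show "((\<lambda>t. fc (w t) k + fc (integral {0..t} (\<lambda>s. Pw (b s) (w s))) k) has_vector_derivative 0) (at s within {0..T})"
          using has_vector_derivative_add[OF ksolD(7)[OF sol s, of k] has_vector_derivative_indefinite_integral[OF cont(2) s, of k]]
          by (simp only: fc_flux(2)[OF bdd[OF s]] UNIV_I if_True right_minus)
      qed
      then show "fc (w t) k = fc (w\<^sub>0 - integral {0..t} (\<lambda>s. Pw (b s) (w s))) k"
        by (simp add: fc_diff fc_0 i eq_diff_eq)
    qed
  qed
  \<comment> \<open>The mean is conserved since \<open>cr 0 l\<close> vanishes, and with it the
    right-hand sides at frequency 0.\<close>
  have avg: "average (b t) = 0 \<and> average (w t) = 0" if t: "t \<in> {0..T}" for t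
  proof -
    have "fc (b t) 0 = fc (b 0) 0"
      by (rule vector_derivative_zero_imp_eq[OF _ t]) (use ksolD(6)[OF sol, of _ 0] in simp)
    moreover have "fc (w t) 0 = fc (w 0) 0"
      by (rule vector_derivative_zero_imp_eq[OF _ t]) (use ksolD(7)[OF sol, of _ 0] in simp)
    ultimately show ?thesis using 0 by (simp add: average_0_iff i)
  qed
  have "(\<lambda>s. Pb (b s) (w s)) integrable_on {0..t}" "(\<lambda>s. Pw (b s) (w s)) integrable_on {0..t}" if "t \<in> {0..T}" for t
    by (rule integrable_continuous_interval[OF continuous_on_subset[OF cont(1)]]
        integrable_continuous_interval[OF continuous_on_subset[OF cont(2)]]; use that in auto)+
  then show ?L unfolding local_strong_solution_def Let_def using T c avg int by blast
qed

end

section \<open>Maximal solutions\<close>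

context tqg_system
begin

text \<open>The initial values are left out so that the notion also fits solutions restarted at a
  later time.\<close>

definition lsol :: "(real \<Rightarrow> l2_torus) \<Rightarrow> (real \<Rightarrow> l2_torus) \<Rightarrow> real \<Rightarrow> bool" where
  "lsol b w T \<longleftrightarrow> 0 < T \<and> (\<exists>R. ksol UNIV T R (\<lambda>t. fc (b t)) (\<lambda>t. fc (w t)))"

lemma lsol_restrict: "lsol b w T \<Longrightarrow> 0 < T' \<Longrightarrow> T' \<le> T \<Longrightarrow> lsol b w T'"
  unfolding lsol_def using ksol_restrict less_imp_le by meson

lemma lsol_cong:
  assumes "lsol b w T" "\<And>t. t \<in> {0..T} \<Longrightarrow> b' t = b t" "\<And>t. t \<in> {0..T} \<Longrightarrow> w' t = w t"
  shows "lsol b' w' T"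
proof -
  obtain R where T: "0 < T" and R: "ksol UNIV T R (\<lambda>t. fc (b t)) (\<lambda>t. fc (w t))"
    using assms(1) by (auto simp: lsol_def)
  have "ksol UNIV T R (\<lambda>t. fc (b' t)) (\<lambda>t. fc (w' t))"
    by (rule ksol_cong[OF R]) (simp_all only: assms(2,3))
  then show ?thesis using T by (auto simp: lsol_def)
qed

lemma lsol_unique:
  assumes "lsol b w T" "lsol b' w' T" and init: "b 0 = b' 0" "w 0 = w' 0" and t: "t \<in> {0..T}"
  shows "b t = b' t" "w t = w' t"
proof -
  obtain R R' where "ksol UNIV T R (\<lambda>t. fc (b t)) (\<lambda>t. fc (w t))" "ksol UNIV T R' (\<lambda>t. fc (b' t)) (\<lambda>t. fc (w' t))"
    using assms(1,2) by (auto simp: lsol_def)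
  then have "ksol UNIV T (max R R') (\<lambda>t. fc (b t)) (\<lambda>t. fc (w t))" "ksol UNIV T (max R R') (\<lambda>t. fc (b' t)) (\<lambda>t. fc (w' t))"
    by (auto intro: ksol_mono)
  from ksol_unique[OF this _ _ t] init have "fc (b t) = fc (b' t)" "fc (w t) = fc (w' t)" by simp_all
  then show "b t = b' t" "w t = w' t" by (auto intro: fc_eqI)
qed

lemma ksol_realize:
  assumes sol: "ksol UNIV T R \<beta> \<eta>"
  obtains b w where "\<And>t. t \<in> {0..T} \<Longrightarrow> fc (b t) = \<beta> t" "\<And>t. t \<in> {0..T} \<Longrightarrow> fc (w t) = \<eta> t"
proof -
  have "\<exists>u. fc u = \<beta> t" if "t \<in> {0..T}" for t
    by (rule ex_fc[OF ksolD(2)[OF sol that] bddD(6)[OF ksolD(1)[OF sol that]]]) (blast intro: ext)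
  moreover have "\<exists>u. fc u = \<eta> t" if "t \<in> {0..T}" for t
    by (rule ex_fc[OF ksolD(3)[OF sol that] bddD(7)[OF ksolD(1)[OF sol that]]]) (blast intro: ext)
  ultimately have "\<exists>b. \<forall>t\<in>{0..T}. fc (b t) = \<beta> t" "\<exists>w. \<forall>t\<in>{0..T}. fc (w t) = \<eta> t" by metis+
  then show thesis using that by blast
qed

lemma lsol_exists:
  assumes "bdd r (fc b\<^sub>0) (fc w\<^sub>0)"
  shows "\<exists>b w. lsol b w (life r) \<and> b 0 = b\<^sub>0 \<and> w 0 = w\<^sub>0"
proof -
  obtain \<beta> \<eta> where k: "ksol UNIV (life r) (2 * r + 1) \<beta> \<eta>" and i: "\<beta> 0 = fc b\<^sub>0" "\<eta> 0 = fc w\<^sub>0"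
    using ksol_exists[OF assms fc_minus fc_minus] by blast
  obtain b w where bw: "\<And>t. t \<in> {0..life r} \<Longrightarrow> fc (b t) = \<beta> t" "\<And>t. t \<in> {0..life r} \<Longrightarrow> fc (w t) = \<eta> t"
    using ksol_realize[OF k] by blast
  have L: "0 < life r" using life_pos[OF bddD(1)[OF assms]] .
  have "ksol UNIV (life r) (2 * r + 1) (\<lambda>t. fc (b t)) (\<lambda>t. fc (w t))" by (rule ksol_cong[OF k]) (use bw in auto)
  moreover have "b 0 = b\<^sub>0" "w 0 = w\<^sub>0" using bw(1)[of 0] bw(2)[of 0] i L by (auto intro: fc_eqI)
  ultimately show ?thesis using L by (auto simp: lsol_def)
qed

lemma lsol_extend:
  assumes sol: "lsol b w T" and bdd: "bdd r (fc (b T)) (fc (w T))"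
  shows "\<exists>b' w'. lsol b' w' (T + life r) \<and> b' 0 = b 0 \<and> w' 0 = w 0"
proof -
  obtain R where T: "0 < T" and R: "ksol UNIV T R (\<lambda>t. fc (b t)) (\<lambda>t. fc (w t))"
    using sol by (auto simp: lsol_def)
  obtain b1 w1 R1 where i: "b1 0 = b T" "w1 0 = w T" and L: "0 < life r"
    and R1: "ksol UNIV (life r) R1 (\<lambda>t. fc (b1 t)) (\<lambda>t. fc (w1 t))"
    using lsol_exists[OF bdd] by (auto simp: lsol_def)
  let ?b = "\<lambda>t. if t \<in> {0..T} then b t else b1 (t - T)" and ?w = "\<lambda>t. if t \<in> {0..T} then w t else w1 (t - T)"
  have "ksol UNIV (T + life r) (max R R1) (\<lambda>t. fc (?b t)) (\<lambda>t. fc (?w t))"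
    unfolding if_distrib[of fc]
    by (rule ksol_append[OF ksol_mono[OF R] ksol_mono[OF R1]]) (simp_all add: i)
  then have "lsol ?b ?w (T + life r)" using T L by (auto simp: lsol_def)
  moreover have "?b 0 = b 0" "?w 0 = w 0" using T by auto
  ultimately show ?thesis by blast
qed

lemma lsol_norm_M_bounded:
  assumes "lsol b w T"
  shows "\<exists>B. \<forall>t\<in>{0..T}. norm_M (b t) (w t) \<le> B"
proof -
  obtain R where R: "ksol UNIV T R (\<lambda>t. fc (b t)) (\<lambda>t. fc (w t))" using assms by (auto simp: lsol_def)
  have "norm_M (b t) (w t) \<le> cs 3 * R + cs 2 * R" if "t \<in> {0..T}" for t
    unfolding norm_M_def
    by (intro add_mono sobolev_of_wbound(2) bddD(2,3)[OF ksolD(1)[OF R that]] order_refl)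
  then show ?thesis by blast
qed

text \<open>The factor 81 is the larger of the two constants \<open>3 ^ Suc s\<close>. Membership in
  the Sobolev spaces, without which the norm says nothing, comes from the solution property.\<close>

lemma bdd_of_norm_M:
  assumes "lsol b w T" "norm_M (b T) (w T) \<le> N"
  shows "bdd (81 * N) (fc (b T)) (fc (w T))"
proof -
  obtain R where R: "ksol UNIV T R (\<lambda>t. fc (b t)) (\<lambda>t. fc (w t))" and T: "T \<in> {0..T}"
    using assms(1) by (auto simp: lsol_def)
  note B = bddD(2,3)[OF ksolD(1)[OF R T] order_refl]
  have N: "sobolev_norm 3 (b T) \<le> N" "sobolev_norm 2 (w T) \<le> N" "0 \<le> N"
    using assms(2) sobolev_norm_nonneg[of 3 "b T"] sobolev_norm_nonneg[of 2 "w T"] unfolding norm_M_def by linarith+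
  show ?thesis
    unfolding bdd_def
    using wbound_mono_bound[OF wbound_of_sobolev[OF sobolev_of_wbound(1)[OF B(1)]], of "81 * N"]
      wbound_mono_bound[OF wbound_of_sobolev[OF sobolev_of_wbound(1)[OF B(2)]], of "81 * N"] N by simp
qed

text \<open>The set \<open>E\<close> of existence times is an interval without largest element,
  since every solution can be continued past its end. Solutions of different lengths agree where
  both are defined and glue to one up to the supremum of \<open>E\<close>.\<close>

theorem maximal_solution_exists_unique:
  assumes avg: "average b\<^sub>0 = 0" "average w\<^sub>0 = 0" and b0: "b\<^sub>0 \<in> sobolev 3" and w0: "w\<^sub>0 \<in> sobolev 2"
  shows "\<exists>b w Tm. maximal_solution \<alpha> v f b\<^sub>0 w\<^sub>0 b w Tm \<and>
    (\<forall>b' w' T'. maximal_solution \<alpha> v f b\<^sub>0 w\<^sub>0 b' w' T' \<longrightarrow>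
      T' = Tm \<and> (\<forall>t\<ge>0. ereal t < Tm \<longrightarrow> b' t = b t \<and> w' t = w t))"
proof -
  define S where "S b w T \<longleftrightarrow> lsol b w T \<and> b 0 = b\<^sub>0 \<and> w 0 = w\<^sub>0" for b w T
  have lss: "local_strong_solution \<alpha> v f b\<^sub>0 w\<^sub>0 b w T \<longleftrightarrow> S b w T" for b w T
    unfolding local_strong_solution_iff[OF avg] S_def lsol_def by blast
  have S0: "0 < T" if "S b w T" for b w T using that by (simp add: S_def lsol_def)
  have S_restrict: "S b w T'" if "S b w T" "0 < T'" "T' \<le> T" for b w T T'
    using that lsol_restrict by (auto simp: S_def)
  have S_unique: "b t = b' t \<and> w t = w' t" if "S b w T" "S b' w' T'" "0 \<le> t" "t \<le> T" "t \<le> T'" for b w b' w' T T' t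
  proof -
    define L where "L = min T T'"
    have L: "0 < L" "L \<le> T" "L \<le> T'" "t \<in> {0..L}" using S0 that by (auto simp: L_def)
    have "S b w L" "S b' w' L" using S_restrict that L by blast+
    then show ?thesis using lsol_unique[of b w L b' w' t] L(4) by (simp add: S_def)
  qed
  define E where "E = {T. \<exists>b w. S b w T}"
  have extend: "T + life r \<in> E" if "S b w T" "bdd r (fc (b T)) (fc (w T))" for b w T r
    using lsol_extend[of b w T r] that by (auto simp: E_def S_def)
  have E_down: "T' \<in> E" if "T \<in> E" "0 < T'" "T' \<le> T" for T T' using that S_restrict unfolding E_def by blast
  have E_open: "\<exists>T'\<in>E. T < T'" if "T \<in> E" for T
  proof -
    obtain b w where s: "S b w T" using \<open>T \<in> E\<close> by (auto simp: E_def)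
    obtain R where "ksol UNIV T R (\<lambda>t. fc (b t)) (\<lambda>t. fc (w t))" "0 < T"
      using s by (auto simp: S_def lsol_def)
    then have r: "bdd R (fc (b T)) (fc (w T))" using ksolD(1)[of UNIV T R _ _ T] by auto
    from extend[OF s r] life_pos[OF bddD(1)[OF r]] show ?thesis by (intro bexI[of _ "T + life R"]) auto
  qed
  have E_ne: "\<exists>T. T \<in> E"
  proof -
    define r where "r = max (3 ^ Suc 3 * sobolev_norm 3 b\<^sub>0) (3 ^ Suc 2 * sobolev_norm 2 w\<^sub>0)"
    have "bdd r (fc b\<^sub>0) (fc w\<^sub>0)"
      unfolding bdd_def r_def by (intro conjI wbound_mono_bound[OF wbound_of_sobolev] b0 w0) auto
    from lsol_exists[OF this] show ?thesis by (auto simp: E_def S_def)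
  qed
  have "\<forall>T\<in>E. \<exists>b w. S b w T" by (auto simp: E_def)
  then obtain bc wc where c: "\<And>T. T \<in> E \<Longrightarrow> S (bc T) (wc T) T" by metis
  \<comment> \<open>At time \<open>t\<close> the chosen solution of length \<open>t\<close> is
    evaluated at its endpoint. Time 0 is separate because \<open>E\<close> contains positive times
    only.\<close>
  define b where "b t = (if t = 0 then b\<^sub>0 else bc t t)" for t
  define w where "w t = (if t = 0 then w\<^sub>0 else wc t t)" for t
  have bw: "S b w T" if T: "T \<in> E" for T
  proof -
    have "b t = bc T t \<and> w t = wc T t" if t: "t \<in> {0..T}" for t
    proof (cases "t = 0")
      case True
      then show ?thesis using c[OF T] by (simp add: S_def b_def w_def)
    next
      case False
      then have "t \<in> E" using E_down[OF T] t by auto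
      from S_unique[OF c[OF this] c[OF T], of t] False t show ?thesis by (simp add: b_def w_def)
    qed
    then have "lsol b w T" using c[OF T] lsol_cong[of "bc T" "wc T" T b w] by (auto simp: S_def)
    then show ?thesis by (simp add: S_def b_def w_def)
  qed
  define Tm where "Tm = (SUP T\<in>E. ereal T)"
  have below: "T \<in> E \<longleftrightarrow> 0 < T \<and> ereal T < Tm" for T
  proof
    assume T: "T \<in> E"
    obtain T' where "T' \<in> E" "T < T'" using E_open[OF T] by blast
    then have "ereal T < Tm" unfolding Tm_def less_SUP_iff by auto
    then show "0 < T \<and> ereal T < Tm" using T S0 by (auto simp: E_def)
  next
    assume "0 < T \<and> ereal T < Tm"
    then show "T \<in> E" unfolding Tm_def less_SUP_iff using E_down by auto
  qed
  obtain T0 where "T0 \<in> E" using E_ne by blast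
  then have T0: "0 < T0" "ereal T0 < Tm" using below by auto
  then have Tm0: "0 < Tm" by (metis ereal_less(2) less_trans)
  obtain Ts :: "nat \<Rightarrow> real" where Ts: "strict_mono Ts" "(\<lambda>n. ereal (Ts n)) \<longlonglongrightarrow> Tm" "\<And>n. 0 < Ts n" "\<And>n. ereal (Ts n) < Tm"
  proof (cases Tm)
    case PInf
    show thesis
    proof (rule that[of "\<lambda>n. real (Suc n)"])
      show "(\<lambda>n. ereal (real (Suc n))) \<longlonglongrightarrow> Tm"
        unfolding PInf tendsto_PInfty_eq_at_top by (rule filterlim_compose[OF filterlim_real_sequentially filterlim_Suc])
    qed (auto simp: strict_mono_def PInf)
  next
    case (real \<tau>)
    then have \<tau>: "0 < \<tau>" using Tm0 by simp
    show thesis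
    \<comment> \<open>The shift by 2 makes the first time positive.\<close>
    proof (rule that[of "\<lambda>n. \<tau> * (1 - 1 / real (n + 2))"])
      show "strict_mono (\<lambda>n. \<tau> * (1 - 1 / real (n + 2)))"
        using \<tau> by (auto simp: strict_mono_def intro!: mult_strict_left_mono divide_strict_left_mono)
      show "(\<lambda>n. ereal (\<tau> * (1 - 1 / real (n + 2)))) \<longlonglongrightarrow> Tm"
        unfolding real lim_ereal
        using tendsto_mult[OF tendsto_const[of \<tau>] tendsto_diff[OF tendsto_const[of 1] LIMSEQ_ignore_initial_segment[OF lim_1_over_n, of 2]]]
        by simp
      show "0 < \<tau> * (1 - 1 / real (n + 2))" "ereal (\<tau> * (1 - 1 / real (n + 2))) < Tm" for n
        using \<tau> by (auto simp: real field_simps intro!: add_pos_nonneg)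
    qed
  next
    case MInf
    then show thesis using Tm0 by simp
  qed
  have sol: "S b w (Ts n)" for n using bw below Ts(3,4) by blast
  have blowup: "limsup (\<lambda>n. ereal ((norm_M (b (Ts n)) (w (Ts n)))\<^sup>2)) = \<infinity>" if fin: "Tm < \<infinity>"
  proof (rule ccontr)
    assume "limsup (\<lambda>n. ereal ((norm_M (b (Ts n)) (w (Ts n)))\<^sup>2)) \<noteq> \<infinity>"
    then have "limsup (\<lambda>n. ereal ((norm_M (b (Ts n)) (w (Ts n)))\<^sup>2)) < \<infinity>" by simp
    then obtain B where "limsup (\<lambda>n. ereal ((norm_M (b (Ts n)) (w (Ts n)))\<^sup>2)) < ereal B"
      using less_PInf_Ex_of_nat[of "limsup (\<lambda>n. ereal ((norm_M (b (Ts n)) (w (Ts n)))\<^sup>2))"] by auto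
    then have "\<forall>\<^sub>F n in sequentially. (norm_M (b (Ts n)) (w (Ts n)))\<^sup>2 < B"
      using Limsup_lessD by fastforce
    then have ev: "\<forall>\<^sub>F n in sequentially. norm_M (b (Ts n)) (w (Ts n)) \<le> sqrt B"
      by (rule eventually_mono) (auto intro: real_le_rsqrt)
    define r where "r = 81 * sqrt B"
    have bdd: "bdd r (fc (b (Ts n))) (fc (w (Ts n)))" if "norm_M (b (Ts n)) (w (Ts n)) \<le> sqrt B" for n
      unfolding r_def using bdd_of_norm_M[of b w "Ts n", OF _ that] sol[of n] by (simp add: S_def)
    have "0 \<le> r" using eventually_happens'[OF _ ev] bdd bddD(1) by fastforce
    then have l: "0 < life r" by (rule life_pos)
    obtain \<tau> where \<tau>: "Tm = ereal \<tau>" using fin Tm0 by (cases Tm) auto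
    have "Ts \<longlonglongrightarrow> \<tau>" using Ts(2) by (simp add: \<tau>)
    then have "\<forall>\<^sub>F n in sequentially. \<tau> - life r < Ts n" using l by (intro order_tendstoD(1)) auto
    with ev have "\<forall>\<^sub>F n in sequentially. norm_M (b (Ts n)) (w (Ts n)) \<le> sqrt B \<and> \<tau> - life r < Ts n"
      by (rule eventually_conj)
    then obtain n where n: "norm_M (b (Ts n)) (w (Ts n)) \<le> sqrt B" "\<tau> - life r < Ts n"
      using eventually_happens'[OF sequentially_bot] by blast
    \<comment> \<open>The gain \<open>life r\<close> is the same for all \<open>n\<close>, and
      \<open>n\<close> was chosen so late that the continuation passes
      \<open>\<tau>\<close>.\<close>
    from extend[OF sol bdd[OF n(1)]] have "ereal (Ts n + life r) < Tm" using below by blast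
    then show False using n(2) \<tau> by simp
  qed
  have max: "maximal_solution \<alpha> v f b\<^sub>0 w\<^sub>0 b w Tm"
    unfolding maximal_solution_def lss using Tm0 Ts(1,2) sol blowup by blast
  have "T' = Tm \<and> (\<forall>t\<ge>0. ereal t < Tm \<longrightarrow> b' t = b t \<and> w' t = w t)"
    if "maximal_solution \<alpha> v f b\<^sub>0 w\<^sub>0 b' w' T'" for b' w' T'
  proof -
    obtain T'' where T'': "strict_mono T''" "(\<lambda>n. ereal (T'' n)) \<longlonglongrightarrow> T'" "\<And>n. S b' w' (T'' n)"
      "T' < \<infinity> \<Longrightarrow> limsup (\<lambda>n. ereal ((norm_M (b' (T'' n)) (w' (T'' n)))\<^sup>2)) = \<infinity>" and T'0: "0 < T'"
      using \<open>maximal_solution \<alpha> v f b\<^sub>0 w\<^sub>0 b' w' T'\<close> unfolding maximal_solution_def lss by blast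
    have inE: "T'' n \<in> E" for n using T''(3) by (auto simp: E_def)
    have eq: "b' t = b t \<and> w' t = w t" if "0 \<le> t" "t \<le> T'' n" for t n
      by (rule S_unique[OF T''(3)[of n] bw[OF inE[of n]]]) (use that in auto)
    have inc: "incseq (\<lambda>n. ereal (T'' n))" using T''(1) by (auto simp: incseq_def strict_mono_less_eq)
    have le: "ereal (T'' n) \<le> T'" for n by (rule incseq_le[OF inc T''(2)])
    have "T' \<le> Tm" by (rule LIMSEQ_le_const2[OF T''(2)]) (use inE below less_imp_le in blast)
    \<comment> \<open>Otherwise \<open>b\<close> and \<open>w\<close> would solve the system on the
      closed interval up to \<open>T'\<close> and be bounded there, and by uniqueness so would the
      other solution, against its blow-up.\<close>
    moreover have "\<not> T' < Tm"
    proof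
      assume lt: "T' < Tm"
      then have fin: "T' < \<infinity>" by auto
      obtain \<tau> where \<tau>: "T' = ereal \<tau>" using fin T'0 by (cases T') auto
      have "\<tau> \<in> E" using below lt T'0 by (simp add: \<tau>)
      then obtain B where B: "\<And>t. t \<in> {0..\<tau>} \<Longrightarrow> norm_M (b t) (w t) \<le> B"
        using lsol_norm_M_bounded bw by (metis S_def)
      have "ereal ((norm_M (b' (T'' n)) (w' (T'' n)))\<^sup>2) \<le> ereal (B\<^sup>2)" for n
      proof -
        have "0 < T'' n" "T'' n \<le> \<tau>" using inE[of n] below le[of n] \<tau> by auto
        then have "norm_M (b' (T'' n)) (w' (T'' n)) \<le> B" using eq[of "T'' n" n] B[of "T'' n"] by simp
        moreover have "0 \<le> norm_M (b' (T'' n)) (w' (T'' n))" by (simp add: norm_M_def sobolev_norm_nonneg)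
        ultimately show ?thesis by (simp add: power_mono)
      qed
      then have "limsup (\<lambda>n. ereal ((norm_M (b' (T'' n)) (w' (T'' n)))\<^sup>2)) \<le> ereal (B\<^sup>2)"
        by (intro Limsup_bounded always_eventually allI)
      then show False using T''(4)[OF fin] by simp
    qed
    ultimately have T': "T' = Tm" by auto
    have "b' t = b t \<and> w' t = w t" if "0 \<le> t" "ereal t < Tm" for t
    proof -
      have "\<forall>\<^sub>F n in sequentially. ereal t < ereal (T'' n)"
        by (rule order_tendstoD(1)[OF T''(2)]) (use that(2) T' in simp)
      then obtain n where "t < T'' n" using eventually_happens'[OF sequentially_bot] by fastforce
      then show ?thesis using eq[of t n] that(1) by simp
    qed
    then show ?thesis using T' by blast
  qed
  with max show ?thesis by blast
qed

end

lemma wbound_add_mono: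
  assumes "wbound W x A" "wbound W y B" "\<And>k. 0 \<le> W k" "\<And>k. 0 \<le> V k"
    and "\<And>k. V k * cmod (z k) \<le> W k * cmod (x k) + W k * cmod (y k)"
  shows "wbound V z (A + B)"
proof (rule wboundI)
  fix K :: "freq set" assume K: "finite K"
  have "L2_set (\<lambda>k. V k * cmod (z k)) K \<le> L2_set (\<lambda>k. W k * cmod (x k) + W k * cmod (y k)) K"
    by (rule L2_set_mono) (use assms in auto)
  also have "\<dots> \<le> L2_set (\<lambda>k. W k * cmod (x k)) K + L2_set (\<lambda>k. W k * cmod (y k)) K"
    by (rule L2_set_triangle_ineq)
  also have "\<dots> \<le> A + B" by (intro add_mono wboundD[OF assms(1) K] wboundD[OF assms(2) K])
  finally show "L2_set (\<lambda>k. V k * cmod (z k)) K \<le> A + B" .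
qed

lemma wt_le_cmod_D1_D2:
  assumes "k \<noteq> 0"
  shows "wt k \<le> cmod (D1 k) + cmod (D2 k)"
proof -
  define a b where "a = \<bar>real_of_int (fst k)\<bar>" and "b = \<bar>real_of_int (snd k)\<bar>"
  have "fst k \<noteq> 0 \<or> snd k \<noteq> 0" using assms by (auto simp: prod_eq_iff)
  then have ab: "1 \<le> a + b" "0 \<le> a" "0 \<le> b" by (auto simp: a_def b_def)
  have "wt k \<le> 2 * (a + b)" using ab by (simp add: wt_def a_def b_def)
  also have "\<dots> \<le> (2 * pi) * (a + b)" using ab pi_gt3 by (intro mult_right_mono) auto
  also have "\<dots> = cmod (D1 k) + cmod (D2 k)"
    using cmod_D[of 1 0 k] cmod_D[of 0 1 k] by (simp add: D_simps[unfolded One_nat_def] a_def b_def algebra_simps)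
  finally show ?thesis .
qed

text \<open>Away from frequency 0 the symbols of the two derivatives together dominate
  \<open>wt\<close>, so three derivatives of the field give four of its stream function. At
  frequency 0 the zero average of \<open>h\<close> takes over.\<close>

lemma stream_of_field:
  assumes h: "h \<in> sobolev 1" "average h = 0" and u: "u = (1/2) *\<^sub>R grad_perp h" "u \<in> sobolev_div 3"
  shows "stream_field (\<lambda>k. fc h k / 2) u" "\<exists>H. wbound (\<lambda>k. wt k ^ 4) (\<lambda>k. fc h k / 2) H"
proof -
  have "fc (weak_deriv 0 1 h) k = D2 k * fc h k" "fc (weak_deriv 1 0 h) k = D1 k * fc h k" for k
    using sobolev_weak_deriv[OF h(1), of 0 1 k] sobolev_weak_deriv[OF h(1), of 1 0 k] by (simp_all only: D_simps)
  then show s: "stream_field (\<lambda>k. fc h k / 2) u"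
    unfolding stream_field_def u(1) grad_perp_def by (simp add: fc_scaleR fc_uminus)
  then have u12: "fc (fst u) k = - D2 k * (fc h k / 2)" "fc (snd u) k = D1 k * (fc h k / 2)" for k
    by (simp_all add: stream_field_def)
  have "fst u \<in> sobolev 3" "snd u \<in> sobolev 3" using u(2) by (auto simp: sobolev_div_def)
  note wb = wbound_of_sobolev[OF this(1)] wbound_of_sobolev[OF this(2)]
  have "wbound (\<lambda>k. wt k ^ 4) (\<lambda>k. fc h k / 2) (3 ^ Suc 3 * sobolev_norm 3 (fst u) + 3 ^ Suc 3 * sobolev_norm 3 (snd u))"
  proof (rule wbound_add_mono[OF wb])
    fix k
    show "wt k ^ 4 * cmod (fc h k / 2) \<le> wt k ^ 3 * cmod (fc (fst u) k) + wt k ^ 3 * cmod (fc (snd u) k)"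
    proof (cases "k = 0")
      case True
      then show ?thesis using h(2) by (simp add: average_0_iff)
    next
      case False
      have "wt k ^ 4 * cmod (fc h k / 2) = wt k ^ 3 * (wt k * cmod (fc h k / 2))" by (simp add: power4_eq_xxxx power3_eq_cube)
      also have "\<dots> \<le> wt k ^ 3 * ((cmod (D1 k) + cmod (D2 k)) * cmod (fc h k / 2))"
        by (intro mult_left_mono mult_right_mono wt_le_cmod_D1_D2 False) auto
      also have "\<dots> = wt k ^ 3 * cmod (fc (fst u) k) + wt k ^ 3 * cmod (fc (snd u) k)"
        unfolding u12 norm_mult norm_minus_cancel by (simp add: algebra_simps)
      finally show ?thesis .
    qed
  qed auto
  then show "\<exists>H. wbound (\<lambda>k. wt k ^ 4) (\<lambda>k. fc h k / 2) H" by blast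
qed

theorem theorem2p15:
  fixes \<alpha> :: real and h f b\<^sub>0 \<omega>\<^sub>0 :: l2_torus and u\<^sub>h :: "l2_torus \<times> l2_torus"
  assumes "\<alpha> > 0"
    and "h \<in> sobolev 1" "average h = 0"
    and "u\<^sub>h = (1/2) *\<^sub>R grad_perp h" "u\<^sub>h \<in> sobolev_div 3"
    and "f \<in> sobolev 2" "average f = 0"
    and "b\<^sub>0 \<in> sobolev 3" "average b\<^sub>0 = 0"
    and "\<omega>\<^sub>0 \<in> sobolev 2" "average \<omega>\<^sub>0 = 0"
  shows "\<exists>b \<omega> T\<^sub>m\<^sub>a\<^sub>x.
           maximal_solution \<alpha> u\<^sub>h f b\<^sub>0 \<omega>\<^sub>0 b \<omega> T\<^sub>m\<^sub>a\<^sub>x \<and>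
           (\<forall>b' \<omega>' T'. maximal_solution \<alpha> u\<^sub>h f b\<^sub>0 \<omega>\<^sub>0 b' \<omega>' T' \<longrightarrow>
              T' = T\<^sub>m\<^sub>a\<^sub>x \<and>
              (\<forall>t\<ge>0. ereal t < T\<^sub>m\<^sub>a\<^sub>x \<longrightarrow> b' t = b t \<and> \<omega>' t = \<omega> t))"
proof -
  note u = stream_of_field[OF assms(2-5)]
  obtain H where H: "wbound (\<lambda>k. wt k ^ 4) (\<lambda>k. fc h k / 2) H" using u(2) by blast
  interpret tqg_system \<alpha> f "\<lambda>k. fc h k / 2" "9 * (1 + 1 / \<alpha>)" "3 ^ Suc 2 * sobolev_norm 2 f" H u\<^sub>h
  proof
    show "wt k ^ 4 * \<bar>mul \<alpha> k\<bar> \<le> 9 * (1 + 1 / \<alpha>)" for k by (rule mul_le[OF assms(1)])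
    show "mul \<alpha> (- k) = mul \<alpha> k" for k by (simp add: mul_def)
    show "fc f (- k) = cnj (fc f k)" "fc h (- k) / 2 = cnj (fc h k / 2)" for k by (simp_all add: fc_minus)
    show "wbound (\<lambda>k. wt k ^ 2) (fc f) (3 ^ Suc 2 * sobolev_norm 2 f)" by (rule wbound_of_sobolev[OF assms(6)])
  qed (use assms(1) H u(1) in auto)
  show ?thesis by (rule maximal_solution_exists_unique[OF assms(9,11,8,10)])
qed

end
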